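(* Let $p\neq 0$ be real and let $\sigma(\xi)=(\xi^2-p^2)\,\tau(\xi)$ satisfy the standing assumptions in the context, with factors $\sigma_\pm,\tau_\pm$. With $\zeta=H(1/\sigma_+)e_p$, $\eta=H(1/\widetilde{\sigma_-})e_p$ and $$A=A(\alpha)=\frac{2ip}{\tau_-(p)\,\tau_+(-p)\,e^{-i\alpha p}-\tau_+(p)\,\tau_-(-p)\,e^{i\alpha p}},$$ there is a $\delta>0$ such that if $A=O(e^{\delta\alpha})$ as $\alpha\to\infty$, then $W_\alpha(\sigma)$ is invertible for large $\alpha$ and $$W_\alpha(\sigma)^{-1}\equiv P_\alpha W(1/\sigma_+)W(1/\sigma_-)P_\alpha-Q_\alpha H(1/\widetilde{\sigma_-})H(1/\sigma_+)Q_\alpha$$ $$+A\Big[e^{i\alpha p}\,\tau_+(p)\,\tau_-(-p)\,(P_\alpha\zeta)\otimes(P_\alpha\eta)-\tau_+(p)\,\tau_+(-p)\,(P_\alpha\zeta)\otimes(Q_\alpha\zeta)$$ $$-\tau_-(p)\,\tau_-(-p)\,(Q_\alpha\eta)\otimes(P_\alpha\eta)+e^{i\alpha p}\,\tau_+(p)\,\tau_-(-p)\,(Q_\alpha\eta)\otimes(Q_\alpha\zeta)\Big],$$ where $\equiv$ means that the difference of the two sides is an integral operator on $L^2(0,\alpha)$ whose kernel is, uniformly on $(0,\alpha)^2$, $O(e^{-\delta'\alpha})$ as $\alpha\to\infty$ for some $\delta'>0$.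
   Context: Conventions. The Fourier transform is $\hat k(\xi)=\int_{-\infty}^\infty e^{ix\xi}k(x)\,dx$. For a function $v$, $\tilde v(\xi)=v(-\xi)$. $e_p(x)=e^{ipx}$ (restricted to $\mathbb{R}^+$ when it is acted on by operators on $\mathbb{R}^+$); $\chi^\pm$ are the indicator functions of $\mathbb{R}^\pm$. Standing assumptions. $\sigma=a+\hat k$ with $a$ constant and $e^{\delta|x|}k(x)\in L^1(\mathbb{R})$ for some $\delta>0$. $\sigma(\xi)=(\xi^2-p^2)\tau(\xi)$ with $p$ real, where $\tau$ is nonzero on $\mathbb{R}$, has index zero (the total change of $\arg\tau$ over $\mathbb{R}$ is $0$), and its Wiener–Hopf factors $\tau_\pm$ are of the order $\xi^{-1}$ as $\xi\to\infty$. Here $\tau=\tau_-\tau_+$, where $\tau_+^{\pm1}$ (resp. $\tau_-^{\pm1}$) extend analytically to the upper (resp. lower) half-plane. The factors of $\sigma$ are $$\sigma_-(\xi)=i(\xi-p)\tau_-(\xi),\qquad \sigma_+(\xi)=-i(\xi+p)\tau_+(\xi),\qquad \sigma=\sigma_-\sigma_+ .$$ Distributional meaning of $1/\sigma_\pm$. Define $1/\sigma_\pm$ as distributions by $$\frac{\tau_-(p)}{\sigma_-(\xi)}=\frac{1}{0+i(\xi-p)}+u_-(\xi),\qquad \frac{\tau_+(-p)}{\sigma_+(\xi)}=\frac{1}{0-i(\xi+p)}+u_+(\xi),$$ where $u_\pm$ are bounded smooth functions; $u_+$ (resp. $u_-$) is a constant plus the Fourier transform of an exponentially decaying function supported on $\mathbb{R}^+$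 (resp. $\mathbb{R}^-$). The distribution $(0-i(\xi+p))^{-1}$ is the Fourier transform of $\chi^+e_p$ and $(0+i(\xi-p))^{-1}$ is the Fourier transform of $\chi^-e_{-p}$. Operators. If $v=\hat V$, then $W(v)$ and $H(v)$ are the operators on functions on $(0,\infty)$ with kernels $V(x-y)$ and $V(x+y)$ respectively; an additive constant $c$ in $v$ contributes $cI$ to $W(v)$ and $0$ to $H(v)$. $W((0-i(\xi+p))^{-1})f(x)=e^{ipx}\int_0^x e^{-ipy}f(y)\,dy$, and $W((0+i(\xi-p))^{-1})f(x)=e^{-ipx}\int_x^\infty e^{ipy}f(y)\,dy$ for $f\in L^1(\mathbb{R}^+)$; this defines $W(1/\sigma_\pm)$. $P_\alpha$ is multiplication by $\chi_{(0,\alpha)}$ or extension by zero from $(0,\alpha)$ to $(0,\infty)$, or restriction to $(0,\alpha)$, depending on context; $(Q_\alpha f)(x)=f(\alpha-x)$ for $0<x<\alpha$. $W_\alpha(v)=P_\alpha W(v)P_\alpha$ acting on $L^2(0,\alpha)$. Tensor products. $v\otimes w$ is the operator $f\mapsto v\,(w,f)$, with the bilinear pairing $(w,f)=\int wf$ (no complex conjugation). Hankel operators with distribution symbols. $H(1/\sigma_+)=\tau_+(-p)^{-1}[e_p\otimes e_p+H(u_+)]$ and $H(1/\widetilde{\sigma_-})=\tau_-(p)^{-1}[e_p\otimes e_p+H(\widetilde{u_-})]$. Products of two such operators and their action on $e_p$ are interpreted by giving $p$ a small positive imaginary part and passing to the limit; in particular the pairing of $e_p$ with itself on $\mathbb{R}^+$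 is $(\chi^+e_p,\chi^+e_p)=-1/(2ip)$. *)

theory Defs
  imports "HOL-Analysis.Analysis" "HOL-Library.Landau_Symbols"
begin

section \<open>Symbols\<close>

definition fourier :: "(real \<Rightarrow> complex) \<Rightarrow> real \<Rightarrow> complex" where
  "fourier k \<xi> = (LINT x|lborel. exp (\<i> * of_real (x * \<xi>)) * k x)"

definition exp_integrable :: "(real \<Rightarrow> complex) \<Rightarrow> bool" where
  "exp_integrable k \<longleftrightarrow>
     (\<exists>d>0. integrable lborel (\<lambda>x. of_real (exp (d * \<bar>x\<bar>)) * k x))"

definition exp_decaying :: "(real \<Rightarrow> complex) \<Rightarrow> bool" where
  "exp_decaying g \<longleftrightarrow> g \<in> borel_measurable borel \<and>
     (\<exists>C. \<exists>d>0. \<forall>x. norm (g x) \<le> C * exp (- d * \<bar>x\<bar>))"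

definition index_zero :: "(real \<Rightarrow> complex) \<Rightarrow> bool" where
  "index_zero \<tau> \<longleftrightarrow>
     (\<exists>\<theta> :: real \<Rightarrow> real. continuous_on UNIV \<theta> \<and>
        (\<forall>\<xi>. \<tau> \<xi> = rcis (norm (\<tau> \<xi>)) (\<theta> \<xi>)) \<and>
        ((\<lambda>R. \<theta> R - \<theta> (- R)) \<longlongrightarrow> 0) at_top)"

text \<open>Being nonzero on the closed half-plane is the analyticity of the reciprocal.
  The functions below are the extensions; the symbols are their restrictions to the real line.\<close>

definition analytic_factor_upper :: "(complex \<Rightarrow> complex) \<Rightarrow> bool" where
  "analytic_factor_upper h \<longleftrightarrow> h holomorphic_on {z. Im z > 0} \<and>
     continuous_on {z. Im z \<ge> 0} h \<and> (\<forall>z. Im z \<ge> 0 \<longrightarrow> h z \<noteq> 0)"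

definition analytic_factor_lower :: "(complex \<Rightarrow> complex) \<Rightarrow> bool" where
  "analytic_factor_lower h \<longleftrightarrow> h holomorphic_on {z. Im z < 0} \<and>
     continuous_on {z. Im z \<le> 0} h \<and> (\<forall>z. Im z \<le> 0 \<longrightarrow> h z \<noteq> 0)"


section \<open>Operators on functions on the half-line\<close>

text \<open>Functions on \<open>(0,\<infinity>)\<close> are represented by functions on the reals whose values
  outside \<open>(0,\<infinity>)\<close> are irrelevant.\<close>

type_synonym fn = "real \<Rightarrow> complex"

definition exp_fn :: "complex \<Rightarrow> fn" where
  "exp_fn q x = exp (\<i> * q * of_real x)"

definition pairing :: "fn \<Rightarrow> fn \<Rightarrow> complex" where
  "pairing w f = (LINT y:{0<..}|lborel. w y * f y)"

definition tensor :: "fn \<Rightarrow> fn \<Rightarrow> fn \<Rightarrow> fn" where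
  "tensor v w f = (\<lambda>x. v x * pairing w f)"

text \<open>The operators \<open>W(v)\<close> and \<open>H(v)\<close> for the symbol \<open>v = c + fourier V\<close>; the
  constant does not contribute to the Hankel operator.\<close>

definition wh_op :: "complex \<Rightarrow> fn \<Rightarrow> fn \<Rightarrow> fn" where
  "wh_op c V f = (\<lambda>x. c * f x + (LINT y:{0<..}|lborel. V (x - y) * f y))"

definition hankel_op :: "fn \<Rightarrow> fn \<Rightarrow> fn" where
  "hankel_op V f = (\<lambda>x. LINT y:{0<..}|lborel. V (x + y) * f y)"

definition proj_op :: "real \<Rightarrow> fn \<Rightarrow> fn" where
  "proj_op \<alpha> f = (\<lambda>x. indicator {0<..<\<alpha>} x * f x)"

definition refl_op :: "real \<Rightarrow> fn \<Rightarrow> fn" where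
  "refl_op \<alpha> f = (\<lambda>x. indicator {0<..<\<alpha>} x * f (\<alpha> - x))"

definition trunc_wh :: "real \<Rightarrow> complex \<Rightarrow> fn \<Rightarrow> fn \<Rightarrow> fn" where
  "trunc_wh \<alpha> c V f = proj_op \<alpha> (wh_op c V (proj_op \<alpha> f))"

text \<open>\<open>W(v)\<close> for the distributions
  \<open>v = t\<^sup>-\<^sup>1 [(0 - i(\<xi> + p))\<^sup>-\<^sup>1 + u]\<close> and \<open>v = t\<^sup>-\<^sup>1 [(0 + i(\<xi> - p))\<^sup>-\<^sup>1 + u]\<close>,
  respectively, where \<open>u = c + fourier g\<close>.\<close>

definition wh_pole_plus :: "real \<Rightarrow> complex \<Rightarrow> complex \<Rightarrow> fn \<Rightarrow> fn \<Rightarrow> fn" where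
  "wh_pole_plus p t c g f = (\<lambda>x.
     (exp_fn (of_real p) x * (LINT y:{0<..<x}|lborel. exp_fn (- of_real p) y * f y)
        + wh_op c g f x) / t)"

definition wh_pole_minus :: "real \<Rightarrow> complex \<Rightarrow> complex \<Rightarrow> fn \<Rightarrow> fn \<Rightarrow> fn" where
  "wh_pole_minus p t c g f = (\<lambda>x.
     (exp_fn (- of_real p) x * (LINT y:{x<..}|lborel. exp_fn (of_real p) y * f y)
        + wh_op c g f x) / t)"

text \<open>The operator \<open>t\<^sup>-\<^sup>1 [e\<^sub>q \<otimes> e\<^sub>q + H(u)]\<close> with \<open>u = c + fourier g\<close>. For \<open>q = p\<close> real
  it can be applied to integrable functions; its action on \<open>e\<^sub>p\<close> and the product of two
  such operators are the limits as \<open>q = p + i\<epsilon>\<close> tends to \<open>p\<close> from the upper half-plane.\<close>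

definition hankel_pole :: "complex \<Rightarrow> complex \<Rightarrow> fn \<Rightarrow> fn \<Rightarrow> fn" where
  "hankel_pole q t g f =
     (\<lambda>x. (tensor (exp_fn q) (exp_fn q) f x + hankel_op g f x) / t)"

definition hankel_pole_exp :: "real \<Rightarrow> complex \<Rightarrow> fn \<Rightarrow> fn" where
  "hankel_pole_exp p t g = (\<lambda>x. Lim (at_right 0)
     (\<lambda>\<epsilon>. hankel_pole (Complex p \<epsilon>) t g (exp_fn (Complex p \<epsilon>)) x))"

definition hankel_pole_prod ::
    "real \<Rightarrow> complex \<Rightarrow> fn \<Rightarrow> complex \<Rightarrow> fn \<Rightarrow> fn \<Rightarrow> fn" where
  "hankel_pole_prod p t1 g1 t2 g2 f = (\<lambda>x. Lim (at_right 0)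
     (\<lambda>\<epsilon>. hankel_pole (Complex p \<epsilon>) t1 g1 (hankel_pole (Complex p \<epsilon>) t2 g2 f) x))"


section \<open>Operators on the Hilbert space \<open>L\<^sup>2(0,\<alpha>)\<close>\<close>

text \<open>Elements are represented by functions, equality being equality almost everywhere
  on \<open>(0,\<alpha>)\<close>.\<close>

abbreviation ivl :: "real \<Rightarrow> real measure" where
  "ivl \<alpha> \<equiv> restrict_space lborel {0<..<\<alpha>}"

definition L2 :: "real \<Rightarrow> fn set" where
  "L2 \<alpha> = {f \<in> borel_measurable (ivl \<alpha>). integrable (ivl \<alpha>) (\<lambda>x. (norm (f x))\<^sup>2)}"

definition L2_norm :: "real \<Rightarrow> fn \<Rightarrow> real" where
  "L2_norm \<alpha> f = sqrt (LINT x|ivl \<alpha>. (norm (f x))\<^sup>2)"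

text \<open>Linearity and boundedness make such an operator compatible with equality almost
  everywhere.\<close>

definition L2_operator :: "real \<Rightarrow> (fn \<Rightarrow> fn) \<Rightarrow> bool" where
  "L2_operator \<alpha> T \<longleftrightarrow>
     (\<forall>f\<in>L2 \<alpha>. T f \<in> L2 \<alpha>) \<and>
     (\<forall>f\<in>L2 \<alpha>. \<forall>g\<in>L2 \<alpha>. \<forall>b c.
        AE x in ivl \<alpha>. T (\<lambda>y. b * f y + c * g y) x = b * T f x + c * T g x) \<and>
     (\<exists>C. \<forall>f\<in>L2 \<alpha>. L2_norm \<alpha> (T f) \<le> C * L2_norm \<alpha> f)"

definition L2_inverse :: "real \<Rightarrow> (fn \<Rightarrow> fn) \<Rightarrow> (fn \<Rightarrow> fn) \<Rightarrow> bool" where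
  "L2_inverse \<alpha> T S \<longleftrightarrow> L2_operator \<alpha> T \<and> L2_operator \<alpha> S \<and>
     (\<forall>f\<in>L2 \<alpha>. (AE x in ivl \<alpha>. S (T f) x = f x) \<and> (AE x in ivl \<alpha>. T (S f) x = f x))"

text \<open>The parameter \<open>\<alpha>\<close> tends to infinity through a set of admissible values; for
  \<open>S = UNIV\<close> this filter is \<open>at_top\<close>. Restricting \<open>\<alpha>\<close> matters when a quantity such as
  \<open>1 / (b exp(-i\<alpha>p) - c exp(i\<alpha>p))\<close> with \<open>|b| = |c|\<close> is required to be bounded or of
  exponential order: its poles are arbitrarily large values of \<open>\<alpha>\<close>.\<close>

definition at_top_in :: "real set \<Rightarrow> real filter" where
  "at_top_in S = inf at_top (principal S)"

text \<open>The relation \<open>\<equiv>\<close> between families of operators indexed by \<open>\<alpha>\<close>.\<close>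

definition exp_equivalent ::
    "real filter \<Rightarrow> (real \<Rightarrow> fn \<Rightarrow> fn) \<Rightarrow> (real \<Rightarrow> fn \<Rightarrow> fn) \<Rightarrow> bool" where
  "exp_equivalent F T1 T2 \<longleftrightarrow>
     (\<exists>d>0. \<exists>C. \<forall>\<^sub>F \<alpha> in F. \<exists>K :: real \<Rightarrow> real \<Rightarrow> complex.
        (\<lambda>(x, y). K x y) \<in> borel_measurable (ivl \<alpha> \<Otimes>\<^sub>M ivl \<alpha>) \<and>
        (\<forall>x\<in>{0<..<\<alpha>}. \<forall>y\<in>{0<..<\<alpha>}. norm (K x y) \<le> C * exp (- d * \<alpha>)) \<and>
        (\<forall>f\<in>L2 \<alpha>. AE x in ivl \<alpha>.
           T1 \<alpha> f x - T2 \<alpha> f x = (LINT y|ivl \<alpha>. K x y * f y)))"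

end

theory Submission
  imports Defs "HOL-Probability.Probability" "HOL-Complex_Analysis.Complex_Analysis"
    "HOL-Real_Asymp.Real_Asymp"
begin

text \<open>Put \<open>\<sigma>\<^sub>- = \<sigma>/\<sigma>\<^sub>+\<close>. By a Paley-Wiener and Liouville argument its convolution kernel lives on the negative
  half-line, where it inverts the kernel of \<open>1/\<sigma>\<^sub>-\<close>. Hence \<open>W(1/\<sigma>\<^sub>+) W(1/\<sigma>\<^sub>-) f\<close> solves the half-line
  equation for every \<open>f\<close> supported in \<open>(0,\<alpha>)\<close>, and truncating it to \<open>(0,\<alpha>)\<close> leaves only Hankel tails.
  Subtracting \<open>Q\<^sub>\<alpha> H(1/\<sigma>\<^sub>-\<^sup>~) H(1/\<sigma>\<^sub>+) Q\<^sub>\<alpha> f\<close> (with \<open>v\<^sup>~(\<xi>) = v(-\<xi>)\<close>) cancels these tails up to exponentially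
  small kernels and up to two rank-one terms \<open>X \<otimes> Q\<^sub>\<alpha> \<zeta>\<close> and \<open>Y \<otimes> P\<^sub>\<alpha> \<eta>\<close>, where \<open>X = P\<^sub>\<alpha> H(\<sigma>) e\<^sub>p\<close> and
  \<open>Y = Q\<^sub>\<alpha> H(\<sigma>\<^sup>~) e\<^sub>p\<close> stem from the nondecaying parts \<open>e\<^sub>p\<close> of the Hankel kernels. Up to exponentially small terms
  \<open>W\<^sub>\<alpha>(\<sigma>)\<close> maps \<open>P\<^sub>\<alpha> \<zeta>\<close> and \<open>Q\<^sub>\<alpha> \<eta>\<close> to combinations of \<open>X\<close> and \<open>Y\<close>; solving this two by two linear system,
  whose determinant is essentially \<open>1/A\<close>, produces the term with the factor \<open>A\<close>. A Neumann series turns the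
  resulting approximate right inverse into an exact one.\<close>

subsection \<open>Convolutions\<close>

text \<open>The obstacle throughout is that the kernels of \<open>1/\<sigma>\<^sub>+\<close> and
  \<open>1/\<sigma>\<^sub>-\<close> contain the exponential \<open>e\<^sub>p\<close>, which is
  bounded but neither integrable nor decaying. Convolutions therefore pair a bounded function with
  an integrable one, expressions involving \<open>e\<^sub>p\<close> alone are computed at p + i
  epsilon and passed to the limit, and exponential smallness can only come from
  \<open>g\<^sub>p\<close> and \<open>g\<^sub>m\<close>: a tail beginning at \<alpha> is small when
  it passes through one of these two kernels. The factors \<open>\<sigma>\<^sub>+\<close> and
  \<open>\<sigma>\<^sub>-\<close> themselves are not given by kernels, so the kernel of
  \<open>\<sigma>\<^sub>-\<close> has to be constructed. The plus case alone is treated; \<xi> ->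
  -\<xi> exchanges it with the minus case. On (0,\<alpha>) operators are a multiple of the identity
  plus a bounded kernel, and each composition of kernels costs a factor \<alpha>. If d is the decay
  rate of the error kernel, \<delta> = d/4 splits it into four parts: one for the factor A in the
  error, one for the A in the approximate inverse, one for powers of \<alpha>, one for the final
  decay.\<close>

lemma integrable_indicator_interval: "integrable lborel (\<lambda>x. indicator {a<..<b::real} x :: complex)"
proof -
  have "integrable lborel (indicator {a<..<b} :: real \<Rightarrow> real)" by (cases "a \<le> b") (auto intro!: integrable_real_indicator)
  then have "integrable lborel (\<lambda>x. complex_of_real (indicator {a<..<b} x))" by simp
  then show ?thesis by (simp add: of_real_indicator)
qed

text \<open>The class of the kernels of \<open>1/\<sigma>\<^sub>+\<close> and
  \<open>1/\<sigma>\<^sub>-\<close>: because of the exponential they are not integrable, and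
  boundedness is what remains for estimates.\<close>

definition bdd_meas :: "(real \<Rightarrow> complex) \<Rightarrow> bool" where
  "bdd_meas G \<longleftrightarrow> G \<in> borel_measurable borel \<and> (\<exists>C. \<forall>x. norm (G x) \<le> C)"

definition conv :: "(real \<Rightarrow> complex) \<Rightarrow> (real \<Rightarrow> complex) \<Rightarrow> real \<Rightarrow> complex" where
  "conv V f x = (LINT y|lborel. V (x - y) * f y)"

lemma bdd_measI: "G \<in> borel_measurable borel \<Longrightarrow> (\<And>x. norm (G x) \<le> C) \<Longrightarrow> bdd_meas G"
  unfolding bdd_meas_def by blast

lemma bdd_measE:
  assumes "bdd_meas G"
  obtains C where "G \<in> borel_measurable borel" "\<And>x. norm (G x) \<le> C" "C > 0"
proof -
  obtain C where C: "\<And>x. norm (G x) \<le> C" and m: "G \<in> borel_measurable borel"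
    using assms unfolding bdd_meas_def by blast
  have "norm (G x) \<le> max C 1" for x using C[of x] by simp
  then show ?thesis using that[of "max C 1"] m by simp
qed

lemma bdd_meas_measurable [measurable_dest]: "bdd_meas G \<Longrightarrow> G \<in> borel_measurable borel"
  unfolding bdd_meas_def by blast

lemma integrable_lborel_measurable: "integrable lborel f \<Longrightarrow> f \<in> borel_measurable borel"
  by (drule borel_measurable_integrable) simp

lemma integrable_mult_bounded:
  fixes f :: "'a \<Rightarrow> complex"
  assumes f: "integrable M f" and g: "g \<in> borel_measurable M" and b: "\<And>x. norm (g x) \<le> C"
  shows "integrable M (\<lambda>x. f x * g x)"
proof (rule Bochner_Integration.integrable_bound)
  show "integrable M (\<lambda>x. C * norm (f x))" using f by (intro integrable_mult_right integrable_norm)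
  show "(\<lambda>x. f x * g x) \<in> borel_measurable M" using f g by measurable
  show "AE x in M. norm (f x * g x) \<le> norm (C * norm (f x))"
  proof (rule AE_I2)
    fix x show "norm (f x * g x) \<le> norm (C * norm (f x))"
      using mult_left_mono[OF b[of x], of "norm (f x)"] abs_ge_self[of "C * norm (f x)"]
      by (simp add: norm_mult mult.commute)
  qed
qed

lemma integrable_mult_bdd:
  assumes "integrable lborel f" "bdd_meas G"
  shows "integrable lborel (\<lambda>x. f x * G x)"
  using assms by (elim bdd_measE) (rule integrable_mult_bounded, auto)

lemma bdd_meas_affine:
  assumes "bdd_meas G" shows "bdd_meas (\<lambda>x. G (a + b * x))"
  using assms by (elim bdd_measE) (rule bdd_measI, measurable, auto)

lemma bdd_meas_shift:
  assumes "bdd_meas G" shows "bdd_meas (\<lambda>x. G (a - x))" "bdd_meas (\<lambda>x. G (a + x))" "bdd_meas (\<lambda>x. G (x + a))"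
     "bdd_meas (\<lambda>x. G (x - a))" "bdd_meas (\<lambda>x. G (- x))"
  using bdd_meas_affine[OF assms, of a "-1"] bdd_meas_affine[OF assms, of a 1] bdd_meas_affine[OF assms, of "-a" 1]
     bdd_meas_affine[OF assms, of 0 "-1"]
  by (simp_all add: add.commute)

lemma bdd_meas_mult:
  assumes "bdd_meas G" "bdd_meas H" shows "bdd_meas (\<lambda>x. G x * H x)"
proof -
  obtain C where C: "G \<in> borel_measurable borel" "\<And>x. norm (G x) \<le> C" "C > 0" using assms(1) by (metis bdd_measE)
  obtain D where D: "H \<in> borel_measurable borel" "\<And>x. norm (H x) \<le> D" "D > 0" using assms(2) by (metis bdd_measE)
  show ?thesis using C D
    by (intro bdd_measI[of _ "C * D"]) (auto simp: norm_mult intro!: mult_mono)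
qed

lemma bdd_meas_add:
  assumes "bdd_meas G" "bdd_meas H" shows "bdd_meas (\<lambda>x. G x + H x)"
proof -
  obtain C where C: "G \<in> borel_measurable borel" "\<And>x. norm (G x) \<le> C" "C > 0" using assms(1) by (metis bdd_measE)
  obtain D where D: "H \<in> borel_measurable borel" "\<And>x. norm (H x) \<le> D" "D > 0" using assms(2) by (metis bdd_measE)
  show ?thesis using C D
    by (intro bdd_measI[of _ "C + D"]) (auto intro!: norm_triangle_mono)
qed

lemma bdd_meas_const [simp]: "bdd_meas (\<lambda>x. c)" by (rule bdd_measI[of _ "norm c"]) auto

lemma bdd_meas_cmult: "bdd_meas G \<Longrightarrow> bdd_meas (\<lambda>x. c * G x)"
  by (rule bdd_meas_mult) auto

lemma bdd_meas_indicator: "A \<in> sets borel \<Longrightarrow> bdd_meas (\<lambda>x. indicator A x)"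
  by (rule bdd_measI[of _ 1]) (auto simp: indicator_def)

lemma bdd_meas_indicator_mult: "A \<in> sets borel \<Longrightarrow> bdd_meas G \<Longrightarrow> bdd_meas (\<lambda>x. indicator A x * G x)"
  by (intro bdd_meas_mult bdd_meas_indicator)

lemma integrable_reflect_shift:
  fixes f :: "real \<Rightarrow> complex"
  assumes "integrable lborel f"
  shows "integrable lborel (\<lambda>y. f (x - y))" "integrable lborel (\<lambda>y. f (x + y))" "integrable lborel (\<lambda>y. f (y + x))"
    "integrable lborel (\<lambda>y. f (y - x))" "integrable lborel (\<lambda>y. f (- y))"
  using lborel_integrable_real_affine[OF assms, of "-1" x] lborel_integrable_real_affine[OF assms, of 1 x]
    lborel_integrable_real_affine[OF assms, of 1 "-x"] lborel_integrable_real_affine[OF assms, of "-1" 0]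
  by (simp_all add: add.commute)

lemma integral_reflect_shift:
  fixes f :: "real \<Rightarrow> complex"
  shows "(LINT y|lborel. f (x - y)) = (LINT y|lborel. f y)" "(LINT y|lborel. f (x + y)) = (LINT y|lborel. f y)"
    "(LINT y|lborel. f (y + x)) = (LINT y|lborel. f y)"
    "(LINT y|lborel. f (y - x)) = (LINT y|lborel. f y)" "(LINT y|lborel. f (- y)) = (LINT y|lborel. f y)"
  using lborel_integral_real_affine[of "-1" f x] lborel_integral_real_affine[of 1 f x]
     lborel_integral_real_affine[of 1 f "-x"] lborel_integral_real_affine[of "-1" f 0]
  by (simp_all add: add.commute)

lemma conv_commute: "conv V f x = conv f V x"
  unfolding conv_def using integral_reflect_shift(1)[of "\<lambda>y. V (x - y) * f y" x]
  by (simp add: mult.commute)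

text \<open>The integrand is dominated by C |k(y)| |f(z)|, so no decay of \<open>G\<close> is
  involved. Nearly all changes of the order of integration below have this form, with the
  nondecaying kernel in the middle.\<close>

lemma Fubini_bounded_kernel:
  fixes k f :: "real \<Rightarrow> complex"
  assumes k: "integrable lborel k" and f: "integrable lborel f"
    and G: "case_prod G \<in> borel_measurable (borel \<Otimes>\<^sub>M borel)" and C: "\<And>y z. norm (G y z) \<le> C"
  shows "integrable (lborel \<Otimes>\<^sub>M lborel) (\<lambda>(y, z). k y * G y z * f z)"
    and "(LINT y|lborel. k y * (LINT z|lborel. G y z * f z)) = (LINT z|lborel. (LINT y|lborel. k y * G y z) * f z)"
proof -
  have [measurable]: "k \<in> borel_measurable borel" "f \<in> borel_measurable borel"
    using k f by (auto dest: integrable_lborel_measurable)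
  note G[measurable]
  have C0: "C \<ge> 0" using order_trans[OF norm_ge_zero C] .
  have Gz[measurable]: "(\<lambda>z. G y z) \<in> borel_measurable borel" for y
    using measurable_compose[OF measurable_Pair1' G, of y] by (simp add: comp_def)
  have Gy[measurable]: "(\<lambda>y. G y z) \<in> borel_measurable borel" for z
    using measurable_compose[OF measurable_Pair2' G, of z] by (simp add: comp_def)
  have i1: "integrable lborel (\<lambda>z. G y z * f z)" for y
    using integrable_mult_bounded[OF f, of "\<lambda>z. G y z" C] C by (simp add: mult.commute)
  have i2: "integrable lborel (\<lambda>z. k y * G y z * f z)" for y
    using integrable_mult_right[OF i1, of "k y"] by (simp add: mult.assoc)
  show int: "integrable (lborel \<Otimes>\<^sub>M lborel) (\<lambda>(y, z). k y * G y z * f z)"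
  proof (rule lborel_pair.Fubini_integrable)
    show "(\<lambda>(y, z). k y * G y z * f z) \<in> borel_measurable (lborel \<Otimes>\<^sub>M lborel)"
      by measurable
    show "AE x in lborel. integrable lborel (\<lambda>y. case (x, y) of (y, z) \<Rightarrow> k y * G y z * f z)"
      using i2 by simp
    show "integrable lborel (\<lambda>x. LINT y|lborel. norm (case (x, y) of (y, z) \<Rightarrow> k y * G y z * f z))"
    proof (rule Bochner_Integration.integrable_bound)
      show "integrable lborel (\<lambda>x. norm (k x) * (C * (LINT z|lborel. norm (f z))))"
        using k by (intro integrable_mult_left integrable_norm)
      show "(\<lambda>x. LINT y|lborel. norm (case (x, y) of (y, z) \<Rightarrow> k y * G y z * f z)) \<in> borel_measurable lborel"
        by measurable
      show "AE x in lborel. norm (LINT y|lborel. norm (case (x, y) of (y, z) \<Rightarrow> k y * G y z * f z))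
          \<le> norm (norm (k x) * (C * (LINT z|lborel. norm (f z))))"
      proof (rule AE_I2)
        fix x
        have "(LINT y|lborel. norm (k x * G x y * f y)) \<le> (LINT y|lborel. norm (k x) * C * norm (f y))"
          using C by (intro integral_mono integrable_norm i2 integrable_mult_right f)
            (auto simp: norm_mult intro!: mult_mono mult_nonneg_nonneg C0)
        also have "\<dots> = norm (k x) * (C * (LINT z|lborel. norm (f z)))"
          by (simp add: mult.assoc)
        finally show "norm (LINT y|lborel. norm (case (x, y) of (y, z) \<Rightarrow> k y * G y z * f z))
          \<le> norm (norm (k x) * (C * (LINT z|lborel. norm (f z))))"
          by (simp add: abs_of_nonneg C0)
      qed
    qed
  qed
  have "(LINT y|lborel. k y * (LINT z|lborel. G y z * f z)) = (LINT y|lborel. (LINT z|lborel. k y * G y z * f z))"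
    by (simp add: mult.assoc)
  also have "\<dots> = (LINT z|lborel. (LINT y|lborel. k y * G y z * f z))"
    by (rule lborel_pair.Fubini_integral[symmetric]) (rule int)
  also have "\<dots> = (LINT z|lborel. (LINT y|lborel. k y * G y z) * f z)"
    by simp
  finally show "(LINT y|lborel. k y * (LINT z|lborel. G y z * f z)) = (LINT z|lborel. (LINT y|lborel. k y * G y z) * f z)" .
qed

lemma integrable_conv_bdd:
  assumes "integrable lborel f" "bdd_meas G"
  shows "integrable lborel (\<lambda>y. G (x - y) * f y)" "integrable lborel (\<lambda>y. f (x - y) * G y)"
proof -
  show "integrable lborel (\<lambda>y. G (x - y) * f y)"
    using integrable_mult_bdd[OF assms(1) bdd_meas_shift(1)[OF assms(2)], of x] by (simp add: mult.commute)
  show "integrable lborel (\<lambda>y. f (x - y) * G y)"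
    by (rule integrable_mult_bdd) (use assms integrable_reflect_shift in auto)
qed

lemma conv_measurable [measurable]:
  assumes [measurable]: "G \<in> borel_measurable borel" "f \<in> borel_measurable borel"
  shows "conv G f \<in> borel_measurable borel"
proof -
  have "(\<lambda>x. LINT y|lborel. G (x - y) * f y) \<in> borel_measurable borel" by measurable
  then show ?thesis by (simp add: conv_def[abs_def])
qed

lemma norm_integral_le_integral:
  fixes f :: "'a \<Rightarrow> complex"
  assumes "integrable M g" "\<And>x. norm (f x) \<le> g x"
  shows "norm (integral\<^sup>L M f) \<le> integral\<^sup>L M g"
proof (cases "integrable M f")
  case True
  have "norm (integral\<^sup>L M f) \<le> (LINT x|M. norm (f x))" by (rule integral_norm_bound)
  also have "\<dots> \<le> integral\<^sup>L M g" using assms True by (intro integral_mono integrable_norm)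
  finally show ?thesis .
next
  case False
  have "0 \<le> g x" for x using assms(2)[of x] norm_ge_zero[of "f x"] by linarith
  then show ?thesis using False by (simp add: not_integrable_integral_eq)
qed

lemma conv_bound:
  assumes f: "integrable lborel f" and C: "\<And>x. norm (G x) \<le> C"
  shows "norm (conv G f x) \<le> C * (LINT y|lborel. norm (f y))"
proof -
  have "norm (conv G f x) \<le> (LINT y|lborel. C * norm (f y))"
    unfolding conv_def using C f
    by (intro norm_integral_le_integral integrable_mult_right integrable_norm) (auto simp: norm_mult intro!: mult_right_mono)
  then show ?thesis by simp
qed

lemma bdd_meas_conv:
  assumes "bdd_meas G" "integrable lborel f"
  shows "bdd_meas (conv G f)" "bdd_meas (conv f G)"
proof -
  show "bdd_meas (conv G f)"
  proof -
    obtain C where C: "G \<in> borel_measurable borel" "\<And>x. norm (G x) \<le> C" using assms(1) by (metis bdd_measE)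
    show ?thesis
      by (rule bdd_measI[OF conv_measurable conv_bound]) (use C assms in \<open>auto dest: integrable_lborel_measurable\<close>)
  qed
  moreover have "conv f G = conv G f" by (rule ext) (rule conv_commute)
  ultimately show "bdd_meas (conv f G)" by simp
qed

text \<open>The two outer factors are integrable and the middle one is only bounded, which is the
  situation of \<open>Fubini_bounded_kernel\<close>.\<close>

lemma conv_assoc:
  assumes k: "integrable lborel k" and f: "integrable lborel f" and G: "bdd_meas G"
  shows "conv k (conv G f) x = conv (conv k G) f x"
proof -
  obtain C where [measurable]: "G \<in> borel_measurable borel" and C: "\<And>x. norm (G x) \<le> C"
    using G by (metis bdd_measE)
  have "conv k (conv G f) x = (LINT y|lborel. k (x - y) * (LINT z|lborel. G (y - z) * f z))"
    by (simp add: conv_def)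
  also have "\<dots> = (LINT z|lborel. (LINT y|lborel. k (x - y) * G (y - z)) * f z)"
    by (rule Fubini_bounded_kernel(2)[where C=C]) (use C integrable_reflect_shift[OF k] f in auto)
  also have "\<dots> = conv (conv k G) f x"
  proof -
    have "(LINT y|lborel. k (x - y) * G (y - z)) = conv k G (x - z)" for z
      using integral_reflect_shift(4)[of "\<lambda>y. k ((x - z) - y) * G y" z] by (simp add: algebra_simps conv_def)
    then show ?thesis by (simp add: conv_def[of "conv k G"])
  qed
  finally show ?thesis .
qed

text \<open>Integrating in x first, the inner norm is translation invariant and hence independent of
  y, which leaves the product of the two L1 norms.\<close>

lemma integrable_prod_translate:
  fixes k f :: "real \<Rightarrow> complex"
  assumes k: "integrable lborel k" and f: "integrable lborel f"
  shows "integrable (lborel \<Otimes>\<^sub>M lborel) (\<lambda>(x, y). k (x - y) * f y)"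
proof -
  have [measurable]: "k \<in> borel_measurable borel" "f \<in> borel_measurable borel"
    using k f by (auto dest: integrable_lborel_measurable)
  have "integrable (lborel \<Otimes>\<^sub>M lborel) (\<lambda>(y, x). k (x - y) * f y)"
  proof (rule lborel_pair.Fubini_integrable)
    show "(\<lambda>(y, x). k (x - y) * f y) \<in> borel_measurable (lborel \<Otimes>\<^sub>M lborel)" by measurable
    show "AE y in lborel. integrable lborel (\<lambda>x. case (y, x) of (y, x) \<Rightarrow> k (x - y) * f y)"
      using integrable_reflect_shift(4)[OF k] by (auto intro!: integrable_mult_left)
    have "(LINT x|lborel. norm (k (x - y) * f y)) = (LINT x|lborel. norm (k x)) * norm (f y)" for y
      using lborel_integral_real_affine[of 1 "\<lambda>x. norm (k x)" "-y"] by (simp add: norm_mult)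
    then show "integrable lborel (\<lambda>x. LINT y|lborel. norm (case (x, y) of (y, x) \<Rightarrow> k (x - y) * f y))"
      using f by (auto intro!: integrable_mult_right)
  qed
  then show ?thesis
    using lborel_pair.integrable_product_swap by force
qed

lemma integrable_conv:
  assumes "integrable lborel k" "integrable lborel f"
  shows "integrable lborel (conv k f)" "AE x in lborel. integrable lborel (\<lambda>y. k (x - y) * f y)"
  using lborel_pair.integrable_fst'[OF integrable_prod_translate[OF assms]]
    lborel_pair.AE_integrable_fst'[OF integrable_prod_translate[OF assms]]
  by (simp_all add: conv_def[abs_def])

lemma conv_add_left:
  assumes "integrable lborel (\<lambda>y. V (x - y) * f y)" "integrable lborel (\<lambda>y. W (x - y) * f y)"
  shows "conv (\<lambda>z. V z + W z) f x = conv V f x + conv W f x"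
  using assms by (simp add: conv_def distrib_right)

lemma conv_add_right:
  assumes "integrable lborel (\<lambda>y. V (x - y) * f y)" "integrable lborel (\<lambda>y. V (x - y) * g y)"
  shows "conv V (\<lambda>y. f y + g y) x = conv V f x + conv V g x"
  using assms by (simp add: conv_def distrib_left)

lemma conv_cmult_left: "conv (\<lambda>z. c * V z) f x = c * conv V f x"
  by (simp add: conv_def mult.assoc)

lemma conv_cmult_right: "conv V (\<lambda>z. c * f z) x = c * conv V f x"
  by (simp add: conv_def mult.left_commute)

lemma conv_divide_left: "conv (\<lambda>z. V z / c) f x = conv V f x / c"
  by (simp add: conv_def)

lemma conv_divide_right: "conv V (\<lambda>z. f z / c) x = conv V f x / c"
  by (simp add: conv_def)

text \<open>The Fourier integral at a complex point. It converges in the closed half-plane selected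
  by the support of \<open>g\<close>: the upper one for support on x >= 0, the lower one for support
  on x <= 0.\<close>

definition cfour :: "(real \<Rightarrow> complex) \<Rightarrow> complex \<Rightarrow> complex" where
  "cfour g z = (LINT x|lborel. exp (\<i> * z * of_real x) * g x)"

lemma fourier_eq_cfour: "fourier g \<xi> = cfour g (of_real \<xi>)"
  by (simp add: fourier_def cfour_def mult.commute mult.left_commute mult.assoc)

lemma integrable_bdd_mult:
  assumes "integrable lborel f" "bdd_meas G" shows "integrable lborel (\<lambda>x. G x * f x)"
proof -
  have "(\<lambda>x. G x * f x) = (\<lambda>x. f x * G x)" by (simp add: fun_eq_iff mult.commute)
  then show ?thesis using integrable_mult_bdd[OF assms] by simp
qed

lemma integrable_exp_mult: 
  assumes "integrable lborel f" shows "integrable lborel (\<lambda>x. exp (\<i> * of_real (x * c)) * f x)"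
proof -
  have "bdd_meas (\<lambda>x. exp (\<i> * of_real (x * c)))" by (rule bdd_measI[of _ 1]) auto
  then show ?thesis by (rule integrable_bdd_mult[OF assms])
qed

subsection \<open>Exponential integrability\<close>

lemma exp_integrable_measurable: 
  assumes "exp_integrable k" shows "k \<in> borel_measurable borel"
proof -
  obtain d where "integrable lborel (\<lambda>x. of_real (exp (d * \<bar>x\<bar>)) * k x)"
    using assms unfolding exp_integrable_def by blast
  then have [measurable]: "(\<lambda>x. of_real (exp (d * \<bar>x\<bar>)) * k x) \<in> borel_measurable borel"
    by (rule integrable_lborel_measurable)
  have "(\<lambda>x. of_real (exp (- d * \<bar>x\<bar>)) * (of_real (exp (d * \<bar>x\<bar>)) * k x)) \<in> borel_measurable borel"
    by measurable
  moreover have "of_real (exp (- d * \<bar>x\<bar>)) * (of_real (exp (d * \<bar>x\<bar>)) * k x) = k x" for x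
    by (simp flip: exp_of_real exp_add mult.assoc)
  ultimately show ?thesis by (simp only:)
qed

lemma integrable_weight:
  fixes k h :: "real \<Rightarrow> complex"
  assumes "integrable lborel (\<lambda>x. of_real (exp (d * \<bar>x\<bar>)) * k x)"
    and "h \<in> borel_measurable borel" and b: "\<And>x. norm (h x) \<le> C * exp (d * \<bar>x\<bar>)"
  shows "integrable lborel (\<lambda>x. h x * k x)"
proof -
  have "integrable lborel (\<lambda>x. (of_real (exp (d * \<bar>x\<bar>)) * k x) * (h x * of_real (exp (- d * \<bar>x\<bar>))))"
  proof (rule integrable_mult_bounded[OF assms(1)])
    show "(\<lambda>x. h x * of_real (exp (- d * \<bar>x\<bar>))) \<in> borel_measurable lborel" using assms(2) by measurable
    fix x show "norm (h x * of_real (exp (- d * \<bar>x\<bar>))) \<le> C"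
      using mult_right_mono[OF b[of x], of "exp (- d * \<bar>x\<bar>)"] by (simp add: norm_mult mult.assoc flip: exp_add)
  qed
  moreover have "(of_real (exp (d * \<bar>x\<bar>)) * k x) * (h x * of_real (exp (- d * \<bar>x\<bar>))) = h x * k x" for x
    by (simp add: exp_minus field_simps)
  ultimately show ?thesis by (simp only:)
qed

lemma exp_integrable_integrable: "exp_integrable k \<Longrightarrow> integrable lborel k"
  unfolding exp_integrable_def using integrable_weight[of _ k "\<lambda>_. 1" 1] by auto

lemma exp_integrable_mono:
  fixes k :: "real \<Rightarrow> complex"
  assumes "integrable lborel (\<lambda>x. of_real (exp (d * \<bar>x\<bar>)) * k x)" "d' \<le> d"
  shows "integrable lborel (\<lambda>x. of_real (exp (d' * \<bar>x\<bar>)) * k x)"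
  by (rule integrable_weight[OF assms(1), where C=1]) (use assms(2) in \<open>auto intro!: mult_right_mono\<close>)

lemma abs_le_exp:
  assumes "(d::real) > 0" shows "\<bar>x\<bar> \<le> (1/d) * exp (d * \<bar>x\<bar>)"
proof -
  have "d * \<bar>x\<bar> \<le> exp (d * \<bar>x\<bar>)" using exp_ge_add_one_self[of "d * \<bar>x\<bar>"] by linarith
  then show ?thesis using assms by (simp add: field_simps)
qed

lemma exp_integrable_abs:
  assumes "exp_integrable k" shows "integrable lborel (\<lambda>x. of_real \<bar>x\<bar> * k x)"
proof -
  obtain d where d: "d > 0" and i: "integrable lborel (\<lambda>x. of_real (exp (d * \<bar>x\<bar>)) * k x)"
    using assms unfolding exp_integrable_def by blast
  show ?thesis using abs_le_exp[OF d] by (intro integrable_weight[OF i, where C="1/d"]) auto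
qed

lemma exp_integrable_add:
  assumes "exp_integrable k" "exp_integrable g" shows "exp_integrable (\<lambda>x. k x + g x)"
proof -
  obtain d where d: "d > 0" "integrable lborel (\<lambda>x. of_real (exp (d * \<bar>x\<bar>)) * k x)"
    using assms unfolding exp_integrable_def by blast
  obtain e where e: "e > 0" "integrable lborel (\<lambda>x. of_real (exp (e * \<bar>x\<bar>)) * g x)"
    using assms unfolding exp_integrable_def by blast
  have "integrable lborel (\<lambda>x. of_real (exp (min d e * \<bar>x\<bar>)) * k x + of_real (exp (min d e * \<bar>x\<bar>)) * g x)"
    using exp_integrable_mono[OF d(2), of "min d e"] exp_integrable_mono[OF e(2), of "min d e"] by (intro Bochner_Integration.integrable_add) auto
  then show ?thesis unfolding exp_integrable_def using d(1) e(1)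
    by (intro exI[of _ "min d e"]) (simp add: distrib_left)
qed

lemma exp_integrable_bdd_mult:
  assumes "exp_integrable k" "bdd_meas G" shows "exp_integrable (\<lambda>x. G x * k x)"
proof -
  obtain d where d: "d > 0" "integrable lborel (\<lambda>x. of_real (exp (d * \<bar>x\<bar>)) * k x)"
    using assms unfolding exp_integrable_def by blast
  show ?thesis unfolding exp_integrable_def using integrable_mult_bdd[OF d(2) assms(2)] d(1)
    by (intro exI[of _ d]) (simp add: mult_ac)
qed

lemma exp_integrable_cmult: "exp_integrable k \<Longrightarrow> exp_integrable (\<lambda>x. c * k x)"
  using exp_integrable_bdd_mult[of k "\<lambda>_. c"] by simp

lemma exp_integrable_reflect:
  assumes "exp_integrable k" shows "exp_integrable (\<lambda>x. k (- x))"
proof -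
  obtain d where d: "d > 0" "integrable lborel (\<lambda>x. of_real (exp (d * \<bar>x\<bar>)) * k x)"
    using assms unfolding exp_integrable_def by blast
  show ?thesis unfolding exp_integrable_def using integrable_reflect_shift(5)[OF d(2)] d(1)
    by (intro exI[of _ d]) simp
qed

lemma integrable_exp_abs:
  assumes "(d::real) > 0" shows "integrable lborel (\<lambda>x. exp (- d * \<bar>x\<bar>))"
proof -
  have 1: "integrable lborel (\<lambda>x::real. exp (- x) * indicator {0<..} x)"
    using has_bochner_integral_I0i_power_exp_m[of 0]
    unfolding has_bochner_integral_iff power_0 mult_1 by blast
  have 2: "integrable lborel (\<lambda>x. exp (- (d * x)) * indicator {0<..} (d * x))"
    using lborel_integrable_real_affine[OF 1, of d 0] assms by simp
  have 3: "integrable lborel (\<lambda>x. exp (- ((-d) * x)) * indicator {0<..} ((-d) * x))"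
    using lborel_integrable_real_affine[OF 1, of "-d" 0] assms by simp
  show ?thesis
  proof (rule Bochner_Integration.integrable_bound[OF Bochner_Integration.integrable_add[OF 2 3]])
    show "AE x in lborel. norm (exp (- d * \<bar>x\<bar>))
         \<le> norm (exp (- (d * x)) * indicator {0<..} (d * x) + exp (- (- d * x)) * indicator {0<..} (- d * x))"
      \<comment> \<open>At 0 both half-line indicators vanish and the bound fails.\<close>
      using AE_lborel_singleton[of 0]
      by eventually_elim (use assms in \<open>auto simp: indicator_def zero_less_mult_iff mult_less_0_iff abs_if\<close>)
  qed measurable
qed

lemma exp_decayingE:
  assumes "exp_decaying g"
  obtains C d where "g \<in> borel_measurable borel" "C > 0" "d > 0" "\<And>x. norm (g x) \<le> C * exp (- d * \<bar>x\<bar>)"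
proof -
  obtain C d where *: "g \<in> borel_measurable borel" "d > 0" "\<And>x. norm (g x) \<le> C * exp (- d * \<bar>x\<bar>)"
    using assms unfolding exp_decaying_def by blast
  have "norm (g x) \<le> max C 1 * exp (- d * \<bar>x\<bar>)" for x
    by (rule order_trans[OF *(3)]) (auto intro!: mult_right_mono)
  then show ?thesis using that[of "max C 1" d] * by simp
qed

lemma exp_decaying_bdd: assumes "exp_decaying g" shows "bdd_meas g"
proof -
  obtain C d where *: "g \<in> borel_measurable borel" "C > 0" "d > 0" "\<And>x. norm (g x) \<le> C * exp (- d * \<bar>x\<bar>)"
    using assms by (metis exp_decayingE)
  have "norm (g x) \<le> C" for x
    by (rule order_trans[OF *(4)]) (use * in \<open>auto simp: mult_le_cancel_left1\<close>)
  then show ?thesis using * by (intro bdd_measI)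
qed

lemma exp_decaying_exp_integrable: assumes "exp_decaying g" shows "exp_integrable g"
proof -
  obtain C d where *[measurable]: "g \<in> borel_measurable borel" and C: "C > 0" "d > 0" "\<And>x. norm (g x) \<le> C * exp (- d * \<bar>x\<bar>)"
    using assms by (metis exp_decayingE)
  have "integrable lborel (\<lambda>x. of_real (exp (d/2 * \<bar>x\<bar>)) * g x)"
  proof (rule Bochner_Integration.integrable_bound)
    show "integrable lborel (\<lambda>x. C * exp (- (d/2) * \<bar>x\<bar>))"
      using C integrable_exp_abs[of "d/2"] by (intro integrable_mult_right) simp
    show "AE x in lborel. norm (of_real (exp (d/2 * \<bar>x\<bar>)) * g x) \<le> norm (C * exp (- (d/2) * \<bar>x\<bar>))"
    proof (rule AE_I2)
      fix x
      have "exp (d/2 * \<bar>x\<bar>) * norm (g x) \<le> exp (d/2 * \<bar>x\<bar>) * (C * exp (- d * \<bar>x\<bar>))"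
        by (intro mult_left_mono C) simp
      also have "\<dots> = C * exp (- (d/2) * \<bar>x\<bar>)"
        by (simp add: mult.left_commute flip: exp_add)
      finally show "norm (of_real (exp (d/2 * \<bar>x\<bar>)) * g x) \<le> norm (C * exp (- (d/2) * \<bar>x\<bar>))"
        using C by (simp add: norm_mult)
    qed
  qed measurable
  then show ?thesis unfolding exp_integrable_def using C(2) by (intro exI[of _ "d/2"]) simp
qed

lemma exp_decaying_integrable: "exp_decaying g \<Longrightarrow> integrable lborel g"
  by (intro exp_integrable_integrable exp_decaying_exp_integrable)

text \<open>The weight exp(m|x|) is submultiplicative under x = (x - y) + y, so the weighted
  convolution is dominated by the convolution of the weighted functions; \<open>m\<close> is the
  smaller of the two rates.\<close>

lemma exp_integrable_conv:
  assumes k: "exp_integrable k" and g: "exp_integrable g" shows "exp_integrable (conv k g)"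
proof -
  note [measurable] = exp_integrable_measurable[OF k] exp_integrable_measurable[OF g]
  obtain d where d: "d > 0" "integrable lborel (\<lambda>x. of_real (exp (d * \<bar>x\<bar>)) * k x)"
    using k unfolding exp_integrable_def by blast
  obtain e where e: "e > 0" "integrable lborel (\<lambda>x. of_real (exp (e * \<bar>x\<bar>)) * g x)"
    using g unfolding exp_integrable_def by blast
  define m where "m = min d e"
  have m: "m > 0" using d e by (simp add: m_def)
  define K where "K x = complex_of_real (exp (m * \<bar>x\<bar>) * norm (k x))" for x
  define G where "G x = complex_of_real (exp (m * \<bar>x\<bar>) * norm (g x))" for x
  have K: "integrable lborel K"
    using integrable_norm[OF exp_integrable_mono[OF d(2), of m]] 
    unfolding K_def by (simp add: m_def norm_mult integrable_of_real del: of_real_mult)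
  have G: "integrable lborel G"
    using integrable_norm[OF exp_integrable_mono[OF e(2), of m]] 
    unfolding G_def by (simp add: m_def norm_mult integrable_of_real del: of_real_mult)
  have "integrable lborel (\<lambda>x. of_real (exp (m * \<bar>x\<bar>)) * conv k g x)"
  proof (rule Bochner_Integration.integrable_bound[OF integrable_norm[OF integrable_conv(1)[OF K G]]])
    show "AE x in lborel. norm (of_real (exp (m * \<bar>x\<bar>)) * conv k g x) \<le> norm (norm (conv K G x))"
      using integrable_conv(2)[OF K G]
    proof eventually_elim
      case (elim x)
      define P where "P y = (exp (m * \<bar>x - y\<bar>) * norm (k (x - y))) * (exp (m * \<bar>y\<bar>) * norm (g y))" for y
      have P: "integrable lborel P"
        using integrable_norm[OF elim] by (simp add: P_def[abs_def] K_def G_def norm_mult)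
      have "norm (of_real (exp (m * \<bar>x\<bar>)) * conv k g x) = norm (LINT y|lborel. of_real (exp (m * \<bar>x\<bar>)) * (k (x - y) * g y))"
        by (simp add: conv_def)
      also have "\<dots> \<le> integral\<^sup>L lborel P"
      proof (rule norm_integral_le_integral[OF P])
        fix y
        have "m * \<bar>x\<bar> \<le> m * \<bar>x - y\<bar> + m * \<bar>y\<bar>" using m by (simp flip: distrib_left)
        then have "exp (m * \<bar>x\<bar>) \<le> exp (m * \<bar>x - y\<bar>) * exp (m * \<bar>y\<bar>)" by (simp flip: exp_add)
        from mult_right_mono[OF this, of "norm (k (x - y)) * norm (g y)"]
        show "norm (of_real (exp (m * \<bar>x\<bar>)) * (k (x - y) * g y)) \<le> P y"
          by (simp add: P_def norm_mult mult_ac)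
      qed
      also have "\<dots> = norm (complex_of_real (integral\<^sup>L lborel P))"
        by (simp add: P_def[abs_def])
      also have "complex_of_real (integral\<^sup>L lborel P) = conv K G x"
        unfolding conv_def integral_complex_of_real[symmetric] by (simp add: P_def K_def G_def)
      finally show ?case by simp
    qed
  qed measurable
  then show ?thesis unfolding exp_integrable_def using m by blast
qed

subsection \<open>Convolution theorem\<close>

lemma integral_conv:
  assumes "integrable lborel k" "integrable lborel g"
  shows "integral\<^sup>L lborel (conv k g) = integral\<^sup>L lborel k * integral\<^sup>L lborel g"
proof -
  have "integral\<^sup>L lborel (conv k g) = (LINT y|lborel. (LINT x|lborel. k (x - y) * g y))"
    unfolding conv_def[abs_def] by (rule lborel_pair.Fubini_integral[symmetric], rule integrable_prod_translate[OF assms])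
  also have "\<dots> = (LINT y|lborel. integral\<^sup>L lborel k * g y)"
    using integral_reflect_shift(4)[of k] by simp
  finally show ?thesis by simp
qed

text \<open>Multiplication by a character commutes with convolution, which reduces the claim to the
  integral of a convolution.\<close>

lemma fourier_conv:
  assumes "integrable lborel k" "integrable lborel g"
  shows "fourier (conv k g) \<xi> = fourier k \<xi> * fourier g \<xi>"
proof -
  let ?e = "\<lambda>x. exp (\<i> * of_real (x * \<xi>))"
  have "?e x * conv k g x = conv (\<lambda>x. ?e x * k x) (\<lambda>x. ?e x * g x) x" for x
  proof -
    have "?e x * (k (x - y) * g y) = ?e (x - y) * k (x - y) * (?e y * g y)" for y
    proof -
      have "?e x = ?e (x - y) * ?e y" by (simp flip: exp_add add: algebra_simps)
      then show ?thesis by (simp only: mult_ac)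
    qed
    then show ?thesis unfolding conv_def by (metis (no_types, lifting) Bochner_Integration.integral_cong integral_mult_right_zero)
  qed
  then have "fourier (conv k g) \<xi> = integral\<^sup>L lborel (conv (\<lambda>x. ?e x * k x) (\<lambda>x. ?e x * g x))"
    by (simp add: fourier_def)
  also have "\<dots> = fourier k \<xi> * fourier g \<xi>"
    unfolding fourier_def by (rule integral_conv) (intro integrable_exp_mult assms)+
  finally show ?thesis .
qed

lemma fourier_add:
  assumes "integrable lborel k" "integrable lborel g"
  shows "fourier (\<lambda>x. k x + g x) \<xi> = fourier k \<xi> + fourier g \<xi>"
  unfolding fourier_def using integrable_exp_mult[OF assms(1), of \<xi>] integrable_exp_mult[OF assms(2), of \<xi>]
  by (simp add: distrib_left)

lemma fourier_cmult: "fourier (\<lambda>x. c * k x) \<xi> = c * fourier k \<xi>"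
  unfolding fourier_def by (simp add: mult.left_commute)

lemma fourier_reflect: "fourier (\<lambda>x. k (- x)) \<xi> = fourier k (- \<xi>)"
  unfolding fourier_def using integral_reflect_shift(5)[of "\<lambda>x. exp (\<i> * of_real (x * - \<xi>)) * k x"] by simp

lemma conv_reflect: "conv (\<lambda>x. V (- x)) (\<lambda>y. f (- y)) (- x) = conv V f x"
  unfolding conv_def using integral_reflect_shift(5)[of "\<lambda>y. V (x - y) * f y"] by (simp add: add.commute)

subsection \<open>Uniqueness\<close>

text \<open>The positive and the negative part have the same Fourier transform, hence the same mass.
  Normalised by this mass they are probability densities with equal characteristic functions, and
  Levy's uniqueness theorem applies.\<close>

lemma fourier_real_unique:
  fixes r :: "real \<Rightarrow> real"
  assumes r: "integrable lborel r" and zero: "\<And>\<xi>. fourier (\<lambda>x. of_real (r x)) \<xi> = 0"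
  shows "AE x in lborel. r x = 0"
proof -
  define a where "a x = max (r x) 0" for x
  define b where "b x = max (- r x) 0" for x
  have [measurable]: "r \<in> borel_measurable borel" using borel_measurable_integrable[OF r] by simp
  have a: "integrable lborel a" and b: "integrable lborel b"
    unfolding a_def b_def using r by auto
  have [measurable]: "a \<in> borel_measurable borel" "b \<in> borel_measurable borel"
    unfolding a_def b_def by measurable
  have nonneg: "a x \<ge> 0" "b x \<ge> 0" for x by (auto simp: a_def b_def)
  have ab: "fourier (\<lambda>x. of_real (a x)) \<xi> = fourier (\<lambda>x. of_real (b x)) \<xi>" for \<xi>
  proof -
    have "(\<lambda>x. complex_of_real (a x)) = (\<lambda>x. of_real (r x) + of_real (b x))"
      by (auto simp: fun_eq_iff a_def b_def max_def simp flip: of_real_add)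
    then show ?thesis using fourier_add[of "\<lambda>x. of_real (r x)" "\<lambda>x. of_real (b x)" \<xi>] r b zero
      by simp
  qed
  define c where "c = integral\<^sup>L lborel a"
  have cb: "integral\<^sup>L lborel b = c"
  proof -
    have "complex_of_real (integral\<^sup>L lborel a) = complex_of_real (integral\<^sup>L lborel b)"
      using ab[of 0] unfolding fourier_def by simp
    then show ?thesis by (simp add: c_def)
  qed
  have "c \<ge> 0" unfolding c_def using nonneg by simp
  show ?thesis
  \<comment> \<open>\<open>c\<close> is the normalising mass; if it vanishes, both parts vanish
    almost everywhere.\<close>
  proof (cases "c = 0")
    case True
    have "AE x in lborel. a x = 0" "AE x in lborel. b x = 0"
      using integral_nonneg_eq_0_iff_AE[OF a] integral_nonneg_eq_0_iff_AE[OF b] nonneg True cb c_def by auto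
    then show ?thesis by eventually_elim (auto simp: a_def b_def max_def split: if_splits)
  next
    case False
    with \<open>c \<ge> 0\<close> have c: "c > 0" by simp
    define M :: "(real \<Rightarrow> real) \<Rightarrow> real measure" where "M f = density lborel (\<lambda>x. ennreal (f x / c))" for f
    have prob: "real_distribution (M f)" if f: "integrable lborel f" "\<And>x. f x \<ge> 0" "integral\<^sup>L lborel f = c" for f
    proof -
      have [measurable]: "f \<in> borel_measurable borel" using borel_measurable_integrable[OF f(1)] by simp
      have "emeasure (M f) (space (M f)) = (\<integral>\<^sup>+x. ennreal (f x / c) \<partial>lborel)"
        unfolding M_def by (subst emeasure_density) (auto intro!: nn_integral_cong)
      also have "\<dots> = ennreal (LINT x|lborel. f x / c)"
        using f c by (intro nn_integral_eq_integral) auto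
      also have "\<dots> = 1" using f c by simp
      finally have "prob_space (M f)" by (rule prob_spaceI)
      then show ?thesis unfolding real_distribution_def real_distribution_axioms_def by (simp add: M_def)
    qed
    have char: "char (M f) t = fourier (\<lambda>x. of_real (f x)) t / c" if f: "integrable lborel f" "\<And>x. f x \<ge> 0" for f t
    proof -
      have [measurable]: "f \<in> borel_measurable borel" using borel_measurable_integrable[OF f(1)] by simp
      have "char (M f) t = (LINT x|lborel. (f x / c) *\<^sub>R iexp (t * x))"
        unfolding char_def M_def by (rule integral_density) (use f c in auto)
      also have "\<dots> = (LINT x|lborel. exp (\<i> * of_real (x * t)) * of_real (f x) / c)"
        by (intro Bochner_Integration.integral_cong) (auto simp: scaleR_conv_of_real mult_ac)
      finally show ?thesis unfolding fourier_def by simp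
    qed
    have "M a = M b"
      by (rule Levy_uniqueness) (use prob a b nonneg c_def cb char ab in \<open>auto simp: fun_eq_iff\<close>)
    then have "AE x in lborel. ennreal (a x / c) = ennreal (b x / c)"
      unfolding M_def by (subst (asm) sigma_finite_measure.density_unique_iff) 
        (auto intro: sigma_finite_lborel lborel.sigma_finite_measure_axioms)
    then show ?thesis
    proof eventually_elim
      case (elim x)
      then have "a x = b x" using nonneg c by (simp add: ennreal_inj)
      then show ?case by (auto simp: a_def b_def max_def split: if_splits)
    qed
  qed
qed

lemma fourier_cnj: "fourier (\<lambda>x. cnj (f x)) \<xi> = cnj (fourier f (- \<xi>))"
proof -
  have "cnj (fourier f (- \<xi>)) = (LINT x|lborel. cnj (exp (\<i> * of_real (x * - \<xi>)) * f x))"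
    unfolding fourier_def by (rule Bochner_Integration.integral_cnj[symmetric])
  also have "\<dots> = fourier (\<lambda>x. cnj (f x)) \<xi>"
    unfolding fourier_def by (simp add: exp_cnj)
  finally show ?thesis by simp
qed

text \<open>The transform of the conjugate at \<xi> is the conjugate of the transform at -\<xi>, so
  the real and the imaginary part also have vanishing transforms.\<close>

lemma fourier_unique:
  assumes f: "integrable lborel f" and zero: "\<And>\<xi>. fourier f \<xi> = 0"
  shows "AE x in lborel. f x = 0"
proof -
  have fc: "integrable lborel (\<lambda>x. cnj (f x))" using f by simp
  have "AE x in lborel. Re (f x) = 0"
  proof (rule fourier_real_unique)
    show "integrable lborel (\<lambda>x. Re (f x))" using f by simp
    fix \<xi>
    have "(\<lambda>x. complex_of_real (Re (f x))) = (\<lambda>x. (1/2) * (f x + cnj (f x)))"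
      by (auto simp: fun_eq_iff complex_add_cnj)
    then show "fourier (\<lambda>x. of_real (Re (f x))) \<xi> = 0"
      using fourier_add[OF f fc, of \<xi>] zero by (simp only: fourier_cmult fourier_cnj) simp
  qed
  moreover have "AE x in lborel. Im (f x) = 0"
  proof (rule fourier_real_unique)
    show "integrable lborel (\<lambda>x. Im (f x))" using f by simp
    fix \<xi>
    have "(\<lambda>x. complex_of_real (Im (f x))) = (\<lambda>x. (- \<i>/2) * (f x + (-1) * cnj (f x)))"
      by (auto simp: fun_eq_iff complex_eq_iff)
    moreover have "fourier (\<lambda>x. f x + (-1) * cnj (f x)) \<xi> = fourier f \<xi> + (-1) * fourier (\<lambda>x. cnj (f x)) \<xi>"
      using fourier_add[OF f, of "\<lambda>x. (-1) * cnj (f x)" \<xi>] fc by (simp only: fourier_cmult integrable_mult_right)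
    ultimately show "fourier (\<lambda>x. of_real (Im (f x))) \<xi> = 0"
      using zero fourier_cmult[of "- \<i>/2" "\<lambda>x. f x + (-1) * cnj (f x)" \<xi>] by (simp add: fourier_cnj)
  qed
  ultimately show ?thesis by eventually_elim (simp add: complex_eq_iff)
qed

subsection \<open>Analyticity in a half-plane\<close>

text \<open>In the left half-plane the derivative of exp has modulus at most 1. This supplies the
  majorant for the difference quotients of \<open>cfour\<close>.\<close>

lemma norm_exp_diff_le:
  assumes "Re a \<le> 0" "Re b \<le> 0" shows "norm (exp a - exp b) \<le> norm (a - b)"
proof -
  have "norm (exp a - exp b) \<le> 1 * norm (a - b)"
  proof (rule field_differentiable_bound[where S="{z. Re z \<le> 0}" and f'=exp])
    show "convex {z. Re z \<le> 0}" by (rule convex_halfspace_Re_le)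
    show "(exp has_field_derivative exp z) (at z within {z. Re z \<le> 0})" for z :: complex
      by (rule DERIV_subset[OF DERIV_exp]) auto
  qed (use assms in auto)
  then show ?thesis by simp
qed

text \<open>Differentiation under the integral along sequences, with majorant |x m(x)|. The
  derivative is taken within the closed half-plane, so that holomorphy inside and continuity up to
  the real axis both follow.\<close>

lemma cfour_has_derivative:
  assumes m: "integrable lborel m" and xm: "integrable lborel (\<lambda>x. of_real \<bar>x\<bar> * m x)"
    and supp: "\<And>x. x < 0 \<Longrightarrow> m x = 0" and z: "Im z \<ge> 0"
  shows "(cfour m has_field_derivative cfour (\<lambda>x. \<i> * of_real x * m x) z) (at z within {z. Im z \<ge> 0})"
  unfolding has_field_derivative_iff tendsto_at_iff_sequentially comp_def
proof (intro allI impI)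
  fix w assume w: "\<forall>i. w i \<in> {z. Im z \<ge> 0} - {z}" and lim: "w \<longlonglongrightarrow> z"
  have [measurable]: "m \<in> borel_measurable borel" using m by (rule integrable_lborel_measurable)
  have int: "integrable lborel (\<lambda>x. exp (\<i> * v * of_real x) * m x)" if v: "Im v \<ge> 0" for v
  proof (rule Bochner_Integration.integrable_bound[OF m])
    show "AE x in lborel. norm (exp (\<i> * v * of_real x) * m x) \<le> norm (m x)"
    proof (rule AE_I2)
      fix x show "norm (exp (\<i> * v * of_real x) * m x) \<le> norm (m x)"
      proof (cases "x < 0")
        case False
        then have "norm (exp (\<i> * v * of_real x)) \<le> 1" using v by simp
        then show ?thesis unfolding norm_mult by (rule mult_left_le_one_le[rotated 2]) auto
      qed (simp add: supp)
    qed
  qed measurable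
  have "(\<lambda>n. LINT x|lborel. (exp (\<i> * w n * of_real x) - exp (\<i> * z * of_real x)) / (w n - z) * m x)
      \<longlonglongrightarrow> (LINT x|lborel. exp (\<i> * z * of_real x) * (\<i> * of_real x * m x))"
  proof (rule integral_dominated_convergence[where w="\<lambda>x. norm (of_real \<bar>x\<bar> * m x)"])
    show "integrable lborel (\<lambda>x. norm (of_real \<bar>x\<bar> * m x))" using xm by (rule integrable_norm)
    show "AE x in lborel. (\<lambda>n. (exp (\<i> * w n * of_real x) - exp (\<i> * z * of_real x)) / (w n - z) * m x)
        \<longlonglongrightarrow> exp (\<i> * z * of_real x) * (\<i> * of_real x * m x)"
    proof (rule AE_I2)
      fix x :: real
      have "((\<lambda>v. exp (\<i> * v * of_real x)) has_field_derivative exp (\<i> * z * of_real x) * (\<i> * of_real x)) (at z)"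
        by (auto intro!: derivative_eq_intros)
      then have "(\<lambda>n. (exp (\<i> * w n * of_real x) - exp (\<i> * z * of_real x)) / (w n - z)) \<longlonglongrightarrow> exp (\<i> * z * of_real x) * (\<i> * of_real x)"
        unfolding has_field_derivative_iff tendsto_at_iff_sequentially comp_def using w lim by blast
      from tendsto_mult_right[OF this, of "m x"]
      show "(\<lambda>n. (exp (\<i> * w n * of_real x) - exp (\<i> * z * of_real x)) / (w n - z) * m x)
        \<longlonglongrightarrow> exp (\<i> * z * of_real x) * (\<i> * of_real x * m x)" by (simp add: mult.assoc)
    qed
    fix n
    show "AE x in lborel. norm ((exp (\<i> * w n * of_real x) - exp (\<i> * z * of_real x)) / (w n - z) * m x) \<le> norm (of_real \<bar>x\<bar> * m x)"
    proof (rule AE_I2)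
      fix x
      show "norm ((exp (\<i> * w n * of_real x) - exp (\<i> * z * of_real x)) / (w n - z) * m x) \<le> norm (of_real \<bar>x\<bar> * m x)"
      proof (cases "x < 0")
        case False
        have wn: "w n \<noteq> z" "Im (w n) \<ge> 0" using w by auto
        have "norm (exp (\<i> * w n * of_real x) - exp (\<i> * z * of_real x)) \<le> norm (\<i> * w n * of_real x - \<i> * z * of_real x)"
          by (rule norm_exp_diff_le) (use False wn z in auto)
        also have "\<dots> = norm (w n - z) * \<bar>x\<bar>"
          by (simp add: norm_mult flip: left_diff_distrib right_diff_distrib)
        finally have "norm (exp (\<i> * w n * of_real x) - exp (\<i> * z * of_real x)) / norm (w n - z) \<le> \<bar>x\<bar>"
          using wn by (simp add: divide_le_eq mult.commute)
        from mult_right_mono[OF this, of "norm (m x)"] show ?thesis by (simp add: norm_mult norm_divide)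
      qed (simp add: supp)
    qed
  qed measurable
  moreover have "(LINT x|lborel. (exp (\<i> * w n * of_real x) - exp (\<i> * z * of_real x)) / (w n - z) * m x) =
     (cfour m (w n) - cfour m z) / (w n - z)" for n
  proof -
    have "Im (w n) \<ge> 0" using w by auto
    then have "cfour m (w n) - cfour m z = (LINT x|lborel. exp (\<i> * w n * of_real x) * m x - exp (\<i> * z * of_real x) * m x)"
      unfolding cfour_def using int z by simp
    then show ?thesis by (simp flip: left_diff_distrib integral_divide_zero add: times_divide_eq_left)
  qed
  ultimately show "(\<lambda>n. (cfour m (w n) - cfour m z) / (w n - z)) \<longlonglongrightarrow> cfour (\<lambda>x. \<i> * of_real x * m x) z"
    by (simp only: cfour_def[of "\<lambda>x. \<i> * of_real x * m x"])
qed

lemma cfour_upper: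
  assumes m: "exp_integrable m" and supp: "\<And>x. x < 0 \<Longrightarrow> m x = 0"
  shows "cfour m holomorphic_on {z. Im z > 0}" "continuous_on {z. Im z \<ge> 0} (cfour m)"
proof -
  note d = cfour_has_derivative[OF exp_integrable_integrable[OF m] exp_integrable_abs[OF m] supp]
  show "continuous_on {z. Im z \<ge> 0} (cfour m)"
    by (rule DERIV_continuous_on) (use d in auto)
  show "cfour m holomorphic_on {z. Im z > 0}"
    unfolding holomorphic_on_def field_differentiable_def
  proof
    fix z assume z: "z \<in> {z. Im z > 0}"
    then have "(cfour m has_field_derivative cfour (\<lambda>x. \<i> * of_real x * m x) z) (at z within {z. Im z \<ge> 0})"
      using d[of z] by auto
    then show "\<exists>D. (cfour m has_field_derivative D) (at z within {z. Im z > 0})"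
      by (intro exI, rule DERIV_subset) auto
  qed
qed

lemma cfour_reflect: "cfour (\<lambda>x. m (- x)) z = cfour m (- z)"
  unfolding cfour_def using integral_reflect_shift(5)[of "\<lambda>x. exp (\<i> * - z * of_real x) * m x"] by simp

lemma cfour_lower:
  assumes m: "exp_integrable m" and supp: "\<And>x. x > 0 \<Longrightarrow> m x = 0"
  shows "cfour m holomorphic_on {z. Im z < 0}" "continuous_on {z. Im z \<le> 0} (cfour m)"
proof -
  have *: "cfour m = (\<lambda>z. cfour (\<lambda>x. m (- x)) (- z))" by (simp add: cfour_reflect fun_eq_iff)
  note u = cfour_upper[OF exp_integrable_reflect[OF m]]
  have s: "m (- x) = 0" if "x < 0" for x using supp[of "- x"] that by simp
  show "cfour m holomorphic_on {z. Im z < 0}"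
    unfolding * by (rule holomorphic_on_compose_gen[OF _ u(1)[OF s], unfolded comp_def]) (auto intro!: holomorphic_intros)
  show "continuous_on {z. Im z \<le> 0} (cfour m)"
    unfolding * by (rule continuous_on_compose2[OF u(2)[OF s]]) (auto intro!: continuous_intros)
qed

lemma fourier_continuous:
  assumes "integrable lborel m" shows "continuous_on UNIV (fourier m)"
proof -
  have [measurable]: "m \<in> borel_measurable borel" using assms by (rule integrable_lborel_measurable)
  have "isCont (fourier m) \<xi>" for \<xi>
    unfolding continuous_at_sequentially comp_def
  proof (intro allI impI)
    fix w assume w: "w \<longlonglongrightarrow> \<xi>"
    show "(\<lambda>n. fourier m (w n)) \<longlonglongrightarrow> fourier m \<xi>" unfolding fourier_def
    proof (rule integral_dominated_convergence[where w="\<lambda>x. norm (m x)"])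
      show "AE x in lborel. (\<lambda>i. exp (\<i> * of_real (x * w i)) * m x) \<longlonglongrightarrow> exp (\<i> * of_real (x * \<xi>)) * m x"
        by (intro AE_I2 tendsto_intros w)
    qed (use assms in \<open>auto simp: norm_mult\<close>)
  qed
  then show ?thesis by (simp add: continuous_on_eq_continuous_at)
qed

text \<open>Identities between symbols are obtained by dividing by \<xi> + p or \<xi> - p;
  continuity recovers them at the excluded point.\<close>

lemma continuous_zero_except_point:
  fixes f :: "real \<Rightarrow> complex"
  assumes "continuous_on UNIV f" "\<And>x. x \<noteq> c \<Longrightarrow> f x = 0" shows "f x = 0"
proof -
  have "(f \<longlongrightarrow> f c) (at c)" using assms(1) by (simp add: continuous_on_eq_continuous_at isCont_def)
  moreover have "(f \<longlongrightarrow> 0) (at c)"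
    by (rule tendsto_eventually) (simp add: eventually_at_filter assms(2))
  ultimately have "f c = 0" by (rule tendsto_unique[rotated]) simp
  then show ?thesis using assms(2) by (cases "x = c") auto
qed

lemma integral_exp_interval:
  fixes c :: complex
  assumes "a \<le> b" "c \<noteq> 0"
  shows "(LINT x|lborel. indicator {a..b} x * exp (c * of_real x)) = (exp (c * of_real b) - exp (c * of_real a)) / c"
proof -
  have "(LINT x|lborel. indicator {a..b} x *\<^sub>R exp (c * of_real x)) = exp (c * of_real b) / c - exp (c * of_real a) / c"
  proof (rule integral_FTC_atLeastAtMost[OF assms(1), where F="\<lambda>x. exp (c * of_real x) / c"])
    fix x
    have "((\<lambda>z. exp (c * z) / c) has_field_derivative exp (c * of_real x)) (at (of_real x))"
      using assms(2) by (auto intro!: derivative_eq_intros)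
    from has_vector_derivative_real_field[OF this]
    show "((\<lambda>x. exp (c * of_real x) / c) has_vector_derivative exp (c * of_real x)) (at x within {a..b})"
      by (simp add: has_vector_derivative_at_within)
  qed (intro continuous_intros)
  then show ?thesis by (simp add: scaleR_conv_of_real of_real_indicator diff_divide_distrib)
qed

subsection \<open>Cancelling a pole by a zero\<close>

text \<open>The bounded function whose Fourier transform is the distribution 1/(0 - i(\<xi> +
  p)).\<close>

definition hexp :: "real \<Rightarrow> real \<Rightarrow> complex" where
  "hexp p x = indicator {0<..} x * exp_fn (of_real p) x"

lemma hexp_eq: "hexp p x = (if x > 0 then exp (\<i> * of_real (p * x)) else 0)"
  by (simp add: hexp_def exp_fn_def indicator_def mult.assoc)

lemma bdd_meas_hexp: "bdd_meas (hexp p)"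
  by (rule bdd_measI[of _ 1]) (auto simp: hexp_eq[abs_def])

text \<open>The kernel of (\<nu> + fourier m) / (-i(\<xi> + p)), which is a genuine function as soon
  as the numerator vanishes at -p.\<close>

definition pole_cancel :: "real \<Rightarrow> complex \<Rightarrow> (real \<Rightarrow> complex) \<Rightarrow> real \<Rightarrow> complex" where
  "pole_cancel p \<nu> m x = \<nu> * hexp p x + conv m (hexp p) x"

context
  fixes p :: real and \<nu> :: complex and m :: "real \<Rightarrow> complex"
  assumes m: "exp_integrable m" and zero: "\<nu> + fourier m (- p) = 0"
begin

text \<open>The vanishing of the numerator at -p writes \<nu> as an integral of \<open>m\<close>, so
  that the two nondecaying terms of \<open>pole_cancel\<close> merge into one integral against
  \<open>m\<close>. The difference of the two half-line indicators is supported between 0 and z, and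
  the nondecaying exponential has disappeared.\<close>

private definition \<kappa> :: "real \<Rightarrow> real \<Rightarrow> complex" where
  "\<kappa> x z = (indicator {z<..} x - indicator {0<..} x) * exp (\<i> * of_real (p * (x - z)))"

private lemma \<kappa>_measurable [measurable]: "case_prod \<kappa> \<in> borel_measurable (borel \<Otimes>\<^sub>M borel)"
proof -
  have "case_prod \<kappa> = (\<lambda>(x, z). ((if z < x then 1 else 0) - (if 0 < x then 1 else 0)) * exp (\<i> * of_real (p * (x - z))))"
    by (auto simp: fun_eq_iff \<kappa>_def indicator_def)
  then show ?thesis by simp
qed

private lemma \<kappa>_bound: "norm (\<kappa> x z) \<le> indicator {-\<bar>z\<bar>..\<bar>z\<bar>} x"
  by (auto simp: \<kappa>_def norm_mult indicator_def)

private lemma pole_cancel_eq: "pole_cancel p \<nu> m x = (LINT z|lborel. \<kappa> x z * m z)"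
proof -
  have int: "integrable lborel m" using m by (rule exp_integrable_integrable)
  let ?e = "\<lambda>z. exp (\<i> * of_real (p * (x - z)))"
  have e: "?e z = exp (\<i> * of_real (p * x)) * exp (\<i> * of_real (z * - p))" for z
    by (simp flip: exp_add add: algebra_simps)
  have i0: "integrable lborel (\<lambda>z. ?e z * m z)"
    unfolding e mult.assoc by (intro integrable_mult_right integrable_exp_mult int)
  have i1: "integrable lborel (\<lambda>z. (indicator {z<..} x * ?e z) * m z)"
  proof (rule integrable_bdd_mult[OF int])
    have "(\<lambda>z. indicator {z<..} x * ?e z) = (\<lambda>z. (if z < x then 1 else 0) * ?e z)" by (auto simp: indicator_def)
    then show "bdd_meas (\<lambda>z. indicator {z<..} x * ?e z)" by (intro bdd_measI[of _ 1]) (auto simp: norm_mult indicator_def)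
  qed
  have nu: "\<nu> * exp (\<i> * of_real (p * x)) = - (LINT z|lborel. ?e z * m z)"
    unfolding e using zero by (simp add: mult.assoc fourier_def add_eq_0_iff2)
  have "(LINT z|lborel. \<kappa> x z * m z) = (LINT z|lborel. (indicator {z<..} x * ?e z) * m z - indicator {0<..} x * (?e z * m z))"
    by (intro Bochner_Integration.integral_cong refl) (simp add: \<kappa>_def algebra_simps)
  also have "\<dots> = (LINT z|lborel. (indicator {z<..} x * ?e z) * m z) - indicator {0<..} x * (LINT z|lborel. ?e z * m z)"
    using i0 i1 by (subst Bochner_Integration.integral_diff) (auto intro!: integrable_mult_right)
  also have "(LINT z|lborel. (indicator {z<..} x * ?e z) * m z) = conv (hexp p) m x"
    unfolding conv_def by (intro Bochner_Integration.integral_cong refl) (auto simp: hexp_eq indicator_def)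
  also have "conv (hexp p) m x = conv m (hexp p) x" by (rule conv_commute)
  finally show ?thesis using nu by (auto simp: pole_cancel_def hexp_eq indicator_def)
qed

text \<open>For fixed z the integration in x runs over an interval of length 2|z| on which the
  weight is at most exp(d|z|). The case d = 0 serves the Fourier transform, the case d > 0
  exponential integrability.\<close>

private lemma \<kappa>_integrable_weight:
  assumes h: "h \<in> borel_measurable borel" and hb: "\<And>x. norm (h x) \<le> exp (d * \<bar>x\<bar>)" and d: "d \<ge> 0"
    and md: "integrable lborel (\<lambda>z. of_real (\<bar>z\<bar> * exp (d * \<bar>z\<bar>)) * m z)"
  shows "integrable (lborel \<Otimes>\<^sub>M lborel) (\<lambda>(z, x). h x * (\<kappa> x z * m z))"
proof (rule lborel_pair.Fubini_integrable)
  note [measurable] = exp_integrable_measurable[OF m] h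
  have \<kappa>m [measurable]: "(\<lambda>x. \<kappa> x z) \<in> borel_measurable borel" for z
    using measurable_compose[OF measurable_Pair2' \<kappa>_measurable, of z] by (simp add: comp_def)
  show "(\<lambda>(z, x). h x * (\<kappa> x z * m z)) \<in> borel_measurable (lborel \<Otimes>\<^sub>M lborel)" by measurable
  have ind: "integrable lborel (\<lambda>x. exp (d * \<bar>z\<bar>) * indicator {-\<bar>z\<bar>..\<bar>z\<bar>} x)" for z :: real
    by (intro integrable_mult_right integrable_real_indicator) auto
  have bd: "norm (h x * \<kappa> x z) \<le> exp (d * \<bar>z\<bar>) * indicator {-\<bar>z\<bar>..\<bar>z\<bar>} x" for x z
  proof (cases "x \<in> {-\<bar>z\<bar>..\<bar>z\<bar>}")
    case True
    then have "norm (h x) \<le> exp (d * \<bar>z\<bar>)"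
      by (intro order_trans[OF hb]) (use d in \<open>auto intro!: mult_left_mono\<close>)
    then show ?thesis using \<kappa>_bound[of x z] by (simp add: norm_mult mult_mono)
  next
    case False then show ?thesis using \<kappa>_bound[of x z] by simp
  qed
  have i1: "integrable lborel (\<lambda>x. h x * \<kappa> x z)" for z
    by (rule Bochner_Integration.integrable_bound[OF ind[of z]])
      (use bd in \<open>auto intro: order_trans[OF _ abs_ge_self]\<close>)
  have i2: "integrable lborel (\<lambda>x. h x * (\<kappa> x z * m z))" for z
    using integrable_mult_left[OF i1, of _ "m z"] by (simp add: mult.assoc)
  then show "AE z in lborel. integrable lborel (\<lambda>x. case (z, x) of (z, x) \<Rightarrow> h x * (\<kappa> x z * m z))" by simp
  show "integrable lborel (\<lambda>z. LINT x|lborel. norm (case (z, x) of (z, x) \<Rightarrow> h x * (\<kappa> x z * m z)))"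
  proof (rule Bochner_Integration.integrable_bound[OF integrable_mult_right[OF integrable_norm[OF md], of 2]])
    show "AE z in lborel. norm (LINT x|lborel. norm (case (z, x) of (z, x) \<Rightarrow> h x * (\<kappa> x z * m z)))
        \<le> norm (2 * norm (of_real (\<bar>z\<bar> * exp (d * \<bar>z\<bar>)) * m z))"
    proof (rule AE_I2)
      fix z
      have "(LINT x|lborel. norm (h x * (\<kappa> x z * m z))) \<le> (LINT x|lborel. (exp (d * \<bar>z\<bar>) * indicator {-\<bar>z\<bar>..\<bar>z\<bar>} x) * norm (m z))"
        using mult_right_mono[OF bd norm_ge_zero] by (intro integral_mono integrable_norm i2 integrable_mult_left ind) (simp add: norm_mult mult.assoc)
      also have "\<dots> = 2 * (\<bar>z\<bar> * exp (d * \<bar>z\<bar>)) * norm (m z)" by simp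
      finally show "norm (LINT x|lborel. norm (case (z, x) of (z, x) \<Rightarrow> h x * (\<kappa> x z * m z)))
        \<le> norm (2 * norm (of_real (\<bar>z\<bar> * exp (d * \<bar>z\<bar>)) * m z))" by (simp add: norm_mult)
    qed
  qed measurable
qed

lemma pole_cancel_exp_integrable: "exp_integrable (pole_cancel p \<nu> m)"
proof -
  obtain d where d: "d > 0" and i: "integrable lborel (\<lambda>x. of_real (exp (d * \<bar>x\<bar>)) * m x)"
    using m unfolding exp_integrable_def by blast
  \<comment> \<open>Half of the exponential rate of \<open>m\<close> is given up to absorb the
    linear factor |z|.\<close>
  have md: "integrable lborel (\<lambda>z. of_real (\<bar>z\<bar> * exp (d/2 * \<bar>z\<bar>)) * m z)"
  proof (rule integrable_weight[OF i, where C="2/d"])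
    fix x
    have "\<bar>x\<bar> * exp (d/2 * \<bar>x\<bar>) \<le> (1/(d/2)) * exp (d/2 * \<bar>x\<bar>) * exp (d/2 * \<bar>x\<bar>)"
      using d by (intro mult_right_mono abs_le_exp) auto
    also have "\<dots> = 2 / d * exp (d * \<bar>x\<bar>)" by (simp flip: exp_add)
    finally show "norm (complex_of_real (\<bar>x\<bar> * exp (d/2 * \<bar>x\<bar>))) \<le> 2 / d * exp (d * \<bar>x\<bar>)" by (simp add: norm_mult)
  qed measurable
  have "integrable (lborel \<Otimes>\<^sub>M lborel) (\<lambda>(z, x). of_real (exp (d/2 * \<bar>x\<bar>)) * (\<kappa> x z * m z))"
    by (rule \<kappa>_integrable_weight[OF _ _ _ md]) (use d in auto)
  from lborel_pair.integrable_snd[OF this]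
  show ?thesis unfolding exp_integrable_def using d
    by (intro exI[of _ "d/2"]) (simp add: pole_cancel_eq)
qed

text \<open>The product form includes \<xi> = -p, where the claim is the hypothesis on the zero;
  elsewhere it follows by Fubini and explicit integration of the exponential over the interval
  between 0 and z.\<close>

lemma pole_cancel_fourier: "fourier (pole_cancel p \<nu> m) \<xi> * (- \<i> * of_real (\<xi> + p)) = \<nu> + fourier m \<xi>"
proof (cases "\<xi> + p = 0")
  case True
  then have "\<xi> = - p" by simp
  then show ?thesis using zero by simp
next
  case False
  define s where "s = \<xi> + p"
  have s: "s \<noteq> 0" using False by (simp add: s_def)
  note [measurable] = exp_integrable_measurable[OF m]
  have int: "integrable lborel m" using m by (rule exp_integrable_integrable)
  have P: "integrable (lborel \<Otimes>\<^sub>M lborel) (\<lambda>(z, x). exp (\<i> * of_real (x * \<xi>)) * (\<kappa> x z * m z))"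
    by (rule \<kappa>_integrable_weight[where d=0]) (use exp_integrable_abs[OF m] in auto)
  let ?E = "\<lambda>z. exp (\<i> * of_real s * of_real z)"
  \<comment> \<open>Up to null sets \<open>\<kappa> x z\<close> is minus the exponential on [0,z] or
    plus the exponential on [z,0], according to the sign of z; both cases integrate to the same
    expression.\<close>
  have inner: "(LINT x|lborel. exp (\<i> * of_real (x * \<xi>)) * \<kappa> x z) = - exp (- \<i> * of_real (p * z)) * (?E z - 1) / (\<i> * of_real s)" for z
  proof -
    have e: "exp (\<i> * of_real (x * \<xi>)) * exp (\<i> * of_real (p * (x - z))) = exp (- \<i> * of_real (p * z)) * ?E x" for x
      by (simp flip: exp_add add: algebra_simps s_def)
    show ?thesis
    proof (cases "z \<ge> 0")
      case True
      have "(LINT x|lborel. exp (\<i> * of_real (x * \<xi>)) * \<kappa> x z) = (LINT x|lborel. - exp (- \<i> * of_real (p * z)) * (indicator {0..z} x * ?E x))"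
      proof (rule integral_cong_AE)
        show "AE x in lborel. exp (\<i> * of_real (x * \<xi>)) * \<kappa> x z = - exp (- \<i> * of_real (p * z)) * (indicator {0..z} x * ?E x)"
          using AE_lborel_singleton[of 0]
        proof eventually_elim
          case (elim x)
          have "indicator {z<..} x - indicator {0<..} x = (- indicator {0..z} x :: complex)"
            using True elim by (auto simp: indicator_def)
          moreover have "exp (\<i> * of_real (x * \<xi>)) * \<kappa> x z = (indicator {z<..} x - indicator {0<..} x)
            * (exp (\<i> * of_real (x * \<xi>)) * exp (\<i> * of_real (p * (x - z))))"
            unfolding \<kappa>_def by (simp only: mult_ac)
          ultimately show ?case unfolding e by (simp only: mult_ac mult_minus_left mult_minus_right)
        qed
      qed (unfold \<kappa>_def, measurable)
      also have "\<dots> = - exp (- \<i> * of_real (p * z)) * ((?E z - 1) / (\<i> * of_real s))"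
        using integral_exp_interval[OF True, of "\<i> * of_real s"] s by simp
      finally show ?thesis by simp
    next
      case False
      have "(LINT x|lborel. exp (\<i> * of_real (x * \<xi>)) * \<kappa> x z) = (LINT x|lborel. exp (- \<i> * of_real (p * z)) * (indicator {z..0} x * ?E x))"
      proof (rule integral_cong_AE)
        show "AE x in lborel. exp (\<i> * of_real (x * \<xi>)) * \<kappa> x z = exp (- \<i> * of_real (p * z)) * (indicator {z..0} x * ?E x)"
          using AE_lborel_singleton[of z]
        proof eventually_elim
          case (elim x)
          have "indicator {z<..} x - indicator {0<..} x = (indicator {z..0} x :: complex)"
            using False elim by (auto simp: indicator_def)
          moreover have "exp (\<i> * of_real (x * \<xi>)) * \<kappa> x z = (indicator {z<..} x - indicator {0<..} x)
            * (exp (\<i> * of_real (x * \<xi>)) * exp (\<i> * of_real (p * (x - z))))"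
            unfolding \<kappa>_def by (simp only: mult_ac)
          ultimately show ?case unfolding e by (simp only: mult_ac mult_minus_left mult_minus_right)
        qed
      qed (unfold \<kappa>_def, measurable)
      also have "\<dots> = exp (- \<i> * of_real (p * z)) * ((1 - ?E z) / (\<i> * of_real s))"
        using integral_exp_interval[of z 0 "\<i> * of_real s"] s False by simp
      finally show ?thesis by (simp add: field_simps)
    qed
  qed
  have "fourier (pole_cancel p \<nu> m) \<xi> = (LINT x|lborel. (LINT z|lborel. exp (\<i> * of_real (x * \<xi>)) * (\<kappa> x z * m z)))"
    by (simp add: fourier_def pole_cancel_eq)
  also have "\<dots> = (LINT z|lborel. (LINT x|lborel. exp (\<i> * of_real (x * \<xi>)) * (\<kappa> x z * m z)))"
    by (rule lborel_pair.Fubini_integral) (rule P)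
  also have "\<dots> = (LINT z|lborel. (LINT x|lborel. exp (\<i> * of_real (x * \<xi>)) * \<kappa> x z) * m z)"
    by (simp flip: mult.assoc)
  also have "\<dots> = (LINT z|lborel. (exp (\<i> * of_real (z * - p)) * m z - exp (\<i> * of_real (z * \<xi>)) * m z) / (\<i> * of_real s))"
  proof (intro Bochner_Integration.integral_cong refl)
    fix z
    have "exp (- \<i> * of_real (p * z)) * ?E z = exp (\<i> * of_real (z * \<xi>))"
      by (simp flip: exp_add add: algebra_simps s_def)
    moreover have "exp (- \<i> * of_real (p * z)) = exp (\<i> * of_real (z * - p))" by (simp add: mult.commute)
    ultimately have "- exp (- \<i> * of_real (p * z)) * (?E z - 1) = exp (\<i> * of_real (z * - p)) - exp (\<i> * of_real (z * \<xi>))"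
      by (simp only: right_diff_distrib mult_minus_left mult_1_right) simp
    then show "(LINT x|lborel. exp (\<i> * of_real (x * \<xi>)) * \<kappa> x z) * m z =
      (exp (\<i> * of_real (z * - p)) * m z - exp (\<i> * of_real (z * \<xi>)) * m z) / (\<i> * of_real s)"
      unfolding inner by (simp only: times_divide_eq_left left_diff_distrib)
  qed
  also have "\<dots> = (fourier m (- p) - fourier m \<xi>) / (\<i> * of_real s)"
    unfolding fourier_def using integrable_exp_mult[OF int, of "- p"] integrable_exp_mult[OF int, of \<xi>] by simp
  finally have "fourier (pole_cancel p \<nu> m) \<xi> = (fourier m (- p) - fourier m \<xi>) / (\<i> * of_real s)" .
  moreover have "fourier m (- p) = - \<nu>" using zero by (simp add: add_eq_0_iff)
  ultimately show ?thesis using s unfolding s_def[symmetric] by (simp add: divide_simps)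
qed

end

subsection \<open>The Riemann-Lebesgue lemma in a half-plane\<close>

text \<open>The direction of approach within the closed upper half-plane is left free. Near the real
  axis the exponential does not decay, and the limit rests on oscillation.\<close>

definition half_infinity :: "complex filter" where
  "half_infinity = inf at_infinity (principal {z. Im z \<ge> 0})"

lemma eventually_half_infinity:
  "eventually P half_infinity \<longleftrightarrow> (\<exists>R. \<forall>z. Im z \<ge> 0 \<and> norm z \<ge> R \<longrightarrow> P z)"
  unfolding half_infinity_def eventually_inf_principal eventually_at_infinity by auto

text \<open>The cut to x >= 0 is built in, so that approximation in L1 need not respect the
  support.\<close>

definition half_cfour :: "(real \<Rightarrow> complex) \<Rightarrow> complex \<Rightarrow> complex" where
  "half_cfour g z = (LINT x|lborel. indicator {0..} x * exp (\<i> * z * of_real x) * g x)"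

lemma half_cfour_integrable:
  assumes g: "integrable lborel g" and z: "Im z \<ge> 0"
  shows "integrable lborel (\<lambda>x. indicator {0..} x * exp (\<i> * z * of_real x) * g x)"
  by (rule integrable_bdd_mult[OF g], rule bdd_measI[of _ 1]) (use z in \<open>auto simp: indicator_def norm_mult\<close>)

lemma half_cfour_bound:
  assumes g: "integrable lborel g" and z: "Im z \<ge> 0"
  shows "norm (half_cfour g z) \<le> (LINT x|lborel. norm (g x))"
  unfolding half_cfour_def
proof (rule norm_integral_le_integral)
  fix x
  have "norm (indicator {0..} x * exp (\<i> * z * of_real x)) \<le> 1" using z by (auto simp: indicator_def norm_mult)
  from mult_right_mono[OF this, of "norm (g x)"]
  show "norm (indicator {0..} x * exp (\<i> * z * of_real x) * g x) \<le> norm (g x)" by (simp add: norm_mult)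
qed (use g in auto)

lemma half_cfour_diff:
  assumes "integrable lborel g" "integrable lborel h" "Im z \<ge> 0"
  shows "half_cfour g z - half_cfour h z = half_cfour (\<lambda>x. g x - h x) z"
  unfolding half_cfour_def right_diff_distrib
  using half_cfour_integrable[OF assms(1,3)] half_cfour_integrable[OF assms(2,3)] by simp

lemma half_cfour_add:
  assumes "integrable lborel g" "integrable lborel h" "Im z \<ge> 0"
  shows "half_cfour (\<lambda>x. g x + h x) z = half_cfour g z + half_cfour h z"
  unfolding half_cfour_def distrib_left
  using half_cfour_integrable[OF assms(1,3)] half_cfour_integrable[OF assms(2,3)] by simp

text \<open>In the upper half-plane \<open>half_cfour\<close> is bounded by the L1 norm, uniformly
  in z; hence the functions with limit 0 form an L1-closed set.\<close>

lemma half_cfour_tendsto_limit: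
  assumes g: "integrable lborel g" and s: "\<And>n. integrable lborel (s n)" 
    and t: "\<And>n. (half_cfour (s n) \<longlongrightarrow> 0) half_infinity"
    and lim: "(\<lambda>n. LINT x|lborel. norm (g x - s n x)) \<longlonglongrightarrow> 0"
  shows "(half_cfour g \<longlongrightarrow> 0) half_infinity"
proof (rule tendstoI)
  fix e :: real assume e: "e > 0"
  obtain n where n: "(LINT x|lborel. norm (g x - s n x)) < e/2"
    using order_tendstoD(2)[OF lim, of "e/2"] e by (auto simp: eventually_sequentially)
  have "\<forall>\<^sub>F z in half_infinity. dist (half_cfour (s n) z) 0 < e/2" using tendstoD[OF t, of "e/2"] e by simp
  moreover have "\<forall>\<^sub>F z in half_infinity. Im z \<ge> 0" by (auto simp: eventually_half_infinity)
  ultimately show "\<forall>\<^sub>F z in half_infinity. dist (half_cfour g z) 0 < e"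
  proof eventually_elim
    case (elim z)
    have "norm (half_cfour g z - half_cfour (s n) z) \<le> (LINT x|lborel. norm (g x - s n x))"
      using half_cfour_bound[of "\<lambda>x. g x - s n x" z] g s elim by (simp add: half_cfour_diff)
    then show ?case using elim n norm_triangle_sub[of "half_cfour g z" "half_cfour (s n) z"] by (simp add: dist_norm)
  qed
qed

lemma half_cfour_interval:
  "(half_cfour (\<lambda>x. indicator ({..a} \<inter> {0..b}) x) \<longlongrightarrow> 0) half_infinity"
proof (cases "min a b \<ge> 0")
  case False
  then have "{..a} \<inter> {0..b} = {}" by auto
  then show ?thesis by (simp add: half_cfour_def[abs_def])
next
  case True
  define c where "c = min a b"
  have *: "half_cfour (\<lambda>x. indicator ({..a} \<inter> {0..b}) x) z = (exp (\<i> * z * of_real c) - 1) / (\<i> * z)" if "z \<noteq> 0" for z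
  proof -
    have "half_cfour (\<lambda>x. indicator ({..a} \<inter> {0..b}) x) z = (LINT x|lborel. indicator {0..c} x * exp (\<i> * z * of_real x))"
      unfolding half_cfour_def by (intro Bochner_Integration.integral_cong refl) (auto simp: indicator_def c_def)
    then show ?thesis using integral_exp_interval[of 0 c "\<i> * z"] that True by (simp add: c_def)
  qed
  show ?thesis
  proof (rule Lim_null_comparison)
    show "\<forall>\<^sub>F z in half_infinity. norm (half_cfour (\<lambda>x. indicator ({..a} \<inter> {0..b}) x) z) \<le> 2 / norm z"
      unfolding eventually_half_infinity
    proof (intro exI[of _ 1] allI impI)
      fix z :: complex assume z: "0 \<le> Im z \<and> 1 \<le> norm z"
      have "norm (exp (\<i> * z * of_real c) - 1) \<le> norm (exp (\<i> * z * of_real c)) + 1"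
        using norm_triangle_ineq4[of "exp (\<i> * z * of_real c)" 1] by simp
      also have "\<dots> \<le> 2" using z True by (simp add: c_def)
      finally show "norm (half_cfour (\<lambda>x. indicator ({..a} \<inter> {0..b}) x) z) \<le> 2 / norm z"
        using z by (subst *) (auto simp: norm_divide norm_mult divide_right_mono)
    qed
    have "((\<lambda>z. 2 / norm z) \<longlongrightarrow> 0) (at_infinity :: complex filter)"
      by (intro real_tendsto_divide_at_top[OF tendsto_const] filterlim_norm_at_top)
    then show "((\<lambda>z. 2 / norm z) \<longlongrightarrow> 0) half_infinity"
      unfolding half_infinity_def by (rule tendsto_mono[rotated]) simp
  qed
qed

text \<open>Dynkin's argument: the sets with this limit contain the half-lines, a generating system
  stable under intersection, and are closed under complements and countable disjoint unions. The
  window [0,b] keeps all measures finite.\<close>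

lemma half_cfour_set:
  assumes "A \<in> sets borel"
  shows "(half_cfour (\<lambda>x. indicator (A \<inter> {0..b}) x) \<longlongrightarrow> 0) half_infinity"
proof -
  have int: "integrable lborel (\<lambda>x. indicator (B \<inter> {0..b}) x :: complex)" if "B \<in> sets borel" for B :: "real set"
  proof -
    have "emeasure lborel (B \<inter> {0..b}) \<le> emeasure lborel {0..b}" using that by (intro emeasure_mono) auto
    also have "\<dots> < \<infinity>" by (cases "0 \<le> b") auto
    finally have "integrable lborel (\<lambda>x. indicator (B \<inter> {0..b}) x :: real)" using that by (intro integrable_real_indicator) auto
    then have "integrable lborel (\<lambda>x. complex_of_real (indicator (B \<inter> {0..b}) x))" by simp
    then show ?thesis by (simp add: of_real_indicator)
  qed
  have 1: "borel = sigma UNIV (range (\<lambda>a::real. {..a}))" by (rule borel_eq_atMost)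
  have A: "A \<in> sigma_sets UNIV (range (\<lambda>a::real. {..a}))" using assms unfolding 1 by simp
  have stable: "Int_stable (range (\<lambda>a::real. {..a}))"
    by (auto simp: Int_stable_def intro!: image_eqI[of _ _ "min _ _"])
  have meas: "B \<in> sets borel" if "B \<in> sigma_sets UNIV (range (\<lambda>a::real. {..a}))" for B using that unfolding 1 by simp
  have pow: "range (\<lambda>a::real. {..a}) \<subseteq> Pow UNIV" by simp
  from stable pow A show ?thesis
  proof (induction A rule: sigma_sets_induct_disjoint)
    case (basic B) then show ?case using half_cfour_interval by auto
  next
    case empty then show ?case by (simp add: half_cfour_def[abs_def])
  next
    case (compl B)
    have f: "(half_cfour (\<lambda>x. indicator ({..b} \<inter> {0..b}) x) \<longlongrightarrow> 0) half_infinity" by (rule half_cfour_interval)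
    have "((\<lambda>z. half_cfour (\<lambda>x. indicator ({..b} \<inter> {0..b}) x) z - half_cfour (\<lambda>x. indicator (B \<inter> {0..b}) x) z) \<longlongrightarrow> 0 - 0) half_infinity"
      by (intro tendsto_diff f compl)
    moreover have "\<forall>\<^sub>F z in half_infinity. half_cfour (\<lambda>x. indicator ({..b} \<inter> {0..b}) x) z - half_cfour (\<lambda>x. indicator (B \<inter> {0..b}) x) z
       = half_cfour (\<lambda>x. indicator ((UNIV - B) \<inter> {0..b}) x) z"
      unfolding eventually_half_infinity
    proof (intro exI[of _ 0] allI impI)
      fix z :: complex assume z: "0 \<le> Im z \<and> 0 \<le> norm z"
      have "(\<lambda>x. indicator ({..b} \<inter> {0..b}) x - indicator (B \<inter> {0..b}) x) = (\<lambda>x. indicator ((UNIV - B) \<inter> {0..b}) x :: complex)"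
        by (auto simp: fun_eq_iff indicator_def)
      then show "half_cfour (\<lambda>x. indicator ({..b} \<inter> {0..b}) x) z - half_cfour (\<lambda>x. indicator (B \<inter> {0..b}) x) z
       = half_cfour (\<lambda>x. indicator ((UNIV - B) \<inter> {0..b}) x) z"
        using half_cfour_diff[OF int int[OF meas[OF compl(1)]], of "{..b}" z] z by simp
    qed
    ultimately show ?case by (simp add: tendsto_cong)
  next
    case (union B)
    have mB: "B i \<in> sets borel" for i using meas union(2) by auto
    let ?s = "\<lambda>n x. indicator ((\<Union>i<n. B i) \<inter> {0..b}) x :: complex"
    show ?case
    proof (rule half_cfour_tendsto_limit[where s="?s"])
      show "integrable lborel (\<lambda>x. indicator (\<Union> (range B) \<inter> {0..b}) x :: complex)" using mB by (intro int) auto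
      show ints: "integrable lborel (?s n)" for n using mB by (intro int) auto
      show "(half_cfour (?s n) \<longlongrightarrow> 0) half_infinity" for n
      proof (induction n)
        case 0 then show ?case by (simp add: half_cfour_def[abs_def])
      next
        case (Suc n)
        have "((\<lambda>z. half_cfour (?s n) z + half_cfour (\<lambda>x. indicator (B n \<inter> {0..b}) x) z) \<longlongrightarrow> 0 + 0) half_infinity"
          by (intro tendsto_add Suc union(3))
        moreover have "\<forall>\<^sub>F z in half_infinity. half_cfour (?s n) z + half_cfour (\<lambda>x. indicator (B n \<inter> {0..b}) x) z = half_cfour (?s (Suc n)) z"
          unfolding eventually_half_infinity
        proof (intro exI[of _ 0] allI impI)
          fix z :: complex assume z: "0 \<le> Im z \<and> 0 \<le> norm z"
          have "?s n x + indicator (B n \<inter> {0..b}) x = ?s (Suc n) x" for x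
          proof -
            have "x \<notin> B i" if "x \<in> B n" "i < n" for i using disjoint_family_onD[OF union(1), of i n] that by auto
            then show ?thesis by (auto simp: indicator_def less_Suc_eq)
          qed
          then show "half_cfour (?s n) z + half_cfour (\<lambda>x. indicator (B n \<inter> {0..b}) x) z = half_cfour (?s (Suc n)) z"
            using half_cfour_add[OF ints int[OF mB], of z n n] z by simp
        qed
        ultimately show ?case by (simp add: tendsto_cong)
      qed
      have "(\<lambda>n. LINT x|lborel. norm (indicator (\<Union> (range B) \<inter> {0..b}) x - ?s n x)) \<longlonglongrightarrow> integral\<^sup>L lborel (\<lambda>x::real. 0::real)"
      proof (rule integral_dominated_convergence[where w="\<lambda>x. norm (indicator (UNIV \<inter> {0..b}) x :: complex)"])
        show "integrable lborel (\<lambda>x. norm (indicator (UNIV \<inter> {0..b}) x :: complex))" by (intro integrable_norm int) auto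
        show "AE x in lborel. (\<lambda>n. norm (indicator (\<Union> (range B) \<inter> {0..b}) x - ?s n x)) \<longlonglongrightarrow> 0"
        proof (rule AE_I2, rule tendsto_eventually)
          fix x
          show "\<forall>\<^sub>F n in sequentially. norm (indicator (\<Union> (range B) \<inter> {0..b}) x - ?s n x) = 0"
          proof (cases "x \<in> \<Union> (range B)")
            case True
            then obtain i where "x \<in> B i" by auto
            then show ?thesis by (intro eventually_sequentiallyI[of "Suc i"]) (auto simp: indicator_def)
          qed (auto simp: indicator_def)
        qed
        show "AE x in lborel. norm (norm (indicator (\<Union> (range B) \<inter> {0..b}) x - ?s n x)) \<le> norm (indicator (UNIV \<inter> {0..b}) x :: complex)" for n
          by (auto simp: indicator_def)
      qed (use mB in measurable)
      then show "(\<lambda>n. LINT x|lborel. norm (indicator (\<Union> (range B) \<inter> {0..b}) x - ?s n x)) \<longlonglongrightarrow> 0" by simp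
    qed
  qed
qed

lemma Riemann_Lebesgue_half:
  assumes "integrable lborel g"
  shows "(half_cfour g \<longlongrightarrow> 0) half_infinity"
  using assms
proof (induction g rule: integrable_induct)
  case (base A c)
  have [measurable]: "A \<in> sets borel" using base by simp
  have fin: "integrable lborel (\<lambda>x. indicator A x *\<^sub>R c)" using base by (intro integrable_indicator) auto
  let ?s = "\<lambda>n x. indicator (A \<inter> {0..real n}) x *\<^sub>R c"
  let ?h = "\<lambda>x. indicator {0..} x * (indicator A x *\<^sub>R c)"
  \<comment> \<open>Only x >= 0 matters, and there the pieces of \<open>A\<close> in [0,n] exhaust
    \<open>A\<close>, which may be unbounded.\<close>
  have h: "half_cfour (\<lambda>x. indicator A x *\<^sub>R c) = half_cfour ?h"
    unfolding half_cfour_def[abs_def] by (auto simp: fun_eq_iff indicator_def intro!: Bochner_Integration.integral_cong)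
  show ?case unfolding h
  proof (rule half_cfour_tendsto_limit[where s="?s"])
    show "integrable lborel ?h" by (rule integrable_bdd_mult[OF fin bdd_meas_indicator]) simp
    have "(\<lambda>x. indicator {0..real n} x * (indicator A x *\<^sub>R c)) = ?s n" for n by (auto simp: fun_eq_iff indicator_def)
    then show "integrable lborel (?s n)" for n
      using integrable_bdd_mult[OF fin bdd_meas_indicator, of "{0..real n}"] by simp
    show "(half_cfour (?s n) \<longlongrightarrow> 0) half_infinity" for n
    proof -
      have "half_cfour (?s n) = (\<lambda>z. half_cfour (\<lambda>x. indicator (A \<inter> {0..real n}) x) z * c)"
        by (auto simp: half_cfour_def fun_eq_iff scaleR_conv_of_real of_real_indicator simp flip: integral_mult_left_zero mult.assoc)
      then show ?thesis using tendsto_mult_right[OF half_cfour_set[of A "real n"], of c] by simp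
    qed
    have "(\<lambda>n. LINT x|lborel. norm (?h x - ?s n x)) \<longlonglongrightarrow> integral\<^sup>L lborel (\<lambda>x::real. 0::real)"
    proof (rule integral_dominated_convergence[where w="\<lambda>x. norm (indicator A x *\<^sub>R c)"])
      show "integrable lborel (\<lambda>x. norm (indicator A x *\<^sub>R c))" by (intro integrable_norm fin)
      show "AE x in lborel. (\<lambda>n. norm (?h x - ?s n x)) \<longlonglongrightarrow> 0"
      proof (rule AE_I2, rule tendsto_eventually)
        fix x
        obtain k :: nat where "x \<le> real k" using real_arch_simple by blast
        then show "\<forall>\<^sub>F n in sequentially. norm (?h x - ?s n x) = 0"
          by (intro eventually_sequentiallyI[of k]) (auto simp: indicator_def)
      qed
      show "AE x in lborel. norm (norm (?h x - ?s n x)) \<le> norm (indicator A x *\<^sub>R c)" for n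
        by (auto simp: indicator_def)
    qed measurable
    then show "(\<lambda>n. LINT x|lborel. norm (?h x - ?s n x)) \<longlonglongrightarrow> 0" by simp
  qed
next
  case (add f g)
  have "((\<lambda>z. half_cfour f z + half_cfour g z) \<longlongrightarrow> 0 + 0) half_infinity"
    by (intro tendsto_add add)
  moreover have "\<forall>\<^sub>F z in half_infinity. half_cfour f z + half_cfour g z = half_cfour (\<lambda>x. f x + g x) z"
    unfolding eventually_half_infinity by (intro exI[of _ 0]) (auto simp: half_cfour_add add)
  ultimately show ?case by (simp add: tendsto_cong)
next
  case (lim f s)
  show ?case
  proof (rule half_cfour_tendsto_limit[OF lim(4) lim(1,5)])
    have [measurable]: "f \<in> borel_measurable borel" "\<And>n. s n \<in> borel_measurable borel"
      using lim(1,4) by (auto dest: integrable_lborel_measurable)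
    have "(\<lambda>n. LINT x|lborel. norm (f x - s n x)) \<longlonglongrightarrow> integral\<^sup>L lborel (\<lambda>x::real. 0::real)"
    proof (rule integral_dominated_convergence[where w="\<lambda>x. 3 * norm (f x)"])
      show "integrable lborel (\<lambda>x. 3 * norm (f x))" using lim(4) by (intro integrable_mult_right integrable_norm)
      show "AE x in lborel. (\<lambda>n. norm (f x - s n x)) \<longlonglongrightarrow> 0"
      proof (rule AE_I2)
        fix x
        have "(\<lambda>n. norm (f x - s n x)) \<longlonglongrightarrow> norm (f x - f x)" by (intro tendsto_intros lim(2)) simp
        then show "(\<lambda>n. norm (f x - s n x)) \<longlonglongrightarrow> 0" by simp
      qed
      show "AE x in lborel. norm (norm (f x - s n x)) \<le> 3 * norm (f x)" for n
      proof (rule AE_I2)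
        fix x
        show "norm (norm (f x - s n x)) \<le> 3 * norm (f x)"
          using lim(3)[of x n] norm_triangle_ineq4[of "f x" "s n x"] by simp
      qed
    qed measurable
    then show "(\<lambda>n. LINT x|lborel. norm (f x - s n x)) \<longlonglongrightarrow> 0" by simp
  qed
qed

lemma cfour_half:
  assumes "\<And>x. x < 0 \<Longrightarrow> g x = 0" shows "cfour g z = half_cfour g z"
  unfolding cfour_def half_cfour_def
  by (intro Bochner_Integration.integral_cong refl) (auto simp: indicator_def assms)

text \<open>The integral is split at 0. The negative half becomes, after reflection, a half-line
  transform at -\<xi>, which also tends to infinity in the closed half-plane.\<close>

lemma Riemann_Lebesgue_real:
  assumes g: "integrable lborel g"
  shows "(fourier g \<longlongrightarrow> 0) at_top"
proof -
  have top: "filterlim (\<lambda>\<xi>::real. complex_of_real \<xi>) half_infinity at_top" "filterlim (\<lambda>\<xi>::real. - complex_of_real \<xi>) half_infinity at_top"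
    unfolding half_infinity_def
    by (auto intro!: filterlim_inf[THEN iffD2] simp: filterlim_principal filterlim_at_infinity[OF order_refl] eventually_at_top_linorder)
      (meson abs_ge_self order_trans)+
  have i: "integrable lborel (\<lambda>x. g (- x))" by (rule integrable_reflect_shift(5)[OF g])
  have "((\<lambda>\<xi>. half_cfour g (of_real \<xi>) + half_cfour (\<lambda>x. g (- x)) (- of_real \<xi>)) \<longlongrightarrow> 0 + 0) at_top"
    by (intro tendsto_add filterlim_compose[OF Riemann_Lebesgue_half] g i top)
  moreover have "half_cfour g (of_real \<xi>) + half_cfour (\<lambda>x. g (- x)) (- of_real \<xi>) = fourier g \<xi>" for \<xi>
  proof -
    let ?e = "\<lambda>x. exp (\<i> * of_real \<xi> * of_real x)"
    have e: "half_cfour (\<lambda>x. g (- x)) (- of_real \<xi>) = (LINT x|lborel. indicator {..0} x * ?e x * g x)"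
    proof -
      have "half_cfour (\<lambda>x. g (- x)) (- of_real \<xi>) = (LINT x|lborel. (\<lambda>x. indicator {..0} x * ?e x * g x) (- x))"
        unfolding half_cfour_def by (intro Bochner_Integration.integral_cong refl) (auto simp: indicator_def)
      also have "\<dots> = (LINT x|lborel. indicator {..0} x * ?e x * g x)" by (rule integral_reflect_shift(5))
      finally show ?thesis .
    qed
    have i1: "integrable lborel (\<lambda>x. indicator {0..} x * ?e x * g x)" by (rule half_cfour_integrable[OF g]) simp
    have i2: "integrable lborel (\<lambda>x. indicator {..0} x * ?e x * g x)"
      by (rule integrable_bdd_mult[OF g], rule bdd_measI[of _ 1]) (auto simp: indicator_def norm_mult)
    have [measurable]: "g \<in> borel_measurable borel" using g by (rule integrable_lborel_measurable)
    have "half_cfour g (of_real \<xi>) + half_cfour (\<lambda>x. g (- x)) (- of_real \<xi>)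
       = (LINT x|lborel. indicator {0..} x * ?e x * g x + indicator {..0} x * ?e x * g x)"
      unfolding e unfolding half_cfour_def using i1 i2 by simp
    also have "\<dots> = fourier g \<xi>" unfolding fourier_eq_cfour cfour_def
    proof (rule integral_cong_AE)
      show "AE x in lborel. indicator {0..} x * ?e x * g x + indicator {..0} x * ?e x * g x = ?e x * g x"
        using AE_lborel_singleton[of 0] by eventually_elim (auto simp: indicator_def)
    qed measurable
    finally show ?thesis .
  qed
  ultimately show ?thesis by simp
qed

text \<open>Extended by 0 to the upper half-plane, \<open>h\<close> becomes entire, since continuous
  functions can be pasted across a line; an entire function that vanishes on an open half-plane is
  0.\<close>

lemma holomorphic_zero_boundary:
  assumes h: "h holomorphic_on {z. Im z < 0}" and c: "continuous_on {z. Im z \<le> 0} h"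
    and z0: "\<And>x. h (of_real x) = 0" and z: "Im z \<le> 0"
  shows "h z = 0"
proof -
  define f where "f z = (if Im z \<le> 0 then h z else 0)" for z
  have real: "h z = 0" if "Im z = 0" for z
    using z0[of "Re z"] that by (metis complex_is_Real_iff of_real_Re)
  have "continuous_on ({z. Im z \<le> 0} \<union> {z. Im z \<ge> 0}) f" unfolding f_def
    by (rule continuous_on_cases) (use c real in \<open>auto intro!: closed_halfspace_Im_le closed_halfspace_Im_ge\<close>)
  moreover have "{z. Im z \<le> 0} \<union> {z. Im z \<ge> 0} = UNIV" by auto
  ultimately have cont: "continuous_on UNIV f" by simp
  have hol: "f holomorphic_on UNIV"
  proof (rule holomorphic_on_paste_across_line[where d=\<i> and k=0])
    show "f holomorphic_on UNIV \<inter> {z. \<i> \<bullet> z < 0}"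
      by (rule holomorphic_transform[of h]) (use h in \<open>auto simp: f_def inner_complex_def\<close>)
    show "f holomorphic_on UNIV \<inter> {z. 0 < \<i> \<bullet> z}"
      by (rule holomorphic_transform[of "\<lambda>_. 0"]) (auto simp: f_def inner_complex_def)
  qed (use cont in auto)
  have "f z = 0"
  proof (rule analytic_continuation_open[where s="{z. Im z > 0}" and s'=UNIV and g="\<lambda>_. 0" and f=f])
    have "\<i> \<in> {z. Im z > 0}" by simp
    then show "{z. Im z > 0} \<noteq> {}" by blast
  qed (use hol in \<open>auto simp: f_def open_halfspace_Im_gt\<close>)
  then show ?thesis using z by (simp add: f_def)
qed

lemma half_infinity_neq_bot: "half_infinity \<noteq> bot"
proof
  assume "half_infinity = bot"
  then have "eventually (\<lambda>_. False) half_infinity" by simp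
  then obtain R where "\<forall>z. Im z \<ge> 0 \<and> norm z \<ge> R \<longrightarrow> False" unfolding eventually_half_infinity by blast
  from this[rule_format, of "\<i> * of_real (max R 0)"] show False by (simp add: norm_mult)
qed

subsection \<open>The symbol and its factors\<close>

text \<open>A locale, because the reflection \<xi> -> -\<xi> yields a second instance in which the
  plus and the minus data are exchanged.\<close>

locale symbol =
  fixes p :: real and a :: complex and k :: "real \<Rightarrow> complex"
    and \<tau>\<^sub>p \<tau>\<^sub>m :: "complex \<Rightarrow> complex" and c\<^sub>p c\<^sub>m :: complex and g\<^sub>p g\<^sub>m :: "real \<Rightarrow> complex"
  assumes p: "p \<noteq> 0"
    and k: "exp_integrable k"
    and factorization: "\<And>\<xi>. a + fourier k \<xi> = of_real (\<xi>\<^sup>2 - p\<^sup>2) * (\<tau>\<^sub>m (of_real \<xi>) * \<tau>\<^sub>p (of_real \<xi>))"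
    and tau_plus: "analytic_factor_upper \<tau>\<^sub>p"
    and tau_minus: "analytic_factor_lower \<tau>\<^sub>m"
    and g_plus: "exp_decaying g\<^sub>p" "\<And>x. x < 0 \<Longrightarrow> g\<^sub>p x = 0"
    and g_minus: "exp_decaying g\<^sub>m" "\<And>x. x > 0 \<Longrightarrow> g\<^sub>m x = 0"
    and u_plus: "\<And>\<xi>. \<xi> \<noteq> - p \<Longrightarrow>
      \<tau>\<^sub>p (- of_real p) / (- \<i> * of_real (\<xi> + p) * \<tau>\<^sub>p (of_real \<xi>)) = 1 / (- \<i> * of_real (\<xi> + p)) + (c\<^sub>p + fourier g\<^sub>p \<xi>)"
    and u_minus: "\<And>\<xi>. \<xi> \<noteq> p \<Longrightarrow>
      \<tau>\<^sub>m (of_real p) / (\<i> * of_real (\<xi> - p) * \<tau>\<^sub>m (of_real \<xi>)) = 1 / (\<i> * of_real (\<xi> - p)) + (c\<^sub>m + fourier g\<^sub>m \<xi>)"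
begin

abbreviation t\<^sub>p :: complex where "t\<^sub>p \<equiv> \<tau>\<^sub>p (- of_real p)"
abbreviation t\<^sub>m :: complex where "t\<^sub>m \<equiv> \<tau>\<^sub>m (of_real p)"

text \<open>With the constants \<open>c\<^sub>p\<close> and \<open>c\<^sub>m\<close> as delta parts,
  \<open>G\<^sub>p\<close> and \<open>G\<^sub>m\<close> are the convolution kernels of
  \<open>t\<^sub>p/\<sigma>\<^sub>+\<close> and \<open>t\<^sub>m/\<sigma>\<^sub>-\<close>; they live
  on opposite half-lines.\<close>

definition G\<^sub>p :: "real \<Rightarrow> complex" where "G\<^sub>p x = hexp p x + g\<^sub>p x"
definition G\<^sub>m :: "real \<Rightarrow> complex" where "G\<^sub>m x = hexp p (- x) + g\<^sub>m x"

text \<open>\<open>\<mu> + fourier m\<close> is \<open>\<sigma>\<^sub>- = \<sigma>/\<sigma>\<^sub>+\<close>, the pole of \<open>1/\<sigma>\<^sub>+\<close> being cancelled by the zero of \<open>\<sigma>\<close>.\<close>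

definition \<mu> :: complex where "\<mu> = a * c\<^sub>p / t\<^sub>p"

definition m :: "real \<Rightarrow> complex" where
  "m x = (pole_cancel p a k x + a * g\<^sub>p x + c\<^sub>p * k x + conv k g\<^sub>p x) / t\<^sub>p"

text \<open>Reflection exchanges the two half-planes, hence the roles of the two factors, and keeps
  p. In this instance \<open>\<zeta>\<close> becomes \<open>\<eta>\<close> and the left Hankel tails
  become right ones.\<close>

lemma symbol_reflect:
  "symbol p a (\<lambda>x. k (- x)) (\<lambda>z. \<tau>\<^sub>m (- z)) (\<lambda>z. \<tau>\<^sub>p (- z)) c\<^sub>m c\<^sub>p (\<lambda>x. g\<^sub>m (- x)) (\<lambda>x. g\<^sub>p (- x))"
proof
  show "p \<noteq> 0" by (rule p)
  show "exp_integrable (\<lambda>x. k (- x))" by (rule exp_integrable_reflect[OF k])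
  show "a + fourier (\<lambda>x. k (- x)) \<xi> = of_real (\<xi>\<^sup>2 - p\<^sup>2) * (\<tau>\<^sub>p (- of_real \<xi>) * \<tau>\<^sub>m (- of_real \<xi>))" for \<xi>
    using factorization[of "- \<xi>"] by (simp add: fourier_reflect mult.commute)
  show "analytic_factor_upper (\<lambda>z. \<tau>\<^sub>m (- z))"
    using tau_minus unfolding analytic_factor_upper_def analytic_factor_lower_def
    by (auto intro!: holomorphic_on_compose_gen[where f=uminus and g=\<tau>\<^sub>m, unfolded comp_def] 
        continuous_on_compose2[where g=\<tau>\<^sub>m and f=uminus] holomorphic_intros continuous_intros)
  show "analytic_factor_lower (\<lambda>z. \<tau>\<^sub>p (- z))"
    using tau_plus unfolding analytic_factor_upper_def analytic_factor_lower_def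
    by (auto intro!: holomorphic_on_compose_gen[where f=uminus and g=\<tau>\<^sub>p, unfolded comp_def] 
        continuous_on_compose2[where g=\<tau>\<^sub>p and f=uminus] holomorphic_intros continuous_intros)
  have refl: "exp_decaying (\<lambda>x. g (- x))" if ed: "exp_decaying g" for g
  proof -
    obtain C d where *[measurable]: "g \<in> borel_measurable borel" and C: "d > 0" "\<And>x. norm (g x) \<le> C * exp (- d * \<bar>x\<bar>)"
      using ed by (metis exp_decayingE)
    have "norm (g (- x)) \<le> C * exp (- d * \<bar>x\<bar>)" for x using C(2)[of "- x"] by simp
    then show ?thesis unfolding exp_decaying_def using C(1) by (intro conjI exI[of _ C] exI[of _ d]) auto
  qed
  show "exp_decaying (\<lambda>x. g\<^sub>m (- x))" "exp_decaying (\<lambda>x. g\<^sub>p (- x))" using refl g_plus g_minus by auto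
  show "g\<^sub>m (- x) = 0" if "x < 0" for x using g_minus(2)[of "- x"] that by simp
  show "g\<^sub>p (- x) = 0" if "x > 0" for x using g_plus(2)[of "- x"] that by simp
  show "\<tau>\<^sub>m (- (- of_real p)) / (- \<i> * of_real (\<xi> + p) * \<tau>\<^sub>m (- of_real \<xi>)) =
      1 / (- \<i> * of_real (\<xi> + p)) + (c\<^sub>m + fourier (\<lambda>x. g\<^sub>m (- x)) \<xi>)" if "\<xi> \<noteq> - p" for \<xi>
  proof -
    have "- \<i> * of_real (\<xi> + p) = \<i> * of_real (- \<xi> - p)" by (simp add: algebra_simps)
    then show ?thesis using u_minus[of "- \<xi>"] that unfolding fourier_reflect by simp
  qed
  show "\<tau>\<^sub>p (- of_real p) / (\<i> * of_real (\<xi> - p) * \<tau>\<^sub>p (- of_real \<xi>)) =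
      1 / (\<i> * of_real (\<xi> - p)) + (c\<^sub>p + fourier (\<lambda>x. g\<^sub>p (- x)) \<xi>)" if "\<xi> \<noteq> p" for \<xi>
  proof -
    have "\<i> * of_real (\<xi> - p) = - \<i> * of_real (- \<xi> + p)" by (simp add: algebra_simps)
    then show ?thesis using u_plus[of "- \<xi>"] that unfolding fourier_reflect by simp
  qed
qed

lemma tau_nonzero: "\<tau>\<^sub>p (of_real \<xi>) \<noteq> 0" "\<tau>\<^sub>m (of_real \<xi>) \<noteq> 0" "t\<^sub>p \<noteq> 0" "t\<^sub>m \<noteq> 0"
  "\<tau>\<^sub>p (of_real p) \<noteq> 0" "\<tau>\<^sub>m (- of_real p) \<noteq> 0"
  using tau_plus tau_minus by (auto simp: analytic_factor_upper_def analytic_factor_lower_def)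

text \<open>Cleared of denominators, the hypothesis extends to \<xi> = -p, where it is
  trivial.\<close>

lemma u_plus': "\<tau>\<^sub>p (- of_real p) = \<tau>\<^sub>p (of_real \<xi>) * (1 - \<i> * of_real (\<xi> + p) * (c\<^sub>p + fourier g\<^sub>p \<xi>))"
proof (cases "\<xi> = - p")
  case False
  then have "of_real (\<xi> + p) \<noteq> (0::complex)" by (metis add_eq_0_iff2 of_real_eq_0_iff)
  then show ?thesis using u_plus[OF False] tau_nonzero(1)[of \<xi>] by (simp add: divide_simps) (simp add: algebra_simps)
qed simp

lemma u_minus': "\<tau>\<^sub>m (of_real p) = \<tau>\<^sub>m (of_real \<xi>) * (1 + \<i> * of_real (\<xi> - p) * (c\<^sub>m + fourier g\<^sub>m \<xi>))"
proof (cases "\<xi> = p")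
  case False
  then have "of_real (\<xi> - p) \<noteq> (0::complex)" by simp
  then show ?thesis using u_minus[OF False] tau_nonzero(2)[of \<xi>] by (simp add: divide_simps)
qed simp

lemma k_int: "integrable lborel k" by (rule exp_integrable_integrable[OF k])
lemma g_int: "integrable lborel g\<^sub>p" "integrable lborel g\<^sub>m"
  using g_plus(1) g_minus(1) by (auto intro: exp_decaying_integrable)
lemma g_bdd: "bdd_meas g\<^sub>p" "bdd_meas g\<^sub>m" using g_plus(1) g_minus(1) by (auto intro: exp_decaying_bdd)
lemma g_exp: "exp_integrable g\<^sub>p" "exp_integrable g\<^sub>m" using g_plus(1) g_minus(1) by (auto intro: exp_decaying_exp_integrable)
lemma G_bdd: "bdd_meas G\<^sub>p" "bdd_meas G\<^sub>m"
  unfolding G\<^sub>p_def[abs_def] G\<^sub>m_def[abs_def] using bdd_meas_hexp by (intro bdd_meas_add g_bdd bdd_meas_shift; simp)+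

lemma pole_zero: "a + fourier k (- p) = 0" using factorization[of "- p"] by simp

lemma m_exp: "exp_integrable m"
proof -
  have "exp_integrable (\<lambda>x. (1 / t\<^sub>p) * (pole_cancel p a k x + a * g\<^sub>p x + c\<^sub>p * k x + conv k g\<^sub>p x))"
    by (intro exp_integrable_cmult exp_integrable_add exp_integrable_conv pole_cancel_exp_integrable k g_exp pole_zero)
  then show ?thesis by (simp add: m_def[abs_def])
qed

lemma m_int: "integrable lborel m" by (rule exp_integrable_integrable[OF m_exp])

text \<open>The definition of \<open>m\<close> exhibits its integrability; this form exhibits it as
  the kernel of the product of a + fourier k with the symbol of \<open>G\<^sub>p\<close>, which is
  what associativity of convolutions uses.\<close>

lemma m_eq: "m x = (a * G\<^sub>p x + c\<^sub>p * k x + conv k G\<^sub>p x) / t\<^sub>p"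
proof -
  have "conv k G\<^sub>p x = conv k (hexp p) x + conv k g\<^sub>p x"
    unfolding G\<^sub>p_def[abs_def]
    by (rule conv_add_right) (intro integrable_conv_bdd k_int bdd_meas_hexp g_bdd)+
  then show ?thesis by (simp add: m_def G\<^sub>p_def pole_cancel_def algebra_simps)
qed

lemma fourier_m: "\<mu> + fourier m \<xi> = \<i> * of_real (\<xi> - p) * \<tau>\<^sub>m (of_real \<xi>)"
proof -
  have gen: "\<mu> + fourier m \<xi> - \<i> * of_real (\<xi> - p) * \<tau>\<^sub>m (of_real \<xi>) = 0" if \<xi>: "\<xi> \<noteq> - p" for \<xi>
  proof -
    let ?P = "pole_cancel p a k"
    have iP: "integrable lborel ?P" by (intro exp_integrable_integrable pole_cancel_exp_integrable k pole_zero)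
    have ic: "integrable lborel (conv k g\<^sub>p)" by (intro integrable_conv k_int g_int)
    have "fourier m \<xi> = fourier (\<lambda>x. (1 / t\<^sub>p) * (?P x + a * g\<^sub>p x + c\<^sub>p * k x + conv k g\<^sub>p x)) \<xi>"
      by (simp add: m_def[abs_def])
    also have "\<dots> = (1 / t\<^sub>p) * (fourier ?P \<xi> + a * fourier g\<^sub>p \<xi> + c\<^sub>p * fourier k \<xi> + fourier k \<xi> * fourier g\<^sub>p \<xi>)"
      using iP ic k_int g_int
      by (subst fourier_cmult, subst fourier_add, simp, simp, subst fourier_add, simp, simp, subst fourier_add, simp, simp)
        (simp add: fourier_cmult fourier_conv)
    finally have fm: "t\<^sub>p * fourier m \<xi> = fourier ?P \<xi> + a * fourier g\<^sub>p \<xi> + c\<^sub>p * fourier k \<xi> + fourier k \<xi> * fourier g\<^sub>p \<xi>"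
      using tau_nonzero by simp
    define s where "s = complex_of_real (\<xi> + p)"
    have s: "s \<noteq> 0" unfolding s_def using \<xi> by (metis add_eq_0_iff2 of_real_eq_0_iff)
    have P: "fourier ?P \<xi> * (- \<i> * s) = a + fourier k \<xi>"
      unfolding s_def by (rule pole_cancel_fourier[OF k pole_zero])
    define S where "S = a + fourier k \<xi>"
    have S: "S = s * (of_real (\<xi> - p) * \<tau>\<^sub>m (of_real \<xi>) * \<tau>\<^sub>p (of_real \<xi>))"
      unfolding S_def factorization s_def by (simp add: power2_eq_square algebra_simps)
    have "t\<^sub>p * (\<mu> + fourier m \<xi>) = a * c\<^sub>p + (fourier ?P \<xi> + a * fourier g\<^sub>p \<xi> + c\<^sub>p * fourier k \<xi> + fourier k \<xi> * fourier g\<^sub>p \<xi>)"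
      using fm tau_nonzero by (simp add: \<mu>_def distrib_left)
    also have "\<dots> = fourier ?P \<xi> + S * (c\<^sub>p + fourier g\<^sub>p \<xi>)" by (simp add: S_def algebra_simps)
    finally have "t\<^sub>p * (\<mu> + fourier m \<xi>) * (- \<i> * s) = fourier ?P \<xi> * (- \<i> * s) + S * (c\<^sub>p + fourier g\<^sub>p \<xi>) * (- \<i> * s)"
      by (simp only: distrib_right)
    also have "\<dots> = S * (1 - \<i> * s * (c\<^sub>p + fourier g\<^sub>p \<xi>))"
      unfolding P S_def[symmetric] by (simp add: algebra_simps)
    also have "\<dots> = s * (of_real (\<xi> - p) * \<tau>\<^sub>m (of_real \<xi>)) * (\<tau>\<^sub>p (of_real \<xi>) * (1 - \<i> * s * (c\<^sub>p + fourier g\<^sub>p \<xi>)))"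
      unfolding S by (simp only: mult_ac)
    also have "\<tau>\<^sub>p (of_real \<xi>) * (1 - \<i> * s * (c\<^sub>p + fourier g\<^sub>p \<xi>)) = t\<^sub>p"
      unfolding s_def by (rule u_plus'[symmetric])
    finally have "(t\<^sub>p * s * - \<i>) * (\<mu> + fourier m \<xi>) = (t\<^sub>p * s * - \<i>) * (\<i> * of_real (\<xi> - p) * \<tau>\<^sub>m (of_real \<xi>))"
      by (simp add: mult_ac)
    then show ?thesis using s tau_nonzero by (subst (asm) mult_left_cancel) auto
  qed
  have tc: "continuous_on UNIV (\<lambda>\<xi>::real. \<tau>\<^sub>m (of_real \<xi>))"
    by (rule continuous_on_compose2[of "{z. Im z \<le> 0}" \<tau>\<^sub>m])
      (use tau_minus in \<open>auto simp: analytic_factor_lower_def intro!: continuous_intros\<close>)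
  have "continuous_on UNIV (\<lambda>\<xi>. \<mu> + fourier m \<xi> - \<i> * of_real (\<xi> - p) * \<tau>\<^sub>m (of_real \<xi>))"
    by (intro continuous_intros tc fourier_continuous[OF m_int])
  from continuous_zero_except_point[where c="- p" and x=\<xi>, OF this gen] show ?thesis by simp
qed

text \<open>The symbol times \<open>t\<^sub>p/\<sigma>\<^sub>+\<close> times
  \<open>t\<^sub>m/\<sigma>\<^sub>-\<close> is constant, and by the Riemann-Lebesgue lemma only the
  three constant parts survive as \<xi> tends to infinity. Hence none of them is 0.\<close>

lemma constants: "a * c\<^sub>p * c\<^sub>m = t\<^sub>p * t\<^sub>m"
proof -
  let ?f = "\<lambda>\<xi>. (a + fourier k \<xi>) * (1 / (- \<i> * of_real (\<xi> + p)) + (c\<^sub>p + fourier g\<^sub>p \<xi>)) * (1 / (\<i> * of_real (\<xi> - p)) + (c\<^sub>m + fourier g\<^sub>m \<xi>))"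
  have z: "((\<lambda>\<xi>::real. 1 / (b * of_real (\<xi> + q))) \<longlongrightarrow> 0) at_top" if "b \<noteq> 0" for b :: complex and q :: real
  proof -
    have "filterlim (\<lambda>\<xi>::real. \<xi> + q) at_top at_top"
      using filterlim_tendsto_add_at_top[OF tendsto_const[of q] filterlim_ident] by (simp add: add.commute)
    then have "filterlim (\<lambda>\<xi>::real. complex_of_real (\<xi> + q)) at_infinity at_top"
      by (rule filterlim_compose[OF filterlim_of_real_at_infinity])
    then have "((\<lambda>\<xi>::real. inverse (complex_of_real (\<xi> + q))) \<longlongrightarrow> 0) at_top"
      by (rule filterlim_compose[OF tendsto_inverse_0])
    from tendsto_mult_left[OF this, of "inverse b"]
    show ?thesis by (simp only: mult_zero_right inverse_mult_distrib divide_inverse mult_1)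
  qed
  have "(?f \<longlongrightarrow> (a + 0) * (0 + (c\<^sub>p + 0)) * (0 + (c\<^sub>m + 0))) at_top"
    using z[of "- \<i>" p] z[of \<i> "- p"] by (intro tendsto_intros Riemann_Lebesgue_real k_int g_int) auto
  moreover have "\<forall>\<^sub>F \<xi> in at_top. ?f \<xi> = t\<^sub>p * t\<^sub>m"
    using eventually_gt_at_top[of "\<bar>p\<bar>"]
  proof eventually_elim
    case (elim \<xi>)
    then have ne: "\<xi> \<noteq> p" "\<xi> \<noteq> - p" by auto
    have s: "complex_of_real (\<xi> + p) \<noteq> 0" "complex_of_real (\<xi> - p) \<noteq> 0"
      using ne by (metis add_eq_0_iff2 of_real_eq_0_iff) (use ne in simp)
    have f: "a + fourier k \<xi> = complex_of_real (\<xi> + p) * complex_of_real (\<xi> - p) * (\<tau>\<^sub>m (of_real \<xi>) * \<tau>\<^sub>p (of_real \<xi>))"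
      unfolding factorization by (simp add: power2_eq_square algebra_simps)
    show ?case unfolding u_plus[OF ne(2), symmetric] u_minus[OF ne(1), symmetric] f
      using s tau_nonzero(1,2)[of \<xi>] by (simp add: divide_simps del: of_real_add of_real_diff)
  qed
  ultimately have "((\<lambda>_::real. t\<^sub>p * t\<^sub>m) \<longlongrightarrow> a * c\<^sub>p * c\<^sub>m) at_top"
    using tendsto_cong by fastforce
  then show ?thesis by (simp add: tendsto_const_iff)
qed

lemma a_nonzero: "a \<noteq> 0" "c\<^sub>p \<noteq> 0" "c\<^sub>m \<noteq> 0"
  using constants tau_nonzero by auto

text \<open>Both sides are holomorphic in the lower half-plane and continuous up to the real axis,
  where they agree by \<open>u_minus'\<close>.\<close>

lemma tau_minus_extension:
  assumes z: "Im z \<le> 0"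
  shows "t\<^sub>m = \<tau>\<^sub>m z * (1 + \<i> * (z - of_real p) * (c\<^sub>m + cfour g\<^sub>m z))"
proof -
  have "\<tau>\<^sub>m z * (1 + \<i> * (z - of_real p) * (c\<^sub>m + cfour g\<^sub>m z)) - t\<^sub>m = 0"
  proof (rule holomorphic_zero_boundary[OF _ _ _ z])
    note g = cfour_lower[OF g_exp(2) g_minus(2)]
    show "(\<lambda>z. \<tau>\<^sub>m z * (1 + \<i> * (z - of_real p) * (c\<^sub>m + cfour g\<^sub>m z)) - t\<^sub>m) holomorphic_on {z. Im z < 0}"
      using tau_minus by (intro holomorphic_intros g) (auto simp: analytic_factor_lower_def)
    show "continuous_on {z. Im z \<le> 0} (\<lambda>z. \<tau>\<^sub>m z * (1 + \<i> * (z - of_real p) * (c\<^sub>m + cfour g\<^sub>m z)) - t\<^sub>m)"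
      using tau_minus by (intro continuous_intros g) (auto simp: analytic_factor_lower_def)
    show "\<tau>\<^sub>m (of_real x) * (1 + \<i> * (of_real x - of_real p) * (c\<^sub>m + cfour g\<^sub>m (of_real x))) - t\<^sub>m = 0" for x
      using u_minus'[of x] by (simp add: fourier_eq_cfour)
  qed
  then show ?thesis by simp
qed

lemma sigma_minus_bounded: "\<exists>B. \<forall>z. Im z \<le> 0 \<longrightarrow> norm (\<i> * (z - of_real p) * \<tau>\<^sub>m z) \<le> B"
proof -
  have "\<forall>\<^sub>F z in half_infinity. norm (half_cfour (\<lambda>x. g\<^sub>m (- x)) z) < norm c\<^sub>m / 2"
    using tendstoD[OF Riemann_Lebesgue_half[OF integrable_reflect_shift(5)[OF g_int(2)]], of "norm c\<^sub>m / 2"] a_nonzero by simp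
  then obtain R where R: "\<And>z. Im z \<ge> 0 \<Longrightarrow> norm z \<ge> R \<Longrightarrow> norm (half_cfour (\<lambda>x. g\<^sub>m (- x)) z) < norm c\<^sub>m / 2"
    unfolding eventually_half_infinity by blast
  \<comment> \<open>The second entry makes |z - p| at least 4/|c|, with c the constant
    \<open>c\<^sub>m\<close>, so that the summand 1 is at most half of |w q|.\<close>
  define R' where "R' = max R (\<bar>p\<bar> + 4 / norm c\<^sub>m)"
  have far: "norm (\<i> * (z - of_real p) * \<tau>\<^sub>m z) \<le> norm t\<^sub>m * (4 / norm c\<^sub>m)" if z: "Im z \<le> 0" "norm z \<ge> R'" for z
  proof -
    define w where "w = \<i> * (z - of_real p)"
    define q where "q = c\<^sub>m + cfour g\<^sub>m z"
    have cf: "cfour g\<^sub>m z = half_cfour (\<lambda>x. g\<^sub>m (- x)) (- z)"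
      using cfour_half[of "\<lambda>x. g\<^sub>m (- x)" "- z"] g_minus(2) by (simp add: cfour_reflect)
    have "norm (cfour g\<^sub>m z) < norm c\<^sub>m / 2" unfolding cf using R[of "- z"] z by (simp add: R'_def)
    then have q: "norm q \<ge> norm c\<^sub>m / 2" unfolding q_def
      using norm_triangle_ineq2[of c\<^sub>m "- cfour g\<^sub>m z"] by simp
    have "norm w \<ge> norm z - \<bar>p\<bar>" unfolding w_def using norm_triangle_ineq2[of z "of_real p"] by (simp add: norm_mult)
    then have w: "norm w \<ge> 4 / norm c\<^sub>m" using z by (simp add: R'_def)
    have c: "norm c\<^sub>m > 0" using a_nonzero by simp
    have w0: "norm w > 0" using w c by (smt (verit) divide_pos_pos)
    have "1 \<le> norm w * (norm c\<^sub>m / 4)" using w c by (simp add: field_simps)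
    moreover have "norm w * (norm c\<^sub>m / 2) \<le> norm (w * q)" unfolding norm_mult using q by (intro mult_left_mono) auto
    moreover have "norm (w * q) - 1 \<le> norm (1 + w * q)"
      using norm_triangle_ineq2[of "w * q" "- 1"] by (simp add: add.commute)
    ultimately have "norm w * (norm c\<^sub>m / 4) \<le> norm (1 + w * q)" by simp
    then have "norm (\<tau>\<^sub>m z) * (norm w * (norm c\<^sub>m / 4)) \<le> norm (\<tau>\<^sub>m z) * norm (1 + w * q)"
      by (intro mult_left_mono) auto
    also have "\<dots> = norm t\<^sub>m" using tau_minus_extension[OF z(1)] by (simp add: w_def q_def norm_mult)
    finally show ?thesis using c unfolding w_def[symmetric] by (simp add: norm_mult field_simps)
  qed
  have "compact (cball 0 R' \<inter> {z. Im z \<le> 0})" by (intro compact_Int_closed compact_cball closed_halfspace_Im_le)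
  moreover have "continuous_on (cball 0 R' \<inter> {z. Im z \<le> 0}) (\<lambda>z. \<i> * (z - of_real p) * \<tau>\<^sub>m z)"
  proof -
    have "continuous_on (cball 0 R' \<inter> {z. Im z \<le> 0}) \<tau>\<^sub>m"
      by (rule continuous_on_subset[of "{z. Im z \<le> 0}"]) (use tau_minus in \<open>auto simp: analytic_factor_lower_def\<close>)
    then show ?thesis by (intro continuous_intros)
  qed
  ultimately have "bounded ((\<lambda>z. \<i> * (z - of_real p) * \<tau>\<^sub>m z) ` (cball 0 R' \<inter> {z. Im z \<le> 0}))"
    by (intro compact_imp_bounded compact_continuous_image)
  then obtain B where B: "\<And>z. z \<in> cball 0 R' \<inter> {z. Im z \<le> 0} \<Longrightarrow> norm (\<i> * (z - of_real p) * \<tau>\<^sub>m z) \<le> B"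
    unfolding bounded_iff by (metis (mono_tags, lifting) image_eqI)
  show ?thesis
  proof (intro exI[of _ "max B (norm t\<^sub>m * (4 / norm c\<^sub>m))"] allI impI)
    fix z assume "Im z \<le> 0"
    then show "norm (\<i> * (z - of_real p) * \<tau>\<^sub>m z) \<le> max B (norm t\<^sub>m * (4 / norm c\<^sub>m))"
      using far[of z] B[of z] by (cases "norm z \<ge> R'") (auto simp: le_max_iff_disj)
  qed
qed

text \<open>Split \<open>m\<close> at 0. On the real line the transform of the positive part equals
  \<open>\<sigma>\<^sub>-\<close> minus \<mu> minus the transform of the negative part; the former
  extends boundedly to the upper, the latter to the lower half-plane, and together they form a
  bounded entire function.\<close>

lemma m_support: "AE x in lborel. x > 0 \<longrightarrow> m x = 0"
proof -
  define m1 where "m1 x = indicator {0<..} x * m x" for x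
  define m2 where "m2 x = indicator {..0} x * m x" for x
  have e1: "exp_integrable m1" and e2: "exp_integrable m2" unfolding m1_def m2_def
    by (intro exp_integrable_bdd_mult m_exp bdd_meas_indicator; simp)+
  have m12: "m = (\<lambda>x. m1 x + m2 x)" by (auto simp: m1_def m2_def indicator_def fun_eq_iff)
  have s1: "m1 x = 0" if "x < 0" for x using that by (simp add: m1_def)
  have s2: "m2 x = 0" if "x > 0" for x using that by (simp add: m2_def)
  define S where "S z = \<i> * (z - of_real p) * \<tau>\<^sub>m z" for z
  have Shol: "S holomorphic_on {z. Im z < 0}" and Scont: "continuous_on {z. Im z \<le> 0} S"
    using tau_minus unfolding S_def[abs_def] analytic_factor_lower_def
    by (auto intro!: holomorphic_intros continuous_intros)
  define f where "f z = (if Im z \<le> 0 then S z - \<mu> - cfour m2 z else cfour m1 z)" for z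
  have real: "S z - \<mu> - cfour m2 z = cfour m1 z" if "Im z = 0" for z
  proof -
    have z: "z = of_real (Re z)" using that by (simp add: complex_eq_iff)
    have "fourier m (Re z) = cfour m1 z + cfour m2 z"
      using fourier_add[OF exp_integrable_integrable[OF e1] exp_integrable_integrable[OF e2], of "Re z"] z
      by (simp add: m12 fourier_eq_cfour)
    then show ?thesis using fourier_m[of "Re z"] z unfolding S_def by (simp add: algebra_simps)
  qed
  have "continuous_on ({z. Im z \<le> 0} \<union> {z. Im z \<ge> 0}) f" unfolding f_def
    by (rule continuous_on_cases)
      (use cfour_upper[OF e1 s1] cfour_lower[OF e2 s2] real in \<open>auto intro!: closed_halfspace_Im_le closed_halfspace_Im_ge continuous_intros Scont\<close>)
  moreover have "{z. Im z \<le> 0} \<union> {z. Im z \<ge> 0} = UNIV" by auto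
  ultimately have cont: "continuous_on UNIV f" by simp
  have hol: "f holomorphic_on UNIV"
  proof (rule holomorphic_on_paste_across_line[where d=\<i> and k=0])
    have hS: "(\<lambda>z. S z - \<mu> - cfour m2 z) holomorphic_on {z. Im z < 0}"
      by (rule holomorphic_on_diff[OF holomorphic_on_diff[OF Shol holomorphic_on_const] cfour_lower(1)[OF e2 s2]])
    show "f holomorphic_on UNIV \<inter> {z. \<i> \<bullet> z < 0}"
      by (rule holomorphic_transform[OF holomorphic_on_subset[OF hS]]) (auto simp: f_def inner_complex_def)
    show "f holomorphic_on UNIV \<inter> {z. 0 < \<i> \<bullet> z}"
      by (rule holomorphic_transform[OF holomorphic_on_subset[OF cfour_upper(1)[OF e1 s1]]]) (auto simp: f_def inner_complex_def)
  qed (use cont in auto)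
  obtain B where B: "\<And>z. Im z \<le> 0 \<Longrightarrow> norm (S z) \<le> B" using sigma_minus_bounded unfolding S_def by blast
  have b1: "norm (cfour m1 z) \<le> (LINT x|lborel. norm (m1 x))" if "Im z \<ge> 0" for z
    using cfour_half[of m1 z] half_cfour_bound[OF exp_integrable_integrable[OF e1] that] s1 by simp
  have b2: "norm (cfour m2 z) \<le> (LINT x|lborel. norm (m2 (- x)))" if "Im z \<le> 0" for z
  proof -
    have "cfour m2 z = half_cfour (\<lambda>x. m2 (- x)) (- z)"
      using cfour_half[of "\<lambda>x. m2 (- x)" "- z"] s2 by (simp add: cfour_reflect)
    then show ?thesis
      using half_cfour_bound[OF integrable_reflect_shift(5)[OF exp_integrable_integrable[OF e2]], of "- z"] that by simp
  qed
  have "bounded (range f)"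
    unfolding bounded_iff
  proof (intro exI[of _ "B + norm \<mu> + (LINT x|lborel. norm (m2 (- x))) + (LINT x|lborel. norm (m1 x))"] ballI)
    fix y assume "y \<in> range f"
    then obtain z where y: "y = f z" by auto
    have nn: "(LINT x|lborel. norm (m2 (- x))) \<ge> 0" "(LINT x|lborel. norm (m1 x)) \<ge> 0" by auto
    show "norm y \<le> B + norm \<mu> + (LINT x|lborel. norm (m2 (- x))) + (LINT x|lborel. norm (m1 x))"
    proof (cases "Im z \<le> 0")
      case True
      have "norm (S z - \<mu> - cfour m2 z) \<le> norm (S z) + norm \<mu> + norm (cfour m2 z)"
        using norm_triangle_ineq4[of "S z - \<mu>" "cfour m2 z"] norm_triangle_ineq4[of "S z" \<mu>] by linarith
      moreover have "norm y = norm (S z - \<mu> - cfour m2 z)" using True y by (simp add: f_def)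
      ultimately show ?thesis using B[OF True] b2[OF True] nn by linarith
    next
      case False
      have "B \<ge> 0" using B[of 0] norm_ge_zero[of "S 0"] by (simp del: norm_ge_zero)
      moreover have "norm y = norm (cfour m1 z)" using False y by (simp add: f_def)
      ultimately show ?thesis using False b1[of z] nn norm_ge_zero[of \<mu>] by linarith
    qed
  qed
  then obtain c where c: "\<And>z. f z = c" using Liouville_theorem[OF hol] unfolding constant_on_def by blast
  \<comment> \<open>Liouville's theorem leaves a constant, and the decay of
    \<open>half_cfour m1\<close> in the upper half-plane forces it to be 0.\<close>
  have "(half_cfour m1 \<longlongrightarrow> 0) half_infinity" by (rule Riemann_Lebesgue_half[OF exp_integrable_integrable[OF e1]])
  moreover have m1c: "cfour m1 z = c" if "Im z \<ge> 0" for z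
    using c[of z] real[of z] that by (cases "Im z = 0") (auto simp: f_def)
  have "\<forall>\<^sub>F z in half_infinity. half_cfour m1 z = c"
    unfolding eventually_half_infinity using m1c cfour_half[of m1] s1 by auto
  ultimately have "((\<lambda>_. c) \<longlongrightarrow> 0) half_infinity" using tendsto_cong by fastforce
  then have "c = 0" using half_infinity_neq_bot by (simp add: tendsto_const_iff)
  then have "AE x in lborel. m1 x = 0"
    using m1c by (intro fourier_unique exp_integrable_integrable[OF e1]) (simp add: fourier_eq_cfour)
  then show ?thesis by eventually_elim (auto simp: m1_def)
qed

lemma mu_eq: "\<mu> * c\<^sub>m = t\<^sub>m"
  using constants tau_nonzero by (simp add: \<mu>_def field_simps)

text \<open>This is the nonconstant part of the identity that \<open>\<sigma>\<^sub>-\<close> times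
  \<open>t\<^sub>m/\<sigma>\<^sub>-\<close> equals \<open>t\<^sub>m\<close>. The pole of
  \<open>1/\<sigma>\<^sub>-\<close> at p is cancelled by the zero of
  \<open>\<sigma>\<^sub>-\<close>, so the left side is integrable and Fourier uniqueness
  applies.\<close>

lemma convolution_inverse: "AE x in lborel. \<mu> * G\<^sub>m x + c\<^sub>m * m x + conv m G\<^sub>m x = 0"
proof -
  \<comment> \<open>The kernel of \<open>\<tau>\<^sub>m\<close> on the real line: the quotient of
    \<open>\<sigma>\<^sub>-\<close> by i(\<xi> - p), obtained from \<open>pole_cancel\<close> after
    reflection.\<close>
  define P where "P x = pole_cancel p \<mu> (\<lambda>x. m (- x)) (- x)" for x
  have z: "\<mu> + fourier (\<lambda>x. m (- x)) (- p) = 0" using fourier_m[of p] by (simp add: fourier_reflect)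
  have mr: "exp_integrable (\<lambda>x. m (- x))" by (rule exp_integrable_reflect[OF m_exp])
  have iP: "integrable lborel P"
    unfolding P_def[abs_def] by (rule integrable_reflect_shift(5)[OF exp_integrable_integrable[OF pole_cancel_exp_integrable[OF mr z]]])
  define n where "n x = P x + \<mu> * g\<^sub>m x + c\<^sub>m * m x + conv m g\<^sub>m x" for x
  have n: "n x = \<mu> * G\<^sub>m x + c\<^sub>m * m x + conv m G\<^sub>m x" for x
  proof -
    have "conv m G\<^sub>m x = conv m (\<lambda>x. hexp p (- x)) x + conv m g\<^sub>m x"
      unfolding G\<^sub>m_def[abs_def]
      by (rule conv_add_right) (intro integrable_conv_bdd m_int bdd_meas_shift(5)[OF bdd_meas_hexp] g_bdd)+
    moreover have "P x = \<mu> * hexp p (- x) + conv m (\<lambda>x. hexp p (- x)) x"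
      unfolding P_def pole_cancel_def using conv_reflect[of m "\<lambda>x. hexp p (- x)" x] by simp
    ultimately show ?thesis by (simp add: n_def G\<^sub>m_def algebra_simps)
  qed
  have ic: "integrable lborel (conv m g\<^sub>m)" by (intro integrable_conv m_int g_int)
  have int: "integrable lborel n" unfolding n_def[abs_def]
    using iP ic m_int g_int by (intro Bochner_Integration.integrable_add integrable_mult_right) auto
  have fn: "fourier n \<xi> = fourier P \<xi> + \<mu> * fourier g\<^sub>m \<xi> + c\<^sub>m * fourier m \<xi> + fourier m \<xi> * fourier g\<^sub>m \<xi>" for \<xi>
    unfolding n_def[abs_def] using iP ic m_int g_int
    by (subst fourier_add, simp, simp, subst fourier_add, simp, simp, subst fourier_add, simp, simp)
        (simp add: fourier_cmult fourier_conv)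
  have zero: "fourier n \<xi> = 0" if \<xi>: "\<xi> \<noteq> p" for \<xi>
  proof -
    define s where "s = \<i> * complex_of_real (\<xi> - p)"
    have s: "s \<noteq> 0" unfolding s_def using \<xi> by simp
    have "fourier P \<xi> * (- \<i> * of_real (- \<xi> + p)) = \<mu> + fourier m \<xi>"
      using pole_cancel_fourier[OF mr z, of "- \<xi>"] unfolding P_def[abs_def] by (simp only: fourier_reflect minus_minus)
    moreover have "- \<i> * of_real (- \<xi> + p) = s" by (simp add: s_def algebra_simps)
    ultimately have "fourier P \<xi> * s = s * \<tau>\<^sub>m (of_real \<xi>)" using fourier_m[of \<xi>] unfolding s_def[symmetric] by metis
    then have P: "fourier P \<xi> = \<tau>\<^sub>m (of_real \<xi>)" using s by (simp add: mult.commute)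
    have "fourier n \<xi> = \<tau>\<^sub>m (of_real \<xi>) + (\<mu> + fourier m \<xi>) * (c\<^sub>m + fourier g\<^sub>m \<xi>) - \<mu> * c\<^sub>m"
      unfolding fn P by (simp add: algebra_simps)
    also have "\<dots> = \<tau>\<^sub>m (of_real \<xi>) * (1 + \<i> * of_real (\<xi> - p) * (c\<^sub>m + fourier g\<^sub>m \<xi>)) - \<mu> * c\<^sub>m"
      unfolding fourier_m by (simp add: algebra_simps)
    also have "\<dots> = 0" using u_minus'[of \<xi>] mu_eq by simp
    finally show ?thesis .
  qed
  have "AE x in lborel. n x = 0"
    by (rule fourier_unique[OF int], rule continuous_zero_except_point[OF fourier_continuous[OF int] zero])
  then show ?thesis unfolding n .
qed

end

lemma AE_reflect_shift:
  assumes "AE x in lborel. P (x::real)" shows "AE y in lborel. P (c - y)"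
proof -
  obtain N where N: "{x \<in> space lborel. \<not> P x} \<subseteq> N" "N \<in> null_sets lborel"
    using assms unfolding eventually_ae_filter by blast
  have [measurable]: "N \<in> sets borel" using N(2) by (auto dest: null_setsD2)
  have "AE x in lborel. x \<notin> N" using AE_not_in[OF N(2)] .
  then have "AE y in lborel. c + (-1) * y \<notin> N" by (intro AE_borel_affine) auto
  then show ?thesis by eventually_elim (use N(1) in auto)
qed

subsection \<open>Exponentials on the half-line\<close>

definition hexpc :: "complex \<Rightarrow> real \<Rightarrow> complex" where
  "hexpc q x = indicator {0<..} x * exp_fn q x"

lemma hexpc_of_real: "hexpc (of_real p) = hexp p" by (simp add: hexpc_def hexp_def fun_eq_iff)

lemma hexpc_measurable [measurable]: "hexpc q \<in> borel_measurable borel"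
  unfolding hexpc_def[abs_def] exp_fn_def[abs_def] by measurable

lemma hexp_measurable [measurable]: "hexp q \<in> borel_measurable borel"
  unfolding hexpc_of_real[symmetric] by measurable

lemma norm_hexpc_le: "Im q \<ge> 0 \<Longrightarrow> norm (hexpc q x) \<le> 1"
  by (auto simp: hexpc_def exp_fn_def indicator_def norm_mult)

lemma norm_hexp_le: "norm (hexp p x) \<le> 1"
  using norm_hexpc_le[of "of_real p" x] by (simp add: hexpc_of_real)

lemma bdd_meas_hexpc: "Im q \<ge> 0 \<Longrightarrow> bdd_meas (hexpc q)"
  by (rule bdd_measI[of _ 1]) (auto simp: norm_hexpc_le)

lemma hexpc_integrable:
  assumes q: "Im q > 0" shows "integrable lborel (hexpc q)"
proof (rule Bochner_Integration.integrable_bound[OF integrable_exp_abs[OF q]])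
  show "AE x in lborel. norm (hexpc q x) \<le> norm (exp (- Im q * \<bar>x\<bar>))"
    by (auto simp: hexpc_def exp_fn_def indicator_def norm_mult)
qed measurable

lemma hexpc_integral:
  assumes q: "Im q > 0" shows "integral\<^sup>L lborel (hexpc q) = \<i> / q"
proof -
  have q0: "q \<noteq> 0" using q by auto
  have "(\<lambda>n. LINT x|lborel. indicator {0..real n} x * exp ((\<i> * q) * of_real x)) \<longlonglongrightarrow> integral\<^sup>L lborel (hexpc q)"
  proof (rule integral_dominated_convergence[where w="\<lambda>x. exp (- Im q * \<bar>x\<bar>)"])
    show "AE x in lborel. (\<lambda>n. indicator {0..real n} x * exp ((\<i> * q) * of_real x)) \<longlonglongrightarrow> hexpc q x"
      using AE_lborel_singleton[of 0]
    proof eventually_elim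
      case (elim x)
      obtain k :: nat where "x \<le> real k" using real_arch_simple by blast
      then show ?case using elim
        by (intro tendsto_eventually eventually_sequentiallyI[of k]) (auto simp: indicator_def hexpc_def exp_fn_def)
    qed
    show "AE x in lborel. norm (indicator {0..real n} x * exp ((\<i> * q) * of_real x)) \<le> exp (- Im q * \<bar>x\<bar>)" for n
      by (auto simp: indicator_def norm_mult)
  qed (use integrable_exp_abs[OF q] in measurable)
  moreover have "(LINT x|lborel. indicator {0..real n} x * exp ((\<i> * q) * of_real x)) = (exp (\<i> * q * of_real (real n)) - 1) / (\<i> * q)" for n
    using integral_exp_interval[of 0 "real n" "\<i> * q"] q0 by simp
  moreover have "(\<lambda>n. (exp (\<i> * q * of_real (real n)) - 1) / (\<i> * q)) \<longlonglongrightarrow> (0 - 1) / (\<i> * q)"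
  proof (intro tendsto_intros)
    show "(\<lambda>n. exp (\<i> * q * of_real (real n))) \<longlonglongrightarrow> 0"
    proof (rule tendsto_norm_zero_cancel)
      have "norm (exp (\<i> * q * of_real (real n))) = exp (- Im q) ^ n" for n
        by (simp add: exp_of_nat_mult[symmetric] mult.commute)
      then show "(\<lambda>n. norm (exp (\<i> * q * of_real (real n)))) \<longlonglongrightarrow> 0"
        using q by (simp add: LIMSEQ_power_zero)
    qed
  qed (use q0 in auto)
  ultimately have "integral\<^sup>L lborel (hexpc q) = (0 - 1) / (\<i> * q)"
    using LIMSEQ_unique by simp
  also have "\<dots> = \<i> / q" using q0 by (subst frac_eq_eq) (auto simp flip: mult.assoc)
  finally show ?thesis .
qed

lemma hexpc_tendsto: "((\<lambda>\<epsilon>. hexpc (Complex p \<epsilon>) x) \<longlongrightarrow> hexp p x) (at_right 0)"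
proof -
  have "((\<lambda>\<epsilon>. Complex p \<epsilon>) \<longlongrightarrow> Complex p 0) (at_right 0)" by (intro tendsto_intros)
  then have "((\<lambda>\<epsilon>. hexpc (Complex p \<epsilon>) x) \<longlongrightarrow> hexpc (Complex p 0) x) (at_right 0)"
    unfolding hexpc_def exp_fn_def by (intro tendsto_intros)
  moreover have "Complex p 0 = of_real p" by (simp add: complex_eq_iff)
  ultimately show ?thesis by (simp add: hexpc_of_real)
qed

lemma integral_hexpc_tendsto:
  assumes g: "integrable lborel g"
  shows "((\<lambda>\<epsilon>. LINT y|lborel. g y * hexpc (Complex p \<epsilon>) y) \<longlongrightarrow> (LINT y|lborel. g y * hexp p y)) (at_right 0)"
\<comment> \<open>Dominated convergence along sequences tending to 0 from the right; the majorant is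
  |g|, since the exponentials are bounded by 1 on the half-line.\<close>
proof (rule tendsto_at_right_sequentially[of 0 1])
  fix S :: "nat \<Rightarrow> real" assume S: "\<And>n. 0 < S n" "S \<longlonglongrightarrow> 0"
  have [measurable]: "g \<in> borel_measurable borel" using g by (rule integrable_lborel_measurable)
  have S': "filterlim S (at_right 0) sequentially"
    using S by (intro filterlim_at_withinI) (auto simp: eventually_sequentially)
  show "(\<lambda>n. LINT y|lborel. g y * hexpc (Complex p (S n)) y) \<longlonglongrightarrow> (LINT y|lborel. g y * hexp p y)"
  proof (rule integral_dominated_convergence[where w="\<lambda>x. norm (g x)"])
    show "AE x in lborel. (\<lambda>n. g x * hexpc (Complex p (S n)) x) \<longlonglongrightarrow> g x * hexp p x"
      by (intro AE_I2 tendsto_mult tendsto_const filterlim_compose[OF hexpc_tendsto S'])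
    show "AE x in lborel. norm (g x * hexpc (Complex p (S n)) x) \<le> norm (g x)" for n
      using norm_hexpc_le[of "Complex p (S n)"] S(1)[of n] by (auto simp: norm_mult mult_left_le)
  qed (use g in \<open>auto simp: borel_measurable_integrable\<close>)
qed simp

text \<open>At q = p this value is -1/(2ip), the convention for the pairing of
  \<open>e\<^sub>p\<close> with itself.\<close>

lemma pairing_exp_fn:
  assumes "Im q > 0" shows "pairing (exp_fn q) (exp_fn q) = \<i> / (2 * q)"
proof -
  have "pairing (exp_fn q) (exp_fn q) = integral\<^sup>L lborel (hexpc (2 * q))"
    unfolding pairing_def set_lebesgue_integral_def
    by (intro Bochner_Integration.integral_cong refl)
      (auto simp: hexpc_def exp_fn_def indicator_def algebra_simps simp flip: exp_add)
  then show ?thesis using hexpc_integral[of "2 * q"] assms by simp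
qed

lemma hankel_op_exp_fn: "hankel_op g (exp_fn q) x = (LINT y|lborel. g (x + y) * hexpc q y)"
  unfolding hankel_op_def set_lebesgue_integral_def
  by (intro Bochner_Integration.integral_cong refl) (auto simp: hexpc_def indicator_def)

context symbol
begin

text \<open>Associativity of convolutions together with \<open>m_eq\<close>: applying the symbol to
  \<open>1/\<sigma>\<^sub>+\<close> leaves \<open>\<sigma>\<^sub>-\<close>. The integral of
  \<open>k\<close> against \<phi> converges only almost everywhere, both being merely
  integrable.\<close>

lemma conv_sigma_plus:
  assumes f: "integrable lborel \<phi>"
  shows "AE x in lborel. a * ((c\<^sub>p * \<phi> x + conv G\<^sub>p \<phi> x) / t\<^sub>p) + conv k (\<lambda>x. (c\<^sub>p * \<phi> x + conv G\<^sub>p \<phi> x) / t\<^sub>p) x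
     = \<mu> * \<phi> x + conv m \<phi> x"
  using integrable_conv(2)[OF k_int f]
proof eventually_elim
  case (elim x)
  have 1: "integrable lborel (\<lambda>y. k (x - y) * conv G\<^sub>p \<phi> y)"
    by (intro integrable_conv_bdd k_int bdd_meas_conv G_bdd f)
  have 2: "integrable lborel (\<lambda>y. conv k G\<^sub>p (x - y) * \<phi> y)" 
    by (intro integrable_conv_bdd f bdd_meas_conv G_bdd k_int)
  have 3: "integrable lborel (\<lambda>y. G\<^sub>p (x - y) * \<phi> y)" 
    by (intro integrable_conv_bdd f G_bdd)
  have "conv k (\<lambda>x. (c\<^sub>p * \<phi> x + conv G\<^sub>p \<phi> x) / t\<^sub>p) x = (c\<^sub>p * conv k \<phi> x + conv k (conv G\<^sub>p \<phi>) x) / t\<^sub>p"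
  proof -
    have "integrable lborel (\<lambda>y. k (x - y) * (c\<^sub>p * \<phi> y))"
      using integrable_mult_right[OF elim, of c\<^sub>p] by (simp add: mult.left_commute)
    then show ?thesis using 1 by (simp add: conv_divide_right conv_add_right conv_cmult_right)
  qed
  moreover have "conv m \<phi> x = (a * conv G\<^sub>p \<phi> x + c\<^sub>p * conv k \<phi> x + conv (conv k G\<^sub>p) \<phi> x) / t\<^sub>p"
  proof -
    have "conv m \<phi> x = conv (\<lambda>x. a * G\<^sub>p x + c\<^sub>p * k x + conv k G\<^sub>p x) \<phi> x / t\<^sub>p"
      by (simp add: m_eq[abs_def] conv_divide_left)
    also have "conv (\<lambda>x. a * G\<^sub>p x + c\<^sub>p * k x + conv k G\<^sub>p x) \<phi> x 
        = conv (\<lambda>x. a * G\<^sub>p x + c\<^sub>p * k x) \<phi> x + conv (conv k G\<^sub>p) \<phi> x"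
      using 2 3 elim by (intro conv_add_left) (auto simp: distrib_right mult.assoc)
    also have "conv (\<lambda>x. a * G\<^sub>p x + c\<^sub>p * k x) \<phi> x = conv (\<lambda>x. a * G\<^sub>p x) \<phi> x + conv (\<lambda>x. c\<^sub>p * k x) \<phi> x"
      using 3 elim by (intro conv_add_left) (auto simp: mult.assoc)
    finally show ?thesis by (simp add: conv_cmult_left)
  qed
  moreover have "conv k (conv G\<^sub>p \<phi>) x = conv (conv k G\<^sub>p) \<phi> x" by (rule conv_assoc[OF k_int f G_bdd(1)])
  ultimately show ?case by (simp add: \<mu>_def add_divide_distrib distrib_left)
qed

text \<open>Convolution with the kernel of \<open>1/\<sigma>\<^sub>-\<close> on the whole line; the
  cut to the positive half-line comes later.\<close>

definition \<psi> :: "(real \<Rightarrow> complex) \<Rightarrow> real \<Rightarrow> complex" where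
  "\<psi> f x = (c\<^sub>m * f x + conv G\<^sub>m f x) / t\<^sub>m"

lemma psi_measurable [measurable]: "f \<in> borel_measurable borel \<Longrightarrow> \<psi> f \<in> borel_measurable borel"
proof -
  note [measurable] = bdd_meas_measurable[OF G_bdd(2)]
  assume [measurable]: "f \<in> borel_measurable borel"
  show ?thesis unfolding \<psi>_def[abs_def] by measurable
qed

lemma conv_sigma_minus:
  assumes f: "integrable lborel f"
  shows "AE x in lborel. integrable lborel (\<lambda>y. m (x - y) * \<psi> f y) \<and> \<mu> * \<psi> f x + conv m (\<psi> f) x = f x"
  using integrable_conv(2)[OF m_int f]
proof eventually_elim
  case (elim x)
  note [measurable] = bdd_meas_measurable[OF G_bdd(2)] integrable_lborel_measurable[OF m_int] integrable_lborel_measurable[OF f]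
  have 1: "integrable lborel (\<lambda>y. m (x - y) * conv G\<^sub>m f y)"
    by (intro integrable_conv_bdd m_int bdd_meas_conv G_bdd f)
  have 2: "integrable lborel (\<lambda>y. conv m G\<^sub>m (x - y) * f y)" 
    by (intro integrable_conv_bdd f bdd_meas_conv G_bdd m_int)
  have 3: "integrable lborel (\<lambda>y. G\<^sub>m (x - y) * f y)" 
    by (intro integrable_conv_bdd f G_bdd)
  have 0: "integrable lborel (\<lambda>y. m (x - y) * (c\<^sub>m * f y))"
    using integrable_mult_right[OF elim, of c\<^sub>m] by (simp add: mult.left_commute)
  have int: "integrable lborel (\<lambda>y. m (x - y) * \<psi> f y)"
    unfolding \<psi>_def using Bochner_Integration.integrable_add[OF 0 1] by (simp flip: distrib_left)
  have "conv m (\<psi> f) x = (c\<^sub>m * conv m f x + conv m (conv G\<^sub>m f) x) / t\<^sub>m"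
    unfolding \<psi>_def[abs_def] using 0 1 by (simp add: conv_divide_right conv_add_right conv_cmult_right)
  also have "conv m (conv G\<^sub>m f) x = conv (conv m G\<^sub>m) f x" by (rule conv_assoc[OF m_int f G_bdd(2)])
  finally have e: "conv m (\<psi> f) x = (c\<^sub>m * conv m f x + conv (conv m G\<^sub>m) f x) / t\<^sub>m" .
  have "conv (\<lambda>x. \<mu> * G\<^sub>m x + c\<^sub>m * m x + conv m G\<^sub>m x) f x = \<mu> * conv G\<^sub>m f x + c\<^sub>m * conv m f x + conv (conv m G\<^sub>m) f x"
  proof -
    have "conv (\<lambda>x. \<mu> * G\<^sub>m x + c\<^sub>m * m x + conv m G\<^sub>m x) f x 
        = conv (\<lambda>x. \<mu> * G\<^sub>m x + c\<^sub>m * m x) f x + conv (conv m G\<^sub>m) f x"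
      using 2 3 elim by (intro conv_add_left) (auto simp: distrib_right mult.assoc)
    also have "conv (\<lambda>x. \<mu> * G\<^sub>m x + c\<^sub>m * m x) f x = conv (\<lambda>x. \<mu> * G\<^sub>m x) f x + conv (\<lambda>x. c\<^sub>m * m x) f x"
      using 3 elim by (intro conv_add_left) (auto simp: mult.assoc)
    finally show ?thesis by (simp add: conv_cmult_left)
  qed
  moreover have "conv (\<lambda>x. \<mu> * G\<^sub>m x + c\<^sub>m * m x + conv m G\<^sub>m x) f x = 0"
  proof -
    have "AE y in lborel. \<mu> * G\<^sub>m (x - y) + c\<^sub>m * m (x - y) + conv m G\<^sub>m (x - y) = 0"
      by (rule AE_reflect_shift[OF convolution_inverse])
    then have "AE y in lborel. (\<mu> * G\<^sub>m (x - y) + c\<^sub>m * m (x - y) + conv m G\<^sub>m (x - y)) * f y = 0"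
      by eventually_elim simp
    then show ?thesis unfolding conv_def[of _ f] by (rule integral_eq_zero_AE)
  qed
  ultimately have z: "\<mu> * conv G\<^sub>m f x + (c\<^sub>m * conv m f x + conv (conv m G\<^sub>m) f x) = 0" by (simp add: add.assoc)
  have "\<mu> * \<psi> f x + conv m (\<psi> f) x = (\<mu> * c\<^sub>m * f x + (\<mu> * conv G\<^sub>m f x + (c\<^sub>m * conv m f x + conv (conv m G\<^sub>m) f x))) / t\<^sub>m"
    unfolding e \<psi>_def using tau_nonzero by (simp add: field_simps)
  also have "\<dots> = f x" unfolding z mu_eq using tau_nonzero by simp
  finally show ?case using int by simp
qed

lemma m_shift_AE: "AE y in lborel. x - y > 0 \<longrightarrow> m (x - y) = 0"
  by (rule AE_reflect_shift[OF m_support])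

text \<open>Triangularity: for x > 0 a value of \<open>\<psi> f\<close> at y <= 0 enters with the
  factor m(x - y) at a positive argument, which is 0. Hence cutting \<open>\<psi> f\<close> at 0
  does not affect the equation on x > 0.\<close>

lemma half_line_inverse:
  assumes f: "integrable lborel f" and \<phi>: "integrable lborel (\<lambda>x. indicator {0<..} x * \<psi> f x)"
  defines "u \<equiv> \<lambda>x. (c\<^sub>p * (indicator {0<..} x * \<psi> f x) + conv G\<^sub>p (\<lambda>x. indicator {0<..} x * \<psi> f x) x) / t\<^sub>p"
  shows "AE x in lborel. x > 0 \<longrightarrow> a * u x + conv k u x = f x"
  using conv_sigma_plus[OF \<phi>] conv_sigma_minus[OF f]
proof eventually_elim
  case (elim x)
  note [measurable] = bdd_meas_measurable[OF G_bdd(2)] integrable_lborel_measurable[OF m_int] integrable_lborel_measurable[OF f]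
  show ?case
  proof
    assume x: "x > 0"
    have "conv m (\<lambda>x. indicator {0<..} x * \<psi> f x) x = conv m (\<psi> f) x"
      unfolding conv_def
    proof (rule integral_cong_AE)
      show "AE y in lborel. m (x - y) * (indicator {0<..} y * \<psi> f y) = m (x - y) * \<psi> f y"
        using m_shift_AE[of x] by eventually_elim (use x in \<open>auto simp: indicator_def\<close>)
    qed measurable
    then show "a * u x + conv k u x = f x" using elim x unfolding u_def by simp
  qed
qed

text \<open>The symbol applied to \<open>1/\<sigma>\<^sub>+\<close> f is
  \<open>\<sigma>\<^sub>-\<close> f, which stays on the negative half-line together with f. With
  suitable f this yields the equations for \<open>\<zeta>\<close> and, reflected, for
  \<open>V\<^sub>0\<close>.\<close>

lemma negative_support:
  assumes f: "integrable lborel f" and neg: "\<And>x. x \<ge> 0 \<Longrightarrow> f x = 0"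
  shows "AE x in lborel. x > 0 \<longrightarrow> a * ((c\<^sub>p * f x + conv G\<^sub>p f x) / t\<^sub>p) + conv k (\<lambda>x. (c\<^sub>p * f x + conv G\<^sub>p f x) / t\<^sub>p) x = 0"
  using conv_sigma_plus[OF f]
proof eventually_elim
  case (elim x)
  show ?case
  proof
    assume x: "x > 0"
    have "AE y in lborel. m (x - y) * f y = 0"
      using m_shift_AE[of x] by eventually_elim (use x neg in force)
    then have "conv m f x = 0" unfolding conv_def by (rule integral_eq_zero_AE)
    then show "a * ((c\<^sub>p * f x + conv G\<^sub>p f x) / t\<^sub>p) + conv k (\<lambda>x. (c\<^sub>p * f x + conv G\<^sub>p f x) / t\<^sub>p) x = 0"
      using elim x neg by simp
  qed
qed

subsection \<open>The functions \<open>\<zeta>\<close> and \<open>\<eta>\<close>\<close>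

text \<open>The limit value of H applied to \<open>e\<^sub>p\<close>, written out: i/(2p) is the
  regularised pairing of \<open>e\<^sub>p\<close> with itself.\<close>

definition \<zeta> :: "real \<Rightarrow> complex" where
  "\<zeta> x = (\<i> / (2 * of_real p) * exp_fn (of_real p) x + (LINT y|lborel. g\<^sub>p (x + y) * hexp p y)) / t\<^sub>p"

text \<open>\<open>s\<^sub>p = 1/\<sigma>\<^sub>+(p)\<close>, and below \<open>s\<^sub>m = 1/\<sigma>\<^sub>-(-p)\<close>.\<close>

definition s\<^sub>p :: complex where "s\<^sub>p = (c\<^sub>p + \<i> / (2 * of_real p) + fourier g\<^sub>p p) / t\<^sub>p"

lemma s_plus: "s\<^sub>p = \<i> / (2 * of_real p * \<tau>\<^sub>p (of_real p))"
proof -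
  have "p \<noteq> - p" using p by simp
  from u_plus[OF this] have "t\<^sub>p / (- \<i> * of_real (2 * p) * \<tau>\<^sub>p (of_real p)) = 1 / (- \<i> * of_real (2 * p)) + (c\<^sub>p + fourier g\<^sub>p p)"
    by simp
  moreover have "1 / (- \<i> * of_real (2 * p)) = \<i> / (2 * of_real p)" using p by (simp add: field_simps)
  ultimately have "t\<^sub>p * s\<^sub>p = t\<^sub>p / (- \<i> * of_real (2 * p) * \<tau>\<^sub>p (of_real p))"
    unfolding s\<^sub>p_def using tau_nonzero by (simp add: add_ac)
  then have "t\<^sub>p * s\<^sub>p = t\<^sub>p * (1 / (- \<i> * of_real (2 * p) * \<tau>\<^sub>p (of_real p)))" by simp
  then have "s\<^sub>p = 1 / (- \<i> * of_real (2 * p) * \<tau>\<^sub>p (of_real p))"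
    using tau_nonzero(3) mult_left_cancel by blast
  also have "\<dots> = \<i> / (2 * of_real p * \<tau>\<^sub>p (of_real p))" using p tau_nonzero(5) by (subst frac_eq_eq) (auto simp flip: mult.assoc)
  finally show ?thesis .
qed

lemma zeta_hankel: "hankel_pole_exp p t\<^sub>p g\<^sub>p = \<zeta>"
proof
  fix x
  have g: "integrable lborel (\<lambda>y. g\<^sub>p (x + y))" by (rule integrable_reflect_shift(2)[OF g_int(1)])
  have cp: "((\<lambda>\<epsilon>. Complex p \<epsilon>) \<longlongrightarrow> of_real p) (at_right 0)"
  proof -
    have "((\<lambda>\<epsilon>. Complex p \<epsilon>) \<longlongrightarrow> Complex p 0) (at_right 0)" by (intro tendsto_intros)
    then show ?thesis by (simp add: complex_of_real_def)
  qed
  have "((\<lambda>\<epsilon>. (exp_fn (Complex p \<epsilon>) x * (\<i> / (2 * Complex p \<epsilon>)) + (LINT y|lborel. g\<^sub>p (x + y) * hexpc (Complex p \<epsilon>) y)) / t\<^sub>p)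
     \<longlongrightarrow> (exp_fn (of_real p) x * (\<i> / (2 * of_real p)) + (LINT y|lborel. g\<^sub>p (x + y) * hexp p y)) / t\<^sub>p) (at_right 0)"
    unfolding exp_fn_def using p tau_nonzero by (intro tendsto_intros cp integral_hexpc_tendsto g) auto
  moreover have "\<forall>\<^sub>F \<epsilon> in at_right 0. (exp_fn (Complex p \<epsilon>) x * (\<i> / (2 * Complex p \<epsilon>)) + (LINT y|lborel. g\<^sub>p (x + y) * hexpc (Complex p \<epsilon>) y)) / t\<^sub>p
     = hankel_pole (Complex p \<epsilon>) t\<^sub>p g\<^sub>p (exp_fn (Complex p \<epsilon>)) x"
    using eventually_at_right_less[of "0::real"]
    by eventually_elim (simp add: hankel_pole_def tensor_def pairing_exp_fn hankel_op_exp_fn)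
  ultimately have "((\<lambda>\<epsilon>. hankel_pole (Complex p \<epsilon>) t\<^sub>p g\<^sub>p (exp_fn (Complex p \<epsilon>)) x) \<longlongrightarrow> \<zeta> x) (at_right 0)"
    unfolding \<zeta>_def by (subst (asm) tendsto_cong) (auto simp: mult.commute)
  then show "hankel_pole_exp p t\<^sub>p g\<^sub>p x = \<zeta> x"
    unfolding hankel_pole_exp_def by (intro tendsto_Lim) auto
qed

lemma zeta_measurable [measurable]: "\<zeta> \<in> borel_measurable borel"
proof -
  note [measurable] = bdd_meas_measurable[OF g_bdd(1)]
  show ?thesis unfolding \<zeta>_def[abs_def] exp_fn_def by measurable
qed

lemma zeta_bounded: "\<exists>C. \<forall>x. norm (\<zeta> x) \<le> C"
proof (intro exI allI)
  fix x
  have "norm (LINT y|lborel. g\<^sub>p (x + y) * hexp p y) \<le> (LINT y|lborel. norm (g\<^sub>p (x + y)))"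
    by (rule norm_integral_le_integral)
      (use integrable_reflect_shift(2)[OF g_int(1), of x] norm_hexp_le in \<open>auto simp: norm_mult mult_left_le\<close>)
  also have "\<dots> = (LINT y|lborel. norm (g\<^sub>p y))"
    using lborel_integral_real_affine[of 1 "\<lambda>y. norm (g\<^sub>p y)" x] by simp
  finally have "norm (\<i> / (2 * of_real p) * exp_fn (of_real p) x + (LINT y|lborel. g\<^sub>p (x + y) * hexp p y)) 
    \<le> norm (\<i> / (2 * of_real p)) + (LINT y|lborel. norm (g\<^sub>p y))"
    by (intro norm_triangle_mono) (unfold norm_mult, auto simp: exp_fn_def)
  then show "norm (\<zeta> x) \<le> (norm (\<i> / (2 * of_real p)) + (LINT y|lborel. norm (g\<^sub>p y))) / norm t\<^sub>p"
    unfolding \<zeta>_def norm_divide by (intro divide_right_mono) auto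
qed

lemma bdd_meas_zeta: "bdd_meas \<zeta>"
  using zeta_bounded by (auto intro: bdd_measI)

text \<open>For \<open>x < 0\<close> the convolution below is \<open>e\<^sub>-\<^sub>q\<close> times the value of the symbol \<open>1/\<sigma>\<^sub>+\<close> at \<open>q\<close>.\<close>

lemma conv_G_hexpc:
  assumes q: "Im q > 0" and x: "x \<noteq> 0"
  shows "conv G\<^sub>p (\<lambda>y. hexpc q (- y)) x = (if x > 0
     then \<i> / (of_real p + q) * exp_fn (of_real p) x + (LINT y|lborel. g\<^sub>p (x + y) * hexpc q y)
     else exp_fn (- q) x * (\<i> / (of_real p + q) + (LINT y|lborel. g\<^sub>p y * hexpc q y)))"
proof -
  have pq: "Im (of_real p + q) > 0" using q by simp
  have qi: "integrable lborel (\<lambda>y. hexpc q (- y))" by (rule integrable_reflect_shift(5)[OF hexpc_integrable[OF q]])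
  have bh: "bdd_meas (hexpc q)" using q by (intro bdd_meas_hexpc) simp
  have add: "conv G\<^sub>p (\<lambda>y. hexpc q (- y)) x = conv (hexp p) (\<lambda>y. hexpc q (- y)) x + conv g\<^sub>p (\<lambda>y. hexpc q (- y)) x"
    unfolding G\<^sub>p_def[abs_def]
    by (rule conv_add_left) (intro integrable_conv_bdd bdd_meas_hexp g_bdd qi)+
  have refl: "conv h (\<lambda>y. hexpc q (- y)) x = (LINT w|lborel. h (x + w) * hexpc q w)" for h
    unfolding conv_def using integral_reflect_shift(5)[of "\<lambda>w. h (x + w) * hexpc q w"] by (simp add: add.commute)
  show ?thesis
  proof (cases "x > 0")
    case True
    have "(LINT w|lborel. hexp p (x + w) * hexpc q w) = (LINT w|lborel. exp_fn (of_real p) x * hexpc (of_real p + q) w)"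
      by (intro Bochner_Integration.integral_cong refl)
        (use True in \<open>auto simp: hexp_def hexpc_def exp_fn_def indicator_def algebra_simps simp flip: exp_add\<close>)
    then show ?thesis unfolding add unfolding refl using True hexpc_integral[OF pq] by (simp add: mult.commute)
  next
    case False
    with x have x: "x < 0" by simp
    have "(LINT w|lborel. hexp p (x + w) * hexpc q w) = (LINT w|lborel. hexp p (x + (w - x)) * hexpc q (w - x))"
      using integral_reflect_shift(4)[of "\<lambda>w. hexp p (x + w) * hexpc q w" x] by simp
    also have "\<dots> = (LINT w|lborel. exp_fn (- q) x * hexpc (of_real p + q) w)"
      by (intro Bochner_Integration.integral_cong refl)
        (use x in \<open>auto simp: hexp_def hexpc_def exp_fn_def indicator_def algebra_simps simp flip: exp_add\<close>)
    finally have 1: "(LINT w|lborel. hexp p (x + w) * hexpc q w) = exp_fn (- q) x * (\<i> / (of_real p + q))"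
      using hexpc_integral[OF pq] by simp
    have "(LINT w|lborel. g\<^sub>p (x + w) * hexpc q w) = (LINT w|lborel. g\<^sub>p (x + (w - x)) * hexpc q (w - x))"
      using integral_reflect_shift(4)[of "\<lambda>w. g\<^sub>p (x + w) * hexpc q w" x] by simp
    also have "\<dots> = (LINT w|lborel. exp_fn (- q) x * (g\<^sub>p w * hexpc q w))"
    proof (rule integral_cong_AE)
      note [measurable] = bdd_meas_measurable[OF g_bdd(1)]
      show "(\<lambda>w. g\<^sub>p (x + (w - x)) * hexpc q (w - x)) \<in> borel_measurable lborel"
        "(\<lambda>w. exp_fn (- q) x * (g\<^sub>p w * hexpc q w)) \<in> borel_measurable lborel" by measurable
      show "AE w in lborel. g\<^sub>p (x + (w - x)) * hexpc q (w - x) = exp_fn (- q) x * (g\<^sub>p w * hexpc q w)"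
        using AE_lborel_singleton[of 0]
      proof eventually_elim
        case (elim w)
        show ?case
        proof (cases "w < 0")
          case False
          then have "hexpc q (w - x) = exp_fn (- q) x * hexpc q w"
            using elim x by (auto simp: hexpc_def exp_fn_def indicator_def algebra_simps simp flip: exp_add)
          then show ?thesis by simp
        qed (simp add: g_plus(2))
      qed
    qed
    finally show ?thesis unfolding add unfolding refl 1 using False by (simp add: distrib_left)
  qed
qed

text \<open>Apply \<open>negative_support\<close> to the regularised exponentials reflected to the
  negative half-line and let q tend to p. The solution tends to \<open>\<zeta>\<close> on the
  positive half-line and to a multiple of the exponential with exponent -ipx on the negative one;
  moved to the right side, the latter becomes a Hankel integral of \<open>e\<^sub>p\<close>.\<close>

lemma zeta_equation:
  "AE x in lborel. x > 0 \<longrightarrow> a * \<zeta> x + (LINT y|lborel. k (x - y) * (indicator {0<..} y * \<zeta> y))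
     = - s\<^sub>p * (LINT w|lborel. k (x + w) * hexp p w)"
proof -
  \<comment> \<open>A sequence p + i/(n+1) rather than a continuous parameter, so that the
    exceptional null sets can be united.\<close>
  define q where "q n = Complex p (inverse (real (Suc n)))" for n
  have q: "Im (q n) > 0" for n by (simp add: q_def)
  have inv: "filterlim (\<lambda>n. inverse (real (Suc n))) (at_right 0) sequentially"
    using LIMSEQ_inverse_real_of_nat by (intro filterlim_at_withinI) auto
  have qlim: "q \<longlonglongrightarrow> of_real p"
  proof -
    have "(\<lambda>n. Complex p (inverse (real (Suc n)))) \<longlonglongrightarrow> Complex p 0" by (intro tendsto_intros LIMSEQ_inverse_real_of_nat)
    then show ?thesis unfolding q_def by (simp add: complex_of_real_def)
  qed
  define Y where "Y n y = hexpc (q n) (- y)" for n y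
  have Y: "integrable lborel (Y n)" for n
    unfolding Y_def by (rule integrable_reflect_shift(5)[OF hexpc_integrable[OF q]])
  define u where "u n x = (c\<^sub>p * Y n x + conv G\<^sub>p (Y n) x) / t\<^sub>p" for n x
  define v where "v x = (if x > 0 then \<zeta> x else s\<^sub>p * exp_fn (- of_real p) x)" for x
  note [measurable] = bdd_meas_measurable[OF g_bdd(1)] bdd_meas_measurable[OF G_bdd(1)] integrable_lborel_measurable[OF k_int]
    integrable_lborel_measurable[OF Y]
  have zero: "AE x in lborel. \<forall>n. x > 0 \<longrightarrow> a * u n x + conv k (u n) x = 0"
    unfolding AE_all_countable u_def
    by (intro allI negative_support Y) (auto simp: Y_def hexpc_def)
  have gl: "(\<lambda>n. LINT y|lborel. g\<^sub>p (x + y) * hexpc (q n) y) \<longlonglongrightarrow> (LINT y|lborel. g\<^sub>p (x + y) * hexp p y)" for x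
    unfolding q_def by (rule filterlim_compose[OF integral_hexpc_tendsto[OF integrable_reflect_shift(2)[OF g_int(1)]] inv])
  have ulim: "(\<lambda>n. u n x) \<longlonglongrightarrow> v x" if x: "x \<noteq> 0" for x
  proof (cases "x > 0")
    case True
    have "(\<lambda>n. (c\<^sub>p * 0 + (\<i> / (of_real p + q n) * exp_fn (of_real p) x + (LINT y|lborel. g\<^sub>p (x + y) * hexpc (q n) y))) / t\<^sub>p)
       \<longlonglongrightarrow> (c\<^sub>p * 0 + (\<i> / (of_real p + of_real p) * exp_fn (of_real p) x + (LINT y|lborel. g\<^sub>p (x + y) * hexp p y))) / t\<^sub>p"
      using p tau_nonzero by (intro tendsto_intros qlim gl) auto
    moreover have "Y n x = 0" for n using True by (simp add: Y_def hexpc_def)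
    moreover have "conv G\<^sub>p (Y n) x = \<i> / (of_real p + q n) * exp_fn (of_real p) x + (LINT y|lborel. g\<^sub>p (x + y) * hexpc (q n) y)" for n
      unfolding Y_def using conv_G_hexpc[OF q x] True by simp
    ultimately show ?thesis using True unfolding u_def v_def \<zeta>_def by simp
  next
    case False
    with x have x': "x < 0" by simp
    have g0: "(\<lambda>n. LINT y|lborel. g\<^sub>p y * hexpc (q n) y) \<longlonglongrightarrow> (LINT y|lborel. g\<^sub>p y * hexp p y)"
      using gl[of 0] by simp
    have "(\<lambda>n. (c\<^sub>p * exp_fn (- q n) x + exp_fn (- q n) x * (\<i> / (of_real p + q n) + (LINT y|lborel. g\<^sub>p y * hexpc (q n) y))) / t\<^sub>p)
       \<longlonglongrightarrow> (c\<^sub>p * exp_fn (- of_real p) x + exp_fn (- of_real p) x * (\<i> / (of_real p + of_real p) + (LINT y|lborel. g\<^sub>p y * hexp p y))) / t\<^sub>p"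
      unfolding exp_fn_def using p tau_nonzero by (intro tendsto_intros qlim g0) auto
    moreover have "Y n x = exp_fn (- q n) x" for n using x' by (simp add: Y_def hexpc_def exp_fn_def)
    moreover have "conv G\<^sub>p (Y n) x = exp_fn (- q n) x * (\<i> / (of_real p + q n) + (LINT y|lborel. g\<^sub>p y * hexpc (q n) y))" for n
      unfolding Y_def using conv_G_hexpc[OF q x] False by simp
    moreover have "(LINT y|lborel. g\<^sub>p y * hexp p y) = fourier g\<^sub>p p"
      unfolding fourier_def
    proof (rule integral_cong_AE)
      show "AE x in lborel. g\<^sub>p x * hexp p x = exp (\<i> * of_real (x * p)) * g\<^sub>p x"
        using AE_lborel_singleton[of 0] by eventually_elim (auto simp: hexp_eq g_plus(2) mult.commute)
    qed measurable
    ultimately show ?thesis using False unfolding u_def v_def s\<^sub>p_def by (simp add: algebra_simps)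
  qed
  define B where "B = (norm c\<^sub>p + (norm (\<i> / of_real (2 * p)) + 0 + (LINT y|lborel. norm (g\<^sub>p y))) ) / norm t\<^sub>p + 0"
  have gb: "norm (LINT y|lborel. g\<^sub>p (x + y) * hexpc (q n) y) \<le> (LINT y|lborel. norm (g\<^sub>p y))" for x n
  proof -
    have "norm (LINT y|lborel. g\<^sub>p (x + y) * hexpc (q n) y) \<le> (LINT y|lborel. norm (g\<^sub>p (x + y)))"
      by (rule norm_integral_le_integral)
        (use integrable_reflect_shift(2)[OF g_int(1), of x] norm_hexpc_le[of "q n"] q[of n] in \<open>auto simp: norm_mult mult_left_le less_imp_le\<close>)
    also have "\<dots> = (LINT y|lborel. norm (g\<^sub>p y))"
      using lborel_integral_real_affine[of 1 "\<lambda>y. norm (g\<^sub>p y)" x] by simp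
    finally show ?thesis .
  qed
  \<comment> \<open>Uniform in n, because the real part of p + q(n) is 2p; this is where p being
    nonzero keeps the regularisation bounded.\<close>
  have pqb: "norm (\<i> / (of_real p + q n)) \<le> norm (\<i> / of_real (2 * p))" for n
  proof -
    have "\<bar>2 * p\<bar> \<le> norm (of_real p + q n)" using abs_Re_le_cmod[of "of_real p + q n"] by (simp add: q_def)
    moreover have "\<bar>2 * p\<bar> > 0" using p by simp
    ultimately show ?thesis unfolding norm_divide by (simp add: frac_le del: abs_mult)
  qed
  have ub: "norm (u n x) \<le> B" if x: "x \<noteq> 0" for n x
  proof -
    have e1: "norm (Y n x) \<le> 1" unfolding Y_def by (rule norm_hexpc_le) (simp add: q_def)
    have cb: "norm (conv G\<^sub>p (Y n) x) \<le> norm (\<i> / of_real (2 * p)) + (LINT y|lborel. norm (g\<^sub>p y))"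
    proof (cases "x > 0")
      case True
      have "norm (\<i> / (of_real p + q n) * exp_fn (of_real p) x) \<le> norm (\<i> / of_real (2 * p))"
        using pqb[of n] unfolding norm_mult by (simp add: exp_fn_def)
      then show ?thesis unfolding Y_def conv_G_hexpc[OF q x] using True gb[of x n] by (auto intro!: norm_triangle_mono)
    next
      case False
      have "norm (exp_fn (- q n) x) \<le> 1" using False q[of n] by (simp add: exp_fn_def mult_nonneg_nonpos)
      moreover have "norm (\<i> / (of_real p + q n) + (LINT y|lborel. g\<^sub>p y * hexpc (q n) y)) \<le> norm (\<i> / of_real (2 * p)) + (LINT y|lborel. norm (g\<^sub>p y))"
        using gb[of 0 n] pqb[of n] by (intro norm_triangle_mono) auto
      ultimately have "norm (exp_fn (- q n) x * (\<i> / (of_real p + q n) + (LINT y|lborel. g\<^sub>p y * hexpc (q n) y)))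
        \<le> 1 * (norm (\<i> / of_real (2 * p)) + (LINT y|lborel. norm (g\<^sub>p y)))"
        unfolding norm_mult by (intro mult_mono) auto
      then show ?thesis unfolding Y_def conv_G_hexpc[OF q x] using False by simp
    qed
    have "norm (c\<^sub>p * Y n x + conv G\<^sub>p (Y n) x) \<le> norm c\<^sub>p + (norm (\<i> / of_real (2 * p)) + (LINT y|lborel. norm (g\<^sub>p y)))"
      using e1 by (intro norm_triangle_mono cb) (auto simp: norm_mult mult_left_le)
    then show ?thesis unfolding u_def B_def norm_divide by (auto intro!: divide_right_mono)
  qed
  have clim: "(\<lambda>n. conv k (u n) x) \<longlonglongrightarrow> conv k v x" for x
    unfolding conv_def
  proof (rule integral_dominated_convergence[where w="\<lambda>y. norm (k (x - y)) * B"])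
    show "integrable lborel (\<lambda>y. norm (k (x - y)) * B)"
      by (intro integrable_mult_left integrable_norm integrable_reflect_shift k_int)
    show "AE y in lborel. (\<lambda>n. k (x - y) * u n y) \<longlonglongrightarrow> k (x - y) * v y"
      using AE_lborel_singleton[of 0] by eventually_elim (intro tendsto_intros ulim)
    show "AE y in lborel. norm (k (x - y) * u n y) \<le> norm (k (x - y)) * B" for n
      using AE_lborel_singleton[of 0] by eventually_elim (simp add: norm_mult ub mult_left_mono)
    show "(\<lambda>y. k (x - y) * v y) \<in> borel_measurable lborel" unfolding v_def[abs_def] exp_fn_def by measurable
    show "(\<lambda>y. k (x - y) * u n y) \<in> borel_measurable lborel" for n unfolding u_def[abs_def] by measurable
  qed
  show ?thesis using zero
  proof eventually_elim
    case (elim x)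
    show ?case
    proof
      assume x: "x > 0"
      have "(\<lambda>n. a * u n x + conv k (u n) x) \<longlonglongrightarrow> a * v x + conv k v x"
        using x by (intro tendsto_intros ulim clim) auto
      moreover have "(\<lambda>n. a * u n x + conv k (u n) x) = (\<lambda>n. 0)" using elim x by auto
      ultimately have z: "a * v x + conv k v x = 0" using LIMSEQ_unique[OF tendsto_const] by metis
      let ?e = "\<lambda>y. indicator {..0} y * exp_fn (- of_real p) y"
      have i1: "integrable lborel (\<lambda>y. k (x - y) * (indicator {0<..} y * \<zeta> y))"
        by (intro integrable_conv_bdd k_int bdd_meas_indicator_mult bdd_meas_zeta) simp
      have i2: "integrable lborel (\<lambda>y. k (x - y) * ?e y)"
        by (intro integrable_conv_bdd k_int bdd_meas_indicator_mult bdd_measI[of _ 1]) (auto simp: exp_fn_def[abs_def])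
      have "conv k v x = (LINT y|lborel. k (x - y) * (indicator {0<..} y * \<zeta> y) + s\<^sub>p * (k (x - y) * ?e y))"
        unfolding conv_def v_def by (intro Bochner_Integration.integral_cong refl) (auto simp: indicator_def)
      also have "\<dots> = (LINT y|lborel. k (x - y) * (indicator {0<..} y * \<zeta> y)) + s\<^sub>p * (LINT y|lborel. k (x - y) * ?e y)"
        using i1 i2 by simp
      also have "(LINT y|lborel. k (x - y) * ?e y) = (LINT w|lborel. k (x + w) * ?e (- w))"
        using integral_reflect_shift(5)[of "\<lambda>y. k (x - y) * ?e y"] by simp
      also have "\<dots> = (LINT w|lborel. k (x + w) * hexp p w)"
      proof (rule integral_cong_AE)
        show "AE w in lborel. k (x + w) * ?e (- w) = k (x + w) * hexp p w"
          using AE_lborel_singleton[of 0] by eventually_elim (auto simp: hexp_def exp_fn_def indicator_def)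
        show "(\<lambda>w. k (x + w) * ?e (- w)) \<in> borel_measurable lborel" unfolding exp_fn_def by measurable
      qed measurable
      finally have cv: "conv k v x = (LINT y|lborel. k (x - y) * (indicator {0<..} y * \<zeta> y)) + s\<^sub>p * (LINT w|lborel. k (x + w) * hexp p w)" .
      have vx: "v x = \<zeta> x" using x by (simp add: v_def)
      show "a * \<zeta> x + (LINT y|lborel. k (x - y) * (indicator {0<..} y * \<zeta> y))
         = - s\<^sub>p * (LINT w|lborel. k (x + w) * hexp p w)"
        using z unfolding vx cv by (simp only: mult_minus_left eq_neg_iff_add_eq_0 add.assoc)
    qed
  qed
qed

text \<open>Formally the integral of \<open>e\<^sub>p\<close> times \<open>G\<^sub>p\<close> over
  the whole half-line is \<open>t\<^sub>p * s\<^sub>p - c\<^sub>p\<close>, and the tail from z on is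
  the term with \<open>\<zeta> z\<close>. Since the square of \<open>e\<^sub>p\<close> is not
  integrable, its part over (0,z) is integrated explicitly and only the part with
  \<open>g\<^sub>p\<close> is split at z.\<close>

lemma partial_pairing:
  assumes z: "z > 0"
  shows "(LINT w|lborel. indicator {0<..<z} w * exp_fn (of_real p) w * G\<^sub>p w)
    = t\<^sub>p * s\<^sub>p - c\<^sub>p - exp_fn (of_real p) z * (t\<^sub>p * \<zeta> z)"
proof -
  note [measurable] = bdd_meas_measurable[OF g_bdd(1)]
  let ?e = "exp_fn (of_real p)"
  have [measurable]: "?e \<in> borel_measurable borel" by (simp add: exp_fn_def[abs_def])
  have be: "bdd_meas (\<lambda>w. indicator A w * ?e w)" if "A \<in> sets borel" for A
    using that by (intro bdd_meas_indicator_mult bdd_measI[of _ 1]) (auto simp: exp_fn_def[abs_def])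
  have i2: "integrable lborel (\<lambda>w. indicator A w * ?e w * g\<^sub>p w)" if "A \<in> sets borel" for A
    using integrable_bdd_mult[OF g_int(1) be[OF that]] .
  have i1: "integrable lborel (\<lambda>w. indicator {0<..<z} w * exp ((2 * \<i> * of_real p) * of_real w))"
  proof (rule Bochner_Integration.integrable_bound[where f="\<lambda>w. indicator {0<..<z} w :: real"])
    show "AE x in lborel. norm (indicator {0<..<z} x * exp ((2 * \<i> * of_real p) * of_real x)) \<le> norm (indicat_real {0<..<z} x)"
      by (auto simp: indicator_def)
  qed (use z in auto)
  have "(LINT w|lborel. indicator {0<..<z} w * ?e w * G\<^sub>p w)
     = (LINT w|lborel. indicator {0<..<z} w * exp ((2 * \<i> * of_real p) * of_real w) + indicator {0<..<z} w * ?e w * g\<^sub>p w)"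
    by (intro Bochner_Integration.integral_cong refl)
      (auto simp: G\<^sub>p_def hexp_def exp_fn_def indicator_def algebra_simps simp flip: exp_add)
  also have "\<dots> = (LINT w|lborel. indicator {0<..<z} w * exp ((2 * \<i> * of_real p) * of_real w))
     + (LINT w|lborel. indicator {0<..<z} w * ?e w * g\<^sub>p w)"
    using i1 i2[of "{0<..<z}"] by simp
  also have "(LINT w|lborel. indicator {0<..<z} w * exp ((2 * \<i> * of_real p) * of_real w))
      = (LINT w|lborel. indicator {0..z} w * exp ((2 * \<i> * of_real p) * of_real w))"
  proof (rule integral_cong_AE)
    show "AE w in lborel. indicator {0<..<z} w * exp ((2 * \<i> * of_real p) * of_real w) = indicator {0..z} w * exp ((2 * \<i> * of_real p) * of_real w)"
      using AE_lborel_singleton[of 0] AE_lborel_singleton[of z] by eventually_elim (auto simp: indicator_def)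
  qed measurable
  also have "\<dots> = (exp (2 * \<i> * of_real p * of_real z) - 1) / (2 * \<i> * of_real p)"
    using integral_exp_interval[of 0 z "2 * \<i> * of_real p"] z p by simp
  also have "exp (2 * \<i> * of_real p * of_real z) = ?e z * ?e z"
    by (simp add: exp_fn_def algebra_simps flip: exp_add)
  also have "(LINT w|lborel. indicator {0<..<z} w * ?e w * g\<^sub>p w) = fourier g\<^sub>p p - ?e z * (LINT y|lborel. g\<^sub>p (z + y) * hexp p y)"
  proof -
    have "(LINT w|lborel. indicator {0<..<z} w * ?e w * g\<^sub>p w) + (LINT w|lborel. indicator {z<..} w * ?e w * g\<^sub>p w)
       = (LINT w|lborel. indicator {0<..<z} w * ?e w * g\<^sub>p w + indicator {z<..} w * ?e w * g\<^sub>p w)"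
      using i2[of "{0<..<z}"] i2[of "{z<..}"] by simp
    also have "\<dots> = fourier g\<^sub>p p" unfolding fourier_def
    proof (rule integral_cong_AE)
      show "AE w in lborel. indicator {0<..<z} w * ?e w * g\<^sub>p w + indicator {z<..} w * ?e w * g\<^sub>p w = exp (\<i> * of_real (w * p)) * g\<^sub>p w"
        using AE_lborel_singleton[of 0] AE_lborel_singleton[of z]
        by eventually_elim (use z in \<open>auto simp: indicator_def exp_fn_def g_plus(2) mult_ac not_less\<close>)
    qed measurable
    finally have 1: "(LINT w|lborel. indicator {0<..<z} w * ?e w * g\<^sub>p w) + (LINT w|lborel. indicator {z<..} w * ?e w * g\<^sub>p w) = fourier g\<^sub>p p" .
    have "(LINT w|lborel. indicator {z<..} w * ?e w * g\<^sub>p w) = (LINT y|lborel. indicator {z<..} (z + y) * ?e (z + y) * g\<^sub>p (z + y))"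
      by (rule integral_reflect_shift(2)[symmetric])
    also have "\<dots> = (LINT y|lborel. ?e z * (g\<^sub>p (z + y) * hexp p y))"
      by (intro Bochner_Integration.integral_cong refl)
        (auto simp: hexp_def exp_fn_def indicator_def algebra_simps exp_add)
    also have "\<dots> = ?e z * (LINT y|lborel. g\<^sub>p (z + y) * hexp p y)" by (rule integral_mult_right_zero)
    finally have 2: "(LINT w|lborel. indicator {z<..} w * ?e w * g\<^sub>p w) = ?e z * (LINT y|lborel. g\<^sub>p (z + y) * hexp p y)" .
    show ?thesis using 1 unfolding 2 by (simp only: eq_diff_eq)
  qed
  finally have e: "(LINT w|lborel. indicator {0<..<z} w * ?e w * G\<^sub>p w)
     = (?e z * ?e z - 1) / (2 * \<i> * of_real p) + (fourier g\<^sub>p p - ?e z * (LINT y|lborel. g\<^sub>p (z + y) * hexp p y))" .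
  have tz: "t\<^sub>p * \<zeta> z = \<i> / (2 * of_real p) * ?e z + (LINT y|lborel. g\<^sub>p (z + y) * hexp p y)"
    using tau_nonzero by (simp add: \<zeta>_def)
  have ts: "t\<^sub>p * s\<^sub>p = c\<^sub>p + \<i> / (2 * of_real p) + fourier g\<^sub>p p"
    using tau_nonzero by (simp add: s\<^sub>p_def)
  have "(?e z * ?e z - 1) / (2 * \<i> * of_real p) = \<i> / (2 * of_real p) - ?e z * (\<i> / (2 * of_real p) * ?e z)"
    using p by (simp add: field_simps)
  then show ?thesis unfolding e tz ts by (simp add: algebra_simps)
qed

end

text \<open>Here the bounded factor stands outside, so the domination is by the product k(y - z)
  f(z), which is integrable in the plane.\<close>

lemma conv_assoc_bdd_left:
  assumes k: "integrable lborel k" and f: "integrable lborel f" and G: "bdd_meas G"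
  shows "conv G (conv k f) x = conv (conv G k) f x"
proof -
  obtain C where [measurable]: "G \<in> borel_measurable borel" and C: "\<And>x. norm (G x) \<le> C"
    using G by (metis bdd_measE)
  have P: "integrable (lborel \<Otimes>\<^sub>M lborel) (\<lambda>(y, z). k (y - z) * f z * G (x - y))"
  proof -
    have "integrable (lborel \<Otimes>\<^sub>M lborel) (\<lambda>p. (case p of (y, z) \<Rightarrow> k (y - z) * f z) * G (x - fst p))"
      by (rule integrable_mult_bounded[OF integrable_prod_translate[OF k f]]) (use C in auto)
    then show ?thesis by (simp add: case_prod_beta')
  qed
  have "conv G (conv k f) x = (LINT y|lborel. (LINT z|lborel. k (y - z) * f z * G (x - y)))"
    unfolding conv_def by (simp add: mult.commute)
  also have "\<dots> = (LINT z|lborel. (LINT y|lborel. k (y - z) * f z * G (x - y)))"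
    by (rule lborel_pair.Fubini_integral[symmetric]) (rule P)
  also have "\<dots> = (LINT z|lborel. conv G k (x - z) * f z)"
  proof (intro Bochner_Integration.integral_cong refl)
    fix z
    have "(LINT y|lborel. k (y - z) * f z * G (x - y)) = (LINT y|lborel. G (x - y) * k (y - z)) * f z"
      by (simp add: mult_ac flip: integral_mult_left_zero)
    also have "(LINT y|lborel. G (x - y) * k (y - z)) = conv G k (x - z)"
      unfolding conv_def using integral_reflect_shift(4)[of "\<lambda>y. G (x - z - y) * k y" z] by (simp add: algebra_simps)
    finally show "(LINT y|lborel. k (y - z) * f z * G (x - y)) = conv G k (x - z) * f z" .
  qed
  finally show ?thesis by (simp add: conv_def)
qed

text \<open>The kernel of the product of the Hankel operators with kernels \<open>g\<close> and
  \<open>G\<close>.\<close>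

definition half_conv :: "(real \<Rightarrow> complex) \<Rightarrow> (real \<Rightarrow> complex) \<Rightarrow> real \<Rightarrow> real \<Rightarrow> complex" where
  "half_conv g G x z = (LINT w|lborel. g (x + w) * (indicator {0<..} w * G (w + z)))"

lemma half_conv_measurable:
  assumes [measurable]: "g \<in> borel_measurable borel" "G \<in> borel_measurable borel"
  shows "case_prod (half_conv g G) \<in> borel_measurable (borel \<Otimes>\<^sub>M borel)"
  unfolding half_conv_def[abs_def] by measurable

lemma half_conv_bound:
  assumes g: "integrable lborel g" and G: "\<And>x. norm (G x) \<le> C"
  shows "norm (half_conv g G x z) \<le> (LINT w|lborel. norm (g w)) * C"
proof -
  have C: "C \<ge> 0" using order_trans[OF norm_ge_zero G] .
  have "norm (half_conv g G x z) \<le> (LINT w|lborel. norm (g (x + w)) * C)"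
    unfolding half_conv_def
    by (rule norm_integral_le_integral) (use G C g integrable_reflect_shift(2)[OF g, of x] in \<open>auto simp: norm_mult indicator_def intro!: mult_left_mono\<close>)
  also have "\<dots> = (LINT w|lborel. norm (g w)) * C"
    using lborel_integral_real_affine[of 1 "\<lambda>y. norm (g y)" x] by simp
  finally show ?thesis .
qed

text \<open>On the half-line x + w is at least x, so the decay of \<open>g\<close> alone gives the
  factor exp(-dx), whatever the bounded \<open>G\<close> is. All exponentially small terms have this
  source.\<close>

lemma half_conv_decay:
  assumes g: "\<And>x. norm (g x) \<le> Cg * exp (- d * \<bar>x\<bar>)" and d: "d > 0" and G: "\<And>x. norm (G x) \<le> C" and x: "x \<ge> 0"
  shows "norm (half_conv g G x z) \<le> Cg * C * (LINT w|lborel. exp (- d * \<bar>w\<bar>)) * exp (- d * x)"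
proof -
  have C: "C \<ge> 0" using order_trans[OF norm_ge_zero G] .
  have Cg: "Cg \<ge> 0" using g[of 0] norm_ge_zero[of "g 0"] by (simp del: norm_ge_zero)
  have "norm (half_conv g G x z) \<le> (LINT w|lborel. Cg * C * exp (- d * x) * exp (- d * \<bar>w\<bar>))"
    unfolding half_conv_def
  proof (rule norm_integral_le_integral)
    show "integrable lborel (\<lambda>w. Cg * C * exp (- d * x) * exp (- d * \<bar>w\<bar>))"
      using integrable_exp_abs[OF d] by (intro integrable_mult_right)
    fix w
    show "norm (g (x + w) * (indicator {0<..} w * G (w + z))) \<le> Cg * C * exp (- d * x) * exp (- d * \<bar>w\<bar>)"
    proof (cases "w > 0")
      case True
      then have "norm (g (x + w)) \<le> Cg * (exp (- d * x) * exp (- d * \<bar>w\<bar>))"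
        using g[of "x + w"] x by (simp add: algebra_simps flip: exp_add)
      from mult_mono[OF this G[of "w + z"]] show ?thesis using True Cg by (simp add: norm_mult mult_ac)
    qed (use C Cg in simp)
  qed
  then show ?thesis by (simp add: mult_ac)
qed

lemma exp_fn_add: "exp_fn q (x + y) = exp_fn q x * exp_fn q y"
  by (simp add: exp_fn_def distrib_left exp_add)

lemma exp_fn_uminus: "exp_fn (- q) x * exp_fn q x = 1" "exp_fn q x * exp_fn (- q) x = 1"
  by (simp_all add: exp_fn_def flip: exp_add)

lemma exp_fn_measurable [measurable]: "exp_fn q \<in> borel_measurable borel"
  unfolding exp_fn_def[abs_def] by measurable

lemma bdd_meas_exp_fn: "bdd_meas (exp_fn (of_real p))" "bdd_meas (exp_fn (- of_real p))"
  by (rule bdd_measI[of _ 1]; simp add: exp_fn_def)+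

context symbol
begin

lemmas [measurable] = bdd_meas_measurable[OF g_bdd(1)] bdd_meas_measurable[OF g_bdd(2)] bdd_meas_measurable[OF G_bdd(1)]
  bdd_meas_measurable[OF G_bdd(2)] integrable_lborel_measurable[OF k_int]

text \<open>\<open>\<zeta>\<close> for the reflected symbol, written out so that the two can appear
  in one formula.\<close>

definition \<eta> :: "real \<Rightarrow> complex" where
  "\<eta> x = (\<i> / (2 * of_real p) * exp_fn (of_real p) x + (LINT y|lborel. g\<^sub>m (- (x + y)) * hexp p y)) / t\<^sub>m"

definition s\<^sub>m :: complex where "s\<^sub>m = (c\<^sub>m + \<i> / (2 * of_real p) + fourier (\<lambda>x. g\<^sub>m (- x)) p) / t\<^sub>m"

lemma eta_hankel: "hankel_pole_exp p t\<^sub>m (\<lambda>x. g\<^sub>m (- x)) = \<eta>"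
proof -
  interpret R: symbol p a "\<lambda>x. k (- x)" "\<lambda>z. \<tau>\<^sub>m (- z)" "\<lambda>z. \<tau>\<^sub>p (- z)" c\<^sub>m c\<^sub>p "\<lambda>x. g\<^sub>m (- x)" "\<lambda>x. g\<^sub>p (- x)"
    by (rule symbol_reflect)
  show ?thesis using R.zeta_hankel by (simp add: R.\<zeta>_def[abs_def] \<eta>_def[abs_def])
qed

lemma s_minus: "s\<^sub>m = \<i> / (2 * of_real p * \<tau>\<^sub>m (- of_real p))"
proof -
  interpret R: symbol p a "\<lambda>x. k (- x)" "\<lambda>z. \<tau>\<^sub>m (- z)" "\<lambda>z. \<tau>\<^sub>p (- z)" c\<^sub>m c\<^sub>p "\<lambda>x. g\<^sub>m (- x)" "\<lambda>x. g\<^sub>p (- x)"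
    by (rule symbol_reflect)
  show ?thesis using R.s_plus by (simp add: R.s\<^sub>p_def s\<^sub>m_def)
qed

lemma bdd_meas_eta: "bdd_meas \<eta>"
proof -
  interpret R: symbol p a "\<lambda>x. k (- x)" "\<lambda>z. \<tau>\<^sub>m (- z)" "\<lambda>z. \<tau>\<^sub>p (- z)" c\<^sub>m c\<^sub>p "\<lambda>x. g\<^sub>m (- x)" "\<lambda>x. g\<^sub>p (- x)"
    by (rule symbol_reflect)
  show ?thesis using R.bdd_meas_zeta by (simp add: R.\<zeta>_def[abs_def] \<eta>_def[abs_def])
qed

lemmas [measurable] = bdd_meas_measurable[OF bdd_meas_eta]

lemma eta_equation:
  "AE x in lborel. x > 0 \<longrightarrow> a * \<eta> x + (LINT y|lborel. k (y - x) * (indicator {0<..} y * \<eta> y))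
     = - s\<^sub>m * (LINT w|lborel. k (- x - w) * hexp p w)"
proof -
  interpret R: symbol p a "\<lambda>x. k (- x)" "\<lambda>z. \<tau>\<^sub>m (- z)" "\<lambda>z. \<tau>\<^sub>p (- z)" c\<^sub>m c\<^sub>p "\<lambda>x. g\<^sub>m (- x)" "\<lambda>x. g\<^sub>p (- x)"
    by (rule symbol_reflect)
  have "R.\<zeta> = \<eta>" by (simp add: R.\<zeta>_def[abs_def] \<eta>_def[abs_def])
  moreover have "R.s\<^sub>p = s\<^sub>m" by (simp add: R.s\<^sub>p_def s\<^sub>m_def)
  ultimately show ?thesis using R.zeta_equation by simp
qed

lemma partial_pairing_minus:
  assumes "z > 0"
  shows "(LINT w|lborel. indicator {0<..<z} w * exp_fn (of_real p) w * G\<^sub>m (- w))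
    = t\<^sub>m * s\<^sub>m - c\<^sub>m - exp_fn (of_real p) z * (t\<^sub>m * \<eta> z)"
proof -
  interpret R: symbol p a "\<lambda>x. k (- x)" "\<lambda>z. \<tau>\<^sub>m (- z)" "\<lambda>z. \<tau>\<^sub>p (- z)" c\<^sub>m c\<^sub>p "\<lambda>x. g\<^sub>m (- x)" "\<lambda>x. g\<^sub>p (- x)"
    by (rule symbol_reflect)
  have "R.\<zeta> = \<eta>" by (simp add: R.\<zeta>_def[abs_def] \<eta>_def[abs_def])
  moreover have "R.s\<^sub>p = s\<^sub>m" by (simp add: R.s\<^sub>p_def s\<^sub>m_def)
  moreover have "R.G\<^sub>p w = G\<^sub>m (- w)" for w by (simp add: R.G\<^sub>p_def G\<^sub>m_def)
  ultimately show ?thesis using R.partial_pairing[OF assms] by simp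
qed

lemma negative_support_minus:
  assumes f: "integrable lborel f" and neg: "\<And>x. x \<ge> 0 \<Longrightarrow> f x = 0"
  defines "Z \<equiv> \<lambda>x. (c\<^sub>m * f x + conv (\<lambda>y. G\<^sub>m (- y)) f x) / t\<^sub>m"
  shows "AE x in lborel. x > 0 \<longrightarrow> a * Z x + conv (\<lambda>x. k (- x)) Z x = 0"
proof -
  interpret R: symbol p a "\<lambda>x. k (- x)" "\<lambda>z. \<tau>\<^sub>m (- z)" "\<lambda>z. \<tau>\<^sub>p (- z)" c\<^sub>m c\<^sub>p "\<lambda>x. g\<^sub>m (- x)" "\<lambda>x. g\<^sub>p (- x)"
    by (rule symbol_reflect)
  have "R.G\<^sub>p = (\<lambda>w. G\<^sub>m (- w))" by (simp add: R.G\<^sub>p_def G\<^sub>m_def fun_eq_iff)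
  then show ?thesis using R.negative_support[OF f neg] unfolding Z_def by simp
qed

lemma G_minus_zero: "x > 0 \<Longrightarrow> G\<^sub>m x = 0" by (simp add: G\<^sub>m_def g_minus hexp_eq)
lemma G_plus_zero: "x < 0 \<Longrightarrow> G\<^sub>p x = 0" by (simp add: G\<^sub>p_def g_plus hexp_eq)

subsection \<open>The truncated operator\<close>

text \<open>The truncated operator without the outer projection: it agrees with it on (0,\<alpha>)
  only, which spares the indicator in the computations.\<close>

definition trunc :: "real \<Rightarrow> (real \<Rightarrow> complex) \<Rightarrow> real \<Rightarrow> complex" where
  "trunc \<alpha> h x = a * h x + (LINT y|lborel. k (x - y) * (indicator {0<..<\<alpha>} y * h y))"

text \<open>\<open>hankel_right \<alpha> T\<close> is \<open>Q\<^sub>\<alpha> H(\<sigma>\<^sup>~) T\<close> and \<open>hankel_left T\<close> is \<open>H(\<sigma>) T\<close>.\<close>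

definition hankel_right :: "real \<Rightarrow> (real \<Rightarrow> complex) \<Rightarrow> real \<Rightarrow> complex" where
  "hankel_right \<alpha> T x = (LINT s|lborel. k (x - \<alpha> - s) * (indicator {0<..} s * T s))"

definition hankel_left :: "(real \<Rightarrow> complex) \<Rightarrow> real \<Rightarrow> complex" where
  "hankel_left T x = (LINT s|lborel. k (x + s) * (indicator {0<..} s * T s))"

abbreviation e\<^sub>p :: "real \<Rightarrow> complex" where "e\<^sub>p \<equiv> exp_fn (of_real p)"
abbreviation e\<^sub>m :: "real \<Rightarrow> complex" where "e\<^sub>m \<equiv> exp_fn (- of_real p)"

lemma hexp_conv: "hexp p = (\<lambda>w. indicator {0<..} w * e\<^sub>p w)" by (simp add: hexp_def fun_eq_iff)

lemma hankel_left_int: "bdd_meas T \<Longrightarrow> integrable lborel (\<lambda>s. k (x + s) * (indicator {0<..} s * T s))"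
  by (intro integrable_mult_bdd integrable_reflect_shift k_int bdd_meas_indicator_mult) auto

lemma hankel_right_int: "bdd_meas T \<Longrightarrow> integrable lborel (\<lambda>s. k (x - \<alpha> - s) * (indicator {0<..} s * T s))"
  by (intro integrable_mult_bdd integrable_reflect_shift k_int bdd_meas_indicator_mult) auto

lemma hankel_left_add: "bdd_meas T \<Longrightarrow> bdd_meas U \<Longrightarrow> hankel_left (\<lambda>s. T s + U s) x = hankel_left T x + hankel_left U x"
  unfolding hankel_left_def distrib_left using hankel_left_int by simp

lemma hankel_right_add: "bdd_meas T \<Longrightarrow> bdd_meas U \<Longrightarrow> hankel_right \<alpha> (\<lambda>s. T s + U s) x = hankel_right \<alpha> T x + hankel_right \<alpha> U x"
  unfolding hankel_right_def distrib_left using hankel_right_int by simp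

lemma hankel_left_cmult: "hankel_left (\<lambda>s. c * T s) x = c * hankel_left T x"
  unfolding hankel_left_def by (simp add: mult.left_commute)

lemma hankel_right_cmult: "hankel_right \<alpha> (\<lambda>s. c * T s) x = c * hankel_right \<alpha> T x"
  unfolding hankel_right_def by (simp add: mult.left_commute)

lemma hankel_left_cong: "(\<And>s. s > 0 \<Longrightarrow> T s = U s) \<Longrightarrow> hankel_left T x = hankel_left U x"
  unfolding hankel_left_def by (intro Bochner_Integration.integral_cong refl) (auto simp: indicator_def)

lemma hankel_right_cong: "(\<And>s. s > 0 \<Longrightarrow> T s = U s) \<Longrightarrow> hankel_right \<alpha> T x = hankel_right \<alpha> U x"
  unfolding hankel_right_def by (intro Bochner_Integration.integral_cong refl) (auto simp: indicator_def)

text \<open>The substitution y = \<alpha> + s turns the discarded part of the integral into a Hankel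
  operator applied to the tail of \<open>h\<close>.\<close>

lemma truncate_right:
  assumes h: "integrable lborel (\<lambda>y. k (x - y) * (indicator {0<..} y * h y))" and [measurable]: "h \<in> borel_measurable borel" and \<alpha>: "\<alpha> > 0"
  shows "(LINT y|lborel. k (x - y) * (indicator {0<..<\<alpha>} y * h y))
    = (LINT y|lborel. k (x - y) * (indicator {0<..} y * h y)) - hankel_right \<alpha> (\<lambda>s. h (\<alpha> + s)) x"
proof -
  let ?I = "\<lambda>A y. k (x - y) * (indicator A y * h y)"
  have int: "integrable lborel (?I A)" if "A \<in> sets borel" "A \<subseteq> {0<..}" for A
    by (rule Bochner_Integration.integrable_bound[OF h]) (use that in \<open>auto simp: indicator_def\<close>)
  have "hankel_right \<alpha> (\<lambda>s. h (\<alpha> + s)) x = (LINT s|lborel. k (x - (\<alpha> + s)) * (indicator {\<alpha><..} (\<alpha> + s) * h (\<alpha> + s)))"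
    unfolding hankel_right_def by (intro Bochner_Integration.integral_cong refl) (auto simp: indicator_def algebra_simps)
  also have "\<dots> = integral\<^sup>L lborel (?I {\<alpha><..})"
    by (rule integral_reflect_shift(2)[where f="?I {\<alpha><..}"])
  finally have 1: "hankel_right \<alpha> (\<lambda>s. h (\<alpha> + s)) x = integral\<^sup>L lborel (?I {\<alpha><..})" .
  have "integral\<^sup>L lborel (?I {0<..<\<alpha>}) + integral\<^sup>L lborel (?I {\<alpha><..}) = (LINT y|lborel. ?I {0<..<\<alpha>} y + ?I {\<alpha><..} y)"
    using int[of "{0<..<\<alpha>}"] int[of "{\<alpha><..}"] \<alpha> by (subst Bochner_Integration.integral_add) (auto simp: subset_iff)
  also have "\<dots> = integral\<^sup>L lborel (?I {0<..})"
  proof (rule integral_cong_AE)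
    show "AE y in lborel. ?I {0<..<\<alpha>} y + ?I {\<alpha><..} y = ?I {0<..} y"
      using AE_lborel_singleton[of \<alpha>] by eventually_elim (use \<alpha> in \<open>auto simp: indicator_def\<close>)
  qed measurable
  finally show ?thesis unfolding 1 by (simp add: eq_diff_eq)
qed

text \<open>The half-line equation contributes the first term. Truncation removes the Hankel image
  of the tail of \<open>\<zeta>\<close> beyond \<alpha>, which consists of a nondecaying multiple of
  \<open>e\<^sub>p\<close>, giving the second term, and of a \<open>g\<^sub>p\<close> part that
  decays in \<alpha>.\<close>

lemma trunc_zeta:
  assumes \<alpha>: "\<alpha> > 0"
  shows "AE x in lborel. x \<in> {0<..<\<alpha>} \<longrightarrow> trunc \<alpha> \<zeta> x =
     - s\<^sub>p * hankel_left e\<^sub>p x - \<i> / (2 * of_real p) * e\<^sub>p \<alpha> / t\<^sub>p * hankel_right \<alpha> e\<^sub>p x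
     - hankel_right \<alpha> (\<lambda>s. half_conv g\<^sub>p e\<^sub>p (\<alpha> + s) 0) x / t\<^sub>p"
  using zeta_equation
proof eventually_elim
  case (elim x)
  show ?case
  proof
    assume x: "x \<in> {0<..<\<alpha>}"
    have bh: "bdd_meas (\<lambda>s. half_conv g\<^sub>p e\<^sub>p (\<alpha> + s) 0)"
    proof (rule bdd_measI)
      show "(\<lambda>s. half_conv g\<^sub>p e\<^sub>p (\<alpha> + s) 0) \<in> borel_measurable borel"
        unfolding half_conv_def by measurable
      show "norm (half_conv g\<^sub>p e\<^sub>p (\<alpha> + s) 0) \<le> (LINT w|lborel. norm (g\<^sub>p w)) * 1" for s
        by (rule half_conv_bound[OF g_int(1)]) (simp add: exp_fn_def)
    qed
    have zt: "\<zeta> (\<alpha> + s) = (\<i> / (2 * of_real p) * e\<^sub>p \<alpha> / t\<^sub>p) * e\<^sub>p s + (1 / t\<^sub>p) * half_conv g\<^sub>p e\<^sub>p (\<alpha> + s) 0" for s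
      unfolding \<zeta>_def half_conv_def exp_fn_add[of _ \<alpha> s] hexp_conv by (simp add: add_divide_distrib)
    have "hankel_right \<alpha> (\<lambda>s. \<zeta> (\<alpha> + s)) x = (\<i> / (2 * of_real p) * e\<^sub>p \<alpha> / t\<^sub>p) * hankel_right \<alpha> e\<^sub>p x
      + (1 / t\<^sub>p) * hankel_right \<alpha> (\<lambda>s. half_conv g\<^sub>p e\<^sub>p (\<alpha> + s) 0) x"
      unfolding zt hankel_right_add[OF bdd_meas_cmult[OF bdd_meas_exp_fn(1)] bdd_meas_cmult[OF bh]] hankel_right_cmult by (rule refl)
    moreover have "(LINT y|lborel. k (x - y) * (indicator {0<..<\<alpha>} y * \<zeta> y))
       = (LINT y|lborel. k (x - y) * (indicator {0<..} y * \<zeta> y)) - hankel_right \<alpha> (\<lambda>s. \<zeta> (\<alpha> + s)) x"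
    proof (rule truncate_right[OF _ _ \<alpha>])
      show "integrable lborel (\<lambda>y. k (x - y) * (indicator {0<..} y * \<zeta> y))"
        by (rule integrable_conv_bdd(2)[OF k_int bdd_meas_indicator_mult[OF _ bdd_meas_zeta]]) simp
    qed measurable
    moreover have "hankel_left e\<^sub>p x = (LINT w|lborel. k (x + w) * hexp p w)"
      by (simp add: hankel_left_def hexp_conv)
    ultimately show "trunc \<alpha> \<zeta> x =
     - s\<^sub>p * hankel_left e\<^sub>p x - \<i> / (2 * of_real p) * e\<^sub>p \<alpha> / t\<^sub>p * hankel_right \<alpha> e\<^sub>p x
     - hankel_right \<alpha> (\<lambda>s. half_conv g\<^sub>p e\<^sub>p (\<alpha> + s) 0) x / t\<^sub>p"
      using elim x unfolding trunc_def by (simp add: algebra_simps)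
  qed
qed

text \<open>This is \<open>trunc_zeta\<close> for the reflected symbol read at \<alpha> - x; the
  reflection of the interval exchanges \<open>hankel_left\<close> and
  \<open>hankel_right\<close>.\<close>

lemma trunc_eta:
  assumes \<alpha>: "\<alpha> > 0"
  shows "AE x in lborel. x \<in> {0<..<\<alpha>} \<longrightarrow> trunc \<alpha> (\<lambda>y. \<eta> (\<alpha> - y)) x =
     - s\<^sub>m * hankel_right \<alpha> e\<^sub>p x - \<i> / (2 * of_real p) * e\<^sub>p \<alpha> / t\<^sub>m * hankel_left e\<^sub>p x
     - hankel_left (\<lambda>s. half_conv (\<lambda>y. g\<^sub>m (- y)) e\<^sub>p (\<alpha> + s) 0) x / t\<^sub>m"
proof -
  interpret R: symbol p a "\<lambda>x. k (- x)" "\<lambda>z. \<tau>\<^sub>m (- z)" "\<lambda>z. \<tau>\<^sub>p (- z)" c\<^sub>m c\<^sub>p "\<lambda>x. g\<^sub>m (- x)" "\<lambda>x. g\<^sub>p (- x)"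
    by (rule symbol_reflect)
  have z: "R.\<zeta> = \<eta>" by (simp add: R.\<zeta>_def[abs_def] \<eta>_def[abs_def])
  have s: "R.s\<^sub>p = s\<^sub>m" by (simp add: R.s\<^sub>p_def s\<^sub>m_def)
  have "AE x in lborel. \<alpha> - x \<in> {0<..<\<alpha>} \<longrightarrow> R.trunc \<alpha> R.\<zeta> (\<alpha> - x) =
     - R.s\<^sub>p * R.hankel_left e\<^sub>p (\<alpha> - x) - \<i> / (2 * of_real p) * e\<^sub>p \<alpha> / \<tau>\<^sub>m (- (- of_real p)) * R.hankel_right \<alpha> e\<^sub>p (\<alpha> - x)
     - R.hankel_right \<alpha> (\<lambda>s. half_conv (\<lambda>x. g\<^sub>m (- x)) e\<^sub>p (\<alpha> + s) 0) (\<alpha> - x) / \<tau>\<^sub>m (- (- of_real p))"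
    by (rule AE_reflect_shift[OF R.trunc_zeta[OF \<alpha>]])
  then show ?thesis
  proof eventually_elim
    case (elim x)
    have hl: "R.hankel_left T (\<alpha> - x) = hankel_right \<alpha> T x" for T
      unfolding R.hankel_left_def hankel_right_def by (simp add: algebra_simps)
    have hr: "R.hankel_right \<alpha> T (\<alpha> - x) = hankel_left T x" for T
      unfolding R.hankel_right_def hankel_left_def by (simp add: algebra_simps)
    have "R.trunc \<alpha> \<eta> (\<alpha> - x) = trunc \<alpha> (\<lambda>y. \<eta> (\<alpha> - y)) x"
    proof -
      have "(LINT y|lborel. k (x - y) * (indicator {0<..<\<alpha>} y * \<eta> (\<alpha> - y)))
         = (LINT y|lborel. k (x - (\<alpha> - y)) * (indicator {0<..<\<alpha>} (\<alpha> - y) * \<eta> (\<alpha> - (\<alpha> - y))))"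
        by (rule integral_reflect_shift(1)[symmetric])
      also have "\<dots> = (LINT y|lborel. k (- (\<alpha> - x - y)) * (indicator {0<..<\<alpha>} y * \<eta> y))"
        by (intro Bochner_Integration.integral_cong refl) (auto simp: indicator_def algebra_simps)
      finally show ?thesis unfolding R.trunc_def trunc_def by simp
    qed
    then show ?case using elim unfolding z s hl hr by auto
  qed
qed

end

section \<open>Truncation error of the half-line solution\<close>

context symbol
begin

context
  fixes \<alpha> :: real and f :: "real \<Rightarrow> complex"
  assumes \<alpha>: "\<alpha> > 0" and f: "integrable lborel f" and supported: "\<forall>x. x \<notin> {0<..<\<alpha>} \<longrightarrow> f x = 0"
begin

private lemma supp: "x \<notin> {0<..<\<alpha>} \<Longrightarrow> f x = 0" using supported by blast

private lemma f_meas [measurable]: "f \<in> borel_measurable borel" by (rule integrable_lborel_measurable[OF f])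

text \<open>\<open>\<phi> = W(1/\<sigma>\<^sub>-) f\<close> and \<open>u = W(1/\<sigma>\<^sub>+) W(1/\<sigma>\<^sub>-) f\<close>.\<close>

definition \<phi> :: "real \<Rightarrow> complex" where "\<phi> x = indicator {0<..} x * \<psi> f x"

definition u :: "real \<Rightarrow> complex" where "u x = (c\<^sub>p * \<phi> x + conv G\<^sub>p \<phi> x) / t\<^sub>p"

lemma psi_right: "x \<ge> \<alpha> \<Longrightarrow> \<psi> f x = 0"
proof -
  assume x: "x \<ge> \<alpha>"
  have "conv G\<^sub>m f x = 0" unfolding conv_def
  proof (intro integral_eq_zero_AE AE_I2)
    fix y show "G\<^sub>m (x - y) * f y = 0"
      using x supp[of y] G_minus_zero[of "x - y"] by (cases "y \<in> {0<..<\<alpha>}") auto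
  qed
  then show "\<psi> f x = 0" using x supp[of x] by (simp add: \<psi>_def)
qed

lemma psi_left: "x \<le> 0 \<Longrightarrow> \<psi> f x = conv G\<^sub>m f x / t\<^sub>m"
  using supp[of x] by (simp add: \<psi>_def)

lemma phi_eq: "\<phi> x = indicator {0<..<\<alpha>} x * \<psi> f x"
  using psi_right[of x] by (auto simp: \<phi>_def indicator_def)

lemma phi_integrable: "integrable lborel \<phi>"
proof -
  have "integrable lborel (\<lambda>x. (c\<^sub>m * f x + indicator {0<..<\<alpha>} x * conv G\<^sub>m f x) / t\<^sub>m)"
    by (intro integrable_divide Bochner_Integration.integrable_add integrable_mult_right f integrable_mult_bdd integrable_indicator_interval bdd_meas_conv G_bdd)
  moreover have "(c\<^sub>m * f x + indicator {0<..<\<alpha>} x * conv G\<^sub>m f x) / t\<^sub>m = \<phi> x" for x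
    using supp[of x] by (auto simp: phi_eq \<psi>_def indicator_def)
  ultimately show ?thesis by simp
qed

lemma phi_measurable [measurable]: "\<phi> \<in> borel_measurable borel"
  by (rule integrable_lborel_measurable[OF phi_integrable])

lemma u_measurable [measurable]: "u \<in> borel_measurable borel" unfolding u_def[abs_def] by measurable

lemma u_left: "x \<le> 0 \<Longrightarrow> u x = 0"
proof -
  assume x: "x \<le> 0"
  have "conv G\<^sub>p \<phi> x = 0" unfolding conv_def
  proof (intro integral_eq_zero_AE AE_I2)
    fix y show "G\<^sub>p (x - y) * \<phi> y = 0"
      using x G_plus_zero[of "x - y"] by (cases "y > 0") (auto simp: \<phi>_def)
  qed
  then show ?thesis using x by (simp add: u_def \<phi>_def)
qed

text \<open>After Fubini the inner integral in y is substituted by w = z - y; since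
  \<open>G\<^sub>m\<close> lives on the negative half-line, only 0 < w < z remains and
  \<open>partial_pairing_minus\<close> evaluates it.\<close>

lemma pairing_phi: "(LINT y|lborel. e\<^sub>m y * \<phi> y) = s\<^sub>m * (LINT z|lborel. e\<^sub>m z * f z) - (LINT z|lborel. \<eta> z * f z)"
proof -
  let ?I = "indicator {0<..<\<alpha>} :: real \<Rightarrow> complex"
  have ie: "integrable lborel (\<lambda>y. ?I y * e\<^sub>m y)" by (rule integrable_mult_bdd[OF integrable_indicator_interval bdd_meas_exp_fn(2)])
  have 1: "integrable lborel (\<lambda>y. e\<^sub>m y * f y)" by (rule integrable_bdd_mult[OF f bdd_meas_exp_fn(2)])
  have 2: "integrable lborel (\<lambda>y. \<eta> y * f y)" by (rule integrable_bdd_mult[OF f bdd_meas_eta])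
  have 3: "integrable lborel (\<lambda>y. ?I y * e\<^sub>m y * conv G\<^sub>m f y)"
    by (rule integrable_mult_bdd[OF ie bdd_meas_conv(1)[OF G_bdd(2) f]])
  obtain C where C: "\<And>x. norm (G\<^sub>m x) \<le> C" using G_bdd(2) by (metis bdd_measE)
  have inner: "(LINT y|lborel. ?I y * e\<^sub>m y * G\<^sub>m (y - z)) = e\<^sub>m z * (t\<^sub>m * s\<^sub>m - c\<^sub>m - e\<^sub>p z * (t\<^sub>m * \<eta> z))" if z: "z \<in> {0<..<\<alpha>}" for z
  proof -
    have "(LINT y|lborel. ?I y * e\<^sub>m y * G\<^sub>m (y - z)) = (LINT w|lborel. ?I (z - w) * e\<^sub>m (z - w) * G\<^sub>m (z - w - z))"
      by (rule integral_reflect_shift(1)[symmetric])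
    also have "\<dots> = (LINT w|lborel. e\<^sub>m z * (indicator {0<..<z} w * e\<^sub>p w * G\<^sub>m (- w)))"
    proof (rule integral_cong_AE)
      show "AE w in lborel. ?I (z - w) * e\<^sub>m (z - w) * G\<^sub>m (z - w - z) = e\<^sub>m z * (indicator {0<..<z} w * e\<^sub>p w * G\<^sub>m (- w))"
        using AE_lborel_singleton[of 0]
      proof eventually_elim
        case (elim w)
        have e: "e\<^sub>m (z - w) = e\<^sub>m z * e\<^sub>p w" by (simp add: exp_fn_def algebra_simps flip: exp_add)
        show ?case
        proof (cases "w < 0")
          case True then show ?thesis using G_minus_zero[of "- w"] by simp
        next
          case False then show ?thesis using elim z unfolding e by (auto simp: indicator_def)
        qed
      qed
    qed measurable
    also have "\<dots> = e\<^sub>m z * (t\<^sub>m * s\<^sub>m - c\<^sub>m - e\<^sub>p z * (t\<^sub>m * \<eta> z))"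
      using partial_pairing_minus[of z] z by simp
    finally show ?thesis .
  qed
  have "(LINT y|lborel. ?I y * e\<^sub>m y * conv G\<^sub>m f y) = (LINT z|lborel. (LINT y|lborel. (?I y * e\<^sub>m y) * G\<^sub>m (y - z)) * f z)"
    unfolding conv_def by (rule Fubini_bounded_kernel(2)[OF ie f _ C]) measurable
  also have "\<dots> = (LINT z|lborel. (t\<^sub>m * s\<^sub>m - c\<^sub>m) * (e\<^sub>m z * f z) - t\<^sub>m * (\<eta> z * f z))"
  proof (intro Bochner_Integration.integral_cong refl)
    fix z
    show "(LINT y|lborel. (?I y * e\<^sub>m y) * G\<^sub>m (y - z)) * f z = (t\<^sub>m * s\<^sub>m - c\<^sub>m) * (e\<^sub>m z * f z) - t\<^sub>m * (\<eta> z * f z)"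
    proof (cases "z \<in> {0<..<\<alpha>}")
      case True
      have "e\<^sub>m z * (t\<^sub>m * s\<^sub>m - c\<^sub>m - e\<^sub>p z * (t\<^sub>m * \<eta> z)) = (t\<^sub>m * s\<^sub>m - c\<^sub>m) * e\<^sub>m z - (e\<^sub>m z * e\<^sub>p z) * (t\<^sub>m * \<eta> z)"
        by (simp add: algebra_simps)
      then show ?thesis unfolding inner[OF True] exp_fn_uminus by (simp add: algebra_simps)
    qed (simp add: supp)
  qed
  also have "\<dots> = (t\<^sub>m * s\<^sub>m - c\<^sub>m) * (LINT z|lborel. e\<^sub>m z * f z) - t\<^sub>m * (LINT z|lborel. \<eta> z * f z)"
    using 1 2 by simp
  finally have A: "(LINT y|lborel. ?I y * e\<^sub>m y * conv G\<^sub>m f y) = (t\<^sub>m * s\<^sub>m - c\<^sub>m) * (LINT z|lborel. e\<^sub>m z * f z) - t\<^sub>m * (LINT z|lborel. \<eta> z * f z)" .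
  have "(LINT y|lborel. e\<^sub>m y * \<phi> y) = (LINT y|lborel. (c\<^sub>m * (e\<^sub>m y * f y) + ?I y * e\<^sub>m y * conv G\<^sub>m f y) / t\<^sub>m)"
  proof (intro Bochner_Integration.integral_cong refl)
    fix y show "e\<^sub>m y * \<phi> y = (c\<^sub>m * (e\<^sub>m y * f y) + ?I y * e\<^sub>m y * conv G\<^sub>m f y) / t\<^sub>m"
      unfolding phi_eq \<psi>_def using supp[of y] by (auto simp: indicator_def algebra_simps)
  qed
  also have "\<dots> = (c\<^sub>m * (LINT y|lborel. e\<^sub>m y * f y) + (LINT y|lborel. ?I y * e\<^sub>m y * conv G\<^sub>m f y)) / t\<^sub>m"
    using 1 3 by simp
  also have "\<dots> = t\<^sub>m * (s\<^sub>m * (LINT z|lborel. e\<^sub>m z * f z) - (LINT z|lborel. \<eta> z * f z)) / t\<^sub>m"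
    unfolding A by (simp only: left_diff_distrib right_diff_distrib mult.assoc) (simp add: algebra_simps)
  finally show ?thesis using tau_nonzero(4) by simp
qed

text \<open>The contribution of \<open>\<psi> f\<close> on the negative half-line to its convolution
  with \<open>g\<^sub>p\<close> beyond \<alpha>. The kernel is a product of Hankel kernels taken at
  \<alpha> + s, hence small.\<close>

definition err_right :: "real \<Rightarrow> complex" where
  "err_right s = (LINT z|lborel. half_conv g\<^sub>p (\<lambda>y. G\<^sub>m (- y)) (\<alpha> + s) z * f z) / t\<^sub>m"

lemma conv_g_phi: "conv g\<^sub>p \<phi> (\<alpha> + s) = conv g\<^sub>p (\<psi> f) (\<alpha> + s) - err_right s"
proof -
  let ?I = "indicator {..0} :: real \<Rightarrow> complex"
  obtain C where C: "\<And>x. norm (G\<^sub>m x) \<le> C" using G_bdd(2) by (metis bdd_measE)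
  have i1: "integrable lborel (\<lambda>y. g\<^sub>p (\<alpha> + s - y) * \<phi> y)" by (rule integrable_conv_bdd(1)[OF phi_integrable g_bdd(1)])
  have gI: "integrable lborel (\<lambda>y. g\<^sub>p (\<alpha> + s - y) * ?I y)"
    by (rule integrable_mult_bdd[OF integrable_reflect_shift(1)[OF g_int(1)] bdd_meas_indicator]) simp
  have i2: "integrable lborel (\<lambda>y. g\<^sub>p (\<alpha> + s - y) * ?I y * conv G\<^sub>m f y)"
    by (rule integrable_mult_bdd[OF gI bdd_meas_conv(1)[OF G_bdd(2) f]])
  have "conv g\<^sub>p (\<psi> f) (\<alpha> + s) = (LINT y|lborel. g\<^sub>p (\<alpha> + s - y) * \<phi> y + g\<^sub>p (\<alpha> + s - y) * ?I y * conv G\<^sub>m f y / t\<^sub>m)"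
    unfolding conv_def[of g\<^sub>p] using psi_left
    by (intro Bochner_Integration.integral_cong refl) (auto simp: \<phi>_def indicator_def)
  also have "\<dots> = conv g\<^sub>p \<phi> (\<alpha> + s) + (LINT y|lborel. g\<^sub>p (\<alpha> + s - y) * ?I y * conv G\<^sub>m f y) / t\<^sub>m"
    using i1 i2 by (simp add: conv_def[of g\<^sub>p])
  also have "(LINT y|lborel. g\<^sub>p (\<alpha> + s - y) * ?I y * conv G\<^sub>m f y)
      = (LINT z|lborel. (LINT y|lborel. (g\<^sub>p (\<alpha> + s - y) * ?I y) * G\<^sub>m (y - z)) * f z)"
    unfolding conv_def by (rule Fubini_bounded_kernel(2)[OF gI f _ C]) measurable
  also have "\<dots> = (LINT z|lborel. half_conv g\<^sub>p (\<lambda>y. G\<^sub>m (- y)) (\<alpha> + s) z * f z)"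
  proof -
    have "(LINT y|lborel. (g\<^sub>p (\<alpha> + s - y) * ?I y) * G\<^sub>m (y - z)) = half_conv g\<^sub>p (\<lambda>y. G\<^sub>m (- y)) (\<alpha> + s) z" for z
    proof -
      have "(LINT y|lborel. (g\<^sub>p (\<alpha> + s - y) * ?I y) * G\<^sub>m (y - z)) = (LINT y|lborel. (g\<^sub>p (\<alpha> + s - - y) * ?I (- y)) * G\<^sub>m (- y - z))"
        by (rule integral_reflect_shift(5)[symmetric])
      also have "\<dots> = half_conv g\<^sub>p (\<lambda>y. G\<^sub>m (- y)) (\<alpha> + s) z" unfolding half_conv_def
      proof (rule integral_cong_AE)
        show "AE y in lborel. (g\<^sub>p (\<alpha> + s - - y) * ?I (- y)) * G\<^sub>m (- y - z) = g\<^sub>p (\<alpha> + s + y) * (indicator {0<..} y * G\<^sub>m (- (y + z)))"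
          using AE_lborel_singleton[of 0] by eventually_elim (auto simp: indicator_def)
      qed measurable
      finally show ?thesis .
    qed
    then show ?thesis by simp
  qed
  finally show ?thesis unfolding err_right_def by (simp add: algebra_simps)
qed

text \<open>Beyond \<alpha> the solution splits into a multiple of \<open>e\<^sub>p\<close>, with
  the coefficient from \<open>pairing_phi\<close>, the convolution of \<open>g\<^sub>p\<close> with
  the uncut \<open>\<psi> f\<close>, which \<open>V\<close> is going to cancel, and the small
  error.\<close>

lemma u_tail:
  assumes s: "s > 0"
  shows "u (\<alpha> + s) = (e\<^sub>p \<alpha> * (s\<^sub>m * (LINT z|lborel. e\<^sub>m z * f z) - (LINT z|lborel. \<eta> z * f z)) * e\<^sub>p s
     + conv g\<^sub>p (\<psi> f) (\<alpha> + s) - err_right s) / t\<^sub>p"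
proof -
  have "conv G\<^sub>p \<phi> (\<alpha> + s) = conv (hexp p) \<phi> (\<alpha> + s) + conv g\<^sub>p \<phi> (\<alpha> + s)"
    unfolding G\<^sub>p_def[abs_def]
    by (rule conv_add_left) (intro integrable_conv_bdd(1) phi_integrable bdd_meas_hexp g_bdd)+
  also have "conv (hexp p) \<phi> (\<alpha> + s) = (LINT y|lborel. e\<^sub>p \<alpha> * e\<^sub>p s * (e\<^sub>m y * \<phi> y))"
    unfolding conv_def
  proof (intro Bochner_Integration.integral_cong refl)
    fix y
    show "hexp p (\<alpha> + s - y) * \<phi> y = e\<^sub>p \<alpha> * e\<^sub>p s * (e\<^sub>m y * \<phi> y)"
    proof (cases "y \<in> {0<..<\<alpha>}")
      case True
      have "e\<^sub>p (\<alpha> + s - y) = e\<^sub>p \<alpha> * e\<^sub>p s * e\<^sub>m y"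
        by (simp add: exp_fn_def algebra_simps flip: exp_add)
      then show ?thesis using True s by (simp add: hexp_def)
    qed (simp add: phi_eq)
  qed
  also have "\<dots> = e\<^sub>p \<alpha> * e\<^sub>p s * (s\<^sub>m * (LINT z|lborel. e\<^sub>m z * f z) - (LINT z|lborel. \<eta> z * f z))"
    by (simp add: pairing_phi)
  finally have c: "conv G\<^sub>p \<phi> (\<alpha> + s) = e\<^sub>p \<alpha> * e\<^sub>p s * (s\<^sub>m * (LINT z|lborel. e\<^sub>m z * f z) - (LINT z|lborel. \<eta> z * f z))
    + conv g\<^sub>p \<phi> (\<alpha> + s)" .
  have "\<phi> (\<alpha> + s) = 0" using s by (simp add: phi_eq)
  then show ?thesis unfolding u_def c conv_g_phi by (simp add: algebra_simps)
qed

text \<open>\<open>V = H(1/\<sigma>\<^sub>-\<^sup>~) H(1/\<sigma>\<^sub>+) Q\<^sub>\<alpha> f\<close>; the contribution of \<open>e\<^sub>p\<close> in \<open>H(1/\<sigma>\<^sub>+)\<close> is split off as \<open>PF\<close>.\<close>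

definition Y\<^sub>0 :: "real \<Rightarrow> complex" where "Y\<^sub>0 r = conv g\<^sub>p f (\<alpha> + r)"
definition PF :: complex where "PF = e\<^sub>p \<alpha> * (LINT z|lborel. e\<^sub>m z * f z)"
definition V\<^sub>0 :: "real \<Rightarrow> complex" where
  "V\<^sub>0 s = (LINT r|lborel. G\<^sub>m (- (s + r)) * (indicator {0<..} r * Y\<^sub>0 r)) / t\<^sub>m"
definition V :: "real \<Rightarrow> complex" where "V s = (PF * \<eta> s + V\<^sub>0 s) / t\<^sub>p"

lemma Y0_integrable: "integrable lborel Y\<^sub>0"
  unfolding Y\<^sub>0_def[abs_def] by (rule integrable_reflect_shift(2)[OF integrable_conv(1)[OF g_int(1) f]])

lemma Y0_bdd: "bdd_meas Y\<^sub>0"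
  unfolding Y\<^sub>0_def[abs_def] by (rule bdd_meas_shift(2)[OF bdd_meas_conv(1)[OF g_bdd(1) f]])

lemmas Y0_meas [measurable] = bdd_meas_measurable[OF Y0_bdd]

lemma V0_bdd: "bdd_meas V\<^sub>0"
proof -
  have "bdd_meas (conv (\<lambda>y. G\<^sub>m (- y)) (\<lambda>r. indicator {..<0} r * Y\<^sub>0 (- r)))"
    by (rule bdd_meas_conv(1)[OF bdd_meas_shift(5)[OF G_bdd(2)]])
      (rule integrable_bdd_mult[OF integrable_reflect_shift(5)[OF Y0_integrable] bdd_meas_indicator], simp)
  moreover have "conv (\<lambda>y. G\<^sub>m (- y)) (\<lambda>r. indicator {..<0} r * Y\<^sub>0 (- r)) s = t\<^sub>m * V\<^sub>0 s" for s
  proof -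
    have "t\<^sub>m * V\<^sub>0 s = (LINT r|lborel. G\<^sub>m (- (s - r)) * (indicator {0<..} (- r) * Y\<^sub>0 (- r)))"
      unfolding V\<^sub>0_def using tau_nonzero(4) integral_reflect_shift(5)[of "\<lambda>r. G\<^sub>m (- (s + r)) * (indicator {0<..} r * Y\<^sub>0 r)"] by simp
    also have "\<dots> = conv (\<lambda>y. G\<^sub>m (- y)) (\<lambda>r. indicator {..<0} r * Y\<^sub>0 (- r)) s"
      unfolding conv_def by (intro Bochner_Integration.integral_cong refl) (auto simp: indicator_def)
    finally show ?thesis by simp
  qed
  then have "conv (\<lambda>y. G\<^sub>m (- y)) (\<lambda>r. indicator {..<0} r * Y\<^sub>0 (- r)) = (\<lambda>s. t\<^sub>m * V\<^sub>0 s)" by (rule ext)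
  ultimately have "bdd_meas (\<lambda>s. t\<^sub>m * V\<^sub>0 s)" by (simp only:)
  from bdd_meas_cmult[OF this, of "1 / t\<^sub>m"] show ?thesis using tau_nonzero(4) by simp
qed

lemma V_bdd: "bdd_meas V"
  using bdd_meas_cmult[OF bdd_meas_add[OF bdd_meas_cmult[OF bdd_meas_eta, of PF] V0_bdd], of "1 / t\<^sub>p"]
  by (simp add: V_def[abs_def])

lemmas V_meas [measurable] = bdd_meas_measurable[OF V_bdd] bdd_meas_measurable[OF V0_bdd]

text \<open>Convolutions with \<open>g\<^sub>p\<close> and \<open>G\<^sub>m\<close> commute, and
  \<open>G\<^sub>m\<close> only looks to the right; so beyond \<alpha> the result depends on
  \<open>f\<close> only through the values of \<open>Y\<^sub>0\<close> on the positive
  half-line.\<close>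

lemma conv_g_psi:
  assumes s: "s > 0"
  shows "conv g\<^sub>p (\<psi> f) (\<alpha> + s) = (c\<^sub>m * Y\<^sub>0 s + (LINT r|lborel. G\<^sub>m (s - r) * (indicator {0<..} r * Y\<^sub>0 r))) / t\<^sub>m"
proof -
  have i1: "integrable lborel (\<lambda>y. g\<^sub>p (\<alpha> + s - y) * (c\<^sub>m * f y))"
    by (rule integrable_conv_bdd(1)[OF integrable_mult_right[OF f] g_bdd(1)])
  have i2: "integrable lborel (\<lambda>y. g\<^sub>p (\<alpha> + s - y) * conv G\<^sub>m f y)"
    by (rule integrable_conv_bdd(2)[OF g_int(1) bdd_meas_conv(1)[OF G_bdd(2) f]])
  have "conv g\<^sub>p (\<psi> f) (\<alpha> + s) = (conv g\<^sub>p (\<lambda>y. c\<^sub>m * f y) (\<alpha> + s) + conv g\<^sub>p (conv G\<^sub>m f) (\<alpha> + s)) / t\<^sub>m"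
    unfolding \<psi>_def[abs_def] conv_divide_right using conv_add_right[OF i1 i2] by simp
  also have "conv g\<^sub>p (\<lambda>y. c\<^sub>m * f y) (\<alpha> + s) = c\<^sub>m * Y\<^sub>0 s" by (simp add: conv_cmult_right Y\<^sub>0_def)
  also have "conv g\<^sub>p (conv G\<^sub>m f) (\<alpha> + s) = conv G\<^sub>m (conv g\<^sub>p f) (\<alpha> + s)"
  proof -
    have "conv g\<^sub>p G\<^sub>m = conv G\<^sub>m g\<^sub>p" by (rule ext) (rule conv_commute)
    then show ?thesis using conv_assoc[OF g_int(1) f G_bdd(2)] conv_assoc_bdd_left[OF g_int(1) f G_bdd(2)] by simp
  qed
  also have "conv G\<^sub>m (conv g\<^sub>p f) (\<alpha> + s) = (LINT r|lborel. G\<^sub>m (s - r) * (indicator {0<..} r * Y\<^sub>0 r))"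
  proof -
    have "conv G\<^sub>m (conv g\<^sub>p f) (\<alpha> + s) = (LINT r|lborel. G\<^sub>m (\<alpha> + s - (\<alpha> + r)) * conv g\<^sub>p f (\<alpha> + r))"
      unfolding conv_def[of G\<^sub>m] by (rule integral_reflect_shift(2)[symmetric])
    also have "\<dots> = (LINT r|lborel. G\<^sub>m (s - r) * (indicator {0<..} r * Y\<^sub>0 r))"
    proof (intro Bochner_Integration.integral_cong refl)
      fix r show "G\<^sub>m (\<alpha> + s - (\<alpha> + r)) * conv g\<^sub>p f (\<alpha> + r) = G\<^sub>m (s - r) * (indicator {0<..} r * Y\<^sub>0 r)"
        using s G_minus_zero[of "s - r"] by (cases "r > 0") (auto simp: Y\<^sub>0_def)
    qed
    finally show ?thesis .
  qed
  finally show ?thesis .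
qed

lemma conv_g_psi_bdd: "bdd_meas (\<lambda>s. conv g\<^sub>p (\<psi> f) (\<alpha> + s))"
proof -
  have i1: "integrable lborel (\<lambda>y. g\<^sub>p (x - y) * (c\<^sub>m * f y))" for x
    by (rule integrable_conv_bdd(1)[OF integrable_mult_right[OF f] g_bdd(1)])
  have i2: "integrable lborel (\<lambda>y. g\<^sub>p (x - y) * conv G\<^sub>m f y)" for x
    by (rule integrable_conv_bdd(2)[OF g_int(1) bdd_meas_conv(1)[OF G_bdd(2) f]])
  have e: "conv g\<^sub>p (\<psi> f) x = (1 / t\<^sub>m) * (c\<^sub>m * conv g\<^sub>p f x + conv g\<^sub>p (conv G\<^sub>m f) x)" for x
    unfolding \<psi>_def[abs_def] conv_divide_right using conv_add_right[OF i1 i2] by (simp add: conv_cmult_right)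
  have "bdd_meas (conv g\<^sub>p (\<psi> f))"
    unfolding e[abs_def] by (intro bdd_meas_cmult bdd_meas_add bdd_meas_conv(1)[OF g_bdd(1) f]
      bdd_meas_conv(2)[OF bdd_meas_conv(1)[OF G_bdd(2) f] g_int(1)])
  from bdd_meas_shift(2)[OF this] show ?thesis .
qed

text \<open>The reflected \<open>negative_support\<close> with source \<open>Y\<^sub>0\<close>
  placed on the negative half-line. The solution is \<open>V\<^sub>0\<close> on the positive side,
  while on the negative side it is by \<open>conv_g_psi\<close> exactly the middle part of
  \<open>u_tail\<close>; this is why subtracting \<open>V\<close> cancels that part.\<close>

lemma V0_equation:
  "AE s in lborel. s > 0 \<longrightarrow> a * V\<^sub>0 s + (LINT y|lborel. k (y - s) * (indicator {0<..} y * V\<^sub>0 y))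
     = - (LINT r|lborel. k (- s - r) * (indicator {0<..} r * conv g\<^sub>p (\<psi> f) (\<alpha> + r)))"
proof -
  define y0 where "y0 x = indicator {..<0} x * Y\<^sub>0 (- x)" for x
  define Z where "Z x = (c\<^sub>m * y0 x + conv (\<lambda>y. G\<^sub>m (- y)) y0 x) / t\<^sub>m" for x
  have y0: "integrable lborel y0" unfolding y0_def[abs_def]
    by (rule integrable_bdd_mult[OF integrable_reflect_shift(5)[OF Y0_integrable] bdd_meas_indicator]) simp
  have y0b: "bdd_meas y0" unfolding y0_def[abs_def]
    by (intro bdd_meas_indicator_mult bdd_meas_shift(5)[OF Y0_bdd]) simp
  have Zb: "bdd_meas Z"
    using bdd_meas_cmult[OF bdd_meas_add[OF bdd_meas_cmult[OF y0b] bdd_meas_conv(1)[OF bdd_meas_shift(5)[OF G_bdd(2)] y0]], of "1 / t\<^sub>m" c\<^sub>m]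
    by (simp add: Z_def[abs_def])
  note [measurable] = bdd_meas_measurable[OF Zb]
  have cy: "conv (\<lambda>y. G\<^sub>m (- y)) y0 x = (LINT r|lborel. G\<^sub>m (- (x + r)) * (indicator {0<..} r * Y\<^sub>0 r))" for x
  proof -
    have "conv (\<lambda>y. G\<^sub>m (- y)) y0 x = (LINT r|lborel. G\<^sub>m (- (x - - r)) * y0 (- r))"
      unfolding conv_def by (rule integral_reflect_shift(5)[symmetric])
    also have "\<dots> = (LINT r|lborel. G\<^sub>m (- (x + r)) * (indicator {0<..} r * Y\<^sub>0 r))"
      by (intro Bochner_Integration.integral_cong refl) (auto simp: y0_def indicator_def)
    finally show ?thesis .
  qed
  have Zpos: "Z x = V\<^sub>0 x" if "x > 0" for x using that unfolding Z_def cy V\<^sub>0_def by (simp add: y0_def)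
  have Zneg: "Z (- x) = conv g\<^sub>p (\<psi> f) (\<alpha> + x)" if "x > 0" for x
    using that unfolding Z_def cy conv_g_psi[OF that] by (simp add: y0_def)
  have "AE s in lborel. s > 0 \<longrightarrow> a * Z s + conv (\<lambda>x. k (- x)) Z s = 0"
    unfolding Z_def by (rule negative_support_minus[OF y0]) (simp add: y0_def)
  then show ?thesis
  proof eventually_elim
    case (elim s)
    have i: "integrable lborel (\<lambda>y. k (y - s) * (indicator A y * Z y))" if "A \<in> sets borel" for A
      by (rule integrable_mult_bdd[OF integrable_reflect_shift(4)[OF k_int] bdd_meas_indicator_mult[OF that Zb]])
    have "conv (\<lambda>x. k (- x)) Z s = (LINT y|lborel. k (y - s) * (indicator {0<..} y * Z y) + k (y - s) * (indicator {..<0} y * Z y))"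
      unfolding conv_def
    proof (rule integral_cong_AE)
      show "AE y in lborel. k (- (s - y)) * Z y = k (y - s) * (indicator {0<..} y * Z y) + k (y - s) * (indicator {..<0} y * Z y)"
        using AE_lborel_singleton[of 0] by eventually_elim (auto simp: indicator_def)
    qed measurable
    also have "\<dots> = (LINT y|lborel. k (y - s) * (indicator {0<..} y * Z y)) + (LINT y|lborel. k (y - s) * (indicator {..<0} y * Z y))"
      using i[of "{0<..}"] i[of "{..<0}"] by simp
    also have "(LINT y|lborel. k (y - s) * (indicator {0<..} y * Z y)) = (LINT y|lborel. k (y - s) * (indicator {0<..} y * V\<^sub>0 y))"
      using Zpos by (intro Bochner_Integration.integral_cong refl) (auto simp: indicator_def)
    also have "(LINT y|lborel. k (y - s) * (indicator {..<0} y * Z y)) = (LINT y|lborel. k (- y - s) * (indicator {..<0} (- y) * Z (- y)))"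
      by (rule integral_reflect_shift(5)[symmetric])
    also have "\<dots> = (LINT r|lborel. k (- s - r) * (indicator {0<..} r * conv g\<^sub>p (\<psi> f) (\<alpha> + r)))"
      using Zneg by (intro Bochner_Integration.integral_cong refl) (auto simp: indicator_def minus_diff_commute)
    finally have c: "conv (\<lambda>x. k (- x)) Z s = (LINT y|lborel. k (y - s) * (indicator {0<..} y * V\<^sub>0 y))
       + (LINT r|lborel. k (- s - r) * (indicator {0<..} r * conv g\<^sub>p (\<psi> f) (\<alpha> + r)))" .
    show ?case using elim unfolding c using Zpos[of s] by (auto simp: eq_neg_iff_add_eq_0 add.assoc)
  qed
qed

lemma V_equation:
  "AE s in lborel. s > 0 \<longrightarrow> a * V s + (LINT y|lborel. k (y - s) * (indicator {0<..} y * V y))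
     = - (PF * s\<^sub>m * (LINT w|lborel. k (- s - w) * hexp p w)
       + (LINT r|lborel. k (- s - r) * (indicator {0<..} r * conv g\<^sub>p (\<psi> f) (\<alpha> + r)))) / t\<^sub>p"
  using V0_equation eta_equation
proof eventually_elim
  case (elim s)
  have i: "integrable lborel (\<lambda>y. k (y - s) * (indicator {0<..} y * T y))" if "bdd_meas T" for T
    by (rule integrable_mult_bdd[OF integrable_reflect_shift(4)[OF k_int] bdd_meas_indicator_mult[OF _ that]]) simp
  have "(LINT y|lborel. k (y - s) * (indicator {0<..} y * V y))
     = (LINT y|lborel. (PF * (k (y - s) * (indicator {0<..} y * \<eta> y)) + k (y - s) * (indicator {0<..} y * V\<^sub>0 y)) / t\<^sub>p)"
    by (intro Bochner_Integration.integral_cong refl) (simp add: V_def algebra_simps)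
  also have "\<dots> = (PF * (LINT y|lborel. k (y - s) * (indicator {0<..} y * \<eta> y)) + (LINT y|lborel. k (y - s) * (indicator {0<..} y * V\<^sub>0 y))) / t\<^sub>p"
    using i[OF bdd_meas_eta] i[OF V0_bdd] by simp
  finally have v: "(LINT y|lborel. k (y - s) * (indicator {0<..} y * V y)) = 
     (PF * (LINT y|lborel. k (y - s) * (indicator {0<..} y * \<eta> y)) + (LINT y|lborel. k (y - s) * (indicator {0<..} y * V\<^sub>0 y))) / t\<^sub>p" .
  show ?case
  proof
    assume s: "s > 0"
    let ?A = "LINT y|lborel. k (y - s) * (indicator {0<..} y * \<eta> y)"
    let ?B = "LINT y|lborel. k (y - s) * (indicator {0<..} y * V\<^sub>0 y)"
    have "a * V s + (PF * ?A + ?B) / t\<^sub>p = (PF * (a * \<eta> s + ?A) + (a * V\<^sub>0 s + ?B)) / t\<^sub>p"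
      unfolding V_def by (simp add: distrib_left add_divide_distrib mult_ac)
    also have "\<dots> = (PF * (- s\<^sub>m * (LINT w|lborel. k (- s - w) * hexp p w))
       + - (LINT r|lborel. k (- s - r) * (indicator {0<..} r * conv g\<^sub>p (\<psi> f) (\<alpha> + r)))) / t\<^sub>p"
      using elim s by simp
    finally show "a * V s + (LINT y|lborel. k (y - s) * (indicator {0<..} y * V y))
     = - (PF * s\<^sub>m * (LINT w|lborel. k (- s - w) * hexp p w)
       + (LINT r|lborel. k (- s - r) * (indicator {0<..} r * conv g\<^sub>p (\<psi> f) (\<alpha> + r)))) / t\<^sub>p"
      unfolding v by simp
  qed
qed

definition lam :: complex where "lam = (LINT z|lborel. \<zeta> (\<alpha> - z) * f z)"

text \<open>The part of \<open>V\<close> beyond \<alpha> that passes through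
  \<open>g\<^sub>m\<close>; the counterpart of \<open>err_right\<close>.\<close>

definition err_left :: "real \<Rightarrow> complex" where
  "err_left s = (LINT z|lborel. half_conv (\<lambda>y. g\<^sub>m (- y)) G\<^sub>p (\<alpha> + s) (\<alpha> - z) * f z) / t\<^sub>p"

lemma PF_eq: "PF = (LINT z|lborel. e\<^sub>p (\<alpha> - z) * f z)"
proof -
  have "e\<^sub>p (\<alpha> - z) = e\<^sub>p \<alpha> * e\<^sub>m z" for z by (simp add: exp_fn_def algebra_simps flip: exp_add)
  then show ?thesis by (simp add: PF_def mult.assoc)
qed

text \<open>Symmetry of Hankel operators: pairing \<open>\<zeta>\<close>, the Hankel image of
  \<open>e\<^sub>p\<close>, with the reflected \<open>f\<close> is the same as pairing
  \<open>e\<^sub>p\<close> with the Hankel image of the reflected \<open>f\<close>. The divergent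
  pairing of \<open>e\<^sub>p\<close> with itself enters through its value i/(2p).\<close>

lemma lam_eq: "lam = (\<i> / (2 * of_real p) * PF + (LINT r|lborel. hexp p r * Y\<^sub>0 r)) / t\<^sub>p"
proof -
  let ?h = "\<lambda>x. hexp p (- x)"
  have hb: "bdd_meas ?h" by (rule bdd_meas_shift(5)[OF bdd_meas_hexp])
  have "(LINT r|lborel. hexp p r * Y\<^sub>0 r) = (LINT r|lborel. hexp p (- (\<alpha> - (\<alpha> + r))) * conv g\<^sub>p f (\<alpha> + r))"
    by (simp add: Y\<^sub>0_def)
  also have "\<dots> = conv ?h (conv g\<^sub>p f) \<alpha>"
    unfolding conv_def[of ?h] by (rule integral_reflect_shift(2)[where f="\<lambda>y. hexp p (- (\<alpha> - y)) * conv g\<^sub>p f y"])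
  also have "\<dots> = conv (conv ?h g\<^sub>p) f \<alpha>" by (rule conv_assoc_bdd_left[OF g_int(1) f hb])
  also have "\<dots> = (LINT z|lborel. (LINT y|lborel. g\<^sub>p (\<alpha> - z + y) * hexp p y) * f z)"
  proof -
    have "conv ?h g\<^sub>p x = (LINT y|lborel. g\<^sub>p (x + y) * hexp p y)" for x
    proof -
      have "conv ?h g\<^sub>p x = conv g\<^sub>p ?h x" by (rule conv_commute)
      also have "\<dots> = (LINT y|lborel. g\<^sub>p (x - - y) * hexp p (- (- y)))"
        unfolding conv_def by (rule integral_reflect_shift(5)[symmetric])
      finally show ?thesis by simp
    qed
    then show ?thesis unfolding conv_def[of _ f] by simp
  qed
  finally have h: "(LINT r|lborel. hexp p r * Y\<^sub>0 r) = (LINT z|lborel. (LINT y|lborel. g\<^sub>p (\<alpha> - z + y) * hexp p y) * f z)" .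
  have i1: "integrable lborel (\<lambda>z. e\<^sub>p (\<alpha> - z) * f z)"
    by (rule integrable_bdd_mult[OF f bdd_meas_shift(1)[OF bdd_meas_exp_fn(1)]])
  have i2: "integrable lborel (\<lambda>z. \<zeta> (\<alpha> - z) * f z)"
    by (rule integrable_bdd_mult[OF f bdd_meas_shift(1)[OF bdd_meas_zeta]])
  have z: "(LINT y|lborel. g\<^sub>p (\<alpha> - z + y) * hexp p y) = t\<^sub>p * \<zeta> (\<alpha> - z) - \<i> / (2 * of_real p) * e\<^sub>p (\<alpha> - z)" for z
    using tau_nonzero(3) by (simp add: \<zeta>_def)
  have "(LINT r|lborel. hexp p r * Y\<^sub>0 r) = (LINT z|lborel. t\<^sub>p * (\<zeta> (\<alpha> - z) * f z) - \<i> / (2 * of_real p) * (e\<^sub>p (\<alpha> - z) * f z))"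
    unfolding h z by (intro Bochner_Integration.integral_cong refl) (simp add: left_diff_distrib mult.assoc)
  also have "\<dots> = t\<^sub>p * lam - \<i> / (2 * of_real p) * PF"
    unfolding lam_def PF_eq using i1 i2 by (subst Bochner_Integration.integral_diff) auto
  finally show ?thesis using tau_nonzero(3) by simp
qed

text \<open>The outer Hankel operator consists of the tensor square of \<open>e\<^sub>p\<close>,
  which by \<open>lam_eq\<close> produces the coefficient \<open>lam\<close>, and of the decaying
  kernel \<open>g\<^sub>m\<close>.\<close>

lemma V_eq:
  assumes s: "s > 0"
  shows "V s = (e\<^sub>p s * lam + (LINT r|lborel. g\<^sub>m (- (s + r)) * (indicator {0<..} r * ((PF * e\<^sub>p r + Y\<^sub>0 r) / t\<^sub>p)))) / t\<^sub>m"
proof -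
  have gi: "integrable lborel (\<lambda>r. g\<^sub>m (- (s + r)))"
    using integrable_reflect_shift(1)[OF g_int(2), of "- s"] by (simp only: minus_add_distrib diff_conv_add_uminus)
  have i1: "integrable lborel (\<lambda>r. g\<^sub>m (- (s + r)) * hexp p r)" by (rule integrable_mult_bdd[OF gi bdd_meas_hexp])
  have i2: "integrable lborel (\<lambda>r. g\<^sub>m (- (s + r)) * (indicator {0<..} r * Y\<^sub>0 r))"
    by (rule integrable_mult_bdd[OF gi bdd_meas_indicator_mult[OF _ Y0_bdd]]) simp
  have i3: "integrable lborel (\<lambda>r. hexp p r * Y\<^sub>0 r)" by (rule integrable_bdd_mult[OF Y0_integrable bdd_meas_hexp])
  have 1: "t\<^sub>m * V\<^sub>0 s = e\<^sub>p s * (LINT r|lborel. hexp p r * Y\<^sub>0 r) + (LINT r|lborel. g\<^sub>m (- (s + r)) * (indicator {0<..} r * Y\<^sub>0 r))"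
  proof -
    have "t\<^sub>m * V\<^sub>0 s = (LINT r|lborel. e\<^sub>p s * (hexp p r * Y\<^sub>0 r) + g\<^sub>m (- (s + r)) * (indicator {0<..} r * Y\<^sub>0 r))"
    proof -
      have "t\<^sub>m * V\<^sub>0 s = (LINT r|lborel. G\<^sub>m (- (s + r)) * (indicator {0<..} r * Y\<^sub>0 r))"
        using tau_nonzero(4) by (simp add: V\<^sub>0_def)
      also have "\<dots> = (LINT r|lborel. e\<^sub>p s * (hexp p r * Y\<^sub>0 r) + g\<^sub>m (- (s + r)) * (indicator {0<..} r * Y\<^sub>0 r))"
        by (intro Bochner_Integration.integral_cong refl)
          (use s in \<open>auto simp: G\<^sub>m_def hexp_def exp_fn_add indicator_def algebra_simps\<close>)
      finally show ?thesis .
    qed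
    then show ?thesis using i2 i3 by simp
  qed
  have 2: "t\<^sub>m * \<eta> s = \<i> / (2 * of_real p) * e\<^sub>p s + (LINT r|lborel. g\<^sub>m (- (s + r)) * hexp p r)"
    using tau_nonzero(4) by (simp add: \<eta>_def)
  have 3: "(LINT r|lborel. g\<^sub>m (- (s + r)) * (indicator {0<..} r * ((PF * e\<^sub>p r + Y\<^sub>0 r) / t\<^sub>p)))
    = (PF * (LINT r|lborel. g\<^sub>m (- (s + r)) * hexp p r) + (LINT r|lborel. g\<^sub>m (- (s + r)) * (indicator {0<..} r * Y\<^sub>0 r))) / t\<^sub>p"
  proof -
    have "(LINT r|lborel. g\<^sub>m (- (s + r)) * (indicator {0<..} r * ((PF * e\<^sub>p r + Y\<^sub>0 r) / t\<^sub>p)))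
      = (LINT r|lborel. (PF * (g\<^sub>m (- (s + r)) * hexp p r) + g\<^sub>m (- (s + r)) * (indicator {0<..} r * Y\<^sub>0 r)) / t\<^sub>p)"
      by (intro Bochner_Integration.integral_cong refl) (simp add: hexp_def algebra_simps)
    then show ?thesis using i1 i2 by simp
  qed
  let ?g = "LINT r|lborel. g\<^sub>m (- (s + r)) * hexp p r"
  let ?y = "LINT r|lborel. g\<^sub>m (- (s + r)) * (indicator {0<..} r * Y\<^sub>0 r)"
  let ?h = "LINT r|lborel. hexp p r * Y\<^sub>0 r"
  have "t\<^sub>m * V s = (PF * (t\<^sub>m * \<eta> s) + t\<^sub>m * V\<^sub>0 s) / t\<^sub>p" by (simp add: V_def algebra_simps)
  also have "\<dots> = (PF * (\<i> / (2 * of_real p) * e\<^sub>p s + ?g) + (e\<^sub>p s * ?h + ?y)) / t\<^sub>p" unfolding 1 2 ..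
  also have "\<dots> = e\<^sub>p s * lam + (PF * ?g + ?y) / t\<^sub>p" unfolding lam_eq by (simp add: add_divide_distrib distrib_left mult_ac)
  finally show ?thesis unfolding 3 using tau_nonzero(4) by (simp add: field_simps)
qed

text \<open>For r > 0 the bracket is the Hankel integral of \<open>G\<^sub>p\<close> against the
  reflected \<open>f\<close>, because r + \<alpha> - z is positive on the support of
  \<open>f\<close>; Fubini then composes the two kernels.\<close>

lemma V_kernel:
  "(LINT r|lborel. g\<^sub>m (- (s + r)) * (indicator {0<..} r * ((PF * e\<^sub>p r + Y\<^sub>0 r) / t\<^sub>p)))
    = (LINT z|lborel. half_conv (\<lambda>y. g\<^sub>m (- y)) G\<^sub>p s (\<alpha> - z) * f z) / t\<^sub>p"
proof -
  obtain C where C: "\<And>x. norm (G\<^sub>p x) \<le> C" using G_bdd(1) by (metis bdd_measE)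
  have gi: "integrable lborel (\<lambda>r. g\<^sub>m (- (s + r)))"
    using integrable_reflect_shift(1)[OF g_int(2), of "- s"] by (simp only: minus_add_distrib diff_conv_add_uminus)
  have gI: "integrable lborel (\<lambda>r. g\<^sub>m (- (s + r)) * indicator {0<..} r)"
    by (rule integrable_mult_bdd[OF gi bdd_meas_indicator]) simp
  have Y: "PF * e\<^sub>p r + Y\<^sub>0 r = (LINT z|lborel. G\<^sub>p (r + (\<alpha> - z)) * f z)" if r: "r > 0" for r
  proof -
    have i1: "integrable lborel (\<lambda>z. e\<^sub>p (\<alpha> - z) * f z)"
      by (rule integrable_bdd_mult[OF f bdd_meas_shift(1)[OF bdd_meas_exp_fn(1)]])
    have i2: "integrable lborel (\<lambda>z. g\<^sub>p (\<alpha> + r - z) * f z)" by (rule integrable_conv_bdd(1)[OF f g_bdd(1)])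
    have "(LINT z|lborel. G\<^sub>p (r + (\<alpha> - z)) * f z) = (LINT z|lborel. e\<^sub>p r * (e\<^sub>p (\<alpha> - z) * f z) + g\<^sub>p (\<alpha> + r - z) * f z)"
    proof (intro Bochner_Integration.integral_cong refl)
      fix z
      show "G\<^sub>p (r + (\<alpha> - z)) * f z = e\<^sub>p r * (e\<^sub>p (\<alpha> - z) * f z) + g\<^sub>p (\<alpha> + r - z) * f z"
      proof (cases "z \<in> {0<..<\<alpha>}")
        case True
        then have "hexp p (r + (\<alpha> - z)) = e\<^sub>p r * e\<^sub>p (\<alpha> - z)" using r by (simp add: hexp_def exp_fn_add)
        then show ?thesis by (simp add: G\<^sub>p_def algebra_simps)
      qed (simp add: supp)
    qed
    also have "\<dots> = e\<^sub>p r * PF + Y\<^sub>0 r" unfolding PF_eq Y\<^sub>0_def conv_def using i1 i2 by simp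
    finally show ?thesis by (simp add: mult.commute)
  qed
  have "(LINT r|lborel. g\<^sub>m (- (s + r)) * (indicator {0<..} r * ((PF * e\<^sub>p r + Y\<^sub>0 r) / t\<^sub>p)))
    = (LINT r|lborel. (g\<^sub>m (- (s + r)) * indicator {0<..} r) * (LINT z|lborel. G\<^sub>p (r + (\<alpha> - z)) * f z) / t\<^sub>p)"
    using Y by (intro Bochner_Integration.integral_cong refl) (auto simp: indicator_def)
  also have "\<dots> = (LINT r|lborel. (g\<^sub>m (- (s + r)) * indicator {0<..} r) * (LINT z|lborel. G\<^sub>p (r + (\<alpha> - z)) * f z)) / t\<^sub>p"
    by simp
  also have "(LINT r|lborel. (g\<^sub>m (- (s + r)) * indicator {0<..} r) * (LINT z|lborel. G\<^sub>p (r + (\<alpha> - z)) * f z))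
    = (LINT z|lborel. (LINT r|lborel. (g\<^sub>m (- (s + r)) * indicator {0<..} r) * G\<^sub>p (r + (\<alpha> - z))) * f z)"
    by (rule Fubini_bounded_kernel(2)[OF gI f _ C]) measurable
  finally show ?thesis by (simp add: half_conv_def mult.assoc)
qed

lemma err_right_bdd: "bdd_meas err_right"
proof -
  have "err_right = (\<lambda>s. conv g\<^sub>p (\<psi> f) (\<alpha> + s) + (-1) * conv g\<^sub>p \<phi> (\<alpha> + s))"
    using conv_g_phi by (intro ext) simp
  moreover have "bdd_meas (\<lambda>s. conv g\<^sub>p (\<psi> f) (\<alpha> + s) + (-1) * conv g\<^sub>p \<phi> (\<alpha> + s))"
    by (intro bdd_meas_add conv_g_psi_bdd bdd_meas_cmult bdd_meas_shift(2)[OF bdd_meas_conv(1)[OF g_bdd(1) phi_integrable]])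
  ultimately show ?thesis by (simp only:)
qed

lemma err_left_bdd: "bdd_meas err_left"
proof -
  have gr: "integrable lborel (\<lambda>y. g\<^sub>m (- y))" by (rule integrable_reflect_shift(5)[OF g_int(2)])
  obtain C where C: "\<And>x. norm (G\<^sub>p x) \<le> C" using G_bdd(1) by (metis bdd_measE)
  have m: "case_prod (half_conv (\<lambda>y. g\<^sub>m (- y)) G\<^sub>p) \<in> borel_measurable (borel \<Otimes>\<^sub>M borel)"
    by (rule half_conv_measurable) measurable
  have [measurable]: "(\<lambda>(s, z). half_conv (\<lambda>y. g\<^sub>m (- y)) G\<^sub>p (\<alpha> + s) (\<alpha> - z)) \<in> borel_measurable (borel \<Otimes>\<^sub>M borel)"
    using measurable_compose[OF _ m, of "\<lambda>(s, z). (\<alpha> + s, \<alpha> - z)" "borel \<Otimes>\<^sub>M borel"] by (simp add: case_prod_beta')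
  show ?thesis
  proof (rule bdd_measI)
    show "err_left \<in> borel_measurable borel" unfolding err_left_def[abs_def] by measurable
    fix s
    have "norm (LINT z|lborel. half_conv (\<lambda>y. g\<^sub>m (- y)) G\<^sub>p (\<alpha> + s) (\<alpha> - z) * f z)
       \<le> (LINT z|lborel. ((LINT w|lborel. norm (g\<^sub>m (- w))) * C) * norm (f z))"
      using half_conv_bound[OF gr C] f
      by (intro norm_integral_le_integral) (auto simp: norm_mult intro!: mult_right_mono)
    then show "norm (err_left s) \<le> (LINT z|lborel. ((LINT w|lborel. norm (g\<^sub>m (- w))) * C) * norm (f z)) / norm t\<^sub>p"
      unfolding err_left_def norm_divide by (intro divide_right_mono) auto
  qed
qed

text \<open>Each of the two functions solves a half-line equation; cutting at the far end leaves the
  Hankel images of \<open>u_tail\<close> and of the tail of \<open>V\<close>. The right side of the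
  equation for \<open>V\<close> removes the middle part of \<open>u_tail\<close> and the part of its
  \<open>e\<^sub>p\<close> term with \<open>s\<^sub>m\<close>, so that the pairings with
  \<open>\<eta>\<close> and \<open>lam\<close> and the two small errors remain.\<close>

theorem approximate_inverse:
  "AE x in lborel. x \<in> {0<..<\<alpha>} \<longrightarrow> trunc \<alpha> (\<lambda>y. u y - V (\<alpha> - y)) x = f x
     + e\<^sub>p \<alpha> / t\<^sub>p * (LINT z|lborel. \<eta> z * f z) * hankel_right \<alpha> e\<^sub>p x + e\<^sub>p \<alpha> / t\<^sub>m * lam * hankel_left e\<^sub>p x
     + hankel_right \<alpha> err_right x / t\<^sub>p + hankel_left err_left x / t\<^sub>m"
proof -
  have half: "AE x in lborel. x > 0 \<longrightarrow> a * u x + conv k u x = f x"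
    using half_line_inverse[OF f phi_integrable[unfolded \<phi>_def[abs_def]]] unfolding u_def[abs_def] \<phi>_def[abs_def] by simp
  have refl: "AE x in lborel. \<alpha> - x > 0 \<longrightarrow> a * V (\<alpha> - x) + (LINT y|lborel. k (y - (\<alpha> - x)) * (indicator {0<..} y * V y))
     = - (PF * s\<^sub>m * (LINT w|lborel. k (- (\<alpha> - x) - w) * hexp p w)
       + (LINT r|lborel. k (- (\<alpha> - x) - r) * (indicator {0<..} r * conv g\<^sub>p (\<psi> f) (\<alpha> + r)))) / t\<^sub>p"
    by (rule AE_reflect_shift[OF V_equation])
  have ku: "AE x in lborel. integrable lborel (\<lambda>y. k (x - y) * u y)"
    using integrable_conv(2)[OF k_int phi_integrable]
  proof eventually_elim
    case (elim x)
    have "integrable lborel (\<lambda>y. (c\<^sub>p * (k (x - y) * \<phi> y) + k (x - y) * conv G\<^sub>p \<phi> y) / t\<^sub>p)"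
      using elim by (intro integrable_divide Bochner_Integration.integrable_add integrable_mult_right
         integrable_conv_bdd(2)[OF k_int bdd_meas_conv(1)[OF G_bdd(1) phi_integrable]])
    then show ?case by (simp add: u_def algebra_simps)
  qed
  show ?thesis using half refl ku
  proof eventually_elim
    case (elim x)
    show ?case
    proof
      assume x: "x \<in> {0<..<\<alpha>}"
      let ?M = "(LINT z|lborel. e\<^sub>m z * f z)" and ?N = "(LINT z|lborel. \<eta> z * f z)"
      let ?P = "\<lambda>s. conv g\<^sub>p (\<psi> f) (\<alpha> + s)"
      have iu: "integrable lborel (\<lambda>y. k (x - y) * (indicator {0<..} y * u y))"
        by (rule Bochner_Integration.integrable_bound[OF elim(3)]) (auto simp: indicator_def)
      have iu': "integrable lborel (\<lambda>y. k (x - y) * (indicator {0<..<\<alpha>} y * u y))"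
        by (rule Bochner_Integration.integrable_bound[OF elim(3)]) (auto simp: indicator_def)
      have cu: "conv k u x = (LINT y|lborel. k (x - y) * (indicator {0<..} y * u y))"
        unfolding conv_def using u_left by (intro Bochner_Integration.integral_cong refl) (auto simp: indicator_def)
      have U: "a * u x + (LINT y|lborel. k (x - y) * (indicator {0<..<\<alpha>} y * u y)) = f x - hankel_right \<alpha> (\<lambda>s. u (\<alpha> + s)) x"
        using elim(1) x unfolding truncate_right[OF iu u_measurable \<alpha>] cu by auto
      have ut: "hankel_right \<alpha> (\<lambda>s. u (\<alpha> + s)) x = (e\<^sub>p \<alpha> * (s\<^sub>m * ?M - ?N) * hankel_right \<alpha> e\<^sub>p x + hankel_right \<alpha> ?P x - hankel_right \<alpha> err_right x) / t\<^sub>p"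
      proof -
        have "hankel_right \<alpha> (\<lambda>s. u (\<alpha> + s)) x = hankel_right \<alpha> (\<lambda>s. 1 / t\<^sub>p * ((e\<^sub>p \<alpha> * (s\<^sub>m * ?M - ?N)) * e\<^sub>p s + (?P s + (-1) * err_right s))) x"
          by (rule hankel_right_cong) (simp add: u_tail)
        also have "\<dots> = 1 / t\<^sub>p * ((e\<^sub>p \<alpha> * (s\<^sub>m * ?M - ?N)) * hankel_right \<alpha> e\<^sub>p x + (hankel_right \<alpha> ?P x + (-1) * hankel_right \<alpha> err_right x))"
          unfolding hankel_right_cmult
            hankel_right_add[OF bdd_meas_cmult[OF bdd_meas_exp_fn(1)] bdd_meas_add[OF conv_g_psi_bdd bdd_meas_cmult[OF err_right_bdd]]]
            hankel_right_add[OF conv_g_psi_bdd bdd_meas_cmult[OF err_right_bdd]] ..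
        finally show ?thesis by simp
      qed
      have iV: "integrable lborel (\<lambda>y. k (y - (\<alpha> - x)) * (indicator A y * V y))" if "A \<in> sets borel" for A
        by (rule integrable_mult_bdd[OF integrable_reflect_shift(4)[OF k_int] bdd_meas_indicator_mult[OF that V_bdd]])
      have V1: "(LINT y|lborel. k (x - y) * (indicator {0<..<\<alpha>} y * V (\<alpha> - y))) = (LINT y|lborel. k (y - (\<alpha> - x)) * (indicator {0<..<\<alpha>} y * V y))"
      proof -
        have "(LINT y|lborel. k (x - y) * (indicator {0<..<\<alpha>} y * V (\<alpha> - y))) = (LINT y|lborel. k (x - (\<alpha> - y)) * (indicator {0<..<\<alpha>} (\<alpha> - y) * V (\<alpha> - (\<alpha> - y))))"
          by (rule integral_reflect_shift(1)[symmetric])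
        also have "\<dots> = (LINT y|lborel. k (y - (\<alpha> - x)) * (indicator {0<..<\<alpha>} y * V y))"
          by (intro Bochner_Integration.integral_cong refl) (auto simp: indicator_def algebra_simps)
        finally show ?thesis .
      qed
      have iV': "integrable lborel (\<lambda>y. k (x - y) * (indicator {0<..<\<alpha>} y * V (\<alpha> - y)))"
        by (rule integrable_conv_bdd(2)[OF k_int bdd_meas_indicator_mult[OF _ bdd_meas_shift(1)[OF V_bdd]]]) simp
      have V2: "(LINT y|lborel. k (y - (\<alpha> - x)) * (indicator {0<..<\<alpha>} y * V y))
         = (LINT y|lborel. k (y - (\<alpha> - x)) * (indicator {0<..} y * V y)) - hankel_left (\<lambda>s. V (\<alpha> + s)) x"
      proof -
        let ?I = "\<lambda>A y. k (y - (\<alpha> - x)) * (indicator A y * V y)"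
        have "hankel_left (\<lambda>s. V (\<alpha> + s)) x = (LINT s|lborel. ?I {\<alpha><..} (\<alpha> + s))"
          unfolding hankel_left_def by (intro Bochner_Integration.integral_cong refl) (auto simp: indicator_def algebra_simps)
        also have "\<dots> = integral\<^sup>L lborel (?I {\<alpha><..})" by (rule integral_reflect_shift(2))
        finally have 1: "hankel_left (\<lambda>s. V (\<alpha> + s)) x = integral\<^sup>L lborel (?I {\<alpha><..})" .
        have "integral\<^sup>L lborel (?I {0<..<\<alpha>}) + integral\<^sup>L lborel (?I {\<alpha><..}) = (LINT y|lborel. ?I {0<..<\<alpha>} y + ?I {\<alpha><..} y)"
          using iV[of "{0<..<\<alpha>}"] iV[of "{\<alpha><..}"] by (subst Bochner_Integration.integral_add) auto
        also have "\<dots> = integral\<^sup>L lborel (?I {0<..})"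
        proof (rule integral_cong_AE)
          show "AE y in lborel. ?I {0<..<\<alpha>} y + ?I {\<alpha><..} y = ?I {0<..} y"
            using AE_lborel_singleton[of \<alpha>] by eventually_elim (use \<alpha> in \<open>auto simp: indicator_def\<close>)
        qed measurable
        finally show ?thesis unfolding 1 by (simp add: eq_diff_eq)
      qed
      have hr: "(LINT w|lborel. k (- (\<alpha> - x) - w) * hexp p w) = hankel_right \<alpha> e\<^sub>p x"
        "(LINT r|lborel. k (- (\<alpha> - x) - r) * (indicator {0<..} r * ?P r)) = hankel_right \<alpha> ?P x"
        unfolding hankel_right_def hexp_conv by simp_all
      have vt: "hankel_left (\<lambda>s. V (\<alpha> + s)) x = (e\<^sub>p \<alpha> * lam * hankel_left e\<^sub>p x + hankel_left err_left x) / t\<^sub>m"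
      proof -
        have "hankel_left (\<lambda>s. V (\<alpha> + s)) x = hankel_left (\<lambda>s. 1 / t\<^sub>m * ((e\<^sub>p \<alpha> * lam) * e\<^sub>p s + err_left s)) x"
        proof (rule hankel_left_cong)
          fix s :: real assume "s > 0"
          then show "V (\<alpha> + s) = 1 / t\<^sub>m * ((e\<^sub>p \<alpha> * lam) * e\<^sub>p s + err_left s)"
            using V_eq[of "\<alpha> + s"] \<alpha> unfolding V_kernel by (simp add: err_left_def exp_fn_add mult_ac)
        qed
        also have "\<dots> = 1 / t\<^sub>m * ((e\<^sub>p \<alpha> * lam) * hankel_left e\<^sub>p x + hankel_left err_left x)"
          unfolding hankel_left_cmult hankel_left_add[OF bdd_meas_cmult[OF bdd_meas_exp_fn(1)] err_left_bdd] ..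
        finally show ?thesis by simp
      qed
      have VV: "a * V (\<alpha> - x) + (LINT y|lborel. k (x - y) * (indicator {0<..<\<alpha>} y * V (\<alpha> - y)))
         = - (PF * s\<^sub>m * hankel_right \<alpha> e\<^sub>p x + hankel_right \<alpha> ?P x) / t\<^sub>p - (e\<^sub>p \<alpha> * lam * hankel_left e\<^sub>p x + hankel_left err_left x) / t\<^sub>m"
      proof -
        have "a * V (\<alpha> - x) + (LINT y|lborel. k (x - y) * (indicator {0<..<\<alpha>} y * V (\<alpha> - y)))
          = a * V (\<alpha> - x) + (LINT y|lborel. k (y - (\<alpha> - x)) * (indicator {0<..} y * V y)) - hankel_left (\<lambda>s. V (\<alpha> + s)) x"
          unfolding V1 V2 by simp
        also have "a * V (\<alpha> - x) + (LINT y|lborel. k (y - (\<alpha> - x)) * (indicator {0<..} y * V y)) 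
           = - (PF * s\<^sub>m * hankel_right \<alpha> e\<^sub>p x + hankel_right \<alpha> ?P x) / t\<^sub>p"
          using elim(2) x unfolding hr by auto
        finally show ?thesis unfolding vt .
      qed
      have split: "trunc \<alpha> (\<lambda>y. u y - V (\<alpha> - y)) x = (a * u x + (LINT y|lborel. k (x - y) * (indicator {0<..<\<alpha>} y * u y)))
         - (a * V (\<alpha> - x) + (LINT y|lborel. k (x - y) * (indicator {0<..<\<alpha>} y * V (\<alpha> - y))))"
        unfolding trunc_def right_diff_distrib using iu' iV' by simp
      \<comment> \<open>The terms with \<open>s\<^sub>m * ?M\<close> and with \<open>?P\<close>
        occur in \<open>ut\<close> and in \<open>VV\<close> and cancel, since \<open>PF\<close> is
        \<open>e\<^sub>p \<alpha> * ?M\<close>.\<close>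
      show "trunc \<alpha> (\<lambda>y. u y - V (\<alpha> - y)) x = f x
         + e\<^sub>p \<alpha> / t\<^sub>p * ?N * hankel_right \<alpha> e\<^sub>p x + e\<^sub>p \<alpha> / t\<^sub>m * lam * hankel_left e\<^sub>p x
         + hankel_right \<alpha> err_right x / t\<^sub>p + hankel_left err_left x / t\<^sub>m"
        unfolding split U VV ut PF_def by (simp add: add_divide_distrib diff_divide_distrib algebra_simps)
    qed
  qed
qed

end

end

subsection \<open>Bounded kernels on a square\<close>

text \<open>Kernels are defined on the whole plane and vanish off the square, so that integrals over
  the line can be used without restricting measures.\<close>

definition kern :: "real \<Rightarrow> real \<Rightarrow> (real \<Rightarrow> real \<Rightarrow> complex) \<Rightarrow> bool" where
  "kern \<alpha> C K \<longleftrightarrow> case_prod K \<in> borel_measurable (borel \<Otimes>\<^sub>M borel) \<and> (\<forall>x y. norm (K x y) \<le> C) \<and>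
     (\<forall>x y. x \<notin> {0<..<\<alpha>} \<or> y \<notin> {0<..<\<alpha>} \<longrightarrow> K x y = 0)"

definition kop :: "(real \<Rightarrow> real \<Rightarrow> complex) \<Rightarrow> (real \<Rightarrow> complex) \<Rightarrow> real \<Rightarrow> complex" where
  "kop K f x = (LINT y|lborel. K x y * f y)"

definition kcomp :: "(real \<Rightarrow> real \<Rightarrow> complex) \<Rightarrow> (real \<Rightarrow> real \<Rightarrow> complex) \<Rightarrow> real \<Rightarrow> real \<Rightarrow> complex" where
  "kcomp K L x y = (LINT z|lborel. K x z * L z y)"

lemma kernD:
  assumes "kern \<alpha> C K"
  shows "case_prod K \<in> borel_measurable (borel \<Otimes>\<^sub>M borel)" "norm (K x y) \<le> C" "C \<ge> 0"
    "x \<notin> {0<..<\<alpha>} \<Longrightarrow> K x y = 0" "y \<notin> {0<..<\<alpha>} \<Longrightarrow> K x y = 0"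
proof -
  show n: "norm (K x y) \<le> C" for x y using assms by (simp add: kern_def)
  show "C \<ge> 0" using order_trans[OF norm_ge_zero n] .
qed (use assms in \<open>auto simp: kern_def\<close>)

lemma kern_measurable_parts:
  assumes "kern \<alpha> C K"
  shows "(\<lambda>y. K x y) \<in> borel_measurable borel" "(\<lambda>x. K x y) \<in> borel_measurable borel"
  using measurable_compose[OF measurable_Pair1' kernD(1)[OF assms], of x] 
     measurable_compose[OF measurable_Pair2' kernD(1)[OF assms], of y] by (simp_all add: comp_def)

lemma kern_integrable:
  assumes "kern \<alpha> C K"
  shows "integrable lborel (\<lambda>y. K x y)" "integrable lborel (\<lambda>x. K x y)"
proof -
  have "integrable lborel (\<lambda>y. indicator {0<..<\<alpha>} y * K x y)"
    by (rule integrable_mult_bounded[OF integrable_indicator_interval]) (use kern_measurable_parts[OF assms] kernD(2)[OF assms] in auto)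
  moreover have "indicator {0<..<\<alpha>} y * K x y = K x y" for y using kernD(5)[OF assms, of y x] by (auto simp: indicator_def)
  ultimately show "integrable lborel (\<lambda>y. K x y)" by simp
  have "integrable lborel (\<lambda>x. indicator {0<..<\<alpha>} x * K x y)"
    by (rule integrable_mult_bounded[OF integrable_indicator_interval]) (use kern_measurable_parts[OF assms] kernD(2)[OF assms] in auto)
  moreover have "indicator {0<..<\<alpha>} x * K x y = K x y" for x using kernD(4)[OF assms, of x y] by (auto simp: indicator_def)
  ultimately show "integrable lborel (\<lambda>x. K x y)" by simp
qed

lemma kern_norm_integral:
  assumes "kern \<alpha> C K" "\<alpha> > 0" shows "(LINT y|lborel. norm (K x y)) \<le> C * \<alpha>"
proof -
  have "(LINT y|lborel. norm (K x y)) \<le> (LINT y|lborel. C * indicator {0<..<\<alpha>} y)"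
  proof (rule integral_mono)
    show "integrable lborel (\<lambda>y. C * indicator {0<..<\<alpha>} y)" using assms(2) by (intro integrable_mult_right integrable_real_indicator) auto
    show "norm (K x y) \<le> C * indicator {0<..<\<alpha>} y" for y
      using kernD(2)[OF assms(1), of x y] kernD(5)[OF assms(1), of y x] by (auto simp: indicator_def)
  qed (use kern_integrable(1)[OF assms(1), of x] in auto)
  then show ?thesis using assms(2) by simp
qed

lemma kern_comp:
  assumes K: "kern \<alpha> C K" and L: "kern \<alpha> D L" and \<alpha>: "\<alpha> > 0"
  shows "kern \<alpha> (C * \<alpha> * D) (kcomp K L)"
  unfolding kern_def
proof (intro conjI allI impI)
  note [measurable] = kernD(1)[OF K] kernD(1)[OF L]
  show "case_prod (kcomp K L) \<in> borel_measurable (borel \<Otimes>\<^sub>M borel)"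
    unfolding kcomp_def[abs_def] by measurable
  fix x y
  have "norm (kcomp K L x y) \<le> (LINT z|lborel. norm (K x z) * D)"
    unfolding kcomp_def using kern_integrable(1)[OF K, of x] kernD(2)[OF L]
    by (intro norm_integral_le_integral) (auto simp: norm_mult intro!: mult_left_mono)
  also have "\<dots> \<le> C * \<alpha> * D"
    using kern_norm_integral[OF K \<alpha>, of x] kernD(3)[OF L] by (simp add: mult_right_mono)
  finally show "norm (kcomp K L x y) \<le> C * \<alpha> * D" .
next
  fix x y assume "x \<notin> {0<..<\<alpha>} \<or> y \<notin> {0<..<\<alpha>}"
  then show "kcomp K L x y = 0"
    unfolding kcomp_def by (intro integral_eq_zero_AE AE_I2) (use kernD(4)[OF K] kernD(5)[OF L] in auto)
qed

lemma kern_add: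
  assumes K: "kern \<alpha> C K" and L: "kern \<alpha> D L"
  shows "kern \<alpha> (C + D) (\<lambda>x y. K x y + L x y)"
proof -
  note [measurable] = kernD(1)[OF K] kernD(1)[OF L]
  show ?thesis unfolding kern_def
    using kernD(2)[OF K] kernD(2)[OF L] kernD(4,5)[OF K] kernD(4,5)[OF L] by (auto intro!: norm_triangle_mono)
qed

lemma kern_cmult:
  assumes K: "kern \<alpha> C K" shows "kern \<alpha> (norm c * C) (\<lambda>x y. c * K x y)"
proof -
  note [measurable] = kernD(1)[OF K]
  show ?thesis unfolding kern_def
    using kernD(2)[OF K] kernD(4,5)[OF K] by (auto simp: norm_mult intro!: mult_left_mono)
qed

lemma kern_mono: "kern \<alpha> C K \<Longrightarrow> C \<le> D \<Longrightarrow> kern \<alpha> D K"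
  unfolding kern_def by (meson order_trans)

lemma kern_reflect_transpose:
  assumes K: "kern \<alpha> C K" shows "kern \<alpha> C (\<lambda>x y. K (\<alpha> - y) (\<alpha> - x))"
proof -
  have [measurable]: "(\<lambda>(x, y). K (\<alpha> - y) (\<alpha> - x)) \<in> borel_measurable (borel \<Otimes>\<^sub>M borel)"
    using measurable_compose[OF _ kernD(1)[OF K], of "\<lambda>(x, y). (\<alpha> - y, \<alpha> - x)" "borel \<Otimes>\<^sub>M borel"] by (simp add: case_prod_beta')
  show ?thesis unfolding kern_def using kernD(2)[OF K] kernD(4,5)[OF K] by auto
qed

lemma kop_integrable:
  assumes K: "kern \<alpha> C K" and f: "integrable lborel f"
  shows "integrable lborel (\<lambda>y. K x y * f y)"
  using integrable_mult_bounded[OF f, of "\<lambda>y. K x y" C] kern_measurable_parts(1)[OF K, of x] kernD(2)[OF K] by (simp add: mult.commute)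

lemma kop_comp:
  assumes K: "kern \<alpha> C K" and L: "kern \<alpha> D L" and f: "integrable lborel f"
  shows "kop K (kop L f) x = kop (kcomp K L) f x"
  unfolding kop_def kcomp_def
  by (rule Fubini_bounded_kernel(2)[OF kern_integrable(1)[OF K] f kernD(1)[OF L] kernD(2)[OF L]])

lemma kop_add_kernel:
  assumes "kern \<alpha> C K" "kern \<alpha> D L" "integrable lborel f"
  shows "kop (\<lambda>x y. K x y + L x y) f x = kop K f x + kop L f x"
  unfolding kop_def using kop_integrable[OF assms(1,3), of x] kop_integrable[OF assms(2,3), of x] by (simp add: distrib_right)

lemma kop_cmult_kernel: "kop (\<lambda>x y. c * K x y) f x = c * kop K f x"
  unfolding kop_def by (simp add: mult.assoc)

lemma kop_add:
  assumes "kern \<alpha> C K" "integrable lborel f" "integrable lborel g"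
  shows "kop K (\<lambda>x. f x + g x) x = kop K f x + kop K g x"
  unfolding kop_def using kop_integrable[OF assms(1,2), of x] kop_integrable[OF assms(1,3), of x] by (simp add: distrib_left)

lemma kop_cmult: "kop K (\<lambda>x. c * f x) x = c * kop K f x"
  unfolding kop_def by (simp add: mult.left_commute)

lemma kop_cong_AE:
  assumes K: "kern \<alpha> C K" and "AE x in lborel. f x = g x" "f \<in> borel_measurable borel" "g \<in> borel_measurable borel"
  shows "kop K f x = kop K g x"
  unfolding kop_def
proof (rule integral_cong_AE)
  note [measurable] = kern_measurable_parts(1)[OF K] assms(3,4)
  show "(\<lambda>y. K x y * f y) \<in> borel_measurable lborel" "(\<lambda>y. K x y * g y) \<in> borel_measurable lborel" by measurable
  show "AE y in lborel. K x y * f y = K x y * g y" using assms(2) by eventually_elim simp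
qed

lemma kop_bound:
  assumes K: "kern \<alpha> C K" and f: "integrable lborel f"
  shows "norm (kop K f x) \<le> C * (LINT y|lborel. norm (f y))"
proof -
  have "norm (kop K f x) \<le> (LINT y|lborel. C * norm (f y))"
    unfolding kop_def using kernD(2)[OF K] f by (intro norm_integral_le_integral) (auto simp: norm_mult intro!: mult_right_mono)
  then show ?thesis by simp
qed

lemma kop_measurable:
  assumes K: "kern \<alpha> C K" and [measurable]: "f \<in> borel_measurable borel"
  shows "kop K f \<in> borel_measurable borel"
proof -
  note [measurable] = kernD(1)[OF K]
  show ?thesis unfolding kop_def[abs_def] by measurable
qed

lemma kop_zero: "kern \<alpha> C K \<Longrightarrow> x \<notin> {0<..<\<alpha>} \<Longrightarrow> kop K f x = 0"
  unfolding kop_def by (intro integral_eq_zero_AE AE_I2) (auto simp: kernD(4))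

text \<open>The resolvent kernel is the alternating sum of the iterates of \<open>E\<close>. A
  composition multiplies sup bounds by the length \<alpha>, so the condition on \<epsilon> \<alpha>
  makes the series geometric with ratio 1/2.\<close>

lemma Neumann_kernel:
  assumes E: "kern \<alpha> \<epsilon> E" and \<alpha>: "\<alpha> > 0" and small: "\<epsilon> * \<alpha> \<le> 1 / 2"
  obtains R where "kern \<alpha> (2 * \<epsilon>) R" "\<And>x y. R x y + E x y + kcomp E R x y = 0"
proof -
  have \<epsilon>: "\<epsilon> \<ge> 0" by (rule kernD(3)[OF E])
  \<comment> \<open>\<open>F n\<close> is the (n+1)-fold composition of \<open>E\<close>; the sign
    of its term is (-1)^(n+1).\<close>
  define F where "F = rec_nat E (\<lambda>_. kcomp E)"
  have F0: "F 0 = E" and FS: "F (Suc n) = kcomp E (F n)" for n by (simp_all add: F_def)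
  have F: "kern \<alpha> (\<epsilon> * (1/2) ^ n) (F n)" for n
  proof (induction n)
    case 0 then show ?case using E by (simp add: F0)
  next
    case (Suc n)
    have "kern \<alpha> (\<epsilon> * \<alpha> * (\<epsilon> * (1/2) ^ n)) (F (Suc n))" unfolding FS by (rule kern_comp[OF E Suc \<alpha>])
    moreover have "\<epsilon> * \<alpha> * (\<epsilon> * (1/2) ^ n) \<le> 1/2 * (\<epsilon> * (1/2) ^ n)" using small \<epsilon> by (intro mult_right_mono) auto
    ultimately show ?case by (elim kern_mono) simp
  qed
  define c where "c n = ((-1) ^ Suc n :: complex)" for n
  have c: "norm (c n) = 1" for n by (simp add: c_def norm_power)
  define T where "T n x y = c n * F n x y" for n x y
  have Tb: "norm (T n x y) \<le> \<epsilon> * (1/2) ^ n" for n x y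
    using kernD(2)[OF F] by (simp add: T_def norm_mult c)
  have geo: "summable (\<lambda>n. \<epsilon> * (1/2) ^ n)" "(\<Sum>n. \<epsilon> * (1/2::real) ^ n) = 2 * \<epsilon>"
    using suminf_mult[of "\<lambda>n. (1/2::real)^n" \<epsilon>] by (auto simp: suminf_geometric)
  have sn: "summable (\<lambda>n. norm (T n x y))" for x y
    by (rule summable_comparison_test'[OF geo(1), of 0]) (use Tb in auto)
  have s: "summable (\<lambda>n. T n x y)" for x y by (rule summable_norm_cancel[OF sn])
  define R where "R x y = (\<Sum>n. T n x y)" for x y
  have Fm [measurable]: "case_prod (F n) \<in> borel_measurable (borel \<Otimes>\<^sub>M borel)" for n by (rule kernD(1)[OF F])
  have R: "kern \<alpha> (2 * \<epsilon>) R"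
    unfolding kern_def
  proof (intro conjI allI impI)
    show "case_prod R \<in> borel_measurable (borel \<Otimes>\<^sub>M borel)"
      unfolding R_def[abs_def] T_def by measurable
    show "norm (R x y) \<le> 2 * \<epsilon>" for x y
    proof -
      have "norm (R x y) \<le> (\<Sum>n. norm (T n x y))" unfolding R_def by (rule summable_norm[OF sn])
      also have "\<dots> \<le> (\<Sum>n. \<epsilon> * (1/2) ^ n)" by (rule suminf_le[OF _ sn geo(1)]) (rule Tb)
      finally show ?thesis using geo(2) by simp
    qed
    show "R x y = 0" if "x \<notin> {0<..<\<alpha>} \<or> y \<notin> {0<..<\<alpha>}" for x y
    proof -
      have "F n x y = 0" for n using kernD(4)[OF F] kernD(5)[OF F] that by blast
      then show ?thesis by (simp add: R_def T_def)
    qed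
  qed
  moreover have "R x y + E x y + kcomp E R x y = 0" for x y
  proof -
    have Ei: "integrable lborel (\<lambda>z. E x z)" by (rule kern_integrable(1)[OF E])
    have i: "integrable lborel (\<lambda>z. E x z * T n z y)" for n
      unfolding T_def using integrable_mult_bounded[OF Ei, of "\<lambda>z. c n * F n z y" "\<epsilon> * (1/2) ^ n"] 
        kern_measurable_parts(2)[OF F, of n y] Tb[of n _ y] unfolding T_def by simp
    \<comment> \<open>Composing with \<open>E\<close> shifts the alternating series by one index and
      changes its sign, so all terms but the first cancel against \<open>R\<close>, and the first
      cancels against \<open>E\<close>.\<close>
    have "kcomp E R x y = (LINT z|lborel. (\<Sum>n. E x z * T n z y))"
      unfolding kcomp_def R_def by (simp add: suminf_mult[OF s])
    also have "\<dots> = (\<Sum>n. LINT z|lborel. E x z * T n z y)"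
    proof (rule integral_suminf[OF i])
      show "AE z in lborel. summable (\<lambda>n. norm (E x z * T n z y))"
        unfolding norm_mult by (intro AE_I2 summable_mult sn)
      show "summable (\<lambda>n. LINT z|lborel. norm (E x z * T n z y))"
      proof (rule summable_comparison_test'[OF summable_mult[OF geo(1), of "LINT z|lborel. norm (E x z)"], of 0])
        fix n
        have "(LINT z|lborel. norm (E x z * T n z y)) \<le> (LINT z|lborel. norm (E x z) * (\<epsilon> * (1/2) ^ n))"
          using i[of n] Ei Tb by (intro integral_mono integrable_norm integrable_mult_left) (auto simp: norm_mult intro!: mult_left_mono)
        then show "norm (LINT z|lborel. norm (E x z * T n z y)) \<le> (LINT z|lborel. norm (E x z)) * (\<epsilon> * (1/2) ^ n)" by simp
      qed
    qed
    also have "\<dots> = (\<Sum>n. - T (Suc n) x y)"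
    proof (rule suminf_cong)
      fix n
      have "(LINT z|lborel. E x z * T n z y) = c n * kcomp E (F n) x y"
        unfolding T_def kcomp_def by (simp add: mult.left_commute)
      then show "(LINT z|lborel. E x z * T n z y) = - T (Suc n) x y" by (simp add: T_def FS c_def)
    qed
    also have "\<dots> = - (\<Sum>n. T (Suc n) x y)"
      using s[of x y] summable_Suc_iff[of "\<lambda>n. T n x y"] by (simp add: suminf_minus)
    also have "(\<Sum>n. T (Suc n) x y) = R x y - T 0 x y" unfolding R_def by (rule suminf_split_head[OF s])
    also have "T 0 x y = - E x y" by (simp add: T_def c_def F0)
    finally show ?thesis by simp
  qed
  ultimately show ?thesis using that by blast
qed

subsection \<open>Square-integrable functions vanishing outside an interval\<close>

text \<open>Representatives of the elements of the Hilbert space on (0,\<alpha>) that are Borel on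
  the whole line and vanish off the interval; \<open>proj_op\<close> passes to them.\<close>

definition L2z :: "real \<Rightarrow> (real \<Rightarrow> complex) set" where
  "L2z \<alpha> = {f \<in> borel_measurable borel. (\<forall>x. x \<notin> {0<..<\<alpha>} \<longrightarrow> f x = 0) \<and> integrable lborel (\<lambda>x. (norm (f x))\<^sup>2)}"

lemma L2z_D:
  assumes "f \<in> L2z \<alpha>"
  shows "f \<in> borel_measurable borel" "x \<notin> {0<..<\<alpha>} \<Longrightarrow> f x = 0" "integrable lborel (\<lambda>x. (norm (f x))\<^sup>2)"
  using assms by (auto simp: L2z_def)

lemma L2z_integrable:
  assumes f: "f \<in> L2z \<alpha>" shows "integrable lborel f"
proof -
  note [measurable] = L2z_D(1)[OF f]
  have "integrable lborel (\<lambda>x. norm (indicator {0<..<\<alpha>} x :: complex) + (norm (f x))\<^sup>2)"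
    by (intro Bochner_Integration.integrable_add integrable_norm integrable_indicator_interval L2z_D(3)[OF f])
  then show ?thesis
  proof (rule Bochner_Integration.integrable_bound)
    show "AE x in lborel. norm (f x) \<le> norm (norm (indicator {0<..<\<alpha>} x :: complex) + (norm (f x))\<^sup>2)"
    proof (rule AE_I2)
      fix x
      show "norm (f x) \<le> norm (norm (indicator {0<..<\<alpha>} x :: complex) + (norm (f x))\<^sup>2)"
      proof (cases "x \<in> {0<..<\<alpha>}")
        case True
        have "2 * norm (f x) \<le> 1 + (norm (f x))\<^sup>2" using zero_le_power2[of "norm (f x) - 1"] by (simp add: power2_eq_square algebra_simps)
        then have "norm (f x) \<le> 1 + (norm (f x))\<^sup>2" using norm_ge_zero[of "f x"] by linarith
        then show ?thesis using True by simp
      qed (simp add: L2z_D(2)[OF f])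
    qed
  qed measurable
qed

lemma L2z_add:
  assumes f: "f \<in> L2z \<alpha>" and g: "g \<in> L2z \<alpha>" shows "(\<lambda>x. f x + g x) \<in> L2z \<alpha>"
proof -
  note [measurable] = L2z_D(1)[OF f] L2z_D(1)[OF g]
  have "integrable lborel (\<lambda>x. 2 * (norm (f x))\<^sup>2 + 2 * (norm (g x))\<^sup>2)"
    by (intro Bochner_Integration.integrable_add integrable_mult_right L2z_D(3)[OF f] L2z_D(3)[OF g])
  then have "integrable lborel (\<lambda>x. (norm (f x + g x))\<^sup>2)"
  proof (rule Bochner_Integration.integrable_bound)
    show "AE x in lborel. norm ((norm (f x + g x))\<^sup>2) \<le> norm (2 * (norm (f x))\<^sup>2 + 2 * (norm (g x))\<^sup>2)"
    proof (rule AE_I2)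
      fix x
      have "(norm (f x + g x))\<^sup>2 \<le> (norm (f x) + norm (g x))\<^sup>2" by (intro power_mono norm_triangle_ineq) auto
      also have "\<dots> \<le> 2 * (norm (f x))\<^sup>2 + 2 * (norm (g x))\<^sup>2"
        using zero_le_power2[of "norm (f x) - norm (g x)"] by (simp add: power2_eq_square algebra_simps)
      finally show "norm ((norm (f x + g x))\<^sup>2) \<le> norm (2 * (norm (f x))\<^sup>2 + 2 * (norm (g x))\<^sup>2)" by simp
    qed
  qed measurable
  then show ?thesis unfolding L2z_def using L2z_D(2)[OF f] L2z_D(2)[OF g] by auto
qed

lemma L2z_cmult:
  assumes f: "f \<in> L2z \<alpha>" shows "(\<lambda>x. c * f x) \<in> L2z \<alpha>"
proof -
  note [measurable] = L2z_D(1)[OF f]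
  show ?thesis unfolding L2z_def using L2z_D(2,3)[OF f] by (auto simp: norm_mult power_mult_distrib)
qed

lemma L2z_cnj: assumes f: "f \<in> L2z \<alpha>" shows "(\<lambda>x. cnj (f x)) \<in> L2z \<alpha>"
proof -
  note [measurable] = L2z_D(1)[OF f]
  have "cnj \<in> borel_measurable borel" by (rule borel_measurable_continuous_onI) (intro continuous_intros)
  from measurable_compose[OF L2z_D(1)[OF f] this]
  show ?thesis unfolding L2z_def using L2z_D(2,3)[OF f] by auto
qed

lemma L2z_reflect:
  assumes f: "f \<in> L2z \<alpha>" shows "(\<lambda>x. f (\<alpha> - x)) \<in> L2z \<alpha>"
proof -
  note [measurable] = L2z_D(1)[OF f]
  have "integrable lborel (\<lambda>x. (norm (f (\<alpha> - x)))\<^sup>2)"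
    using lborel_integrable_real_affine[OF L2z_D(3)[OF f], of "-1" \<alpha>] by simp
  then show ?thesis unfolding L2z_def using L2z_D(2)[OF f] by auto
qed

lemma L2z_product_integrable:
  assumes f: "f \<in> L2z \<alpha>" and g: "g \<in> L2z \<alpha>" shows "integrable lborel (\<lambda>x. f x * g x)"
proof -
  note [measurable] = L2z_D(1)[OF f] L2z_D(1)[OF g]
  have "integrable lborel (\<lambda>x. (norm (f x))\<^sup>2 + (norm (g x))\<^sup>2)"
    by (intro Bochner_Integration.integrable_add L2z_D(3)[OF f] L2z_D(3)[OF g])
  then show ?thesis
  proof (rule Bochner_Integration.integrable_bound)
    show "AE x in lborel. norm (f x * g x) \<le> norm ((norm (f x))\<^sup>2 + (norm (g x))\<^sup>2)"
    proof (rule AE_I2)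
      fix x
      have "2 * (norm (f x) * norm (g x)) \<le> (norm (f x))\<^sup>2 + (norm (g x))\<^sup>2"
        using zero_le_power2[of "norm (f x) - norm (g x)"] by (simp add: power2_eq_square algebra_simps)
      moreover have "norm (f x) * norm (g x) \<ge> 0" by simp
      ultimately have "norm (f x) * norm (g x) \<le> (norm (f x))\<^sup>2 + (norm (g x))\<^sup>2" by linarith
      then show "norm (f x * g x) \<le> norm ((norm (f x))\<^sup>2 + (norm (g x))\<^sup>2)" by (simp add: norm_mult)
    qed
  qed measurable
qed

definition l2n :: "(real \<Rightarrow> complex) \<Rightarrow> real" where "l2n f = (LINT x|lborel. (norm (f x))\<^sup>2)"

lemma l2n_nonneg: "l2n f \<ge> 0" by (simp add: l2n_def)

text \<open>The inequality is used at t = c/N, where the first summand becomes c. This turns a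
  family of arithmetic-geometric estimates into a Cauchy-Schwarz inequality.\<close>

lemma square_le_from_AMGM:
  assumes "c \<ge> 0" "N > 0" "\<And>t. t > 0 \<Longrightarrow> 2 * c \<le> t * N + M / t" "M \<ge> 0" shows "c\<^sup>2 \<le> N * (M::real)"
proof (cases "c = 0")
  case True then show ?thesis using assms by simp
next
  case False
  then have c: "c > 0" using assms by simp
  have "2 * c \<le> c / N * N + M / (c / N)" using assms(3)[of "c / N"] c assms(2) by simp
  then have "c \<le> M * N / c" using assms(2) by simp
  then show ?thesis using c by (simp add: power2_eq_square pos_le_divide_eq mult.commute)
qed

text \<open>Integrate the pointwise estimate 2|f| <= t + |f|^2/t against the weight |w| and optimise
  in t. \<open>N\<close> is only a positive upper bound of the mass, which allows w = 0.\<close>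

lemma weighted_Cauchy_Schwarz:
  fixes w f :: "'a \<Rightarrow> complex"
  assumes w: "integrable M w" and wf: "integrable M (\<lambda>y. w y * f y)" and wf2: "integrable M (\<lambda>y. norm (w y) * (norm (f y))\<^sup>2)"
    and N: "N > 0" "(LINT y|M. norm (w y)) \<le> N"
  shows "(norm (LINT y|M. w y * f y))\<^sup>2 \<le> N * (LINT y|M. norm (w y) * (norm (f y))\<^sup>2)"
proof (rule square_le_from_AMGM)
  fix t :: real assume t: "t > 0"
  have "2 * norm (LINT y|M. w y * f y) = norm (LINT y|M. 2 * (w y * f y))" by (simp add: norm_mult)
  also have "\<dots> \<le> (LINT y|M. t * norm (w y) + (norm (w y) * (norm (f y))\<^sup>2) / t)"
  proof (rule norm_integral_le_integral)
    show "integrable M (\<lambda>y. t * norm (w y) + (norm (w y) * (norm (f y))\<^sup>2) / t)"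
      using w wf2 by (intro Bochner_Integration.integrable_add integrable_mult_right integrable_divide integrable_norm)
    fix y
    have "0 \<le> (norm (f y) - t)\<^sup>2 / t" using t by simp
    then have "2 * norm (f y) \<le> t + (norm (f y))\<^sup>2 / t" using t by (simp add: power2_eq_square field_simps)
    from mult_left_mono[OF this, of "norm (w y)"]
    show "norm (2 * (w y * f y)) \<le> t * norm (w y) + (norm (w y) * (norm (f y))\<^sup>2) / t" by (simp add: norm_mult algebra_simps)
  qed
  also have "\<dots> = t * (LINT y|M. norm (w y)) + (LINT y|M. norm (w y) * (norm (f y))\<^sup>2) / t"
    using w wf2 by simp
  also have "\<dots> \<le> t * N + (LINT y|M. norm (w y) * (norm (f y))\<^sup>2) / t" using N t by simp
  finally show "2 * norm (LINT y|M. w y * f y) \<le> t * N + (LINT y|M. norm (w y) * (norm (f y))\<^sup>2) / t" .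
qed (use N in auto)

lemma L2z_norm1:
  assumes f: "f \<in> L2z \<alpha>" and \<alpha>: "\<alpha> > 0"
  shows "(LINT y|lborel. norm (f y))\<^sup>2 \<le> \<alpha> * l2n f"
proof -
  let ?I = "indicator {0<..<\<alpha>} :: real \<Rightarrow> complex"
  have e: "?I y * of_real (norm (f y)) = of_real (norm (f y))" "norm (?I y) * (norm (f y))\<^sup>2 = (norm (f y))\<^sup>2" for y
    using L2z_D(2)[OF f, of y] by (auto simp: indicator_def)
  have "(norm (LINT y|lborel. ?I y * of_real (norm (f y))))\<^sup>2 \<le> \<alpha> * (LINT y|lborel. norm (?I y) * (norm (of_real (norm (f y)) :: complex))\<^sup>2)"
  proof (rule weighted_Cauchy_Schwarz[OF integrable_indicator_interval _ _ \<alpha>])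
    show "integrable lborel (\<lambda>y. ?I y * of_real (norm (f y)))" unfolding e using L2z_integrable[OF f] by simp
    show "integrable lborel (\<lambda>y. norm (?I y) * (norm (of_real (norm (f y)) :: complex))\<^sup>2)" using L2z_D(3)[OF f] by (simp add: e)
    have "norm (?I y) = indicator {0<..<\<alpha>} y" for y by (auto simp: indicator_def)
    then show "(LINT y|lborel. norm (?I y)) \<le> \<alpha>" using \<alpha> by simp
  qed
  then show ?thesis unfolding e l2n_def by (simp add: e)
qed

lemma kop_L2z:
  assumes K: "kern \<alpha> C K" and f: "f \<in> L2z \<alpha>" and \<alpha>: "\<alpha> > 0"
  shows "kop K f \<in> L2z \<alpha>" "l2n (kop K f) \<le> (C * \<alpha>)\<^sup>2 * l2n f"
proof -
  have m [measurable]: "kop K f \<in> borel_measurable borel" by (rule kop_measurable[OF K L2z_D(1)[OF f]])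
  define B where "B = (C * (LINT y|lborel. norm (f y)))\<^sup>2"
  have b: "(norm (kop K f x))\<^sup>2 \<le> B * indicator {0<..<\<alpha>} x" for x
    using kop_bound[OF K L2z_integrable[OF f], of x] kop_zero[OF K, of x f] kernD(3)[OF K]
    by (cases "x \<in> {0<..<\<alpha>}") (auto simp: B_def intro!: power_mono)
  have i: "integrable lborel (\<lambda>x. B * indicator {0<..<\<alpha>} x)" using \<alpha> by (intro integrable_mult_right integrable_real_indicator) auto
  have j: "integrable lborel (\<lambda>x. (norm (kop K f x))\<^sup>2)"
    by (rule Bochner_Integration.integrable_bound[OF i]) (use b in \<open>auto intro: order_trans[OF _ abs_ge_self]\<close>)
  then show "kop K f \<in> L2z \<alpha>" unfolding L2z_def using m kop_zero[OF K] by auto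
  have "l2n (kop K f) \<le> (LINT x|lborel. B * indicator {0<..<\<alpha>} x)" unfolding l2n_def by (rule integral_mono[OF j i b])
  also have "\<dots> = B * \<alpha>" using \<alpha> by simp
  also have "\<dots> = C\<^sup>2 * \<alpha> * (LINT y|lborel. norm (f y))\<^sup>2" by (simp add: B_def power_mult_distrib)
  also have "\<dots> \<le> C\<^sup>2 * \<alpha> * (\<alpha> * l2n f)" using \<alpha> by (intro mult_left_mono L2z_norm1[OF f \<alpha>]) auto
  finally show "l2n (kop K f) \<le> (C * \<alpha>)\<^sup>2 * l2n f" by (simp add: power_mult_distrib power2_eq_square mult_ac)
qed

lemma l2n_add:
  assumes f: "f \<in> L2z \<alpha>" and g: "g \<in> L2z \<alpha>" shows "l2n (\<lambda>x. f x + g x) \<le> 2 * l2n f + 2 * l2n g"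
proof -
  have "l2n (\<lambda>x. f x + g x) \<le> (LINT x|lborel. 2 * (norm (f x))\<^sup>2 + 2 * (norm (g x))\<^sup>2)"
    unfolding l2n_def
  proof (rule integral_mono)
    show "integrable lborel (\<lambda>x. (norm (f x + g x))\<^sup>2)" by (rule L2z_D(3)[OF L2z_add[OF f g]])
    show "integrable lborel (\<lambda>x. 2 * (norm (f x))\<^sup>2 + 2 * (norm (g x))\<^sup>2)"
      by (intro Bochner_Integration.integrable_add integrable_mult_right L2z_D(3)[OF f] L2z_D(3)[OF g])
    fix x
    have "(norm (f x + g x))\<^sup>2 \<le> (norm (f x) + norm (g x))\<^sup>2" by (intro power_mono norm_triangle_ineq) auto
    also have "\<dots> \<le> 2 * (norm (f x))\<^sup>2 + 2 * (norm (g x))\<^sup>2"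
      using zero_le_power2[of "norm (f x) - norm (g x)"] by (simp add: power2_eq_square algebra_simps)
    finally show "(norm (f x + g x))\<^sup>2 \<le> 2 * (norm (f x))\<^sup>2 + 2 * (norm (g x))\<^sup>2" .
  qed
  then show ?thesis using L2z_D(3)[OF f] L2z_D(3)[OF g] by (simp add: l2n_def)
qed

lemma l2n_cmult: "l2n (\<lambda>x. c * f x) = (norm c)\<^sup>2 * l2n f"
  by (simp add: l2n_def norm_mult power_mult_distrib)

subsection \<open>Truncated convolutions on square-integrable functions\<close>

context
  fixes \<alpha> :: real and a :: complex and k :: "real \<Rightarrow> complex"
  assumes \<alpha>: "\<alpha> > 0" and k: "integrable lborel k"
begin

definition Wop :: "(real \<Rightarrow> complex) \<Rightarrow> real \<Rightarrow> complex" where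
  "Wop f x = indicator {0<..<\<alpha>} x * (a * f x + conv k f x)"

private lemma k_meas [measurable]: "k \<in> borel_measurable borel" by (rule integrable_lborel_measurable[OF k])

text \<open>Young's inequality: by Cauchy-Schwarz with weight |k| the square of the convolution is
  at most \<open>N\<close> times the convolution of |k| with |f|^2, whose integral factorises. The
  summand 1 in \<open>N\<close> makes it positive.\<close>

lemma conv_L2z:
  assumes f: "f \<in> L2z \<alpha>"
  shows "(\<lambda>x. indicator {0<..<\<alpha>} x * conv k f x) \<in> L2z \<alpha>"
    "l2n (\<lambda>x. indicator {0<..<\<alpha>} x * conv k f x) \<le> (1 + (LINT x|lborel. norm (k x)))\<^sup>2 * l2n f"
proof -
  note [measurable] = L2z_D(1)[OF f]
  define N where "N = 1 + (LINT x|lborel. norm (k x))"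
  have N: "N > 0" "N \<ge> (LINT x|lborel. norm (k x))" unfolding N_def by (auto intro: add_pos_nonneg)
  \<comment> \<open>Nonnegative functions are made complex-valued so that the results on
    \<open>conv\<close> apply.\<close>
  define q where "q x = complex_of_real ((norm (f x))\<^sup>2)" for x
  define k' where "k' x = complex_of_real (norm (k x))" for x
  have k': "integrable lborel k'" and q: "integrable lborel q"
    unfolding k'_def q_def using k L2z_D(3)[OF f] by (auto simp del: of_real_power)
  have "AE x in lborel. (norm (indicator {0<..<\<alpha>} x * conv k f x))\<^sup>2 \<le> N * norm (conv k' q x)"
    using integrable_conv(2)[OF k L2z_integrable[OF f]] integrable_conv(2)[OF k' q]
  proof eventually_elim
    case (elim x)
    have i2: "integrable lborel (\<lambda>y. norm (k (x - y)) * (norm (f y))\<^sup>2)"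
      using integrable_norm[OF elim(2)] by (simp add: k'_def q_def norm_mult norm_power)
    have "(norm (conv k f x))\<^sup>2 \<le> N * (LINT y|lborel. norm (k (x - y)) * (norm (f y))\<^sup>2)"
      unfolding conv_def
    proof (rule weighted_Cauchy_Schwarz[OF integrable_reflect_shift(1)[OF k] elim(1) i2 N(1)])
      have "(LINT y|lborel. norm (k (x - y))) = (LINT y|lborel. norm (k y))"
        using lborel_integral_real_affine[of "-1" "\<lambda>y. norm (k y)" x] by simp
      then show "(LINT y|lborel. norm (k (x - y))) \<le> N" using N by simp
    qed
    also have "(LINT y|lborel. norm (k (x - y)) * (norm (f y))\<^sup>2) = norm (conv k' q x)"
    proof -
      have "conv k' q x = of_real (LINT y|lborel. norm (k (x - y)) * (norm (f y))\<^sup>2)"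
        unfolding conv_def k'_def q_def by (simp flip: of_real_mult of_real_power)
      then show ?thesis by simp
    qed
    finally show ?case by (auto simp: indicator_def N(1) less_imp_le)
  qed
  note bd = this
  have ci: "integrable lborel (\<lambda>x. N * norm (conv k' q x))"
    by (intro integrable_mult_right integrable_norm integrable_conv k' q)
  have fi: "integrable lborel (\<lambda>x. (norm (indicator {0<..<\<alpha>} x * conv k f x))\<^sup>2)"
  proof (rule Bochner_Integration.integrable_bound[OF ci])
    show "AE x in lborel. norm ((norm (indicator {0<..<\<alpha>} x * conv k f x))\<^sup>2) \<le> norm (N * norm (conv k' q x))"
      using bd by eventually_elim (use N in auto)
  qed measurable
  then show "(\<lambda>x. indicator {0<..<\<alpha>} x * conv k f x) \<in> L2z \<alpha>" unfolding L2z_def by auto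
  have "l2n (\<lambda>x. indicator {0<..<\<alpha>} x * conv k f x) \<le> (LINT x|lborel. N * norm (conv k' q x))"
    unfolding l2n_def by (rule integral_mono_AE[OF fi ci bd])
  also have "\<dots> = N * (LINT x|lborel. norm (conv k' q x))" by simp
  also have "(LINT x|lborel. norm (conv k' q x)) = norm (integral\<^sup>L lborel (conv k' q))"
  proof -
    have cr: "conv k' q x = of_real (LINT y|lborel. norm (k (x - y)) * (norm (f y))\<^sup>2)" for x
      unfolding conv_def k'_def q_def by (simp flip: of_real_mult of_real_power)
    show ?thesis unfolding cr[abs_def] by simp
  qed
  also have "\<dots> = (LINT x|lborel. norm (k x)) * l2n f"
    unfolding integral_conv[OF k' q] unfolding k'_def q_def l2n_def by (simp add: norm_mult flip: of_real_power)
  also have "N * \<dots> \<le> N\<^sup>2 * l2n f"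
    using N l2n_nonneg[of f] by (simp add: power2_eq_square mult.assoc mult_left_mono mult_right_mono)
  finally show "l2n (\<lambda>x. indicator {0<..<\<alpha>} x * conv k f x) \<le> (1 + (LINT x|lborel. norm (k x)))\<^sup>2 * l2n f"
    unfolding N_def .
qed

lemma Wop_eq: "f \<in> L2z \<alpha> \<Longrightarrow> Wop f x = a * f x + indicator {0<..<\<alpha>} x * conv k f x"
  using L2z_D(2)[of f \<alpha> x] by (auto simp: Wop_def indicator_def)

lemma Wop_L2z: assumes f: "f \<in> L2z \<alpha>" shows "Wop f \<in> L2z \<alpha>"
proof -
  have "Wop f = (\<lambda>x. a * f x + indicator {0<..<\<alpha>} x * conv k f x)" using Wop_eq[OF f] by (rule ext)
  then show ?thesis using L2z_add[OF L2z_cmult[OF f, of a] conv_L2z(1)[OF f]] by simp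
qed

lemma Wop_bounded:
  assumes f: "f \<in> L2z \<alpha>"
  shows "l2n (Wop f) \<le> (2 * (norm a)\<^sup>2 + 2 * (1 + (LINT x|lborel. norm (k x)))\<^sup>2) * l2n f"
proof -
  have "l2n (Wop f) = l2n (\<lambda>x. a * f x + indicator {0<..<\<alpha>} x * conv k f x)" using Wop_eq[OF f] by (simp add: l2n_def)
  also have "\<dots> \<le> 2 * l2n (\<lambda>x. a * f x) + 2 * l2n (\<lambda>x. indicator {0<..<\<alpha>} x * conv k f x)"
    by (rule l2n_add[OF L2z_cmult[OF f] conv_L2z(1)[OF f]])
  also have "\<dots> \<le> 2 * ((norm a)\<^sup>2 * l2n f) + 2 * ((1 + (LINT x|lborel. norm (k x)))\<^sup>2 * l2n f)"
    unfolding l2n_cmult using conv_L2z(2)[OF f] by simp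
  finally show ?thesis by (simp add: algebra_simps)
qed

lemma Wop_linear:
  assumes f: "f \<in> L2z \<alpha>" and g: "g \<in> L2z \<alpha>"
  shows "AE x in lborel. Wop (\<lambda>y. b * f y + c * g y) x = b * Wop f x + c * Wop g x"
  using integrable_conv(2)[OF k L2z_integrable[OF f]] integrable_conv(2)[OF k L2z_integrable[OF g]]
proof eventually_elim
  case (elim x)
  have "conv k (\<lambda>y. b * f y + c * g y) x = b * conv k f x + c * conv k g x"
    using conv_add_right[of k x "\<lambda>y. b * f y" "\<lambda>y. c * g y"] integrable_mult_right[OF elim(1), of b] integrable_mult_right[OF elim(2), of c]
    by (simp add: mult.left_commute conv_cmult_right)
  then show ?case by (simp add: Wop_def algebra_simps)
qed

text \<open>The transposed kernel k(y - x) is the original one conjugated by x -> \<alpha> -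
  x.\<close>

lemma Wop_transpose:
  assumes f: "f \<in> L2z \<alpha>" and h: "h \<in> L2z \<alpha>"
  shows "(LINT x|lborel. Wop f x * h x) = (LINT x|lborel. f x * Wop (\<lambda>y. h (\<alpha> - y)) (\<alpha> - x))"
proof -
  note [measurable] = L2z_D(1)[OF f] L2z_D(1)[OF h]
  define h' where "h' y = h (\<alpha> - y)" for y
  have h': "h' \<in> L2z \<alpha>" unfolding h'_def by (rule L2z_reflect[OF h])
  \<comment> \<open>The product of \<open>f\<close> and \<open>h\<close> is dominated by |f|^2 +
    |h|^2, which reduces absolute integrability to two translation kernels.\<close>
  have P: "integrable (lborel \<Otimes>\<^sub>M lborel) (\<lambda>(x, y). k (x - y) * f y * h x)"
  proof -
    define F where "F x = complex_of_real ((norm (f x))\<^sup>2)" for x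
    define H where "H x = complex_of_real ((norm (h x))\<^sup>2)" for x
    have FH: "integrable lborel F" "integrable lborel H"
      unfolding F_def H_def using L2z_D(3)[OF f] L2z_D(3)[OF h] by (auto simp del: of_real_power)
    have i1: "integrable (lborel \<Otimes>\<^sub>M lborel) (\<lambda>(x, y). k (x - y) * F y)" by (rule integrable_prod_translate[OF k FH(1)])
    have "integrable (lborel \<Otimes>\<^sub>M lborel) (\<lambda>(y, x). k (- (y - x)) * H x)"
      using integrable_prod_translate[OF integrable_reflect_shift(5)[OF k] FH(2)] .
    from lborel_pair.integrable_product_swap[OF this]
    have i2: "integrable (lborel \<Otimes>\<^sub>M lborel) (\<lambda>(x, y). k (x - y) * H x)" by simp
    have "integrable (lborel \<Otimes>\<^sub>M lborel) (\<lambda>z. norm (case z of (x, y) \<Rightarrow> k (x - y) * F y) + norm (case z of (x, y) \<Rightarrow> k (x - y) * H x))"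
      by (intro Bochner_Integration.integrable_add integrable_norm i1 i2)
    then show ?thesis
    proof (rule Bochner_Integration.integrable_bound)
      show "(\<lambda>(x, y). k (x - y) * f y * h x) \<in> borel_measurable (lborel \<Otimes>\<^sub>M lborel)" by measurable
      show "AE z in lborel \<Otimes>\<^sub>M lborel. norm (case z of (x, y) \<Rightarrow> k (x - y) * f y * h x) \<le>
        norm (norm (case z of (x, y) \<Rightarrow> k (x - y) * F y) + norm (case z of (x, y) \<Rightarrow> k (x - y) * H x))"
      proof (rule AE_I2)
        fix z :: "real \<times> real"
        obtain x y where z: "z = (x, y)" by (cases z)
        have "2 * (norm (f y) * norm (h x)) \<le> (norm (f y))\<^sup>2 + (norm (h x))\<^sup>2"
          using zero_le_power2[of "norm (f y) - norm (h x)"] by (simp add: power2_eq_square algebra_simps)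
        moreover have "norm (f y) * norm (h x) \<ge> 0" by simp
        ultimately have "norm (f y) * norm (h x) \<le> (norm (f y))\<^sup>2 + (norm (h x))\<^sup>2" by linarith
        from mult_left_mono[OF this, of "norm (k (x - y))"]
        show "norm (case z of (x, y) \<Rightarrow> k (x - y) * f y * h x) \<le>
          norm (norm (case z of (x, y) \<Rightarrow> k (x - y) * F y) + norm (case z of (x, y) \<Rightarrow> k (x - y) * H x))"
          by (simp add: z norm_mult F_def H_def norm_power algebra_simps)
      qed
    qed
  qed
  have c1: "integrable lborel (\<lambda>x. indicator {0<..<\<alpha>} x * conv k f x * h x)"
    by (rule L2z_product_integrable[OF conv_L2z(1)[OF f] h])
  have c2: "integrable lborel (\<lambda>x. f x * (indicator {0<..<\<alpha>} (\<alpha> - x) * conv k h' (\<alpha> - x)))"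
    using L2z_product_integrable[OF f L2z_reflect[OF conv_L2z(1)[OF h']]] by simp
  have fh: "integrable lborel (\<lambda>x. f x * h x)" by (rule L2z_product_integrable[OF f h])
  have "(LINT x|lborel. indicator {0<..<\<alpha>} x * conv k f x * h x) = (LINT x|lborel. (LINT y|lborel. k (x - y) * f y * h x))"
  proof (intro Bochner_Integration.integral_cong refl)
    fix x
    have "(LINT y|lborel. k (x - y) * f y * h x) = conv k f x * h x" by (simp add: conv_def)
    then show "indicator {0<..<\<alpha>} x * conv k f x * h x = (LINT y|lborel. k (x - y) * f y * h x)"
      using L2z_D(2)[OF h, of x] by (auto simp: indicator_def)
  qed
  also have "\<dots> = (LINT y|lborel. (LINT x|lborel. k (x - y) * f y * h x))"
    by (rule lborel_pair.Fubini_integral[symmetric]) (rule P)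
  also have "\<dots> = (LINT y|lborel. f y * (indicator {0<..<\<alpha>} (\<alpha> - y) * conv k h' (\<alpha> - y)))"
  proof (intro Bochner_Integration.integral_cong refl)
    fix y
    have "(LINT x|lborel. k (x - y) * f y * h x) = f y * (LINT x|lborel. k (x - y) * h x)"
      by (simp add: mult_ac flip: integral_mult_right_zero)
    also have "(LINT x|lborel. k (x - y) * h x) = (LINT x|lborel. k (\<alpha> - x - y) * h (\<alpha> - x))"
      by (rule integral_reflect_shift(1)[symmetric])
    also have "\<dots> = conv k h' (\<alpha> - y)" unfolding conv_def h'_def by (simp add: algebra_simps)
    finally show "(LINT x|lborel. k (x - y) * f y * h x) = f y * (indicator {0<..<\<alpha>} (\<alpha> - y) * conv k h' (\<alpha> - y))"
      using L2z_D(2)[OF f, of y] by (auto simp: indicator_def)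
  qed
  finally have c: "(LINT x|lborel. indicator {0<..<\<alpha>} x * conv k f x * h x) = 
    (LINT y|lborel. f y * (indicator {0<..<\<alpha>} (\<alpha> - y) * conv k h' (\<alpha> - y)))" .
  have "(LINT x|lborel. Wop f x * h x) = (LINT x|lborel. a * (f x * h x) + indicator {0<..<\<alpha>} x * conv k f x * h x)"
    using Wop_eq[OF f] by (intro Bochner_Integration.integral_cong refl) (simp add: algebra_simps)
  also have "\<dots> = a * (LINT x|lborel. f x * h x) + (LINT x|lborel. indicator {0<..<\<alpha>} x * conv k f x * h x)"
    using fh c1 by simp
  also have "\<dots> = (LINT x|lborel. a * (f x * h x) + f x * (indicator {0<..<\<alpha>} (\<alpha> - x) * conv k h' (\<alpha> - x)))"
    unfolding c using fh c2 by simp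
  also have "\<dots> = (LINT x|lborel. f x * Wop h' (\<alpha> - x))"
    unfolding Wop_eq[OF h'] by (intro Bochner_Integration.integral_cong refl) (simp add: h'_def algebra_simps)
  finally show ?thesis unfolding h'_def .
qed

end

definition idk :: "complex \<Rightarrow> (real \<Rightarrow> real \<Rightarrow> complex) \<Rightarrow> (real \<Rightarrow> complex) \<Rightarrow> real \<Rightarrow> complex" where
  "idk b K f x = b * f x + kop K f x"

lemma idk_L2z:
  assumes "kern \<alpha> C K" "f \<in> L2z \<alpha>" "\<alpha> > 0" shows "idk b K f \<in> L2z \<alpha>"
  unfolding idk_def[abs_def] by (intro L2z_add L2z_cmult kop_L2z[OF assms] assms)

lemma idk_bounded:
  assumes K: "kern \<alpha> C K" and f: "f \<in> L2z \<alpha>" and \<alpha>: "\<alpha> > 0"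
  shows "l2n (idk b K f) \<le> (2 * (norm b)\<^sup>2 + 2 * (C * \<alpha>)\<^sup>2) * l2n f"
proof -
  have "l2n (idk b K f) \<le> 2 * l2n (\<lambda>x. b * f x) + 2 * l2n (kop K f)"
    unfolding idk_def[abs_def] by (rule l2n_add[OF L2z_cmult[OF f] kop_L2z(1)[OF K f \<alpha>]])
  also have "\<dots> \<le> 2 * ((norm b)\<^sup>2 * l2n f) + 2 * ((C * \<alpha>)\<^sup>2 * l2n f)"
    unfolding l2n_cmult using kop_L2z(2)[OF K f \<alpha>] by simp
  finally show ?thesis by (simp add: algebra_simps)
qed

lemma idk_transpose:
  assumes K: "kern \<alpha> C K" and f: "f \<in> L2z \<alpha>" and h: "h \<in> L2z \<alpha>" and \<alpha>: "\<alpha> > 0"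
  shows "(LINT x|lborel. idk b (\<lambda>x y. K (\<alpha> - y) (\<alpha> - x)) f x * h x) = (LINT x|lborel. f x * idk b K (\<lambda>y. h (\<alpha> - y)) (\<alpha> - x))"
proof -
  let ?K = "\<lambda>x y. K (\<alpha> - y) (\<alpha> - x)"
  have K': "kern \<alpha> C ?K" by (rule kern_reflect_transpose[OF K])
  have h': "(\<lambda>y. h (\<alpha> - y)) \<in> L2z \<alpha>" by (rule L2z_reflect[OF h])
  have fh: "integrable lborel (\<lambda>x. f x * h x)" by (rule L2z_product_integrable[OF f h])
  have i1: "integrable lborel (\<lambda>x. kop ?K f x * h x)" by (rule L2z_product_integrable[OF kop_L2z(1)[OF K' f \<alpha>] h])
  have i2: "integrable lborel (\<lambda>x. f x * kop K (\<lambda>y. h (\<alpha> - y)) (\<alpha> - x))"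
    by (rule L2z_product_integrable[OF f L2z_reflect[OF kop_L2z(1)[OF K h' \<alpha>]]])
  have "(LINT x|lborel. kop ?K f x * h x) = (LINT x|lborel. h x * (LINT y|lborel. ?K x y * f y))"
    by (simp add: kop_def mult.commute)
  also have "\<dots> = (LINT y|lborel. (LINT x|lborel. h x * ?K x y) * f y)"
    by (rule Fubini_bounded_kernel(2)[OF L2z_integrable[OF h] L2z_integrable[OF f] kernD(1)[OF K'] kernD(2)[OF K']])
  also have "\<dots> = (LINT y|lborel. f y * kop K (\<lambda>y. h (\<alpha> - y)) (\<alpha> - y))"
  proof (intro Bochner_Integration.integral_cong refl)
    fix y
    have "(LINT x|lborel. h x * K (\<alpha> - y) (\<alpha> - x)) = (LINT x|lborel. h (\<alpha> - x) * K (\<alpha> - y) (\<alpha> - (\<alpha> - x)))"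
      by (rule integral_reflect_shift(1)[symmetric])
    then show "(LINT x|lborel. h x * K (\<alpha> - y) (\<alpha> - x)) * f y = f y * kop K (\<lambda>y. h (\<alpha> - y)) (\<alpha> - y)"
      by (simp add: kop_def mult.commute)
  qed
  finally have k: "(LINT x|lborel. kop ?K f x * h x) = (LINT y|lborel. f y * kop K (\<lambda>y. h (\<alpha> - y)) (\<alpha> - y))" .
  have "(LINT x|lborel. idk b ?K f x * h x) = (LINT x|lborel. b * (f x * h x) + kop ?K f x * h x)"
    by (intro Bochner_Integration.integral_cong refl) (simp add: idk_def algebra_simps)
  also have "\<dots> = b * (LINT x|lborel. f x * h x) + (LINT x|lborel. kop ?K f x * h x)"
    using fh i1 by simp
  also have "\<dots> = (LINT x|lborel. b * (f x * h x) + f x * kop K (\<lambda>y. h (\<alpha> - y)) (\<alpha> - x))"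
    unfolding k using fh i2 by simp
  also have "\<dots> = (LINT x|lborel. f x * idk b K (\<lambda>y. h (\<alpha> - y)) (\<alpha> - x))"
    by (intro Bochner_Integration.integral_cong refl) (simp add: idk_def algebra_simps)
  finally show ?thesis .
qed

text \<open>The pairing is bilinear, so the test function is the complex conjugate of
  \<open>d\<close>.\<close>

lemma L2z_eq_zero:
  assumes d: "d \<in> L2z \<alpha>" and z: "\<And>h. h \<in> L2z \<alpha> \<Longrightarrow> (LINT x|lborel. d x * h x) = 0"
  shows "AE x in lborel. d x = 0"
proof -
  have "(LINT x|lborel. d x * cnj (d x)) = 0" by (rule z[OF L2z_cnj[OF d]])
  then have "(LINT x|lborel. complex_of_real ((norm (d x))\<^sup>2)) = 0" by (simp only: complex_norm_square)
  then have "(LINT x|lborel. (norm (d x))\<^sup>2) = 0" by (simp del: of_real_power)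
  then have "AE x in lborel. (norm (d x))\<^sup>2 = 0"
    by (subst (asm) integral_nonneg_eq_0_iff_AE) (use L2z_D(3)[OF d] in auto)
  then show ?thesis by eventually_elim simp
qed

text \<open>A right inverse of the form identity plus kernel is a left inverse: the reflection
  \<open>x \<mapsto> \<alpha> - x\<close> turns a truncated convolution into its transpose.\<close>

lemma right_inverse_imp_left_inverse:
  assumes \<alpha>: "\<alpha> > 0" and k: "integrable lborel k" and K: "kern \<alpha> C K"
    and right: "\<And>f. f \<in> L2z \<alpha> \<Longrightarrow> AE x in lborel. Wop \<alpha> a k (idk b K f) x = f x"
    and f: "f \<in> L2z \<alpha>"
  shows "AE x in lborel. idk b K (Wop \<alpha> a k f) x = f x"
proof -
  let ?K = "\<lambda>x y. K (\<alpha> - y) (\<alpha> - x)"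
  let ?W = "Wop \<alpha> a k"
  have K': "kern \<alpha> C ?K" by (rule kern_reflect_transpose[OF K])
  have left: "AE x in lborel. idk b ?K (?W g) x = g x" if g: "g \<in> L2z \<alpha>" for g
  proof -
    have Wg: "?W g \<in> L2z \<alpha>" by (rule Wop_L2z[OF \<alpha> k g])
    have SW: "idk b ?K (?W g) \<in> L2z \<alpha>" by (rule idk_L2z[OF K' Wg \<alpha>])
    define d where "d x = idk b ?K (?W g) x + (-1) * g x" for x
    have d: "d \<in> L2z \<alpha>" unfolding d_def[abs_def] by (rule L2z_add[OF SW L2z_cmult[OF g]])
    have "AE x in lborel. d x = 0"
    proof (rule L2z_eq_zero[OF d])
      fix h assume h: "h \<in> L2z \<alpha>"
      have h': "(\<lambda>y. h (\<alpha> - y)) \<in> L2z \<alpha>" by (rule L2z_reflect[OF h])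
      let ?S = "idk b K (\<lambda>y. h (\<alpha> - y))"
      have S: "?S \<in> L2z \<alpha>" by (rule idk_L2z[OF K h' \<alpha>])
      have Sr: "(\<lambda>x. ?S (\<alpha> - x)) \<in> L2z \<alpha>" by (rule L2z_reflect[OF S])
      have "(LINT x|lborel. idk b ?K (?W g) x * h x) = (LINT x|lborel. ?W g x * ?S (\<alpha> - x))"
        by (rule idk_transpose[OF K Wg h \<alpha>])
      also have "\<dots> = (LINT x|lborel. g x * ?W (\<lambda>y. ?S (\<alpha> - (\<alpha> - y))) (\<alpha> - x))"
        by (rule Wop_transpose[OF \<alpha> k g Sr])
      also have "\<dots> = (LINT x|lborel. g x * h x)"
      proof (rule integral_cong_AE)
        have "AE x in lborel. ?W ?S (\<alpha> - x) = h (\<alpha> - (\<alpha> - x))" by (rule AE_reflect_shift[OF right[OF h']])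
        then show "AE x in lborel. g x * ?W (\<lambda>y. ?S (\<alpha> - (\<alpha> - y))) (\<alpha> - x) = g x * h x"
          by eventually_elim simp
        have "(\<lambda>x. ?W ?S (\<alpha> - x)) \<in> L2z \<alpha>" by (rule L2z_reflect[OF Wop_L2z[OF \<alpha> k S]])
        from L2z_D(1)[OF this] L2z_D(1)[OF g] L2z_D(1)[OF h]
        show "(\<lambda>x. g x * ?W (\<lambda>y. ?S (\<alpha> - (\<alpha> - y))) (\<alpha> - x)) \<in> borel_measurable lborel"
          "(\<lambda>x. g x * h x) \<in> borel_measurable lborel" by simp_all
      qed
      finally have e: "(LINT x|lborel. idk b ?K (?W g) x * h x) = (LINT x|lborel. g x * h x)" .
      have "(LINT x|lborel. d x * h x) = (LINT x|lborel. idk b ?K (?W g) x * h x - g x * h x)"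
        by (intro Bochner_Integration.integral_cong refl) (simp add: d_def algebra_simps)
      also have "\<dots> = 0" using L2z_product_integrable[OF SW h] L2z_product_integrable[OF g h] e by simp
      finally show "(LINT x|lborel. d x * h x) = 0" .
    qed
    then show ?thesis by eventually_elim (simp add: d_def)
  qed
  have Wf: "?W f \<in> L2z \<alpha>" by (rule Wop_L2z[OF \<alpha> k f])
  define g where "g = ?W f"
  have g: "g \<in> L2z \<alpha>" using Wf by (simp add: g_def)
  have Sg: "idk b K g \<in> L2z \<alpha>" by (rule idk_L2z[OF K g \<alpha>])
  have WSg: "?W (idk b K g) \<in> L2z \<alpha>" by (rule Wop_L2z[OF \<alpha> k Sg])
  have kc: "kop ?K (?W (idk b K g)) x = kop ?K g x" for x
    by (rule kop_cong_AE[OF K' right[OF g] L2z_D(1)[OF WSg] L2z_D(1)[OF g]])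
  \<comment> \<open>With S' the left inverse found above, S g = S' W S g = S' g for g = W f, and S'
    W f = f.\<close>
  show ?thesis using left[OF Sg] right[OF g] left[OF f]
  proof eventually_elim
    case (elim x)
    have "idk b ?K g x = idk b ?K (?W (idk b K g)) x" using elim(2) by (simp add: idk_def kc)
    then show ?case using elim unfolding g_def by simp
  qed
qed

text \<open>If W S = 1 + E and (1 + E)(1 + R) = 1, then S(1 + R) is a right inverse;
  \<open>M\<close> is the kernel of S R, and its bound is the sum of the bounds of its two parts.
  The left inverse comes from the transposition argument.\<close>

lemma inverse_from_approximate:
  assumes \<alpha>: "\<alpha> > 0" and k: "integrable lborel k" and K: "kern \<alpha> C K" and E: "kern \<alpha> \<epsilon> E" and small: "\<epsilon> * \<alpha> \<le> 1 / 2"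
    and app: "\<And>f. f \<in> L2z \<alpha> \<Longrightarrow> AE x in lborel. Wop \<alpha> a k (idk b K f) x = f x + kop E f x"
  shows "\<exists>M. kern \<alpha> (2 * \<epsilon> * (norm b + \<alpha> * C)) M \<and>
    (\<forall>f\<in>L2z \<alpha>. (AE x in lborel. Wop \<alpha> a k (idk b (\<lambda>x y. K x y + M x y) f) x = f x) \<and>
      (AE x in lborel. idk b (\<lambda>x y. K x y + M x y) (Wop \<alpha> a k f) x = f x))"
proof -
  obtain R where R: "kern \<alpha> (2 * \<epsilon>) R" "\<And>x y. R x y + E x y + kcomp E R x y = 0"
    using Neumann_kernel[OF E \<alpha> small] by blast
  define M where "M x y = b * R x y + kcomp K R x y" for x y
  have KR: "kern \<alpha> (C * \<alpha> * (2 * \<epsilon>)) (kcomp K R)" by (rule kern_comp[OF K R(1) \<alpha>])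
  have bR: "kern \<alpha> (norm b * (2 * \<epsilon>)) (\<lambda>x y. b * R x y)" by (rule kern_cmult[OF R(1)])
  have M: "kern \<alpha> (2 * \<epsilon> * (norm b + \<alpha> * C)) M"
    using kern_add[OF bR KR] unfolding M_def[abs_def] by (simp add: algebra_simps)
  have KM: "kern \<alpha> (C + 2 * \<epsilon> * (norm b + \<alpha> * C)) (\<lambda>x y. K x y + M x y)" by (rule kern_add[OF K M])
  have right: "AE x in lborel. Wop \<alpha> a k (idk b (\<lambda>x y. K x y + M x y) f) x = f x" if f: "f \<in> L2z \<alpha>" for f
  proof -
    note fi = L2z_integrable[OF f]
    define g where "g x = f x + kop R f x" for x
    have Rf: "kop R f \<in> L2z \<alpha>" by (rule kop_L2z(1)[OF R(1) f \<alpha>])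
    have g: "g \<in> L2z \<alpha>" unfolding g_def[abs_def] by (rule L2z_add[OF f Rf])
    have "idk b K g x = idk b (\<lambda>x y. K x y + M x y) f x" for x
    proof -
      have "kop K g x = kop K f x + kop (kcomp K R) f x"
        unfolding g_def[abs_def] kop_add[OF K fi L2z_integrable[OF Rf]] kop_comp[OF K R(1) fi] ..
      moreover have "kop (\<lambda>x y. K x y + M x y) f x = kop K f x + (b * kop R f x + kop (kcomp K R) f x)"
        unfolding kop_add_kernel[OF K M fi] unfolding M_def[abs_def] kop_add_kernel[OF bR KR fi] kop_cmult_kernel ..
      ultimately show ?thesis by (simp add: idk_def g_def algebra_simps)
    qed
    then have e: "idk b K g = idk b (\<lambda>x y. K x y + M x y) f" by (rule ext)
    have z: "kop R f x + kop E g x = 0" for x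
    proof -
      have ER: "kern \<alpha> (\<epsilon> * \<alpha> * (2 * \<epsilon>)) (kcomp E R)" by (rule kern_comp[OF E R(1) \<alpha>])
      have "kop E g x = kop E f x + kop (kcomp E R) f x"
        unfolding g_def[abs_def] kop_add[OF E fi L2z_integrable[OF Rf]] kop_comp[OF E R(1) fi] ..
      then have "kop R f x + kop E g x = kop (\<lambda>x y. R x y + E x y + kcomp E R x y) f x"
        unfolding kop_add_kernel[OF kern_add[OF R(1) E] ER fi] kop_add_kernel[OF R(1) E fi] by simp
      also have "\<dots> = 0" unfolding R(2) by (simp add: kop_def)
      finally show ?thesis .
    qed
    show ?thesis using app[OF g] unfolding e
    proof eventually_elim
      case (elim x)
      then show ?case using z[of x] unfolding g_def by (simp add: add.assoc)
    qed
  qed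
  show ?thesis
    by (intro exI[of _ M] conjI ballI M right right_inverse_imp_left_inverse[OF \<alpha> k KM right])
qed

subsection \<open>The Hilbert space \<open>L\<^sup>2(0,\<alpha>)\<close>\<close>

lemma proj_op_scaleR: "indicator {0<..<\<alpha>} x *\<^sub>R f x = proj_op \<alpha> f x"
  by (simp add: proj_op_def indicator_def)

lemma L2_iff_L2z: "f \<in> L2 \<alpha> \<longleftrightarrow> proj_op \<alpha> f \<in> L2z \<alpha>"
proof -
  have m: "f \<in> borel_measurable (ivl \<alpha>) \<longleftrightarrow> proj_op \<alpha> f \<in> borel_measurable borel"
    by (subst borel_measurable_restrict_space_iff) (auto simp: proj_op_scaleR cong: measurable_cong)
  have "indicator {0<..<\<alpha>} x *\<^sub>R (norm (f x))\<^sup>2 = (norm (proj_op \<alpha> f x))\<^sup>2" for x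
    by (simp add: proj_op_def indicator_def)
  then have i: "integrable (ivl \<alpha>) (\<lambda>x. (norm (f x))\<^sup>2) \<longleftrightarrow> integrable lborel (\<lambda>x. (norm (proj_op \<alpha> f x))\<^sup>2)"
    by (subst integrable_restrict_space) auto
  show ?thesis unfolding L2_def L2z_def using m i by (auto simp: proj_op_def)
qed

lemma L2_norm_proj: "L2_norm \<alpha> f = sqrt (l2n (proj_op \<alpha> f))"
proof -
  have "indicator {0<..<\<alpha>} x *\<^sub>R (norm (f x))\<^sup>2 = (norm (proj_op \<alpha> f x))\<^sup>2" for x
    by (simp add: proj_op_def indicator_def)
  then show ?thesis unfolding L2_norm_def l2n_def by (subst integral_restrict_space) auto
qed

lemma proj_op_L2z: "f \<in> L2z \<alpha> \<Longrightarrow> proj_op \<alpha> f = f"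
  using L2z_D(2)[of f \<alpha>] by (auto simp: proj_op_def indicator_def fun_eq_iff)

lemma AE_ivl: "(AE x in ivl \<alpha>. P x) \<longleftrightarrow> (AE x in lborel. x \<in> {0<..<\<alpha>} \<longrightarrow> P x)"
  by (subst AE_restrict_space_iff) auto

lemma proj_op_linear: "proj_op \<alpha> (\<lambda>y. b * f y + c * g y) = (\<lambda>y. b * proj_op \<alpha> f y + c * proj_op \<alpha> g y)"
  by (simp add: proj_op_def fun_eq_iff algebra_simps)

lemma L2_operatorI:
  assumes L: "\<And>f. f \<in> L2z \<alpha> \<Longrightarrow> T f \<in> L2z \<alpha>"
    and lin: "\<And>f g b c. f \<in> L2z \<alpha> \<Longrightarrow> g \<in> L2z \<alpha> \<Longrightarrow> AE x in lborel. T (\<lambda>y. b * f y + c * g y) x = b * T f x + c * T g x"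
    and bd: "\<And>f. f \<in> L2z \<alpha> \<Longrightarrow> l2n (T f) \<le> C * l2n f" "C \<ge> 0"
  shows "L2_operator \<alpha> (\<lambda>f. T (proj_op \<alpha> f))"
  unfolding L2_operator_def
proof (intro conjI ballI allI)
  show "T (proj_op \<alpha> f) \<in> L2 \<alpha>" if "f \<in> L2 \<alpha>" for f
    using that L[of "proj_op \<alpha> f"] proj_op_L2z[of "T (proj_op \<alpha> f)" \<alpha>] unfolding L2_iff_L2z by simp
  show "AE x in ivl \<alpha>. T (proj_op \<alpha> (\<lambda>y. b * f y + c * g y)) x = b * T (proj_op \<alpha> f) x + c * T (proj_op \<alpha> g) x"
    if "f \<in> L2 \<alpha>" "g \<in> L2 \<alpha>" for f g b c
    using lin[of "proj_op \<alpha> f" "proj_op \<alpha> g" b c] that unfolding L2_iff_L2z proj_op_linear AE_ivl by auto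
  show "\<exists>C. \<forall>f\<in>L2 \<alpha>. L2_norm \<alpha> (T (proj_op \<alpha> f)) \<le> C * L2_norm \<alpha> f"
  proof (intro exI[of _ "sqrt C"] ballI)
    fix f assume "f \<in> L2 \<alpha>"
    then have f: "proj_op \<alpha> f \<in> L2z \<alpha>" unfolding L2_iff_L2z .
    show "L2_norm \<alpha> (T (proj_op \<alpha> f)) \<le> sqrt C * L2_norm \<alpha> f"
      unfolding L2_norm_proj proj_op_L2z[OF L[OF f]] real_sqrt_mult[symmetric] using bd(1)[OF f] by simp
  qed
qed

lemma trunc_wh_Wop: "trunc_wh \<alpha> a k f = Wop \<alpha> a k (proj_op \<alpha> f)" if "\<alpha> > 0" "integrable lborel k" for f
proof
  fix x
  have "(LINT y:{0<..}|lborel. k (x - y) * proj_op \<alpha> f y) = conv k (proj_op \<alpha> f) x"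
    unfolding conv_def set_lebesgue_integral_def
    by (intro Bochner_Integration.integral_cong refl) (auto simp: proj_op_def indicator_def)
  then show "trunc_wh \<alpha> a k f x = Wop \<alpha> a k (proj_op \<alpha> f) x"
    unfolding Wop_def[OF that] by (simp add: trunc_wh_def proj_op_def wh_op_def)
qed

lemma L2_inverse_idk:
  assumes \<alpha>: "\<alpha> > 0" and k: "integrable lborel k" and K: "kern \<alpha> C K"
    and right: "\<And>f. f \<in> L2z \<alpha> \<Longrightarrow> AE x in lborel. Wop \<alpha> a k (idk b K f) x = f x"
    and left: "\<And>f. f \<in> L2z \<alpha> \<Longrightarrow> AE x in lborel. idk b K (Wop \<alpha> a k f) x = f x"
  shows "L2_inverse \<alpha> (trunc_wh \<alpha> a k) (\<lambda>f. idk b K (proj_op \<alpha> f))"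
proof -
  have T: "trunc_wh \<alpha> a k = (\<lambda>f. Wop \<alpha> a k (proj_op \<alpha> f))" using trunc_wh_Wop[OF \<alpha> k] by (rule ext)
  have W: "L2_operator \<alpha> (\<lambda>f. Wop \<alpha> a k (proj_op \<alpha> f))"
    by (rule L2_operatorI[OF Wop_L2z[OF \<alpha> k] Wop_linear[OF \<alpha> k] Wop_bounded[OF \<alpha> k]]) auto
  have S: "L2_operator \<alpha> (\<lambda>f. idk b K (proj_op \<alpha> f))"
  proof (rule L2_operatorI)
    show "idk b K f \<in> L2z \<alpha>" if "f \<in> L2z \<alpha>" for f by (rule idk_L2z[OF K that \<alpha>])
    show "l2n (idk b K f) \<le> (2 * (norm b)\<^sup>2 + 2 * (C * \<alpha>)\<^sup>2) * l2n f" if "f \<in> L2z \<alpha>" for f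
      by (rule idk_bounded[OF K that \<alpha>])
    show "AE x in lborel. idk b K (\<lambda>y. d * f y + c * g y) x = d * idk b K f x + c * idk b K g x"
      if "f \<in> L2z \<alpha>" "g \<in> L2z \<alpha>" for f g d c
      using kop_add[OF K integrable_mult_right[OF L2z_integrable[OF that(1)], of d] integrable_mult_right[OF L2z_integrable[OF that(2)], of c]]
      by (simp add: idk_def kop_cmult algebra_simps)
  qed auto
  show ?thesis unfolding L2_inverse_def
  proof (intro conjI ballI)
    show "L2_operator \<alpha> (trunc_wh \<alpha> a k)" unfolding T by (rule W)
    show "L2_operator \<alpha> (\<lambda>f. idk b K (proj_op \<alpha> f))" by (rule S)
    fix f assume "f \<in> L2 \<alpha>"
    then have f: "proj_op \<alpha> f \<in> L2z \<alpha>" unfolding L2_iff_L2z .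
    show "AE x in ivl \<alpha>. idk b K (proj_op \<alpha> (trunc_wh \<alpha> a k f)) x = f x"
      unfolding T AE_ivl proj_op_L2z[OF Wop_L2z[OF \<alpha> k f]] using left[OF f]
      by eventually_elim (auto simp: proj_op_def)
    show "AE x in ivl \<alpha>. trunc_wh \<alpha> a k (idk b K (proj_op \<alpha> f)) x = f x"
      unfolding T AE_ivl proj_op_L2z[OF idk_L2z[OF K f \<alpha>]] using right[OF f]
      by eventually_elim (auto simp: proj_op_def)
  qed
qed

definition cut :: "real \<Rightarrow> (real \<Rightarrow> real \<Rightarrow> complex) \<Rightarrow> real \<Rightarrow> real \<Rightarrow> complex" where
  "cut \<alpha> K x y = indicator {0<..<\<alpha>} x * indicator {0<..<\<alpha>} y * K x y"

lemma kern_cut: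
  assumes m: "case_prod K \<in> borel_measurable (borel \<Otimes>\<^sub>M borel)"
    and b: "\<And>x y. x \<in> {0<..<\<alpha>} \<Longrightarrow> y \<in> {0<..<\<alpha>} \<Longrightarrow> norm (K x y) \<le> C" and C: "C \<ge> 0"
  shows "kern \<alpha> C (cut \<alpha> K)"
  unfolding kern_def
proof (intro conjI allI impI)
  note [measurable] = m
  show "case_prod (cut \<alpha> K) \<in> borel_measurable (borel \<Otimes>\<^sub>M borel)" unfolding cut_def[abs_def] by measurable
  show "norm (cut \<alpha> K x y) \<le> C" for x y
    using b[of x y] C by (cases "x \<in> {0<..<\<alpha>} \<and> y \<in> {0<..<\<alpha>}") (auto simp: cut_def)
qed (auto simp: cut_def)

lemma kop_cut:
  assumes "\<And>x. x \<notin> {0<..<\<alpha>} \<Longrightarrow> f x = 0" "x \<in> {0<..<\<alpha>}"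
  shows "kop (cut \<alpha> K) f x = (LINT y|lborel. K x y * f y)"
  unfolding kop_def cut_def
proof (intro Bochner_Integration.integral_cong refl)
  fix y show "indicator {0<..<\<alpha>} x * indicator {0<..<\<alpha>} y * K x y * f y = K x y * f y"
    using assms by (cases "y \<in> {0<..<\<alpha>}") auto
qed

section \<open>Kernels of the approximate inverse and of its error\<close>

context symbol
begin

text \<open>By \<open>constants\<close> this is 1/a, the inverse of the value of the symbol at
  infinity.\<close>

definition b\<^sub>0 :: complex where "b\<^sub>0 = c\<^sub>p * c\<^sub>m / (t\<^sub>p * t\<^sub>m)"

text \<open>The product of \<open>c\<^sub>p\<close> plus \<open>G\<^sub>p\<close> with
  \<open>c\<^sub>m\<close> plus \<open>G\<^sub>m\<close>, expanded without the product of the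
  constants. The intermediate variable is confined to (0,\<alpha>), because \<open>\<phi>\<close>
  lives there.\<close>

definition KU :: "real \<Rightarrow> real \<Rightarrow> real \<Rightarrow> complex" where
  "KU \<alpha> x z = (c\<^sub>p * G\<^sub>m (x - z) + c\<^sub>m * G\<^sub>p (x - z) + (LINT y|lborel. G\<^sub>p (x - y) * indicator {0<..<\<alpha>} y * G\<^sub>m (y - z))) / (t\<^sub>p * t\<^sub>m)"

text \<open>The kernel of the product of the two Hankel operators between reflections: the tensor
  square of \<open>e\<^sub>p\<close> followed by symmetry gives \<open>e\<^sub>p\<close> times
  \<open>\<zeta>\<close>, the rest is a convergent product of kernels.\<close>

definition KV :: "real \<Rightarrow> real \<Rightarrow> real \<Rightarrow> complex" where
  "KV \<alpha> x z = (e\<^sub>p (\<alpha> - x) * \<zeta> (\<alpha> - z) + half_conv (\<lambda>y. g\<^sub>m (- y)) G\<^sub>p (\<alpha> - x) (\<alpha> - z) / t\<^sub>p) / t\<^sub>m"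

definition KT :: "real \<Rightarrow> real \<Rightarrow> real \<Rightarrow> complex" where
  "KT \<alpha> x z = e\<^sub>p \<alpha> * \<tau>\<^sub>p (of_real p) * \<tau>\<^sub>m (- of_real p) * \<zeta> x * \<eta> z
     - \<tau>\<^sub>p (of_real p) * t\<^sub>p * \<zeta> x * \<zeta> (\<alpha> - z) - t\<^sub>m * \<tau>\<^sub>m (- of_real p) * \<eta> (\<alpha> - x) * \<eta> z
     + e\<^sub>p \<alpha> * \<tau>\<^sub>p (of_real p) * \<tau>\<^sub>m (- of_real p) * \<eta> (\<alpha> - x) * \<zeta> (\<alpha> - z)"

text \<open>Up to the nonzero factor -exp(ip\<alpha>) / (4 p^2
  \<open>\<tau>\<^sub>p(p) \<tau>\<^sub>m(-p) t\<^sub>p t\<^sub>m\<close>) this is the determinant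
  of the system expressing the main terms of \<open>trunc_zeta\<close> and \<open>trunc_eta\<close>
  through the two Hankel images of \<open>e\<^sub>p\<close>.\<close>

definition D :: "real \<Rightarrow> complex" where
  "D \<alpha> = t\<^sub>m * t\<^sub>p * e\<^sub>m \<alpha> - \<tau>\<^sub>p (of_real p) * \<tau>\<^sub>m (- of_real p) * e\<^sub>p \<alpha>"

definition A :: "real \<Rightarrow> complex" where "A \<alpha> = 2 * \<i> * of_real p / D \<alpha>"

definition kernel :: "real \<Rightarrow> real \<Rightarrow> real \<Rightarrow> complex" where
  "kernel \<alpha> = cut \<alpha> (\<lambda>x z. KU \<alpha> x z - KV \<alpha> x z + A \<alpha> * KT \<alpha> x z)"

lemma half_conv_minus_measurable:
  "case_prod (half_conv (\<lambda>y. g\<^sub>m (- y)) G\<^sub>p) \<in> borel_measurable (borel \<Otimes>\<^sub>M borel)"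
  "case_prod (half_conv g\<^sub>p (\<lambda>y. G\<^sub>m (- y))) \<in> borel_measurable (borel \<Otimes>\<^sub>M borel)"
  by (rule half_conv_measurable; measurable)+

lemma KU_measurable: "case_prod (KU \<alpha>) \<in> borel_measurable (borel \<Otimes>\<^sub>M borel)"
  unfolding KU_def[abs_def] by measurable

lemma KV_measurable: "case_prod (KV \<alpha>) \<in> borel_measurable (borel \<Otimes>\<^sub>M borel)"
proof -
  have [measurable]: "(\<lambda>(x, z). half_conv (\<lambda>y. g\<^sub>m (- y)) G\<^sub>p (\<alpha> - x) (\<alpha> - z)) \<in> borel_measurable (borel \<Otimes>\<^sub>M borel)"
    using measurable_compose[OF _ half_conv_minus_measurable(1), of "\<lambda>(s, z). (\<alpha> - s, \<alpha> - z)" "borel \<Otimes>\<^sub>M borel"] by (simp add: case_prod_beta')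
  show ?thesis unfolding KV_def[abs_def] by measurable
qed

lemma KT_measurable: "case_prod (KT \<alpha>) \<in> borel_measurable (borel \<Otimes>\<^sub>M borel)"
  unfolding KT_def[abs_def] by measurable

text \<open>The factor 1 + \<alpha> comes from the integral over (0,\<alpha>) of a product of two
  nondecaying kernels in \<open>KU\<close>; everything else is bounded, up to the factor
  \<open>A\<close>.\<close>

lemma kernel_kern: "\<exists>C\<ge>0. \<forall>\<alpha>>0. kern \<alpha> (C * (1 + \<alpha>) * (1 + norm (A \<alpha>))) (kernel \<alpha>)"
proof -
  obtain Cp where Cp: "\<And>x. norm (G\<^sub>p x) \<le> Cp" "Cp > 0" using G_bdd(1) by (metis bdd_measE)
  obtain Cm where Cm: "\<And>x. norm (G\<^sub>m x) \<le> Cm" "Cm > 0" using G_bdd(2) by (metis bdd_measE)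
  obtain Z where Z: "\<And>x. norm (\<zeta> x) \<le> Z" "Z > 0" using bdd_meas_zeta by (metis bdd_measE)
  obtain H where H: "\<And>x. norm (\<eta> x) \<le> H" "H > 0" using bdd_meas_eta by (metis bdd_measE)
  define c1 where "c1 = (norm c\<^sub>p * Cm + norm c\<^sub>m * Cp + Cp * Cm) / norm (t\<^sub>p * t\<^sub>m)"
  define g where "g = (LINT w|lborel. norm (g\<^sub>m (- w)))"
  define c2 where "c2 = (Z + g * Cp / norm t\<^sub>p) / norm t\<^sub>m"
  define c3 where "c3 = norm (\<tau>\<^sub>p (of_real p)) * norm (\<tau>\<^sub>m (- of_real p)) * Z * H + norm (\<tau>\<^sub>p (of_real p)) * norm t\<^sub>p * Z * Z
     + norm t\<^sub>m * norm (\<tau>\<^sub>m (- of_real p)) * H * H + norm (\<tau>\<^sub>p (of_real p)) * norm (\<tau>\<^sub>m (- of_real p)) * H * Z"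
  have g0: "g \<ge> 0" by (simp add: g_def)
  have nn: "c1 \<ge> 0" "c2 \<ge> 0" "c3 \<ge> 0" unfolding c1_def c2_def c3_def using Cp(2) Cm(2) Z(2) H(2) g0
    by (auto intro!: add_nonneg_nonneg divide_nonneg_nonneg mult_nonneg_nonneg)
  have e1: "norm (e\<^sub>p x) = 1" for x by (simp add: exp_fn_def)
  have ku: "norm (KU \<alpha> x z) \<le> c1 * (1 + \<alpha>)" if \<alpha>: "\<alpha> > 0" for \<alpha> x z
  proof -
    have "norm (LINT y|lborel. G\<^sub>p (x - y) * indicator {0<..<\<alpha>} y * G\<^sub>m (y - z)) \<le> (LINT y|lborel. Cp * Cm * indicator {0<..<\<alpha>} y)"
    proof (rule norm_integral_le_integral)
      show "integrable lborel (\<lambda>y. Cp * Cm * indicator {0<..<\<alpha>} y)" using \<alpha> by (intro integrable_mult_right integrable_real_indicator) auto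
      show "norm (G\<^sub>p (x - y) * indicator {0<..<\<alpha>} y * G\<^sub>m (y - z)) \<le> Cp * Cm * indicator {0<..<\<alpha>} y" for y
        using Cp Cm by (auto simp: norm_mult indicator_def intro!: mult_mono)
    qed
    also have "\<dots> = Cp * Cm * \<alpha>" using \<alpha> by simp
    finally have i: "norm (LINT y|lborel. G\<^sub>p (x - y) * indicator {0<..<\<alpha>} y * G\<^sub>m (y - z)) \<le> Cp * Cm * \<alpha>" .
    have "norm (c\<^sub>p * G\<^sub>m (x - z) + c\<^sub>m * G\<^sub>p (x - z) + (LINT y|lborel. G\<^sub>p (x - y) * indicator {0<..<\<alpha>} y * G\<^sub>m (y - z)))
       \<le> norm c\<^sub>p * Cm + norm c\<^sub>m * Cp + Cp * Cm * \<alpha>"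
      using Cp Cm by (intro norm_triangle_mono i) (auto simp: norm_mult intro!: mult_left_mono)
    also have "\<dots> \<le> (norm c\<^sub>p * Cm + norm c\<^sub>m * Cp + Cp * Cm) * (1 + \<alpha>)"
    proof -
      have "0 \<le> (norm c\<^sub>p * Cm + norm c\<^sub>m * Cp) * \<alpha> + Cp * Cm"
        using Cp(2) Cm(2) \<alpha> by (intro add_nonneg_nonneg mult_nonneg_nonneg) auto
      then show ?thesis by (simp add: algebra_simps)
    qed
    finally show ?thesis unfolding KU_def norm_divide c1_def by (simp add: divide_right_mono)
  qed
  have kv: "norm (KV \<alpha> x z) \<le> c2" for \<alpha> x z
  proof -
    have "norm (half_conv (\<lambda>y. g\<^sub>m (- y)) G\<^sub>p (\<alpha> - x) (\<alpha> - z)) \<le> g * Cp" unfolding g_def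
      by (rule half_conv_bound[OF integrable_reflect_shift(5)[OF g_int(2)] Cp(1)])
    then have "norm (half_conv (\<lambda>y. g\<^sub>m (- y)) G\<^sub>p (\<alpha> - x) (\<alpha> - z) / t\<^sub>p) \<le> g * Cp / norm t\<^sub>p"
      unfolding norm_divide by (intro divide_right_mono) auto
    then have "norm (e\<^sub>p (\<alpha> - x) * \<zeta> (\<alpha> - z) + half_conv (\<lambda>y. g\<^sub>m (- y)) G\<^sub>p (\<alpha> - x) (\<alpha> - z) / t\<^sub>p) \<le> Z + g * Cp / norm t\<^sub>p"
      using Z by (intro norm_triangle_mono) (auto simp: norm_mult e1)
    then show ?thesis unfolding KV_def c2_def norm_divide[of _ t\<^sub>m] by (intro divide_right_mono) auto
  qed
  have kt: "norm (KT \<alpha> x z) \<le> c3" for \<alpha> x z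
    unfolding KT_def c3_def
    by (intro norm_triangle_mono order_trans[OF norm_triangle_ineq4] add_mono)
      (use Z H in \<open>auto simp: norm_mult e1 intro!: mult_mono mult_nonneg_nonneg\<close>)
  have "kern \<alpha> ((c1 + c2 + c3) * (1 + \<alpha>) * (1 + norm (A \<alpha>))) (kernel \<alpha>)" if \<alpha>: "\<alpha> > 0" for \<alpha>
    unfolding kernel_def
  proof (rule kern_cut)
    note [measurable] = KU_measurable[of \<alpha>] KV_measurable[of \<alpha>] KT_measurable[of \<alpha>]
    show "(\<lambda>(x, z). KU \<alpha> x z - KV \<alpha> x z + A \<alpha> * KT \<alpha> x z) \<in> borel_measurable (borel \<Otimes>\<^sub>M borel)" by measurable
    show "0 \<le> (c1 + c2 + c3) * (1 + \<alpha>) * (1 + norm (A \<alpha>))" using nn \<alpha> by simp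
    fix x z
    have "norm (KU \<alpha> x z - KV \<alpha> x z + A \<alpha> * KT \<alpha> x z) \<le> c1 * (1 + \<alpha>) + c2 + norm (A \<alpha>) * c3"
      using ku[OF \<alpha>, of x z] kv[of \<alpha> x z] kt[of \<alpha> x z]
      by (intro norm_triangle_mono order_trans[OF norm_triangle_ineq4] add_mono) (auto simp: norm_mult intro!: mult_left_mono)
    also have "\<dots> \<le> (c1 + c2 + c3) * (1 + \<alpha>) * (1 + norm (A \<alpha>))"
    proof -
      have "0 \<le> c2 * \<alpha> + c3 + c3 * \<alpha> + (c1 + c2) * (1 + \<alpha>) * norm (A \<alpha>) + c3 * \<alpha> * norm (A \<alpha>)"
        using nn \<alpha> by (intro add_nonneg_nonneg mult_nonneg_nonneg) auto
      then show ?thesis by (simp add: algebra_simps)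
    qed
    finally show "norm (KU \<alpha> x z - KV \<alpha> x z + A \<alpha> * KT \<alpha> x z) \<le> (c1 + c2 + c3) * (1 + \<alpha>) * (1 + norm (A \<alpha>))" .
  qed
  then show ?thesis using nn by (intro exI[of _ "c1 + c2 + c3"]) auto
qed

text \<open>Kernel form of the two remainders in \<open>approximate_inverse\<close>.\<close>

definition KE :: "real \<Rightarrow> real \<Rightarrow> real \<Rightarrow> complex" where
  "KE \<alpha> x z = (hankel_right \<alpha> (\<lambda>s. half_conv g\<^sub>p (\<lambda>y. G\<^sub>m (- y)) (\<alpha> + s) z) x
       + hankel_left (\<lambda>s. half_conv (\<lambda>y. g\<^sub>m (- y)) G\<^sub>p (\<alpha> + s) (\<alpha> - z)) x) / (t\<^sub>p * t\<^sub>m)"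

text \<open>Collects the decaying remainders of \<open>trunc_zeta\<close> and
  \<open>trunc_eta\<close>, weighted with the coefficients that the rank-one terms assign to
  \<open>\<zeta>\<close> and to the reflected \<open>\<eta>\<close>.\<close>

definition KR :: "real \<Rightarrow> real \<Rightarrow> real \<Rightarrow> complex" where
  "KR \<alpha> x z = hankel_right \<alpha> (\<lambda>s. half_conv g\<^sub>p e\<^sub>p (\<alpha> + s) 0) x / t\<^sub>p
        * (e\<^sub>p \<alpha> * \<tau>\<^sub>p (of_real p) * \<tau>\<^sub>m (- of_real p) * \<eta> z - \<tau>\<^sub>p (of_real p) * t\<^sub>p * \<zeta> (\<alpha> - z))
     + hankel_left (\<lambda>s. half_conv (\<lambda>y. g\<^sub>m (- y)) e\<^sub>p (\<alpha> + s) 0) x / t\<^sub>m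
        * (e\<^sub>p \<alpha> * \<tau>\<^sub>p (of_real p) * \<tau>\<^sub>m (- of_real p) * \<zeta> (\<alpha> - z) - t\<^sub>m * \<tau>\<^sub>m (- of_real p) * \<eta> z)"

definition err_kernel :: "real \<Rightarrow> real \<Rightarrow> real \<Rightarrow> complex" where
  "err_kernel \<alpha> = cut \<alpha> (\<lambda>x z. KE \<alpha> x z - A \<alpha> * KR \<alpha> x z)"

lemma hankel_bound:
  assumes "\<And>s. s > 0 \<Longrightarrow> norm (T s) \<le> C" "C \<ge> 0"
  shows "norm (hankel_right \<alpha> T x) \<le> (LINT y|lborel. norm (k y)) * C" "norm (hankel_left T x) \<le> (LINT y|lborel. norm (k y)) * C"
proof -
  have "norm (hankel_right \<alpha> T x) \<le> (LINT s|lborel. norm (k (x - \<alpha> - s)) * C)" unfolding hankel_right_def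
    by (rule norm_integral_le_integral)
      (use integrable_reflect_shift(1)[OF k_int, of "x - \<alpha>"] assms in \<open>auto simp: norm_mult indicator_def intro!: mult_left_mono\<close>)
  then show "norm (hankel_right \<alpha> T x) \<le> (LINT y|lborel. norm (k y)) * C"
    using lborel_integral_real_affine[of "-1" "\<lambda>y. norm (k y)" "x - \<alpha>"] by simp
  have "norm (hankel_left T x) \<le> (LINT s|lborel. norm (k (x + s)) * C)" unfolding hankel_left_def
    by (rule norm_integral_le_integral)
      (use integrable_reflect_shift(2)[OF k_int, of x] assms in \<open>auto simp: norm_mult indicator_def intro!: mult_left_mono\<close>)
  then show "norm (hankel_left T x) \<le> (LINT y|lborel. norm (k y)) * C"
    using lborel_integral_real_affine[of 1 "\<lambda>y. norm (k y)" x] by simp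
qed

lemma KE_measurable: "case_prod (KE \<alpha>) \<in> borel_measurable (borel \<Otimes>\<^sub>M borel)"
proof -
  have m1 [measurable]: "(\<lambda>(z, s). half_conv g\<^sub>p (\<lambda>y. G\<^sub>m (- y)) (\<alpha> + s) z) \<in> borel_measurable (borel \<Otimes>\<^sub>M borel)"
    using measurable_compose[OF _ half_conv_minus_measurable(2), of "\<lambda>(z, s). (\<alpha> + s, z)" "borel \<Otimes>\<^sub>M borel"] by (simp add: case_prod_beta')
  have m2 [measurable]: "(\<lambda>(z, s). half_conv (\<lambda>y. g\<^sub>m (- y)) G\<^sub>p (\<alpha> + s) (\<alpha> - z)) \<in> borel_measurable (borel \<Otimes>\<^sub>M borel)"
    using measurable_compose[OF _ half_conv_minus_measurable(1), of "\<lambda>(z, s). (\<alpha> + s, \<alpha> - z)" "borel \<Otimes>\<^sub>M borel"] by (simp add: case_prod_beta')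
  show ?thesis unfolding KE_def[abs_def] hankel_right_def hankel_left_def by measurable
qed

lemma KR_measurable: "case_prod (KR \<alpha>) \<in> borel_measurable (borel \<Otimes>\<^sub>M borel)"
proof -
  have [measurable]: "(\<lambda>s. half_conv g\<^sub>p e\<^sub>p (\<alpha> + s) 0) \<in> borel_measurable borel"
    "(\<lambda>s. half_conv (\<lambda>y. g\<^sub>m (- y)) e\<^sub>p (\<alpha> + s) 0) \<in> borel_measurable borel"
    unfolding half_conv_def by measurable
  show ?thesis unfolding KR_def[abs_def] hankel_right_def hankel_left_def by measurable
qed

text \<open>Every term contains a \<open>half_conv\<close> at \<alpha> + s with s > 0 and thus
  decays at the smaller of the rates of \<open>g\<^sub>p\<close> and \<open>g\<^sub>m\<close>;
  \<open>k\<close> contributes its L1 norm.\<close>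

lemma err_kernel_kern:
  "\<exists>C\<ge>0. \<exists>d>0. \<forall>\<alpha>>0. kern \<alpha> (C * (1 + norm (A \<alpha>)) * exp (- d * \<alpha>)) (err_kernel \<alpha>)"
proof -
  obtain Cp where Cp: "\<And>x. norm (G\<^sub>p x) \<le> Cp" "Cp > 0" using G_bdd(1) by (metis bdd_measE)
  obtain Cm where Cm: "\<And>x. norm (G\<^sub>m x) \<le> Cm" "Cm > 0" using G_bdd(2) by (metis bdd_measE)
  obtain Z where Z: "\<And>x. norm (\<zeta> x) \<le> Z" "Z > 0" using bdd_meas_zeta by (metis bdd_measE)
  obtain H where H: "\<And>x. norm (\<eta> x) \<le> H" "H > 0" using bdd_meas_eta by (metis bdd_measE)
  obtain g1 d1 where g1: "g1 > 0" "d1 > 0" "\<And>x. norm (g\<^sub>p x) \<le> g1 * exp (- d1 * \<bar>x\<bar>)" using g_plus(1) by (metis exp_decayingE)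
  obtain g2 d2 where g2: "g2 > 0" "d2 > 0" "\<And>x. norm (g\<^sub>m x) \<le> g2 * exp (- d2 * \<bar>x\<bar>)" using g_minus(1) by (metis exp_decayingE)
  define d where "d = min d1 d2"
  have d: "d > 0" using g1 g2 by (simp add: d_def)
  define g where "g = max g1 g2"
  have g: "g > 0" using g1 by (simp add: g_def)
  have gp: "norm (g\<^sub>p x) \<le> g * exp (- d * \<bar>x\<bar>)" for x
    by (rule order_trans[OF g1(3)]) (use g1(1) in \<open>auto simp: g_def d_def intro!: mult_mono mult_right_mono\<close>)
  have gm: "norm (g\<^sub>m (- x)) \<le> g * exp (- d * \<bar>x\<bar>)" for x
    by (rule order_trans[OF g2(3)]) (use g2(1) in \<open>auto simp: g_def d_def intro!: mult_mono mult_right_mono\<close>)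
  define I where "I = (LINT w|lborel. exp (- d * \<bar>w\<bar>))"
  have I: "I \<ge> 0" by (simp add: I_def)
  have e1: "norm (e\<^sub>p x) = 1" for x by (simp add: exp_fn_def)
  define N where "N = (LINT y|lborel. norm (k y))"
  have N: "N \<ge> 0" by (simp add: N_def)
  have decay: "exp (- d * (\<alpha> + s)) \<le> exp (- d * \<alpha>)" if "s > 0" for \<alpha> s using d that by simp
  have hb: "norm (hankel_right \<alpha> (\<lambda>s. half_conv h G (\<alpha> + s) z) x) \<le> N * (g * C * I * exp (- d * \<alpha>))"
    "norm (hankel_left (\<lambda>s. half_conv h G (\<alpha> + s) z) x) \<le> N * (g * C * I * exp (- d * \<alpha>))"
    if h: "\<And>x. norm (h x) \<le> g * exp (- d * \<bar>x\<bar>)" and G: "\<And>x. norm (G x) \<le> C" "C > 0" and \<alpha>: "\<alpha> > 0" for h G C \<alpha> z x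
  proof -
    have "norm (half_conv h G (\<alpha> + s) z) \<le> g * C * I * exp (- d * \<alpha>)" if s: "s > 0" for s
    proof -
      have "norm (half_conv h G (\<alpha> + s) z) \<le> g * C * I * exp (- d * (\<alpha> + s))"
        unfolding I_def by (rule half_conv_decay[OF h d G(1)]) (use s \<alpha> in simp)
      also have "\<dots> \<le> g * C * I * exp (- d * \<alpha>)" using g G I decay[OF s, of \<alpha>] by (intro mult_left_mono) auto
      finally show ?thesis .
    qed
    then show "norm (hankel_right \<alpha> (\<lambda>s. half_conv h G (\<alpha> + s) z) x) \<le> N * (g * C * I * exp (- d * \<alpha>))"
      "norm (hankel_left (\<lambda>s. half_conv h G (\<alpha> + s) z) x) \<le> N * (g * C * I * exp (- d * \<alpha>))"
      unfolding N_def using g G I by (intro hankel_bound; simp)+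
  qed
  define c1 where "c1 = (N * (g * Cm * I) + N * (g * Cp * I)) / norm (t\<^sub>p * t\<^sub>m)"
  define m1 where "m1 = norm (\<tau>\<^sub>p (of_real p)) * norm (\<tau>\<^sub>m (- of_real p)) * H + norm (\<tau>\<^sub>p (of_real p)) * norm t\<^sub>p * Z"
  define m2 where "m2 = norm (\<tau>\<^sub>p (of_real p)) * norm (\<tau>\<^sub>m (- of_real p)) * Z + norm t\<^sub>m * norm (\<tau>\<^sub>m (- of_real p)) * H"
  define c2 where "c2 = N * (g * 1 * I) / norm t\<^sub>p * m1 + N * (g * 1 * I) / norm t\<^sub>m * m2"
  have mm: "m1 \<ge> 0" "m2 \<ge> 0" unfolding m1_def m2_def using Z(2) H(2) by auto
  have nn: "c1 \<ge> 0" "c2 \<ge> 0" unfolding c1_def c2_def using Cp(2) Cm(2) N g I mm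
    by (auto intro!: add_nonneg_nonneg divide_nonneg_nonneg mult_nonneg_nonneg)
  have "kern \<alpha> ((c1 + c2) * (1 + norm (A \<alpha>)) * exp (- d * \<alpha>)) (err_kernel \<alpha>)" if \<alpha>: "\<alpha> > 0" for \<alpha>
    unfolding err_kernel_def
  proof (rule kern_cut)
    note [measurable] = KE_measurable[of \<alpha>] KR_measurable[of \<alpha>]
    show "(\<lambda>(x, z). KE \<alpha> x z - A \<alpha> * KR \<alpha> x z) \<in> borel_measurable (borel \<Otimes>\<^sub>M borel)" by measurable
    show "0 \<le> (c1 + c2) * (1 + norm (A \<alpha>)) * exp (- d * \<alpha>)" using nn by simp
    fix x z
    have ke: "norm (KE \<alpha> x z) \<le> c1 * exp (- d * \<alpha>)"
    proof -
      have "norm (hankel_right \<alpha> (\<lambda>s. half_conv g\<^sub>p (\<lambda>y. G\<^sub>m (- y)) (\<alpha> + s) z) x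
       + hankel_left (\<lambda>s. half_conv (\<lambda>y. g\<^sub>m (- y)) G\<^sub>p (\<alpha> + s) (\<alpha> - z)) x) \<le> N * (g * Cm * I * exp (- d * \<alpha>)) + N * (g * Cp * I * exp (- d * \<alpha>))"
        using Cm Cp by (intro norm_triangle_mono hb gp gm \<alpha>) auto
      also have "\<dots> = (N * (g * Cm * I) + N * (g * Cp * I)) * exp (- d * \<alpha>)" by (simp add: algebra_simps)
      finally show ?thesis unfolding KE_def c1_def norm_divide by (simp add: divide_right_mono)
    qed
    have kr: "norm (KR \<alpha> x z) \<le> c2 * exp (- d * \<alpha>)"
    proof -
      have r1: "norm (hankel_right \<alpha> (\<lambda>s. half_conv g\<^sub>p e\<^sub>p (\<alpha> + s) 0) x / t\<^sub>p) \<le> N * (g * 1 * I * exp (- d * \<alpha>)) / norm t\<^sub>p"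
        unfolding norm_divide by (intro divide_right_mono hb gp \<alpha>) (auto simp: e1)
      have r2: "norm (hankel_left (\<lambda>s. half_conv (\<lambda>y. g\<^sub>m (- y)) e\<^sub>p (\<alpha> + s) 0) x / t\<^sub>m) \<le> N * (g * 1 * I * exp (- d * \<alpha>)) / norm t\<^sub>m"
        unfolding norm_divide by (intro divide_right_mono hb gm \<alpha>) (auto simp: e1)
      have r3: "norm (e\<^sub>p \<alpha> * \<tau>\<^sub>p (of_real p) * \<tau>\<^sub>m (- of_real p) * \<eta> z - \<tau>\<^sub>p (of_real p) * t\<^sub>p * \<zeta> (\<alpha> - z)) \<le> m1"
        unfolding m1_def using Z H by (intro order_trans[OF norm_triangle_ineq4] add_mono) (auto simp: norm_mult e1 intro!: mult_left_mono)
      have r4: "norm (e\<^sub>p \<alpha> * \<tau>\<^sub>p (of_real p) * \<tau>\<^sub>m (- of_real p) * \<zeta> (\<alpha> - z) - t\<^sub>m * \<tau>\<^sub>m (- of_real p) * \<eta> z) \<le> m2"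
        unfolding m2_def using Z H by (intro order_trans[OF norm_triangle_ineq4] add_mono) (auto simp: norm_mult e1 intro!: mult_left_mono)
      have "norm (KR \<alpha> x z) \<le> N * (g * 1 * I * exp (- d * \<alpha>)) / norm t\<^sub>p * m1 + N * (g * 1 * I * exp (- d * \<alpha>)) / norm t\<^sub>m * m2"
        unfolding KR_def
        by (intro norm_triangle_mono) (unfold norm_mult, (intro mult_mono r1 r2 r3 r4; use N g I in \<open>simp\<close>)+)
      also have "\<dots> = c2 * exp (- d * \<alpha>)" unfolding c2_def by (simp add: algebra_simps)
      finally show ?thesis .
    qed
    have "norm (KE \<alpha> x z - A \<alpha> * KR \<alpha> x z) \<le> c1 * exp (- d * \<alpha>) + norm (A \<alpha>) * (c2 * exp (- d * \<alpha>))"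
      using ke kr by (intro order_trans[OF norm_triangle_ineq4] add_mono) (auto simp: norm_mult intro!: mult_left_mono)
    also have "\<dots> \<le> (c1 + c2) * (1 + norm (A \<alpha>)) * exp (- d * \<alpha>)"
    proof -
      have "0 \<le> c2 * exp (- d * \<alpha>) + c1 * norm (A \<alpha>) * exp (- d * \<alpha>)" using nn by simp
      then show ?thesis by (simp add: algebra_simps)
    qed
    finally show "norm (KE \<alpha> x z - A \<alpha> * KR \<alpha> x z) \<le> (c1 + c2) * (1 + norm (A \<alpha>)) * exp (- d * \<alpha>)" .
  qed
  then show ?thesis using nn d by (intro exI[of _ "c1 + c2"] conjI exI[of _ d]) auto
qed

end

section \<open>Integral representations and the two by two system\<close>

context symbol
begin

context
  fixes \<alpha> :: real and f :: "real \<Rightarrow> complex"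
  assumes \<alpha>: "\<alpha> > 0" and f: "integrable lborel f" and supported: "\<forall>x. x \<notin> {0<..<\<alpha>} \<longrightarrow> f x = 0"
begin

private lemma f_zero: "x \<notin> {0<..<\<alpha>} \<Longrightarrow> f x = 0" using supported by blast

private lemma f_borel [measurable]: "f \<in> borel_measurable borel" by (rule integrable_lborel_measurable[OF f])

text \<open>Fubini applies because the intermediate integration runs over the bounded interval
  (0,\<alpha>), where the nondecaying \<open>G\<^sub>p\<close> is integrable.\<close>

lemma u_kernel_integrable: "integrable lborel (\<lambda>z. KU \<alpha> x z * f z)"
  and u_kernel: "x \<in> {0<..<\<alpha>} \<Longrightarrow> u f x = b\<^sub>0 * f x + (LINT z|lborel. KU \<alpha> x z * f z)"
proof -
  let ?I = "indicator {0<..<\<alpha>} :: real \<Rightarrow> complex"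
  let ?J = "\<lambda>x z. LINT y|lborel. G\<^sub>p (x - y) * ?I y * G\<^sub>m (y - z)"
  obtain Cm where Cm: "\<And>x. norm (G\<^sub>m x) \<le> Cm" using G_bdd(2) by (metis bdd_measE)
  have gI: "integrable lborel (\<lambda>y. G\<^sub>p (x - y) * ?I y)" for x
    using integrable_mult_bdd[OF integrable_indicator_interval bdd_meas_shift(1)[OF G_bdd(1)], of 0 \<alpha> x] by (simp add: mult.commute)
  have P: "integrable (lborel \<Otimes>\<^sub>M lborel) (\<lambda>(y, z). (G\<^sub>p (x - y) * ?I y) * G\<^sub>m (y - z) * f z)"
    and F: "(LINT y|lborel. (G\<^sub>p (x - y) * ?I y) * (LINT z|lborel. G\<^sub>m (y - z) * f z)) = (LINT z|lborel. ?J x z * f z)" for x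
    by (rule Fubini_bounded_kernel[OF gI f _ Cm]; measurable)+
  have i1: "integrable lborel (\<lambda>z. G\<^sub>m (x - z) * f z)" "integrable lborel (\<lambda>z. G\<^sub>p (x - z) * f z)" for x
    by (rule integrable_conv_bdd(1)[OF f G_bdd(2)], rule integrable_conv_bdd(1)[OF f G_bdd(1)])
  have i2: "integrable lborel (\<lambda>z. ?J x z * f z)" for x
  proof -
    have "integrable lborel (\<lambda>z. LINT y|lborel. (G\<^sub>p (x - y) * ?I y) * G\<^sub>m (y - z) * f z)"
      by (rule lborel_pair.integrable_snd) (rule P)
    then show ?thesis by simp
  qed
  have e: "KU \<alpha> x z * f z = (c\<^sub>p * (G\<^sub>m (x - z) * f z) + c\<^sub>m * (G\<^sub>p (x - z) * f z) + ?J x z * f z) / (t\<^sub>p * t\<^sub>m)" for x z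
    unfolding KU_def by (simp add: algebra_simps)
  show "integrable lborel (\<lambda>z. KU \<alpha> x z * f z)" unfolding e
    by (intro integrable_divide Bochner_Integration.integrable_add integrable_mult_right i1 i2)
  assume x: "x \<in> {0<..<\<alpha>}"
  have k: "(LINT z|lborel. KU \<alpha> x z * f z) = (c\<^sub>p * conv G\<^sub>m f x + c\<^sub>m * conv G\<^sub>p f x + (LINT z|lborel. ?J x z * f z)) / (t\<^sub>p * t\<^sub>m)"
    unfolding e conv_def using i1[of x] i2[of x] by simp
  have i3: "integrable lborel (\<lambda>y. (G\<^sub>p (x - y) * ?I y) * conv G\<^sub>m f y)"
    by (rule integrable_mult_bdd[OF gI bdd_meas_conv(1)[OF G_bdd(2) f]])
  have "conv G\<^sub>p (\<phi> f) x = (LINT y|lborel. (c\<^sub>m * (G\<^sub>p (x - y) * f y) + (G\<^sub>p (x - y) * ?I y) * conv G\<^sub>m f y) / t\<^sub>m)"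
    unfolding conv_def[of G\<^sub>p]
  proof (intro Bochner_Integration.integral_cong refl)
    fix y
    show "G\<^sub>p (x - y) * \<phi> f y = (c\<^sub>m * (G\<^sub>p (x - y) * f y) + (G\<^sub>p (x - y) * ?I y) * conv G\<^sub>m f y) / t\<^sub>m"
      unfolding phi_eq[OF \<alpha> f supported] \<psi>_def using f_zero[of y] by (auto simp: indicator_def algebra_simps)
  qed
  also have "\<dots> = (c\<^sub>m * conv G\<^sub>p f x + (LINT y|lborel. (G\<^sub>p (x - y) * ?I y) * conv G\<^sub>m f y)) / t\<^sub>m"
    using i1(2)[of x] i3 by (simp add: conv_def[of G\<^sub>p f])
  also have "(LINT y|lborel. (G\<^sub>p (x - y) * ?I y) * conv G\<^sub>m f y) = (LINT z|lborel. ?J x z * f z)"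
    unfolding conv_def[of G\<^sub>m] by (rule F)
  finally have c: "conv G\<^sub>p (\<phi> f) x = (c\<^sub>m * conv G\<^sub>p f x + (LINT z|lborel. ?J x z * f z)) / t\<^sub>m" .
  have ph: "\<phi> f x = (c\<^sub>m * f x + conv G\<^sub>m f x) / t\<^sub>m"
    unfolding phi_eq[OF \<alpha> f supported] \<psi>_def using x by simp
  show "u f x = b\<^sub>0 * f x + (LINT z|lborel. KU \<alpha> x z * f z)"
    unfolding u_def[OF \<alpha> f supported] k c ph b\<^sub>0_def using tau_nonzero(3,4) by (simp add: divide_simps) (simp add: algebra_simps)
qed

lemma V_kernel_integrable: "integrable lborel (\<lambda>z. KV \<alpha> x z * f z)"
  and V_kernel_eq: "x \<in> {0<..<\<alpha>} \<Longrightarrow> V \<alpha> f (\<alpha> - x) = (LINT z|lborel. KV \<alpha> x z * f z)"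
proof -
  let ?h = "\<lambda>s z. half_conv (\<lambda>y. g\<^sub>m (- y)) G\<^sub>p s (\<alpha> - z)"
  have gr: "integrable lborel (\<lambda>y. g\<^sub>m (- y))" by (rule integrable_reflect_shift(5)[OF g_int(2)])
  obtain C where C: "\<And>x. norm (G\<^sub>p x) \<le> C" using G_bdd(1) by (metis bdd_measE)
  have i1: "integrable lborel (\<lambda>z. \<zeta> (\<alpha> - z) * f z)" by (rule integrable_bdd_mult[OF f bdd_meas_shift(1)[OF bdd_meas_zeta]])
  have i2: "integrable lborel (\<lambda>z. ?h s z * f z)" for s
  proof (rule integrable_bdd_mult[OF f], rule bdd_measI)
    show "(\<lambda>z. ?h s z) \<in> borel_measurable borel"
      using measurable_compose[OF _ half_conv_minus_measurable(1), of "\<lambda>z. (s, \<alpha> - z)" borel] by simp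
    show "norm (?h s z) \<le> (LINT w|lborel. norm (g\<^sub>m (- w))) * C" for z by (rule half_conv_bound[OF gr C])
  qed
  have e: "KV \<alpha> x z * f z = (e\<^sub>p (\<alpha> - x) * (\<zeta> (\<alpha> - z) * f z) + ?h (\<alpha> - x) z * f z / t\<^sub>p) / t\<^sub>m" for x z
    unfolding KV_def by (simp add: algebra_simps)
  show "integrable lborel (\<lambda>z. KV \<alpha> x z * f z)" unfolding e
    by (intro integrable_divide Bochner_Integration.integrable_add integrable_mult_right i1 i2)
  assume x: "x \<in> {0<..<\<alpha>}"
  then show "V \<alpha> f (\<alpha> - x) = (LINT z|lborel. KV \<alpha> x z * f z)"
    unfolding e using V_eq[OF \<alpha> f supported, of "\<alpha> - x"] i1 i2[of "\<alpha> - x"]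
    unfolding V_kernel[OF \<alpha> f supported] lam_def[OF \<alpha> f supported] by simp
qed

lemma KT_kernel_integrable: "integrable lborel (\<lambda>z. KT \<alpha> x z * f z)"
  and KT_kernel: "(LINT z|lborel. KT \<alpha> x z * f z) =
     (e\<^sub>p \<alpha> * \<tau>\<^sub>p (of_real p) * \<tau>\<^sub>m (- of_real p) * (LINT z|lborel. \<eta> z * f z) - \<tau>\<^sub>p (of_real p) * t\<^sub>p * lam \<alpha> f) * \<zeta> x
   + (e\<^sub>p \<alpha> * \<tau>\<^sub>p (of_real p) * \<tau>\<^sub>m (- of_real p) * lam \<alpha> f - t\<^sub>m * \<tau>\<^sub>m (- of_real p) * (LINT z|lborel. \<eta> z * f z)) * \<eta> (\<alpha> - x)"
proof -
  have i1: "integrable lborel (\<lambda>z. \<zeta> (\<alpha> - z) * f z)" by (rule integrable_bdd_mult[OF f bdd_meas_shift(1)[OF bdd_meas_zeta]])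
  have i2: "integrable lborel (\<lambda>z. \<eta> z * f z)" by (rule integrable_bdd_mult[OF f bdd_meas_eta])
  define P where "P = (e\<^sub>p \<alpha> * \<tau>\<^sub>p (of_real p) * \<tau>\<^sub>m (- of_real p) * \<zeta> x - t\<^sub>m * \<tau>\<^sub>m (- of_real p) * \<eta> (\<alpha> - x))"
  define Q where "Q = (e\<^sub>p \<alpha> * \<tau>\<^sub>p (of_real p) * \<tau>\<^sub>m (- of_real p) * \<eta> (\<alpha> - x) - \<tau>\<^sub>p (of_real p) * t\<^sub>p * \<zeta> x)"
  have e: "KT \<alpha> x z * f z = P * (\<eta> z * f z) + Q * (\<zeta> (\<alpha> - z) * f z)" for z
    unfolding KT_def P_def Q_def by (simp add: algebra_simps)
  show "integrable lborel (\<lambda>z. KT \<alpha> x z * f z)" unfolding e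
    by (intro Bochner_Integration.integrable_add integrable_mult_right i1 i2)
  have "(LINT z|lborel. KT \<alpha> x z * f z) = P * (LINT z|lborel. \<eta> z * f z) + Q * lam \<alpha> f"
    unfolding e lam_def[OF \<alpha> f supported] using i1 i2 by simp
  then show "(LINT z|lborel. KT \<alpha> x z * f z) =
     (e\<^sub>p \<alpha> * \<tau>\<^sub>p (of_real p) * \<tau>\<^sub>m (- of_real p) * (LINT z|lborel. \<eta> z * f z) - \<tau>\<^sub>p (of_real p) * t\<^sub>p * lam \<alpha> f) * \<zeta> x
   + (e\<^sub>p \<alpha> * \<tau>\<^sub>p (of_real p) * \<tau>\<^sub>m (- of_real p) * lam \<alpha> f - t\<^sub>m * \<tau>\<^sub>m (- of_real p) * (LINT z|lborel. \<eta> z * f z)) * \<eta> (\<alpha> - x)"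
    unfolding P_def Q_def by (simp add: algebra_simps)
qed

lemma KE_kernel_integrable: "integrable lborel (\<lambda>z. KE \<alpha> x z * f z)"
  and KE_kernel: "(LINT z|lborel. KE \<alpha> x z * f z) = hankel_right \<alpha> (err_right \<alpha> f) x / t\<^sub>p + hankel_left (err_left \<alpha> f) x / t\<^sub>m"
proof -
  let ?h1 = "\<lambda>s z. half_conv g\<^sub>p (\<lambda>y. G\<^sub>m (- y)) (\<alpha> + s) z"
  let ?h2 = "\<lambda>s z. half_conv (\<lambda>y. g\<^sub>m (- y)) G\<^sub>p (\<alpha> + s) (\<alpha> - z)"
  have gr: "integrable lborel (\<lambda>y. g\<^sub>m (- y))" by (rule integrable_reflect_shift(5)[OF g_int(2)])
  obtain C where C: "\<And>x. norm (G\<^sub>p x) \<le> C" using G_bdd(1) by (metis bdd_measE)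
  obtain C' where C': "\<And>x. norm (G\<^sub>m x) \<le> C'" using G_bdd(2) by (metis bdd_measE)
  have b1: "norm (?h1 s z) \<le> (LINT w|lborel. norm (g\<^sub>p w)) * C'" for s z by (rule half_conv_bound[OF g_int(1) C'])
  have b2: "norm (?h2 s z) \<le> (LINT w|lborel. norm (g\<^sub>m (- w))) * C" for s z by (rule half_conv_bound[OF gr C])
  have m1: "case_prod ?h1 \<in> borel_measurable (borel \<Otimes>\<^sub>M borel)"
    using measurable_compose[OF _ half_conv_minus_measurable(2), of "\<lambda>(s, z). (\<alpha> + s, z)" "borel \<Otimes>\<^sub>M borel"] by (simp add: case_prod_beta')
  have m2: "case_prod ?h2 \<in> borel_measurable (borel \<Otimes>\<^sub>M borel)"
    using measurable_compose[OF _ half_conv_minus_measurable(1), of "\<lambda>(s, z). (\<alpha> + s, \<alpha> - z)" "borel \<Otimes>\<^sub>M borel"] by (simp add: case_prod_beta')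
  have k1: "integrable lborel (\<lambda>s. k (x - \<alpha> - s) * indicator {0<..} s)"
    by (rule integrable_mult_bdd[OF integrable_reflect_shift(1)[OF k_int] bdd_meas_indicator]) simp
  have k2: "integrable lborel (\<lambda>s. k (x + s) * indicator {0<..} s)"
    by (rule integrable_mult_bdd[OF integrable_reflect_shift(2)[OF k_int] bdd_meas_indicator]) simp
  note F1 = Fubini_bounded_kernel[OF k1 f m1 b1]
  note F2 = Fubini_bounded_kernel[OF k2 f m2 b2]
  have h1: "hankel_right \<alpha> (\<lambda>s. ?h1 s z) x = (LINT s|lborel. (k (x - \<alpha> - s) * indicator {0<..} s) * ?h1 s z)" for z
    unfolding hankel_right_def by (simp add: mult.assoc)
  have h2: "hankel_left (\<lambda>s. ?h2 s z) x = (LINT s|lborel. (k (x + s) * indicator {0<..} s) * ?h2 s z)" for z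
    unfolding hankel_left_def by (simp add: mult.assoc)
  have i1: "integrable lborel (\<lambda>z. hankel_right \<alpha> (\<lambda>s. ?h1 s z) x * f z)"
  proof -
    have "integrable lborel (\<lambda>z. LINT s|lborel. (k (x - \<alpha> - s) * indicator {0<..} s) * ?h1 s z * f z)"
      by (rule lborel_pair.integrable_snd) (rule F1(1))
    then show ?thesis unfolding h1 by simp
  qed
  have i2: "integrable lborel (\<lambda>z. hankel_left (\<lambda>s. ?h2 s z) x * f z)"
  proof -
    have "integrable lborel (\<lambda>z. LINT s|lborel. (k (x + s) * indicator {0<..} s) * ?h2 s z * f z)"
      by (rule lborel_pair.integrable_snd) (rule F2(1))
    then show ?thesis unfolding h2 by simp
  qed
  have e: "KE \<alpha> x z * f z = (hankel_right \<alpha> (\<lambda>s. ?h1 s z) x * f z + hankel_left (\<lambda>s. ?h2 s z) x * f z) / (t\<^sub>p * t\<^sub>m)" for z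
    unfolding KE_def by (simp add: distrib_right)
  show "integrable lborel (\<lambda>z. KE \<alpha> x z * f z)" unfolding e
    by (intro integrable_divide Bochner_Integration.integrable_add i1 i2)
  have r: "hankel_right \<alpha> (err_right \<alpha> f) x = (LINT z|lborel. hankel_right \<alpha> (\<lambda>s. ?h1 s z) x * f z) / t\<^sub>m"
  proof -
    have "hankel_right \<alpha> (err_right \<alpha> f) x = (LINT s|lborel. (k (x - \<alpha> - s) * indicator {0<..} s) * (LINT z|lborel. ?h1 s z * f z) / t\<^sub>m)"
      unfolding hankel_right_def err_right_def[OF \<alpha> f supported] by (simp add: mult.assoc)
    also have "\<dots> = (LINT s|lborel. (k (x - \<alpha> - s) * indicator {0<..} s) * (LINT z|lborel. ?h1 s z * f z)) / t\<^sub>m" by simp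
    finally show ?thesis unfolding F1(2) h1 .
  qed
  have l: "hankel_left (err_left \<alpha> f) x = (LINT z|lborel. hankel_left (\<lambda>s. ?h2 s z) x * f z) / t\<^sub>p"
  proof -
    have "hankel_left (err_left \<alpha> f) x = (LINT s|lborel. (k (x + s) * indicator {0<..} s) * (LINT z|lborel. ?h2 s z * f z) / t\<^sub>p)"
      unfolding hankel_left_def err_left_def[OF \<alpha> f supported] by (simp add: mult.assoc)
    also have "\<dots> = (LINT s|lborel. (k (x + s) * indicator {0<..} s) * (LINT z|lborel. ?h2 s z * f z)) / t\<^sub>p" by simp
    finally show ?thesis unfolding F2(2) h2 .
  qed
  show "(LINT z|lborel. KE \<alpha> x z * f z) = hankel_right \<alpha> (err_right \<alpha> f) x / t\<^sub>p + hankel_left (err_left \<alpha> f) x / t\<^sub>m"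
    unfolding e r l using i1 i2 by (simp add: add_divide_distrib mult.commute)
qed

lemma KR_kernel_integrable: "integrable lborel (\<lambda>z. KR \<alpha> x z * f z)"
  and KR_kernel: "(LINT z|lborel. KR \<alpha> x z * f z) =
     hankel_right \<alpha> (\<lambda>s. half_conv g\<^sub>p e\<^sub>p (\<alpha> + s) 0) x / t\<^sub>p
       * (e\<^sub>p \<alpha> * \<tau>\<^sub>p (of_real p) * \<tau>\<^sub>m (- of_real p) * (LINT z|lborel. \<eta> z * f z) - \<tau>\<^sub>p (of_real p) * t\<^sub>p * lam \<alpha> f)
   + hankel_left (\<lambda>s. half_conv (\<lambda>y. g\<^sub>m (- y)) e\<^sub>p (\<alpha> + s) 0) x / t\<^sub>m
       * (e\<^sub>p \<alpha> * \<tau>\<^sub>p (of_real p) * \<tau>\<^sub>m (- of_real p) * lam \<alpha> f - t\<^sub>m * \<tau>\<^sub>m (- of_real p) * (LINT z|lborel. \<eta> z * f z))"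
proof -
  have i1: "integrable lborel (\<lambda>z. \<zeta> (\<alpha> - z) * f z)" by (rule integrable_bdd_mult[OF f bdd_meas_shift(1)[OF bdd_meas_zeta]])
  have i2: "integrable lborel (\<lambda>z. \<eta> z * f z)" by (rule integrable_bdd_mult[OF f bdd_meas_eta])
  define r where "r = hankel_right \<alpha> (\<lambda>s. half_conv g\<^sub>p e\<^sub>p (\<alpha> + s) 0) x / t\<^sub>p"
  define l where "l = hankel_left (\<lambda>s. half_conv (\<lambda>y. g\<^sub>m (- y)) e\<^sub>p (\<alpha> + s) 0) x / t\<^sub>m"
  define P where "P = r * (e\<^sub>p \<alpha> * \<tau>\<^sub>p (of_real p) * \<tau>\<^sub>m (- of_real p)) - l * (t\<^sub>m * \<tau>\<^sub>m (- of_real p))"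
  define Q where "Q = l * (e\<^sub>p \<alpha> * \<tau>\<^sub>p (of_real p) * \<tau>\<^sub>m (- of_real p)) - r * (\<tau>\<^sub>p (of_real p) * t\<^sub>p)"
  have e: "KR \<alpha> x z * f z = P * (\<eta> z * f z) + Q * (\<zeta> (\<alpha> - z) * f z)" for z
    unfolding KR_def r_def[symmetric] l_def[symmetric] P_def Q_def by (simp add: algebra_simps)
  show "integrable lborel (\<lambda>z. KR \<alpha> x z * f z)" unfolding e
    by (intro Bochner_Integration.integrable_add integrable_mult_right i1 i2)
  have "(LINT z|lborel. KR \<alpha> x z * f z) = P * (LINT z|lborel. \<eta> z * f z) + Q * lam \<alpha> f"
    unfolding e lam_def[OF \<alpha> f supported] using i1 i2 by simp
  then show "(LINT z|lborel. KR \<alpha> x z * f z) =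
     hankel_right \<alpha> (\<lambda>s. half_conv g\<^sub>p e\<^sub>p (\<alpha> + s) 0) x / t\<^sub>p
       * (e\<^sub>p \<alpha> * \<tau>\<^sub>p (of_real p) * \<tau>\<^sub>m (- of_real p) * (LINT z|lborel. \<eta> z * f z) - \<tau>\<^sub>p (of_real p) * t\<^sub>p * lam \<alpha> f)
   + hankel_left (\<lambda>s. half_conv (\<lambda>y. g\<^sub>m (- y)) e\<^sub>p (\<alpha> + s) 0) x / t\<^sub>m
       * (e\<^sub>p \<alpha> * \<tau>\<^sub>p (of_real p) * \<tau>\<^sub>m (- of_real p) * lam \<alpha> f - t\<^sub>m * \<tau>\<^sub>m (- of_real p) * (LINT z|lborel. \<eta> z * f z))"
    unfolding r_def[symmetric] l_def[symmetric] P_def Q_def by (simp add: algebra_simps)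
qed

lemma explicit_operator:
  assumes x: "x \<in> {0<..<\<alpha>}"
  shows "idk b\<^sub>0 (kernel \<alpha>) f x = u f x - V \<alpha> f (\<alpha> - x) + A \<alpha> * (
     (e\<^sub>p \<alpha> * \<tau>\<^sub>p (of_real p) * \<tau>\<^sub>m (- of_real p) * (LINT z|lborel. \<eta> z * f z) - \<tau>\<^sub>p (of_real p) * t\<^sub>p * lam \<alpha> f) * \<zeta> x
   + (e\<^sub>p \<alpha> * \<tau>\<^sub>p (of_real p) * \<tau>\<^sub>m (- of_real p) * lam \<alpha> f - t\<^sub>m * \<tau>\<^sub>m (- of_real p) * (LINT z|lborel. \<eta> z * f z)) * \<eta> (\<alpha> - x))"
proof -
  have "kop (kernel \<alpha>) f x = (LINT z|lborel. (KU \<alpha> x z - KV \<alpha> x z + A \<alpha> * KT \<alpha> x z) * f z)"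
    unfolding kernel_def by (rule kop_cut[OF f_zero x])
  also have "\<dots> = (LINT z|lborel. KU \<alpha> x z * f z - KV \<alpha> x z * f z + A \<alpha> * (KT \<alpha> x z * f z))"
    by (simp add: algebra_simps)
  also have "\<dots> = (LINT z|lborel. KU \<alpha> x z * f z) - (LINT z|lborel. KV \<alpha> x z * f z) + A \<alpha> * (LINT z|lborel. KT \<alpha> x z * f z)"
    using u_kernel_integrable[of x] V_kernel_integrable[of x] KT_kernel_integrable[of x] by simp
  finally show ?thesis unfolding idk_def KT_kernel V_kernel_eq[OF x] u_kernel[OF x] by simp
qed

end

lemma trunc_cong: "(\<And>y. y \<in> {0<..<\<alpha>} \<Longrightarrow> h y = h' y) \<Longrightarrow> x \<in> {0<..<\<alpha>} \<Longrightarrow> trunc \<alpha> h x = trunc \<alpha> h' x"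
proof -
  assume h: "\<And>y. y \<in> {0<..<\<alpha>} \<Longrightarrow> h y = h' y" and x: "x \<in> {0<..<\<alpha>}"
  have "(LINT y|lborel. k (x - y) * (indicator {0<..<\<alpha>} y * h y)) = (LINT y|lborel. k (x - y) * (indicator {0<..<\<alpha>} y * h' y))"
    using h by (intro Bochner_Integration.integral_cong refl) (auto simp: indicator_def)
  then show ?thesis using h[OF x] by (simp add: trunc_def)
qed

lemma trunc_Wop:
  assumes "\<alpha> > 0" "h \<in> L2z \<alpha>" "x \<in> {0<..<\<alpha>}"
  shows "trunc \<alpha> h x = Wop \<alpha> a k h x"
proof -
  have "(LINT y|lborel. k (x - y) * (indicator {0<..<\<alpha>} y * h y)) = conv k h x"
    unfolding conv_def using L2z_D(2)[OF assms(2)]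
    by (intro Bochner_Integration.integral_cong refl) (auto simp: indicator_def)
  then show ?thesis using assms(3) by (simp add: trunc_def Wop_def[OF assms(1) k_int])
qed

text \<open>\<open>X\<close> and \<open>Y\<close> stand for the left and right Hankel images of
  \<open>e\<^sub>p\<close>, \<open>N\<close> and \<open>M\<close> for the pairings of
  \<open>f\<close> with \<open>\<eta>\<close> and with the reflected \<open>\<zeta>\<close>. The
  coefficients of the rank-one terms solve the linear system: after inserting
  \<open>s\<^sub>p\<close> and \<open>s\<^sub>m\<close> the bracket is i/(2p) times \<open>D\<close>
  times the unwanted terms, and A i/(2p) is -1/D.\<close>

lemma matching_identity:
  fixes X Y M N :: complex
  assumes D: "D \<alpha> \<noteq> 0"
  defines "a1 \<equiv> \<tau>\<^sub>p (of_real p)" and "d1 \<equiv> \<tau>\<^sub>m (- of_real p)" and "E \<equiv> e\<^sub>p \<alpha>"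
  shows "E / t\<^sub>p * N * Y + E / t\<^sub>m * M * X
    + A \<alpha> * ((E * a1 * d1 * N - a1 * t\<^sub>p * M) * (- s\<^sub>p * X - \<i> / (2 * of_real p) * E / t\<^sub>p * Y)
    + (E * a1 * d1 * M - t\<^sub>m * d1 * N) * (- s\<^sub>m * Y - \<i> / (2 * of_real p) * E / t\<^sub>m * X)) = 0"
proof -
  have a1: "a1 \<noteq> 0" and d1: "d1 \<noteq> 0" unfolding a1_def d1_def using tau_nonzero by auto
  have E: "E \<noteq> 0" unfolding E_def by (simp add: exp_fn_def)
  have P: "complex_of_real p \<noteq> 0" using p by simp
  have em: "e\<^sub>m \<alpha> = 1 / E"
    unfolding E_def using exp_fn_uminus(1)[of "of_real p" \<alpha>] by (metis nonzero_eq_divide_eq mult_zero_right zero_neq_one)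
  have D': "D \<alpha> = t\<^sub>m * t\<^sub>p / E - a1 * d1 * E" unfolding D_def em a1_def d1_def E_def[symmetric] by (simp add: mult_ac)
  define i2p where "i2p = \<i> / (2 * complex_of_real p)"
  have i2: "\<i> * \<i> = (-1::complex)" by simp
  have Ai: "A \<alpha> * i2p = - 1 / D \<alpha>"
    unfolding A_def i2p_def using P by (simp add: field_simps)
  have sp: "s\<^sub>p = i2p / a1" "s\<^sub>m = i2p / d1" unfolding s_plus s_minus i2p_def a1_def d1_def by simp_all
  have "(E * a1 * d1 * N - a1 * t\<^sub>p * M) * (- s\<^sub>p * X - i2p * E / t\<^sub>p * Y)
    + (E * a1 * d1 * M - t\<^sub>m * d1 * N) * (- s\<^sub>m * Y - i2p * E / t\<^sub>m * X)
    = i2p * (- ((E * a1 * d1 * N - a1 * t\<^sub>p * M) * (X / a1 + E / t\<^sub>p * Y) + (E * a1 * d1 * M - t\<^sub>m * d1 * N) * (Y / d1 + E / t\<^sub>m * X)))"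
    unfolding sp by (simp add: algebra_simps)
  also have "(E * a1 * d1 * N - a1 * t\<^sub>p * M) * (X / a1 + E / t\<^sub>p * Y) + (E * a1 * d1 * M - t\<^sub>m * d1 * N) * (Y / d1 + E / t\<^sub>m * X)
    = - (E / t\<^sub>p * N * Y + E / t\<^sub>m * M * X) * D \<alpha>"
    unfolding D' using a1 d1 E tau_nonzero(3,4) by (simp add: field_simps)
  also have "i2p * (- (- (E / t\<^sub>p * N * Y + E / t\<^sub>m * M * X) * D \<alpha>)) = i2p * ((E / t\<^sub>p * N * Y + E / t\<^sub>m * M * X) * D \<alpha>)"
    by (simp only: mult_minus_left minus_minus)
  finally have "A \<alpha> * ((E * a1 * d1 * N - a1 * t\<^sub>p * M) * (- s\<^sub>p * X - i2p * E / t\<^sub>p * Y)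
    + (E * a1 * d1 * M - t\<^sub>m * d1 * N) * (- s\<^sub>m * Y - i2p * E / t\<^sub>m * X)) = A \<alpha> * i2p * ((E / t\<^sub>p * N * Y + E / t\<^sub>m * M * X) * D \<alpha>)"
    by (simp only: mult.assoc)
  also have "\<dots> = - (E / t\<^sub>p * N * Y + E / t\<^sub>m * M * X)" unfolding Ai using D by simp
  finally show ?thesis unfolding i2p_def by simp
qed

text \<open>\<open>matching_identity\<close> cancels the rank-one terms of
  \<open>approximate_inverse\<close> against the main terms of \<open>trunc_zeta\<close> and
  \<open>trunc_eta\<close>; what is left is the error kernel.\<close>

lemma explicit_operator_approximate_inverse:
  assumes \<alpha>: "\<alpha> > 0" and D: "D \<alpha> \<noteq> 0" and f: "f \<in> L2z \<alpha>"
  shows "AE x in lborel. Wop \<alpha> a k (idk b\<^sub>0 (kernel \<alpha>) f) x = f x + kop (err_kernel \<alpha>) f x"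
proof -
  note fi = L2z_integrable[OF f] and supp = L2z_D(2)[OF f]
  have supported: "\<forall>x. x \<notin> {0<..<\<alpha>} \<longrightarrow> f x = 0" using supp by blast
  note ctx = \<alpha> fi supported
  obtain C where K: "kern \<alpha> C (kernel \<alpha>)" using kernel_kern \<alpha> by blast
  obtain C' where KE: "kern \<alpha> C' (err_kernel \<alpha>)" using err_kernel_kern \<alpha> by blast
  have B: "idk b\<^sub>0 (kernel \<alpha>) f \<in> L2z \<alpha>" by (rule idk_L2z[OF K f \<alpha>])
  let ?N = "LINT z|lborel. \<eta> z * f z" and ?M = "lam \<alpha> f"
  define P where "P = e\<^sub>p \<alpha> * \<tau>\<^sub>p (of_real p) * \<tau>\<^sub>m (- of_real p) * ?N - \<tau>\<^sub>p (of_real p) * t\<^sub>p * ?M"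
  define Q where "Q = e\<^sub>p \<alpha> * \<tau>\<^sub>p (of_real p) * \<tau>\<^sub>m (- of_real p) * ?M - t\<^sub>m * \<tau>\<^sub>m (- of_real p) * ?N"
  let ?h = "\<lambda>y. u f y - V \<alpha> f (\<alpha> - y)"
  have Beq: "idk b\<^sub>0 (kernel \<alpha>) f y = ?h y + (A \<alpha> * P * \<zeta> y + A \<alpha> * Q * \<eta> (\<alpha> - y))" if "y \<in> {0<..<\<alpha>}" for y
    unfolding explicit_operator[OF ctx that] P_def Q_def by (simp add: algebra_simps)
  have intB: "AE x in lborel. integrable lborel (\<lambda>y. k (x - y) * idk b\<^sub>0 (kernel \<alpha>) f y)"
    by (rule integrable_conv(2)[OF k_int L2z_integrable[OF B]])
  show ?thesis
    using approximate_inverse[OF ctx] trunc_zeta[OF \<alpha>] trunc_eta[OF \<alpha>] intB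
  proof eventually_elim
    case (elim x)
    show ?case
    proof (cases "x \<in> {0<..<\<alpha>}")
      case False
      then show ?thesis using supp kop_zero[OF KE] by (simp add: Wop_def[OF \<alpha> k_int])
    next
      case True
      have i1: "integrable lborel (\<lambda>y. k (x - y) * (indicator {0<..<\<alpha>} y * \<zeta> y))"
        by (rule integrable_conv_bdd(2)[OF k_int bdd_meas_indicator_mult[OF _ bdd_meas_zeta]]) simp
      have i2: "integrable lborel (\<lambda>y. k (x - y) * (indicator {0<..<\<alpha>} y * \<eta> (\<alpha> - y)))"
        by (rule integrable_conv_bdd(2)[OF k_int bdd_meas_indicator_mult[OF _ bdd_meas_shift(1)[OF bdd_meas_eta]]]) simp
      \<comment> \<open>Integrability is known almost everywhere for the whole operator applied to
        \<open>f\<close> and everywhere for the two rank-one terms; \<open>?h\<close> is their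
        difference on (0,\<alpha>).\<close>
      have i3: "integrable lborel (\<lambda>y. k (x - y) * (indicator {0<..<\<alpha>} y * ?h y))"
      proof -
        have "integrable lborel (\<lambda>y. k (x - y) * idk b\<^sub>0 (kernel \<alpha>) f y - A \<alpha> * P * (k (x - y) * (indicator {0<..<\<alpha>} y * \<zeta> y))
          - A \<alpha> * Q * (k (x - y) * (indicator {0<..<\<alpha>} y * \<eta> (\<alpha> - y))))"
          by (intro Bochner_Integration.integrable_diff integrable_mult_right elim(4) i1 i2)
        moreover have "k (x - y) * idk b\<^sub>0 (kernel \<alpha>) f y - A \<alpha> * P * (k (x - y) * (indicator {0<..<\<alpha>} y * \<zeta> y))
          - A \<alpha> * Q * (k (x - y) * (indicator {0<..<\<alpha>} y * \<eta> (\<alpha> - y))) = k (x - y) * (indicator {0<..<\<alpha>} y * ?h y)" for y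
        proof (cases "y \<in> {0<..<\<alpha>}")
          case True
          then show ?thesis unfolding Beq[OF True] by (simp add: algebra_simps)
        next
          case False
          then show ?thesis using L2z_D(2)[OF B False] by simp
        qed
        ultimately show ?thesis by (simp only:)
      qed
      have "Wop \<alpha> a k (idk b\<^sub>0 (kernel \<alpha>) f) x = trunc \<alpha> (\<lambda>y. ?h y + (A \<alpha> * P * \<zeta> y + A \<alpha> * Q * \<eta> (\<alpha> - y))) x"
        unfolding trunc_Wop[OF \<alpha> B True, symmetric] by (rule trunc_cong[OF Beq True])
      also have "\<dots> = trunc \<alpha> ?h x + (A \<alpha> * P * trunc \<alpha> \<zeta> x + A \<alpha> * Q * trunc \<alpha> (\<lambda>y. \<eta> (\<alpha> - y)) x)"
      proof -
        have "(LINT y|lborel. k (x - y) * (indicator {0<..<\<alpha>} y * (?h y + (A \<alpha> * P * \<zeta> y + A \<alpha> * Q * \<eta> (\<alpha> - y)))))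
          = (LINT y|lborel. k (x - y) * (indicator {0<..<\<alpha>} y * ?h y) + (A \<alpha> * P * (k (x - y) * (indicator {0<..<\<alpha>} y * \<zeta> y))
            + A \<alpha> * Q * (k (x - y) * (indicator {0<..<\<alpha>} y * \<eta> (\<alpha> - y)))))"
          by (intro Bochner_Integration.integral_cong refl) (simp add: algebra_simps)
        also have "\<dots> = (LINT y|lborel. k (x - y) * (indicator {0<..<\<alpha>} y * ?h y)) + (A \<alpha> * P * (LINT y|lborel. k (x - y) * (indicator {0<..<\<alpha>} y * \<zeta> y))
            + A \<alpha> * Q * (LINT y|lborel. k (x - y) * (indicator {0<..<\<alpha>} y * \<eta> (\<alpha> - y))))"
          using i1 i2 i3 by simp
        finally have i: "(LINT y|lborel. k (x - y) * (indicator {0<..<\<alpha>} y * (?h y + (A \<alpha> * P * \<zeta> y + A \<alpha> * Q * \<eta> (\<alpha> - y)))))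
          = (LINT y|lborel. k (x - y) * (indicator {0<..<\<alpha>} y * ?h y)) + (A \<alpha> * P * (LINT y|lborel. k (x - y) * (indicator {0<..<\<alpha>} y * \<zeta> y))
            + A \<alpha> * Q * (LINT y|lborel. k (x - y) * (indicator {0<..<\<alpha>} y * \<eta> (\<alpha> - y))))" .
        show ?thesis unfolding trunc_def i by (simp only: distrib_left mult_ac add_ac)
      qed
      finally have W: "Wop \<alpha> a k (idk b\<^sub>0 (kernel \<alpha>) f) x = trunc \<alpha> ?h x + (A \<alpha> * P * trunc \<alpha> \<zeta> x + A \<alpha> * Q * trunc \<alpha> (\<lambda>y. \<eta> (\<alpha> - y)) x)" .
      have kE: "kop (err_kernel \<alpha>) f x = (LINT z|lborel. KE \<alpha> x z * f z) - A \<alpha> * (LINT z|lborel. KR \<alpha> x z * f z)"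
      proof -
        have "kop (err_kernel \<alpha>) f x = (LINT z|lborel. (KE \<alpha> x z - A \<alpha> * KR \<alpha> x z) * f z)"
          unfolding err_kernel_def by (rule kop_cut[OF supp True])
        also have "\<dots> = (LINT z|lborel. KE \<alpha> x z * f z - A \<alpha> * (KR \<alpha> x z * f z))" by (simp add: algebra_simps)
        also have "\<dots> = (LINT z|lborel. KE \<alpha> x z * f z) - A \<alpha> * (LINT z|lborel. KR \<alpha> x z * f z)"
          using KE_kernel_integrable[OF ctx, of x] KR_kernel_integrable[OF ctx, of x] by simp
        finally show ?thesis .
      qed
      let ?X = "hankel_left e\<^sub>p x" and ?Y = "hankel_right \<alpha> e\<^sub>p x"
      let ?r = "hankel_right \<alpha> (\<lambda>s. half_conv g\<^sub>p e\<^sub>p (\<alpha> + s) 0) x / t\<^sub>p"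
      let ?l = "hankel_left (\<lambda>s. half_conv (\<lambda>y. g\<^sub>m (- y)) e\<^sub>p (\<alpha> + s) 0) x / t\<^sub>m"
      define z1 where "z1 = - s\<^sub>p * ?X - \<i> / (2 * of_real p) * e\<^sub>p \<alpha> / t\<^sub>p * ?Y"
      define z2 where "z2 = - s\<^sub>m * ?Y - \<i> / (2 * of_real p) * e\<^sub>p \<alpha> / t\<^sub>m * ?X"
      have tz: "trunc \<alpha> \<zeta> x = z1 - ?r" using elim(2) True unfolding z1_def by blast
      have te: "trunc \<alpha> (\<lambda>y. \<eta> (\<alpha> - y)) x = z2 - ?l" using elim(3) True unfolding z2_def by blast
      have th: "trunc \<alpha> ?h x = f x + e\<^sub>p \<alpha> / t\<^sub>p * ?N * ?Y + e\<^sub>p \<alpha> / t\<^sub>m * ?M * ?X + (LINT z|lborel. KE \<alpha> x z * f z)"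
        using elim(1) True unfolding KE_kernel[OF ctx] by auto
      have m: "e\<^sub>p \<alpha> / t\<^sub>p * ?N * ?Y + e\<^sub>p \<alpha> / t\<^sub>m * ?M * ?X + A \<alpha> * (P * z1 + Q * z2) = 0"
        unfolding P_def Q_def z1_def z2_def by (rule matching_identity[OF D])
      have kr: "(LINT z|lborel. KR \<alpha> x z * f z) = ?r * P + ?l * Q"
        unfolding KR_kernel[OF ctx] P_def Q_def ..
      have "Wop \<alpha> a k (idk b\<^sub>0 (kernel \<alpha>) f) x = f x + ((e\<^sub>p \<alpha> / t\<^sub>p * ?N * ?Y + e\<^sub>p \<alpha> / t\<^sub>m * ?M * ?X) + A \<alpha> * (P * z1 + Q * z2))
         + ((LINT z|lborel. KE \<alpha> x z * f z) - A \<alpha> * (?r * P + ?l * Q))"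
        unfolding W tz te th by (simp only: distrib_left right_diff_distrib mult_ac) (simp add: algebra_simps)
      then show ?thesis unfolding m kE kr by simp
    qed
  qed
qed

end

section \<open>Identification with the operators of the statement\<close>

context symbol
begin

context
  fixes \<alpha> :: real and f :: "real \<Rightarrow> complex"
  assumes \<alpha>: "\<alpha> > 0" and f: "integrable lborel f" and supported: "\<forall>x. x \<notin> {0<..<\<alpha>} \<longrightarrow> f x = 0"
begin

private lemma f_vanishes: "x \<notin> {0<..<\<alpha>} \<Longrightarrow> f x = 0" using supported by blast
private lemma f_measurable [measurable]: "f \<in> borel_measurable borel" by (rule integrable_lborel_measurable[OF f])

lemma wh_pole_minus_eq: "wh_pole_minus p t\<^sub>m c\<^sub>m g\<^sub>m f = \<psi> f"
proof
  fix x
  have "conv G\<^sub>m f x = conv (\<lambda>x. hexp p (- x)) f x + conv g\<^sub>m f x"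
    unfolding G\<^sub>m_def[abs_def]
    by (rule conv_add_left) (intro integrable_conv_bdd(1) f bdd_meas_shift(5)[OF bdd_meas_hexp] g_bdd)+
  also have "conv (\<lambda>x. hexp p (- x)) f x = (LINT y|lborel. e\<^sub>m x * (indicator {x<..} y *\<^sub>R (e\<^sub>p y * f y)))"
    unfolding conv_def
    by (intro Bochner_Integration.integral_cong refl)
      (auto simp: hexp_def exp_fn_def indicator_def algebra_simps exp_diff exp_minus divide_inverse)
  also have "\<dots> = e\<^sub>m x * (LINT y:{x<..}|lborel. e\<^sub>p y * f y)" by (simp only: set_lebesgue_integral_def integral_mult_right_zero)
  also have "conv g\<^sub>m f x = (LINT y:{0<..}|lborel. g\<^sub>m (x - y) * f y)"
    unfolding conv_def set_lebesgue_integral_def using f_vanishes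
    by (intro Bochner_Integration.integral_cong refl) (auto simp: indicator_def)
  finally show "wh_pole_minus p t\<^sub>m c\<^sub>m g\<^sub>m f x = \<psi> f x"
    by (simp add: wh_pole_minus_def wh_op_def \<psi>_def algebra_simps)
qed

lemma wh_pole_plus_eq:
  assumes x: "x \<in> {0<..<\<alpha>}"
  shows "wh_pole_plus p t\<^sub>p c\<^sub>p g\<^sub>p (wh_pole_minus p t\<^sub>m c\<^sub>m g\<^sub>m f) x = u f x"
proof -
  have "conv G\<^sub>p (\<phi> f) x = conv (hexp p) (\<phi> f) x + conv g\<^sub>p (\<phi> f) x"
    unfolding G\<^sub>p_def[abs_def]
    by (rule conv_add_left) (intro integrable_conv_bdd(1) phi_integrable[OF \<alpha> f supported] bdd_meas_hexp g_bdd)+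
  also have "conv (hexp p) (\<phi> f) x = (LINT y|lborel. e\<^sub>p x * (indicator {0<..<x} y *\<^sub>R (e\<^sub>m y * \<psi> f y)))"
    unfolding conv_def
    by (intro Bochner_Integration.integral_cong refl)
      (auto simp: \<phi>_def[OF \<alpha> f supported] hexp_def exp_fn_def indicator_def algebra_simps exp_diff exp_minus divide_inverse)
  also have "\<dots> = e\<^sub>p x * (LINT y:{0<..<x}|lborel. e\<^sub>m y * \<psi> f y)" by (simp only: set_lebesgue_integral_def integral_mult_right_zero)
  also have "conv g\<^sub>p (\<phi> f) x = (LINT y:{0<..}|lborel. g\<^sub>p (x - y) * \<psi> f y)"
    unfolding conv_def set_lebesgue_integral_def
    by (intro Bochner_Integration.integral_cong refl) (auto simp: \<phi>_def[OF \<alpha> f supported] indicator_def)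
  finally have c: "conv G\<^sub>p (\<phi> f) x = e\<^sub>p x * (LINT y:{0<..<x}|lborel. e\<^sub>m y * \<psi> f y)
    + (LINT y:{0<..}|lborel. g\<^sub>p (x - y) * \<psi> f y)" .
  have "\<phi> f x = \<psi> f x" using x by (simp add: \<phi>_def[OF \<alpha> f supported])
  then show ?thesis
    unfolding wh_pole_minus_eq u_def[OF \<alpha> f supported] c by (simp add: wh_pole_plus_def wh_op_def algebra_simps)
qed

text \<open>For q = p + i epsilon the product is evaluated in closed form: the pairing of the
  exponential with itself is i/(2q), and the other ingredients \<open>P\<close>, \<open>R\<close>,
  \<open>S\<close> are integrals of integrable functions against the exponential and hence converge.
  \<open>W\<close> does not depend on q.\<close>

lemma hankel_pole_prod_eq:
  assumes s: "s > 0"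
  shows "hankel_pole_prod p t\<^sub>m (\<lambda>x. g\<^sub>m (- x)) t\<^sub>p g\<^sub>p (\<lambda>y. f (\<alpha> - y)) s = V \<alpha> f s"
proof -
  note ctx = \<alpha> f supported
  let ?F = "\<lambda>y. f (\<alpha> - y)"
  let ?Y = "Y\<^sub>0 \<alpha> f"
  have Fi: "integrable lborel ?F" by (rule integrable_reflect_shift(1)[OF f])
  have Yi: "integrable lborel ?Y" and Yb: "bdd_meas ?Y" by (rule Y0_integrable[OF ctx], rule Y0_bdd[OF ctx])
  define P where "P q = (LINT y|lborel. ?F y * hexpc q y)" for q
  define R where "R q = (LINT y|lborel. ?Y y * hexpc q y)" for q
  define S where "S q = (LINT y|lborel. g\<^sub>m (- (s + y)) * hexpc q y)" for q
  define W where "W = (LINT y|lborel. g\<^sub>m (- (s + y)) * (indicator {0<..} y * ?Y y))"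
  have gi: "integrable lborel (\<lambda>r. g\<^sub>m (- (s + r)))"
    using integrable_reflect_shift(1)[OF g_int(2), of "- s"] by (simp only: minus_add_distrib diff_conv_add_uminus)
  have iW: "integrable lborel (\<lambda>r. g\<^sub>m (- (s + r)) * (indicator {0<..} r * ?Y r))"
    by (rule integrable_mult_bdd[OF gi bdd_meas_indicator_mult[OF _ Yb]]) simp
  have val: "hankel_pole q t\<^sub>m (\<lambda>x. g\<^sub>m (- x)) (hankel_pole q t\<^sub>p g\<^sub>p ?F) s
    = (exp_fn q s * ((P q * (\<i> / (2 * q)) + R q) / t\<^sub>p) + (P q * S q + W) / t\<^sub>p) / t\<^sub>m" if q: "Im q > 0" for q
  proof -
    have bq: "bdd_meas (hexpc q)" using q by (intro bdd_meas_hexpc) simp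
    have h: "hankel_op g\<^sub>p ?F x = ?Y x" for x
    proof -
      have "hankel_op g\<^sub>p ?F x = (LINT y|lborel. g\<^sub>p (\<alpha> + x - (\<alpha> - y)) * f (\<alpha> - y))"
        unfolding hankel_op_def set_lebesgue_integral_def using f_vanishes
        by (intro Bochner_Integration.integral_cong refl) (auto simp: indicator_def algebra_simps)
      also have "\<dots> = (LINT y|lborel. g\<^sub>p (\<alpha> + x - y) * f y)"
        by (rule integral_reflect_shift(1)[where f="\<lambda>y. g\<^sub>p (\<alpha> + x - y) * f y"])
      finally show ?thesis by (simp add: Y\<^sub>0_def[OF ctx] conv_def)
    qed
    have pr: "pairing (exp_fn q) T = (LINT y|lborel. T y * hexpc q y)" for T
      unfolding pairing_def set_lebesgue_integral_def
      by (intro Bochner_Integration.integral_cong refl) (auto simp: hexpc_def indicator_def)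
    have inner: "hankel_pole q t\<^sub>p g\<^sub>p ?F = (\<lambda>x. (P q * exp_fn q x + ?Y x) / t\<^sub>p)"
      unfolding hankel_pole_def tensor_def h pr P_def by (simp add: mult.commute)
    have i0: "integrable lborel (\<lambda>y. exp_fn q y * hexpc q y)"
    proof -
      have "exp_fn q y * hexpc q y = hexpc (2 * q) y" for y
        by (auto simp: hexpc_def exp_fn_def indicator_def algebra_simps simp flip: exp_add)
      then show ?thesis using hexpc_integrable[of "2 * q"] q by simp
    qed
    have i1: "integrable lborel (\<lambda>y. ?Y y * hexpc q y)" by (rule integrable_mult_bdd[OF Yi bq])
    have "pairing (exp_fn q) (\<lambda>x. (P q * exp_fn q x + ?Y x) / t\<^sub>p)
       = (LINT y|lborel. (P q * (exp_fn q y * hexpc q y) + ?Y y * hexpc q y) / t\<^sub>p)"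
      unfolding pr by (intro Bochner_Integration.integral_cong refl) (simp add: algebra_simps)
    also have "\<dots> = (P q * pairing (exp_fn q) (exp_fn q) + R q) / t\<^sub>p"
      unfolding pr[of "exp_fn q"] R_def using i0 i1 by simp
    finally have 1: "pairing (exp_fn q) (\<lambda>x. (P q * exp_fn q x + ?Y x) / t\<^sub>p) = (P q * (\<i> / (2 * q)) + R q) / t\<^sub>p"
      unfolding pairing_exp_fn[OF q] .
    have "hankel_op (\<lambda>x. g\<^sub>m (- x)) (\<lambda>x. (P q * exp_fn q x + ?Y x) / t\<^sub>p) s
      = (LINT y|lborel. (P q * (g\<^sub>m (- (s + y)) * hexpc q y) + g\<^sub>m (- (s + y)) * (indicator {0<..} y * ?Y y)) / t\<^sub>p)"
      unfolding hankel_op_def set_lebesgue_integral_def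
      by (intro Bochner_Integration.integral_cong refl) (auto simp: hexpc_def indicator_def algebra_simps)
    also have "\<dots> = (P q * S q + W) / t\<^sub>p"
      unfolding S_def W_def using iW integrable_mult_bdd[OF gi bq] by simp
    finally have 2: "hankel_op (\<lambda>x. g\<^sub>m (- x)) (\<lambda>x. (P q * exp_fn q x + ?Y x) / t\<^sub>p) s = (P q * S q + W) / t\<^sub>p" .
    show ?thesis unfolding inner unfolding hankel_pole_def tensor_def 1 2 ..
  qed
  have cp: "((\<lambda>\<epsilon>. Complex p \<epsilon>) \<longlongrightarrow> of_real p) (at_right 0)"
  proof -
    have "((\<lambda>\<epsilon>. Complex p \<epsilon>) \<longlongrightarrow> Complex p 0) (at_right 0)" by (intro tendsto_intros)
    then show ?thesis by (simp add: complex_of_real_def)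
  qed
  have lim: "((\<lambda>\<epsilon>. P (Complex p \<epsilon>)) \<longlongrightarrow> P (of_real p)) (at_right 0)" "((\<lambda>\<epsilon>. R (Complex p \<epsilon>)) \<longlongrightarrow> R (of_real p)) (at_right 0)"
    "((\<lambda>\<epsilon>. S (Complex p \<epsilon>)) \<longlongrightarrow> S (of_real p)) (at_right 0)"
    unfolding P_def R_def S_def hexpc_of_real by (intro integral_hexpc_tendsto Fi Yi gi)+
  have "((\<lambda>\<epsilon>. (exp_fn (Complex p \<epsilon>) s * ((P (Complex p \<epsilon>) * (\<i> / (2 * Complex p \<epsilon>)) + R (Complex p \<epsilon>)) / t\<^sub>p) + (P (Complex p \<epsilon>) * S (Complex p \<epsilon>) + W) / t\<^sub>p) / t\<^sub>m)
    \<longlongrightarrow> (e\<^sub>p s * ((P (of_real p) * (\<i> / (2 * of_real p)) + R (of_real p)) / t\<^sub>p) + (P (of_real p) * S (of_real p) + W) / t\<^sub>p) / t\<^sub>m) (at_right 0)"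
    unfolding exp_fn_def using p tau_nonzero(3,4) by (intro tendsto_intros cp lim) auto
  moreover have "\<forall>\<^sub>F \<epsilon> in at_right 0. (exp_fn (Complex p \<epsilon>) s * ((P (Complex p \<epsilon>) * (\<i> / (2 * Complex p \<epsilon>)) + R (Complex p \<epsilon>)) / t\<^sub>p) + (P (Complex p \<epsilon>) * S (Complex p \<epsilon>) + W) / t\<^sub>p) / t\<^sub>m
     = hankel_pole (Complex p \<epsilon>) t\<^sub>m (\<lambda>x. g\<^sub>m (- x)) (hankel_pole (Complex p \<epsilon>) t\<^sub>p g\<^sub>p ?F) s"
    using eventually_at_right_less[of "0::real"] by eventually_elim (simp only: val complex.sel)
  ultimately have L: "((\<lambda>\<epsilon>. hankel_pole (Complex p \<epsilon>) t\<^sub>m (\<lambda>x. g\<^sub>m (- x)) (hankel_pole (Complex p \<epsilon>) t\<^sub>p g\<^sub>p ?F) s)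
    \<longlongrightarrow> (e\<^sub>p s * ((P (of_real p) * (\<i> / (2 * of_real p)) + R (of_real p)) / t\<^sub>p) + (P (of_real p) * S (of_real p) + W) / t\<^sub>p) / t\<^sub>m) (at_right 0)"
    by (rule Lim_transform_eventually)
  have PP: "P (of_real p) = PF \<alpha> f"
  proof -
    have "P (of_real p) = (LINT y|lborel. e\<^sub>p (\<alpha> - (\<alpha> - y)) * f (\<alpha> - y))"
      unfolding P_def hexpc_def using f_vanishes
      by (intro Bochner_Integration.integral_cong refl) (auto simp: indicator_def)
    also have "\<dots> = (LINT y|lborel. e\<^sub>p (\<alpha> - y) * f y)" by (rule integral_reflect_shift(1)[where f="\<lambda>y. e\<^sub>p (\<alpha> - y) * f y"])
    finally show ?thesis by (simp add: PF_eq[OF ctx])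
  qed
  have lamP: "lam \<alpha> f = (PF \<alpha> f * (\<i> / (2 * of_real p)) + R (of_real p)) / t\<^sub>p"
    unfolding lam_eq[OF ctx] R_def hexpc_of_real by (simp add: mult.commute)
  have VW: "(LINT r|lborel. g\<^sub>m (- (s + r)) * (indicator {0<..} r * ((PF \<alpha> f * e\<^sub>p r + ?Y r) / t\<^sub>p))) = (PF \<alpha> f * S (of_real p) + W) / t\<^sub>p"
  proof -
    have "(LINT r|lborel. g\<^sub>m (- (s + r)) * (indicator {0<..} r * ((PF \<alpha> f * e\<^sub>p r + ?Y r) / t\<^sub>p)))
      = (LINT r|lborel. (PF \<alpha> f * (g\<^sub>m (- (s + r)) * hexpc (of_real p) r) + g\<^sub>m (- (s + r)) * (indicator {0<..} r * ?Y r)) / t\<^sub>p)"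
      by (intro Bochner_Integration.integral_cong refl) (simp add: hexpc_def algebra_simps)
    then show ?thesis unfolding S_def W_def using iW integrable_mult_bdd[OF gi bdd_meas_hexp] by (simp add: hexpc_of_real)
  qed
  have "hankel_pole_prod p t\<^sub>m (\<lambda>x. g\<^sub>m (- x)) t\<^sub>p g\<^sub>p ?F s
    = (e\<^sub>p s * ((P (of_real p) * (\<i> / (2 * of_real p)) + R (of_real p)) / t\<^sub>p) + (P (of_real p) * S (of_real p) + W) / t\<^sub>p) / t\<^sub>m"
    unfolding hankel_pole_prod_def by (rule tendsto_Lim[OF _ L]) simp
  then show ?thesis unfolding V_eq[OF ctx s] VW lamP PP .
qed

end

lemma refl_op_proj: "refl_op \<alpha> f = (\<lambda>y. proj_op \<alpha> f (\<alpha> - y))"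
  by (auto simp: refl_op_def proj_op_def indicator_def fun_eq_iff)

lemma pairing_proj: "pairing (proj_op \<alpha> w) f = (LINT z|lborel. w z * proj_op \<alpha> f z)"
  unfolding pairing_def set_lebesgue_integral_def
  by (intro Bochner_Integration.integral_cong refl) (auto simp: proj_op_def indicator_def)

lemma pairing_refl: "pairing (refl_op \<alpha> w) f = (LINT z|lborel. w (\<alpha> - z) * proj_op \<alpha> f z)"
  unfolding pairing_def set_lebesgue_integral_def
  by (intro Bochner_Integration.integral_cong refl) (auto simp: proj_op_def refl_op_def indicator_def)

lemma explicit_operator_eq:
  assumes \<alpha>: "\<alpha> > 0" and f: "f \<in> L2 \<alpha>" and x: "x \<in> {0<..<\<alpha>}"
  shows "proj_op \<alpha> (wh_pole_plus p t\<^sub>p c\<^sub>p g\<^sub>p (wh_pole_minus p t\<^sub>m c\<^sub>m g\<^sub>m (proj_op \<alpha> f))) x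
         - refl_op \<alpha> (hankel_pole_prod p t\<^sub>m (\<lambda>x. g\<^sub>m (- x)) t\<^sub>p g\<^sub>p (refl_op \<alpha> f)) x
         + A \<alpha> *
           (e\<^sub>p \<alpha> * \<tau>\<^sub>p (of_real p) * \<tau>\<^sub>m (- of_real p) * tensor (proj_op \<alpha> \<zeta>) (proj_op \<alpha> \<eta>) f x
            - \<tau>\<^sub>p (of_real p) * t\<^sub>p * tensor (proj_op \<alpha> \<zeta>) (refl_op \<alpha> \<zeta>) f x
            - t\<^sub>m * \<tau>\<^sub>m (- of_real p) * tensor (refl_op \<alpha> \<eta>) (proj_op \<alpha> \<eta>) f x
            + e\<^sub>p \<alpha> * \<tau>\<^sub>p (of_real p) * \<tau>\<^sub>m (- of_real p) * tensor (refl_op \<alpha> \<eta>) (refl_op \<alpha> \<zeta>) f x)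
     = idk b\<^sub>0 (kernel \<alpha>) (proj_op \<alpha> f) x"
proof -
  have f0: "proj_op \<alpha> f \<in> L2z \<alpha>" using f unfolding L2_iff_L2z .
  have supported: "\<forall>x. x \<notin> {0<..<\<alpha>} \<longrightarrow> proj_op \<alpha> f x = 0" using L2z_D(2)[OF f0] by blast
  note ctx = \<alpha> L2z_integrable[OF f0] supported
  have 1: "proj_op \<alpha> (wh_pole_plus p t\<^sub>p c\<^sub>p g\<^sub>p (wh_pole_minus p t\<^sub>m c\<^sub>m g\<^sub>m (proj_op \<alpha> f))) x = u (proj_op \<alpha> f) x"
    using wh_pole_plus_eq[OF ctx x] x by (simp add: proj_op_def[of \<alpha> "wh_pole_plus p t\<^sub>p c\<^sub>p g\<^sub>p _"])
  have 2: "refl_op \<alpha> (hankel_pole_prod p t\<^sub>m (\<lambda>x. g\<^sub>m (- x)) t\<^sub>p g\<^sub>p (refl_op \<alpha> f)) x = V \<alpha> (proj_op \<alpha> f) (\<alpha> - x)"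
    unfolding refl_op_proj[of \<alpha> f] using hankel_pole_prod_eq[OF ctx, of "\<alpha> - x"] x by (simp add: refl_op_def)
  have 3: "proj_op \<alpha> \<zeta> x = \<zeta> x" "refl_op \<alpha> \<eta> x = \<eta> (\<alpha> - x)" using x by (simp_all add: proj_op_def refl_op_def)
  have 4: "pairing (refl_op \<alpha> \<zeta>) f = lam \<alpha> (proj_op \<alpha> f)" unfolding pairing_refl lam_def[OF ctx] ..
  show ?thesis unfolding explicit_operator[OF ctx x] 1 2 tensor_def 3 4 pairing_proj by (simp add: algebra_simps)
qed

end

section \<open>Passage to the exact inverse and uniform estimates\<close>

lemma eventually_at_top_in: "eventually P at_top \<Longrightarrow> eventually P (at_top_in S)"
  unfolding at_top_in_def eventually_inf_principal by (auto elim: eventually_mono)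

theorem theorem1:
  fixes p :: real and a :: complex and k :: "real \<Rightarrow> complex"
    and \<sigma> \<tau> \<sigma>\<^sub>p \<sigma>\<^sub>m :: "real \<Rightarrow> complex"
    and \<tau>\<^sub>p \<tau>\<^sub>m :: "complex \<Rightarrow> complex"
    and c\<^sub>p c\<^sub>m :: complex and g\<^sub>p g\<^sub>m :: "real \<Rightarrow> complex"
    and \<zeta> \<eta> :: "real \<Rightarrow> complex" and D A :: "real \<Rightarrow> complex"
  assumes p: "p \<noteq> 0"
    and k: "exp_integrable k"
    and sigma: "\<And>\<xi>. \<sigma> \<xi> = a + fourier k \<xi>"
    and sigma_tau: "\<And>\<xi>. \<sigma> \<xi> = of_real (\<xi>\<^sup>2 - p\<^sup>2) * \<tau> \<xi>"
    and tau_nonzero: "\<And>\<xi>. \<tau> \<xi> \<noteq> 0"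
    and tau_index: "index_zero \<tau>"
    and tau_factors: "\<And>\<xi>. \<tau> \<xi> = \<tau>\<^sub>m (of_real \<xi>) * \<tau>\<^sub>p (of_real \<xi>)"
    and tau_plus: "analytic_factor_upper \<tau>\<^sub>p"
    and tau_minus: "analytic_factor_lower \<tau>\<^sub>m"
    and tau_plus_order:
      "(\<lambda>\<xi>::real. \<tau>\<^sub>p (of_real \<xi>)) \<in> \<Theta>[at_infinity](\<lambda>\<xi>. 1 / of_real \<xi>)"
    and tau_minus_order:
      "(\<lambda>\<xi>::real. \<tau>\<^sub>m (of_real \<xi>)) \<in> \<Theta>[at_infinity](\<lambda>\<xi>. 1 / of_real \<xi>)"
    and sigma_plus: "\<And>\<xi>. \<sigma>\<^sub>p \<xi> = - \<i> * of_real (\<xi> + p) * \<tau>\<^sub>p (of_real \<xi>)"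
    and sigma_minus: "\<And>\<xi>. \<sigma>\<^sub>m \<xi> = \<i> * of_real (\<xi> - p) * \<tau>\<^sub>m (of_real \<xi>)"
    and g_plus: "exp_decaying g\<^sub>p" "\<And>x. x < 0 \<Longrightarrow> g\<^sub>p x = 0"
    and g_minus: "exp_decaying g\<^sub>m" "\<And>x. x > 0 \<Longrightarrow> g\<^sub>m x = 0"
    and u_plus: "\<And>\<xi>. \<xi> \<noteq> - p \<Longrightarrow>
      \<tau>\<^sub>p (- of_real p) / \<sigma>\<^sub>p \<xi> = 1 / (- \<i> * of_real (\<xi> + p)) + (c\<^sub>p + fourier g\<^sub>p \<xi>)"
    and u_minus: "\<And>\<xi>. \<xi> \<noteq> p \<Longrightarrow>
      \<tau>\<^sub>m (of_real p) / \<sigma>\<^sub>m \<xi> = 1 / (\<i> * of_real (\<xi> - p)) + (c\<^sub>m + fourier g\<^sub>m \<xi>)"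
    and zeta: "\<zeta> = hankel_pole_exp p (\<tau>\<^sub>p (- of_real p)) g\<^sub>p"
    and eta: "\<eta> = hankel_pole_exp p (\<tau>\<^sub>m (of_real p)) (\<lambda>x. g\<^sub>m (- x))"
    and D: "\<And>\<alpha>. D \<alpha> = \<tau>\<^sub>m (of_real p) * \<tau>\<^sub>p (- of_real p) * exp (- \<i> * of_real (\<alpha> * p))
                      - \<tau>\<^sub>p (of_real p) * \<tau>\<^sub>m (- of_real p) * exp (\<i> * of_real (\<alpha> * p))"
    and A: "\<And>\<alpha>. A \<alpha> = 2 * \<i> * of_real p / D \<alpha>"
  shows "\<exists>\<delta>>0. \<forall>S.
    (\<forall>\<^sub>F \<alpha> in at_top_in S. D \<alpha> \<noteq> 0) \<and> (\<lambda>\<alpha>. norm (A \<alpha>)) \<in> O[at_top_in S](\<lambda>\<alpha>. exp (\<delta> * \<alpha>)) \<longrightarrow>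
    (\<exists>Winv.
      (\<forall>\<^sub>F \<alpha> in at_top_in S. L2_inverse \<alpha> (trunc_wh \<alpha> a k) (Winv \<alpha>)) \<and>
      exp_equivalent (at_top_in S) Winv
        (\<lambda>\<alpha> f x.
           proj_op \<alpha> (wh_pole_plus p (\<tau>\<^sub>p (- of_real p)) c\<^sub>p g\<^sub>p
             (wh_pole_minus p (\<tau>\<^sub>m (of_real p)) c\<^sub>m g\<^sub>m (proj_op \<alpha> f))) x
         - refl_op \<alpha> (hankel_pole_prod p (\<tau>\<^sub>m (of_real p)) (\<lambda>x. g\<^sub>m (- x))
             (\<tau>\<^sub>p (- of_real p)) g\<^sub>p (refl_op \<alpha> f)) x
         + A \<alpha> *
           (exp (\<i> * of_real (\<alpha> * p)) * \<tau>\<^sub>p (of_real p) * \<tau>\<^sub>m (- of_real p)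
              * tensor (proj_op \<alpha> \<zeta>) (proj_op \<alpha> \<eta>) f x
            - \<tau>\<^sub>p (of_real p) * \<tau>\<^sub>p (- of_real p)
              * tensor (proj_op \<alpha> \<zeta>) (refl_op \<alpha> \<zeta>) f x
            - \<tau>\<^sub>m (of_real p) * \<tau>\<^sub>m (- of_real p)
              * tensor (refl_op \<alpha> \<eta>) (proj_op \<alpha> \<eta>) f x
            + exp (\<i> * of_real (\<alpha> * p)) * \<tau>\<^sub>p (of_real p) * \<tau>\<^sub>m (- of_real p)
              * tensor (refl_op \<alpha> \<eta>) (refl_op \<alpha> \<zeta>) f x)))"
proof -
  interpret S: symbol p a k \<tau>\<^sub>p \<tau>\<^sub>m c\<^sub>p c\<^sub>m g\<^sub>p g\<^sub>m
  proof
    show "a + fourier k \<xi> = of_real (\<xi>\<^sup>2 - p\<^sup>2) * (\<tau>\<^sub>m (of_real \<xi>) * \<tau>\<^sub>p (of_real \<xi>))" for \<xi>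
      using sigma[of \<xi>] sigma_tau[of \<xi>] tau_factors[of \<xi>] by simp
    show "\<tau>\<^sub>p (- of_real p) / (- \<i> * of_real (\<xi> + p) * \<tau>\<^sub>p (of_real \<xi>)) = 1 / (- \<i> * of_real (\<xi> + p)) + (c\<^sub>p + fourier g\<^sub>p \<xi>)"
      if "\<xi> \<noteq> - p" for \<xi> using u_plus[OF that] unfolding sigma_plus .
    show "\<tau>\<^sub>m (of_real p) / (\<i> * of_real (\<xi> - p) * \<tau>\<^sub>m (of_real \<xi>)) = 1 / (\<i> * of_real (\<xi> - p)) + (c\<^sub>m + fourier g\<^sub>m \<xi>)"
      if "\<xi> \<noteq> p" for \<xi> using u_minus[OF that] unfolding sigma_minus .
  qed (use p k tau_plus tau_minus g_plus g_minus in auto)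
  have z: "\<zeta> = S.\<zeta>" and e: "\<eta> = S.\<eta>" unfolding zeta eta by (rule S.zeta_hankel, rule S.eta_hankel)
  have ep: "exp (\<i> * of_real (\<alpha> * p)) = exp_fn (of_real p) \<alpha>" "exp (- \<i> * of_real (\<alpha> * p)) = exp_fn (- of_real p) \<alpha>" for \<alpha>
    by (simp_all add: exp_fn_def mult_ac)
  have DS: "D = S.D" unfolding S.D_def[abs_def] D[abs_def] ep ..
  have AS: "A = S.A" unfolding S.A_def[abs_def] A[abs_def] DS ..
  obtain C0 where C0: "C0 \<ge> 0" "\<And>\<alpha>. \<alpha> > 0 \<Longrightarrow> kern \<alpha> (C0 * (1 + \<alpha>) * (1 + norm (S.A \<alpha>))) (S.kernel \<alpha>)"
    using S.kernel_kern by blast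
  obtain C1 d where C1: "C1 \<ge> 0" and d: "d > 0" and
    E: "\<And>\<alpha>. \<alpha> > 0 \<Longrightarrow> kern \<alpha> (C1 * (1 + norm (S.A \<alpha>)) * exp (- d * \<alpha>)) (S.err_kernel \<alpha>)"
    using S.err_kernel_kern by blast
  \<comment> \<open>With d = 4\<delta> the error kernel is of order exp(-3\<delta>\<alpha>) when A
    is of order exp(\<delta>\<alpha>). The correction multiplies it by \<alpha> times the bound of
    the approximate inverse, at most of order exp(2\<delta>\<alpha>), so exp(-\<delta>\<alpha>)
    remains.\<close>
  define \<delta> where "\<delta> = d / 4"
  have \<delta>: "\<delta> > 0" using d by (simp add: \<delta>_def)
  let ?B = "S.b\<^sub>0"
  show ?thesis unfolding DS AS z e ep
  \<comment> \<open>\<delta> is fixed by the decay rate of the error kernel before the set of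
    admissible parameters is chosen, as the order of the quantifiers demands.\<close>
  proof (intro exI[of _ \<delta>] conjI \<delta> allI impI)
    fix X
    let ?F = "at_top_in X"
    assume asm: "(\<forall>\<^sub>F \<alpha> in ?F. S.D \<alpha> \<noteq> 0) \<and> (\<lambda>\<alpha>. norm (S.A \<alpha>)) \<in> O[?F](\<lambda>\<alpha>. exp (\<delta> * \<alpha>))"
    obtain c where c: "c > 0" and "\<forall>\<^sub>F \<alpha> in ?F. norm (norm (S.A \<alpha>)) \<le> c * norm (exp (\<delta> * \<alpha>))"
      using asm by (auto elim: landau_o.bigE)
    then have Ab: "\<forall>\<^sub>F \<alpha> in ?F. norm (S.A \<alpha>) \<le> c * exp (\<delta> * \<alpha>)" by simp
    define e where "e \<alpha> = C1 * (1 + norm (S.A \<alpha>)) * exp (- d * \<alpha>)" for \<alpha>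
    define CK where "CK \<alpha> = C0 * (1 + \<alpha>) * (1 + norm (S.A \<alpha>))" for \<alpha>
    \<comment> \<open>\<open>M\<close> is the kernel of the difference between the exact inverse and
      the explicit operator; its bound is the one from
      \<open>inverse_from_approximate\<close>.\<close>
    define good where "good \<alpha> M \<longleftrightarrow> kern \<alpha> (2 * e \<alpha> * (norm ?B + \<alpha> * CK \<alpha>)) M \<and>
       L2_inverse \<alpha> (trunc_wh \<alpha> a k) (\<lambda>f. idk ?B (\<lambda>x y. S.kernel \<alpha> x y + M x y) (proj_op \<alpha> f))" for \<alpha> M
    have "\<forall>\<^sub>F \<alpha> in at_top. C1 * (1 + c) * \<alpha> * exp (- (2 * \<delta>) * \<alpha>) < 1 / 2" using \<delta> by real_asymp
    then have ev1: "\<forall>\<^sub>F \<alpha> in ?F. C1 * (1 + c) * \<alpha> * exp (- (2 * \<delta>) * \<alpha>) < 1 / 2" by (rule eventually_at_top_in)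
    \<comment> \<open>One factor exp(\<delta>\<alpha>) is spent on the polynomial growth from the
      size of the interval and from \<open>KU\<close>.\<close>
    have "\<forall>\<^sub>F \<alpha> in at_top. \<alpha> * (1 + \<alpha>) < exp (\<delta> * \<alpha>)" using \<delta> by real_asymp
    then have ev2: "\<forall>\<^sub>F \<alpha> in ?F. \<alpha> * (1 + \<alpha>) < exp (\<delta> * \<alpha>)" by (rule eventually_at_top_in)
    have ev3: "\<forall>\<^sub>F \<alpha> in ?F. \<alpha> > 0" by (rule eventually_at_top_in[OF eventually_gt_at_top])
    have A1: "1 + norm (S.A \<alpha>) \<le> (1 + c) * exp (\<delta> * \<alpha>)" if "norm (S.A \<alpha>) \<le> c * exp (\<delta> * \<alpha>)" "\<alpha> > 0" for \<alpha>
    proof -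
      have "1 \<le> exp (\<delta> * \<alpha>)" using \<delta> that by simp
      then show ?thesis using that(1) unfolding distrib_right by linarith
    qed
    have e_le: "e \<alpha> \<le> C1 * (1 + c) * exp (- (3 * \<delta>) * \<alpha>)" if "norm (S.A \<alpha>) \<le> c * exp (\<delta> * \<alpha>)" "\<alpha> > 0" for \<alpha>
    proof -
      have "e \<alpha> \<le> C1 * ((1 + c) * exp (\<delta> * \<alpha>)) * exp (- d * \<alpha>)"
        unfolding e_def using A1[OF that] C1 by (intro mult_right_mono mult_left_mono) auto
      also have "\<dots> = C1 * (1 + c) * (exp (\<delta> * \<alpha>) * exp (- d * \<alpha>))" by simp
      also have "exp (\<delta> * \<alpha>) * exp (- d * \<alpha>) = exp (- (3 * \<delta>) * \<alpha>)"
        unfolding exp_add[symmetric] by (simp add: \<delta>_def algebra_simps)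
      finally show ?thesis .
    qed
    have ex: "\<forall>\<^sub>F \<alpha> in ?F. \<exists>M. good \<alpha> M"
      using asm[THEN conjunct1] Ab ev1 ev3
    proof eventually_elim
      case (elim \<alpha>)
      have "e \<alpha> * \<alpha> \<le> C1 * (1 + c) * exp (- (3 * \<delta>) * \<alpha>) * \<alpha>"
        using e_le[OF elim(2) elim(4)] elim(4) by (intro mult_right_mono) auto
      also have "\<dots> \<le> C1 * (1 + c) * exp (- (2 * \<delta>) * \<alpha>) * \<alpha>"
        using C1 c elim(4) \<delta> by (intro mult_right_mono mult_left_mono) auto
      also have "\<dots> \<le> 1 / 2" using elim(3) by (simp add: mult_ac)
      finally have small: "e \<alpha> * \<alpha> \<le> 1 / 2" .
      have K: "kern \<alpha> (CK \<alpha>) (S.kernel \<alpha>)" unfolding CK_def by (rule C0(2)[OF elim(4)])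
      have KE: "kern \<alpha> (e \<alpha>) (S.err_kernel \<alpha>)" unfolding e_def by (rule E[OF elim(4)])
      obtain M where M: "kern \<alpha> (2 * e \<alpha> * (norm ?B + \<alpha> * CK \<alpha>)) M" and
        inv: "\<forall>f\<in>L2z \<alpha>. (AE x in lborel. Wop \<alpha> a k (idk ?B (\<lambda>x y. S.kernel \<alpha> x y + M x y) f) x = f x) \<and>
          (AE x in lborel. idk ?B (\<lambda>x y. S.kernel \<alpha> x y + M x y) (Wop \<alpha> a k f) x = f x)"
        using inverse_from_approximate[OF elim(4) S.k_int K KE small S.explicit_operator_approximate_inverse[OF elim(4) elim(1)]] by blast
      have "good \<alpha> M" unfolding good_def
        using M L2_inverse_idk[OF elim(4) S.k_int kern_add[OF K M]] inv by blast
      then show ?case by blast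
    qed
    \<comment> \<open>The correction exists separately for each large \<alpha>; a choice turns it
      into one family, as the statement asks for a single \<open>Winv\<close>.\<close>
    define M where "M \<alpha> = (SOME M. good \<alpha> M)" for \<alpha>
    have good: "\<forall>\<^sub>F \<alpha> in ?F. good \<alpha> (M \<alpha>)"
      using ex
    proof (rule eventually_mono)
      show "good \<alpha> (M \<alpha>)" if "\<exists>M. good \<alpha> M" for \<alpha> unfolding M_def using that by (rule someI_ex)
    qed
    define Winv where "Winv \<alpha> f = idk ?B (\<lambda>x y. S.kernel \<alpha> x y + M \<alpha> x y) (proj_op \<alpha> f)" for \<alpha> f
    let ?T = "\<lambda>\<alpha> f x. proj_op \<alpha> (wh_pole_plus p S.t\<^sub>p c\<^sub>p g\<^sub>p (wh_pole_minus p S.t\<^sub>m c\<^sub>m g\<^sub>m (proj_op \<alpha> f))) x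
         - refl_op \<alpha> (hankel_pole_prod p S.t\<^sub>m (\<lambda>x. g\<^sub>m (- x)) S.t\<^sub>p g\<^sub>p (refl_op \<alpha> f)) x
         + S.A \<alpha> *
           (S.e\<^sub>p \<alpha> * \<tau>\<^sub>p (of_real p) * \<tau>\<^sub>m (- of_real p) * tensor (proj_op \<alpha> S.\<zeta>) (proj_op \<alpha> S.\<eta>) f x
            - \<tau>\<^sub>p (of_real p) * S.t\<^sub>p * tensor (proj_op \<alpha> S.\<zeta>) (refl_op \<alpha> S.\<zeta>) f x
            - S.t\<^sub>m * \<tau>\<^sub>m (- of_real p) * tensor (refl_op \<alpha> S.\<eta>) (proj_op \<alpha> S.\<eta>) f x
            + S.e\<^sub>p \<alpha> * \<tau>\<^sub>p (of_real p) * \<tau>\<^sub>m (- of_real p) * tensor (refl_op \<alpha> S.\<eta>) (refl_op \<alpha> S.\<zeta>) f x)"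
    have "\<forall>\<^sub>F \<alpha> in ?F. L2_inverse \<alpha> (trunc_wh \<alpha> a k) (Winv \<alpha>)"
      using good by eventually_elim (simp add: good_def Winv_def[abs_def])
    moreover have "exp_equivalent ?F Winv ?T"
      unfolding exp_equivalent_def
    proof (rule exI[of _ \<delta>], rule conjI[OF \<delta>], rule exI[of _ "2 * (C1 * (1 + c)) * (norm ?B + C0 * (1 + c))"])
      show "\<forall>\<^sub>F \<alpha> in ?F. \<exists>K. (\<lambda>(x, y). K x y) \<in> borel_measurable (ivl \<alpha> \<Otimes>\<^sub>M ivl \<alpha>) \<and>
        (\<forall>x\<in>{0<..<\<alpha>}. \<forall>y\<in>{0<..<\<alpha>}. norm (K x y) \<le> 2 * (C1 * (1 + c)) * (norm ?B + C0 * (1 + c)) * exp (- \<delta> * \<alpha>)) \<and>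
        (\<forall>f\<in>L2 \<alpha>. AE x in ivl \<alpha>. Winv \<alpha> f x - ?T \<alpha> f x = (LINT y|ivl \<alpha>. K x y * f y))"
        using good Ab ev2 ev3
      proof eventually_elim
        case (elim \<alpha>)
        have \<alpha>: "\<alpha> > 0" by (rule elim(4))
        have Mk: "kern \<alpha> (2 * e \<alpha> * (norm ?B + \<alpha> * CK \<alpha>)) (M \<alpha>)" using elim(1) by (simp add: good_def)
        have K: "kern \<alpha> (CK \<alpha>) (S.kernel \<alpha>)" unfolding CK_def by (rule C0(2)[OF \<alpha>])
        \<comment> \<open>Up to constants, \<open>e\<close> contributes exp(-3\<delta>\<alpha>) and
          \<open>\<alpha> * CK \<alpha>\<close> contributes exp(2\<delta>\<alpha>); the latter also
          dominates the constant \<open>?B\<close>.\<close>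
        have bound: "2 * e \<alpha> * (norm ?B + \<alpha> * CK \<alpha>) \<le> 2 * (C1 * (1 + c)) * (norm ?B + C0 * (1 + c)) * exp (- \<delta> * \<alpha>)"
        proof -
          have e0: "e \<alpha> \<ge> 0" unfolding e_def using C1 by simp
          have "\<alpha> * CK \<alpha> = C0 * (\<alpha> * (1 + \<alpha>)) * (1 + norm (S.A \<alpha>))" unfolding CK_def by simp
          also have "\<dots> \<le> C0 * exp (\<delta> * \<alpha>) * ((1 + c) * exp (\<delta> * \<alpha>))"
            using A1[OF elim(2) \<alpha>] elim(3) C0(1) by (intro mult_mono mult_left_mono) auto
          also have "\<dots> = C0 * (1 + c) * (exp (\<delta> * \<alpha>) * exp (\<delta> * \<alpha>))" by simp
          finally have 1: "\<alpha> * CK \<alpha> \<le> C0 * (1 + c) * (exp (\<delta> * \<alpha>) * exp (\<delta> * \<alpha>))" .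
          have "1 * 1 \<le> exp (\<delta> * \<alpha>) * exp (\<delta> * \<alpha>)" using \<delta> \<alpha> by (intro mult_mono) auto
          then have "norm ?B \<le> norm ?B * (exp (\<delta> * \<alpha>) * exp (\<delta> * \<alpha>))" by (simp add: mult_le_cancel_left1)
          with 1 have 2: "norm ?B + \<alpha> * CK \<alpha> \<le> (norm ?B + C0 * (1 + c)) * (exp (\<delta> * \<alpha>) * exp (\<delta> * \<alpha>))"
            by (simp only: distrib_right)
          have ck0: "0 \<le> \<alpha> * CK \<alpha>" unfolding CK_def using \<alpha> C0(1) by simp
          have "2 * e \<alpha> * (norm ?B + \<alpha> * CK \<alpha>)
              \<le> 2 * (C1 * (1 + c) * exp (- (3 * \<delta>) * \<alpha>)) * ((norm ?B + C0 * (1 + c)) * (exp (\<delta> * \<alpha>) * exp (\<delta> * \<alpha>)))"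
            using e_le[OF elim(2) \<alpha>] e0 2 ck0 C1 c by (intro mult_mono) auto
          also have "\<dots> = 2 * (C1 * (1 + c)) * (norm ?B + C0 * (1 + c)) * (exp (- (3 * \<delta>) * \<alpha>) * (exp (\<delta> * \<alpha>) * exp (\<delta> * \<alpha>)))"
            by (simp only: mult_ac)
          also have "exp (- (3 * \<delta>) * \<alpha>) * (exp (\<delta> * \<alpha>) * exp (\<delta> * \<alpha>)) = exp (- \<delta> * \<alpha>)"
            unfolding exp_add[symmetric] by (simp add: algebra_simps)
          finally show ?thesis .
        qed
        have id: "(\<lambda>x. x) \<in> measurable (ivl \<alpha>) borel"
          by (rule measurable_restrict_space1[OF measurable_ident_sets[OF sets_lborel]])
        have fst: "fst \<in> measurable (ivl \<alpha> \<Otimes>\<^sub>M ivl \<alpha>) borel" and snd: "snd \<in> measurable (ivl \<alpha> \<Otimes>\<^sub>M ivl \<alpha>) borel"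
          by (rule measurable_compose[OF measurable_fst id], rule measurable_compose[OF measurable_snd id])
        have meas: "(\<lambda>(x, y). M \<alpha> x y) \<in> borel_measurable (ivl \<alpha> \<Otimes>\<^sub>M ivl \<alpha>)"
          using measurable_compose[OF measurable_Pair[OF fst snd] kernD(1)[OF Mk]] by (simp add: case_prod_beta')
        have eq: "AE x in ivl \<alpha>. Winv \<alpha> f x - ?T \<alpha> f x = (LINT y|ivl \<alpha>. M \<alpha> x y * f y)" if f: "f \<in> L2 \<alpha>" for f
          unfolding AE_ivl
        proof (intro AE_I2 impI)
          fix x assume x: "x \<in> {0<..<\<alpha>}"
          have f0: "proj_op \<alpha> f \<in> L2z \<alpha>" using f unfolding L2_iff_L2z .
          have "Winv \<alpha> f x = idk ?B (S.kernel \<alpha>) (proj_op \<alpha> f) x + kop (M \<alpha>) (proj_op \<alpha> f) x"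
            unfolding Winv_def idk_def kop_add_kernel[OF K Mk L2z_integrable[OF f0]] by simp
          moreover have "kop (M \<alpha>) (proj_op \<alpha> f) x = (LINT y|ivl \<alpha>. M \<alpha> x y * f y)"
          proof -
            have "(LINT y|ivl \<alpha>. M \<alpha> x y * f y) = (LINT y|lborel. indicator {0<..<\<alpha>} y *\<^sub>R (M \<alpha> x y * f y))"
              by (rule integral_restrict_space) simp
            also have "\<dots> = kop (M \<alpha>) (proj_op \<alpha> f) x"
              unfolding kop_def by (intro Bochner_Integration.integral_cong refl) (auto simp: proj_op_def indicator_def)
            finally show ?thesis by simp
          qed
          ultimately show "Winv \<alpha> f x - ?T \<alpha> f x = (LINT y|ivl \<alpha>. M \<alpha> x y * f y)"
            unfolding S.explicit_operator_eq[OF \<alpha> f x] by simp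
        qed
        show ?case
          by (intro exI[of _ "M \<alpha>"] conjI ballI meas order_trans[OF kernD(2)[OF Mk] bound] eq)
      qed
    qed
    ultimately show "\<exists>Winv. (\<forall>\<^sub>F \<alpha> in ?F. L2_inverse \<alpha> (trunc_wh \<alpha> a k) (Winv \<alpha>)) \<and> exp_equivalent ?F Winv ?T"
      by blast
  qed
qed

end
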